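(* Let $n\geqslant 1$ and let $\psi_j\in H^{-2j}(\mathbb{R}^n)\cap L^1(\mathbb{R}^n)$ for $j=0,1,2$. Let $\psi=\psi(t,x)$ be the solution of the Cauchy problem $$(\partial_t-\kappa\Delta)(\psi_{tt}-\Delta\psi-\delta\Delta\psi_t)+\kappa(\gamma-1)(b\nu-\kappa)\Delta^2\psi_t=0,\quad x\in\mathbb{R}^n,\ t>0,$$ $$\psi(0,x)=\psi_0(x),\quad \psi_t(0,x)=\psi_1(x),\quad \psi_{tt}(0,x)=\psi_2(x),\quad x\in\mathbb{R}^n.$$ Then $$\|\psi(t,\cdot)-\psi^{(1)}(t,\cdot)\|_{L^2}=o\big(\mathcal{D}_n^{(2)}(t)\big)\quad\text{as } t\to\infty.$$ Moreover, if $|P_{\psi_2}|\neq 0$, then for $t\gg1$ $$\mathcal{D}_n^{(2)}(t)\,|P_{\psi_2}|\lesssim\|\psi(t,\cdot)\|_{L^2}\lesssim \mathcal{D}_n^{(2)}(t)\sum_{j=0,1,2}\|\psi_j\|_{H^{-2j}\cap L^1}.$$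
   Context: Parameters: $\gamma\in(1,\tfrac53]$, $b>0$, $\nu>0$, $\kappa>0$, and $\delta:=b\nu+(\gamma-1)\kappa$. It is assumed throughout that $0<\kappa\ll\delta$, i.e. $\kappa/\delta$ is smaller than a sufficiently small positive constant. Fourier transform: $\widehat f(\xi)=\int_{\mathbb{R}^n}e^{-ix\cdot\xi}f(x)\,dx$, with inverse $\mathcal{F}^{-1}_{\xi\to x}$. The solution $\psi$ is understood via the partial Fourier transform in $x$: for each $\xi$, $\widehat\psi(t,\xi)$ solves the linear ODE in $t$ obtained by transforming the equation, with data $\widehat\psi_0(\xi),\widehat\psi_1(\xi),\widehat\psi_2(\xi)$. For $s\geqslant 0$, $H^{-s}$ is the space of $f$ with $\mathcal{F}^{-1}(\langle\xi\rangle^{-s}\widehat f)\in L^2$, $\langle\xi\rangle=\sqrt{1+|\xi|^2}$ (so $H^0=L^2$), and $\|f\|_{H^{-s}\cap L^1}=\|f\|_{H^{-s}}+\|f\|_{L^1}$. For summable $f$, $P_f:=\int_{\mathbb{R}^n}f(x)\,dx$. First-order profile: $\psi^{(1)}(t,x):=G_0(t,x)P_{\psi_2}$, where $$G_0(t,x):=\mathcal{F}^{-1}_{\xi\to x}\left(\frac{1}{|\xi|^2}\left(e^{-\kappa|\xi|^2t}-\cos(|\xi|t)\,e^{-\frac{\delta}{2}|\xi|^2t}\right)\right).$$ Rate function: $\mathcal{D}_n^{(2)}(t)=t^{2-\frac n2}$ if $n\leqslant3$; $(\ln t)^{\frac12}$ if $n=4$; $t^{1-\frac n4}$ if $n\geqslant5$.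 $f\lesssim g$ means $f\leqslant Cg$ with a constant $C>0$ independent of $t$ and of the initial data (it may depend on $n$ and the parameters). "For $t\gg1$" means for all $t\geqslant T$ with some sufficiently large $T$; in the lower bound $T$ may depend on the initial data. *)

theory Defs
  imports "HOL-Analysis.Analysis" "HOL-Library.Landau_Symbols"
begin

section \<open>Lebesgue spaces and the Fourier transform on Euclidean space\<close>

text \<open>
  Elements of Lebesgue spaces are represented by Borel measurable functions; all notions below
  depend only on the almost-everywhere class.
\<close>

definition L1 :: "('a::euclidean_space \<Rightarrow> complex) set" where
  "L1 = {f. integrable lborel f}"

definition norm_L1 :: "('a::euclidean_space \<Rightarrow> complex) \<Rightarrow> real" where
  "norm_L1 f = (LINT x|lborel. cmod (f x))"

definition L2 :: "('a::euclidean_space \<Rightarrow> complex) set" where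
  "L2 = {f. f \<in> borel_measurable lborel \<and> integrable lborel (\<lambda>x. (cmod (f x))\<^sup>2)}"

definition norm_L2 :: "('a::euclidean_space \<Rightarrow> complex) \<Rightarrow> real" where
  "norm_L2 f = sqrt (LINT x|lborel. (cmod (f x))\<^sup>2)"

definition total_integral :: "('a::euclidean_space \<Rightarrow> complex) \<Rightarrow> complex" where
  "total_integral f = (LINT x|lborel. f x)"

definition fourier :: "('a::euclidean_space \<Rightarrow> complex) \<Rightarrow> 'a \<Rightarrow> complex" where
  "fourier f \<xi> = (LINT x|lborel. cis (- (x \<bullet> \<xi>)) * f x)"

definition inv_fourier :: "('a::euclidean_space \<Rightarrow> complex) \<Rightarrow> 'a \<Rightarrow> complex" where
  "inv_fourier h x = (LINT \<xi>|lborel. cis (x \<bullet> \<xi>) * h \<xi>) / (2 * pi) ^ DIM('a)"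

text \<open>
  The integrals above are meaningful for integrable functions. On square-integrable functions the
  transforms are the \<open>L\<^sup>2\<close> limits of the transforms of the truncations to balls. They are stated as
  relations because their values are only determined almost everywhere.
\<close>

definition truncate_ball :: "real \<Rightarrow> ('a::euclidean_space \<Rightarrow> complex) \<Rightarrow> 'a \<Rightarrow> complex" where
  "truncate_ball R f x = (if norm x \<le> R then f x else 0)"

definition is_fourier_L2 ::
    "('a::euclidean_space \<Rightarrow> complex) \<Rightarrow> ('a \<Rightarrow> complex) \<Rightarrow> bool" where
  "is_fourier_L2 f h \<longleftrightarrow> f \<in> L2 \<and> h \<in> L2 \<and>
     ((\<lambda>R. \<integral>\<^sup>+\<xi>. ennreal ((cmod (fourier (truncate_ball R f) \<xi> - h \<xi>))\<^sup>2) \<partial>lborel) \<longlongrightarrow> 0) at_top"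

definition is_inv_fourier_L2 ::
    "('a::euclidean_space \<Rightarrow> complex) \<Rightarrow> ('a \<Rightarrow> complex) \<Rightarrow> bool" where
  "is_inv_fourier_L2 h f \<longleftrightarrow> h \<in> L2 \<and> f \<in> L2 \<and>
     ((\<lambda>R. \<integral>\<^sup>+x. ennreal ((cmod (inv_fourier (truncate_ball R h) x - f x))\<^sup>2) \<partial>lborel) \<longlongrightarrow> 0) at_top"

section \<open>Sobolev spaces of negative order\<close>

definition japanese_bracket :: "'a::euclidean_space \<Rightarrow> real" where
  "japanese_bracket \<xi> = sqrt (1 + (norm \<xi>)\<^sup>2)"

definition bessel_symbol ::
    "real \<Rightarrow> ('a::euclidean_space \<Rightarrow> complex) \<Rightarrow> 'a \<Rightarrow> complex" where
  "bessel_symbol s f \<xi> = complex_of_real (japanese_bracket \<xi> powr (- s)) * fourier f \<xi>"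

text \<open>
  Only the intersection of \<open>H\<^sup>-\<^sup>s\<close> with \<open>L\<^sup>1\<close> is needed, so that \<open>fourier f\<close> is the classical
  transform. The choice of \<open>g\<close> in the norm is immaterial: all candidates agree almost everywhere.
\<close>

definition Hneg_L1 :: "real \<Rightarrow> ('a::euclidean_space \<Rightarrow> complex) set" where
  "Hneg_L1 s = {f \<in> L1. \<exists>g. is_inv_fourier_L2 (bessel_symbol s f) g}"

definition norm_Hneg :: "real \<Rightarrow> ('a::euclidean_space \<Rightarrow> complex) \<Rightarrow> real" where
  "norm_Hneg s f = norm_L2 (SOME g. is_inv_fourier_L2 (bessel_symbol s f) g)"

definition norm_Hneg_L1 :: "real \<Rightarrow> ('a::euclidean_space \<Rightarrow> complex) \<Rightarrow> real" where
  "norm_Hneg_L1 s f = norm_Hneg s f + norm_L1 f"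

section \<open>The Cauchy problem\<close>

definition diffusion_coeff :: "real \<Rightarrow> real \<Rightarrow> real \<Rightarrow> real \<Rightarrow> real" where
  "diffusion_coeff \<gamma> b \<nu> \<kappa> = b * \<nu> + (\<gamma> - 1) * \<kappa>"

text \<open>
  The equation at a fixed frequency with \<open>|\<xi>| = r\<close>, obtained by replacing the Laplacian with
  \<open>- r\<^sup>2\<close>. Here \<open>u\<close>, \<open>u1\<close>, \<open>u2\<close> are the transform of the solution and its first two time
  derivatives, \<open>w\<close> is the transform of \<open>\<psi>\<^sub>t\<^sub>t - \<Delta>\<psi> - \<delta>\<Delta>\<psi>\<^sub>t\<close>, and \<open>a0\<close>, \<open>a1\<close>, \<open>a2\<close> are the
  initial values. Derivatives at time zero are one-sided.
\<close>

definition solves_freq_ode ::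
    "real \<Rightarrow> real \<Rightarrow> real \<Rightarrow> real \<Rightarrow> real \<Rightarrow>
     complex \<Rightarrow> complex \<Rightarrow> complex \<Rightarrow> (real \<Rightarrow> complex) \<Rightarrow> bool" where
  "solves_freq_ode \<gamma> b \<nu> \<kappa> r a0 a1 a2 u \<longleftrightarrow>
     (let \<delta> = diffusion_coeff \<gamma> b \<nu> \<kappa> in
      \<exists>u1 u2 w w'.
        u 0 = a0 \<and> u1 0 = a1 \<and> u2 0 = a2 \<and>
        (\<forall>t\<ge>0.
          (u has_vector_derivative u1 t) (at t within {0..}) \<and>
          (u1 has_vector_derivative u2 t) (at t within {0..}) \<and>
          w t = u2 t + r\<^sup>2 *\<^sub>R u t + (\<delta> * r\<^sup>2) *\<^sub>R u1 t \<and>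
          (w has_vector_derivative w' t) (at t within {0..}) \<and>
          (w' t + (\<kappa> * r\<^sup>2) *\<^sub>R w t) + (\<kappa> * (\<gamma> - 1) * (b * \<nu> - \<kappa>) * r ^ 4) *\<^sub>R u1 t = 0))"

definition is_solution ::
    "real \<Rightarrow> real \<Rightarrow> real \<Rightarrow> real \<Rightarrow>
     (nat \<Rightarrow> 'a::euclidean_space \<Rightarrow> complex) \<Rightarrow> (real \<Rightarrow> 'a \<Rightarrow> complex) \<Rightarrow> bool" where
  "is_solution \<gamma> b \<nu> \<kappa> \<phi> \<psi> \<longleftrightarrow>
     (\<exists>\<psi>hat.
        (\<forall>\<xi>. solves_freq_ode \<gamma> b \<nu> \<kappa> (norm \<xi>)
               (fourier (\<phi> 0) \<xi>) (fourier (\<phi> 1) \<xi>) (fourier (\<phi> 2) \<xi>) (\<lambda>t. \<psi>hat t \<xi>)) \<and>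
        (\<forall>t\<ge>0. is_fourier_L2 (\<psi> t) (\<psi>hat t)))"

section \<open>Asymptotic profile and decay rate\<close>

text \<open>
  For \<open>t > 0\<close> the symbol is integrable, so the classical inverse transform applies; its value at
  the single frequency \<open>\<xi> = 0\<close> is irrelevant.
\<close>

definition profile_symbol ::
    "real \<Rightarrow> real \<Rightarrow> real \<Rightarrow> 'a::euclidean_space \<Rightarrow> complex" where
  "profile_symbol \<kappa> \<delta> t \<xi> = complex_of_real
     (1 / (norm \<xi>)\<^sup>2 *
       (exp (- \<kappa> * (norm \<xi>)\<^sup>2 * t) - cos (norm \<xi> * t) * exp (- (\<delta> / 2) * (norm \<xi>)\<^sup>2 * t)))"

definition G0 :: "real \<Rightarrow> real \<Rightarrow> real \<Rightarrow> 'a::euclidean_space \<Rightarrow> complex" where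
  "G0 \<kappa> \<delta> t = inv_fourier (profile_symbol \<kappa> \<delta> t)"

definition profile ::
    "real \<Rightarrow> real \<Rightarrow> ('a::euclidean_space \<Rightarrow> complex) \<Rightarrow> real \<Rightarrow> 'a \<Rightarrow> complex" where
  "profile \<kappa> \<delta> f t x = G0 \<kappa> \<delta> t x * total_integral f"

definition rate :: "nat \<Rightarrow> real \<Rightarrow> real" where
  "rate n t =
     (if n \<le> 3 then t powr (2 - real n / 2)
      else if n = 4 then ln t powr (1 / 2)
      else t powr (1 - real n / 4))"

end

theory Submission
  imports Defs "HOL-Probability.Characteristic_Functions"
begin

text \<open>
  By Plancherel's theorem everything is decided on the Fourier side, where the equation is a linear
  third-order ODE in \<open>t\<close> for each \<open>r = |\<xi>|\<close>. For small \<open>r\<close> the symbol of the profile times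
  \<open>a\<^sub>2 = fourier \<psi>\<^sub>2 \<xi>\<close> is an approximate solution, and an energy estimate for the difference bounds
  it by \<open>min (1 + t) (exp (- c r\<^sup>2 t) / r)\<close>; for \<open>r\<close> bounded away from zero the solution decays
  exponentially. In \<open>L\<^sup>2\<close> these errors are smaller than the rate by a factor \<open>\<surd>(ln t)\<close>. As the
  profile concentrates at \<open>r = 0\<close>, \<open>a\<^sub>2\<close> may further be replaced by its value at zero, the total
  integral. It remains to compute the size of the profile in polar coordinates: its symbol behaves
  like \<open>t\<^sup>2/2\<close> for \<open>r \<lesssim> 1/t\<close> and like \<open>r\<^sup>-\<^sup>2\<close> for \<open>1/t \<lesssim> r \<lesssim> 1/\<surd>t\<close>, the first region dominating for
  \<open>n \<le> 3\<close>, the second at its outer end for \<open>n \<ge> 5\<close>, and all scales of the second contributing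
  equally, hence the logarithm, for \<open>n = 4\<close>.
\<close>

section \<open>Square-integrable functions\<close>

text \<open>The roots of the characteristic cubic behave differently for small and for large r, and
  the estimates must be uniform across the transition; quadratic functionals achieve this with only
  the coefficients as input. Their form is dictated by degenerate damping. For small r, all modes
  are damped only at rate r^2 while two of them rotate at speed r. For large r two modes decay at a
  rate of order r^2 but the third keeps the bounded rate
  \<open>\<kappa> / (\<kappa> * \<delta> + m)\<close>: there is time decay but no smoothing, and u
  is controlled by a0, a1 / r^2 and a2 / r^4, which is where the spaces of order -2j enter. The
  smallness of \<kappa> / \<delta> is used as \<kappa> < \<delta> / 2: the heat factor of the
  profile then outlives the wave factor, and together with \<gamma> \<le> 5/3 it makes the coupling
  m positive. The error stemming from the equation has constants independent of the data. Only the
  replacement of a2 by the total integral is qualitative, because an integrable function gives no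
  modulus of continuity for its transform. Hence the upper bound starts at a time common to all
  data, while the lower bound does not.\<close>

definition nnL2 :: "('a::euclidean_space \<Rightarrow> complex) \<Rightarrow> ennreal" where
  "nnL2 f = (\<integral>\<^sup>+x. ennreal ((cmod (f x))\<^sup>2) \<partial>lborel)"

lemma L2_iff: "f \<in> L2 \<longleftrightarrow> f \<in> borel_measurable lborel \<and> nnL2 f < \<infinity>"
  by (auto simp: L2_def nnL2_def integrable_iff_bounded)

lemma L2_measurable: "f \<in> L2 \<Longrightarrow> f \<in> borel_measurable lborel"
  by (simp add: L2_def)

lemma nnL2_eq_norm_L2:
  assumes "f \<in> L2"
  shows "nnL2 f = ennreal ((norm_L2 f)\<^sup>2)"
  using assms by (simp add: L2_def nnL2_def norm_L2_def nn_integral_eq_integral)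

lemma norm_L2_nonneg: "0 \<le> norm_L2 f"
  by (simp add: norm_L2_def)

lemma nnL2_mono:
  assumes "AE x in lborel. cmod (f x) \<le> cmod (g x)"
  shows "nnL2 f \<le> nnL2 g"
  unfolding nnL2_def using assms
  by (intro nn_integral_mono_AE) (auto intro!: ennreal_leI power_mono)

lemma nnL2_cmult:
  assumes [measurable]: "f \<in> borel_measurable lborel"
  shows "nnL2 (\<lambda>x. c * f x) = ennreal ((cmod c)\<^sup>2) * nnL2 f"
  by (simp add: nnL2_def norm_mult power_mult_distrib ennreal_mult nn_integral_cmult)

lemma norm_add_sq_le: "(norm (x + y))\<^sup>2 \<le> 2 * (norm x)\<^sup>2 + 2 * (norm (y::'a::real_normed_vector))\<^sup>2"
proof -
  have "(norm (x + y))\<^sup>2 \<le> (norm x + norm y)\<^sup>2"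
    by (intro power_mono norm_triangle_ineq) auto
  also have "\<dots> \<le> 2 * (norm x)\<^sup>2 + 2 * (norm y)\<^sup>2"
    using sum_squares_bound[of "norm x" "norm y"] by (simp add: power2_sum)
  finally show ?thesis .
qed

text \<open>The constant 2 stands in for Minkowski's inequality. Only measurability is assumed, so
  such bounds can be chained while the values may still be infinite.\<close>

lemma nnL2_add_le:
  assumes [measurable]: "f \<in> borel_measurable lborel" "g \<in> borel_measurable lborel"
  shows "nnL2 (\<lambda>x. f x + g x) \<le> 2 * nnL2 f + 2 * nnL2 g"
proof -
  have "nnL2 (\<lambda>x. f x + g x) \<le> (\<integral>\<^sup>+x. 2 * ennreal ((cmod (f x))\<^sup>2) + 2 * ennreal ((cmod (g x))\<^sup>2) \<partial>lborel)"
    unfolding nnL2_def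
  proof (rule nn_integral_mono)
    fix x
    have "ennreal ((cmod (f x + g x))\<^sup>2) \<le> ennreal (2 * (cmod (f x))\<^sup>2 + 2 * (cmod (g x))\<^sup>2)"
      by (intro ennreal_leI norm_add_sq_le)
    also have "\<dots> = 2 * ennreal ((cmod (f x))\<^sup>2) + 2 * ennreal ((cmod (g x))\<^sup>2)"
      by (simp add: ennreal_mult)
    finally show "ennreal ((cmod (f x + g x))\<^sup>2) \<le> 2 * ennreal ((cmod (f x))\<^sup>2) + 2 * ennreal ((cmod (g x))\<^sup>2)" .
  qed
  also have "\<dots> = 2 * nnL2 f + 2 * nnL2 g"
    unfolding nnL2_def by (subst nn_integral_add) (auto simp: nn_integral_cmult)
  finally show ?thesis .
qed

lemma nnL2_diff_le:
  assumes [measurable]: "f \<in> borel_measurable lborel" "g \<in> borel_measurable lborel"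
  shows "nnL2 (\<lambda>x. f x - g x) \<le> 2 * nnL2 f + 2 * nnL2 g"
  using nnL2_add_le[of f "\<lambda>x. - g x"] by (simp add: nnL2_def)

lemma L2_add:
  assumes "f \<in> L2" "g \<in> L2"
  shows "(\<lambda>x. f x + g x) \<in> L2"
proof -
  have m[measurable]: "f \<in> borel_measurable lborel" "g \<in> borel_measurable lborel"
    and fin: "nnL2 f < \<infinity>" "nnL2 g < \<infinity>" using assms by (auto simp: L2_iff)
  have "nnL2 (\<lambda>x. f x + g x) < \<infinity>"
    by (rule order.strict_trans1[OF nnL2_add_le[OF m]]) (use fin in \<open>simp add: ennreal_mult_less_top\<close>)
  then show ?thesis by (simp add: L2_iff)
qed

lemma L2_cmult: "f \<in> L2 \<Longrightarrow> (\<lambda>x. c * f x) \<in> L2"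
  by (auto simp: L2_iff nnL2_cmult ennreal_mult_less_top)

lemma L2_diff: "f \<in> L2 \<Longrightarrow> g \<in> L2 \<Longrightarrow> (\<lambda>x. f x - g x) \<in> L2"
  using L2_add[of f "\<lambda>x. - 1 * g x"] L2_cmult[of g "-1"] by simp

lemma integrable_L2_mult:
  assumes "f \<in> L2" "g \<in> L2"
  shows "integrable lborel (\<lambda>x. f x * g x)"
proof (rule Bochner_Integration.integrable_bound)
  show "integrable lborel (\<lambda>x. (cmod (f x))\<^sup>2 + (cmod (g x))\<^sup>2)"
    using assms by (simp add: L2_def)
  show "(\<lambda>x. f x * g x) \<in> borel_measurable lborel"
    using assms by (auto simp: L2_def)
  show "AE x in lborel. norm (f x * g x) \<le> norm ((cmod (f x))\<^sup>2 + (cmod (g x))\<^sup>2)"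
  proof (rule AE_I2)
    fix x
    have "2 * (cmod (f x) * cmod (g x)) \<le> (cmod (f x))\<^sup>2 + (cmod (g x))\<^sup>2"
      using sum_squares_bound[of "cmod (f x)" "cmod (g x)"] by simp
    moreover have "0 \<le> cmod (f x) * cmod (g x)" by simp
    ultimately have "cmod (f x) * cmod (g x) \<le> (cmod (f x))\<^sup>2 + (cmod (g x))\<^sup>2"
      by linarith
    then show "norm (f x * g x) \<le> norm ((cmod (f x))\<^sup>2 + (cmod (g x))\<^sup>2)"
      by (simp add: norm_mult)
  qed
qed

text \<open>The means by which transforms defined as limits of truncations inherit Plancherel. The
  factor 4 is two applications of the triangle inequality with constant 2; it is harmless because
  every later bound is up to a constant.\<close>

lemma nnL2_limit_bound:
  assumes F: "F \<noteq> bot"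
    and m: "\<And>R. f' R \<in> borel_measurable lborel" "\<And>R. h' R \<in> borel_measurable lborel"
           "f \<in> borel_measurable lborel" "h \<in> borel_measurable lborel"
    and lf: "((\<lambda>R. nnL2 (\<lambda>x. f' R x - f x)) \<longlongrightarrow> 0) F"
    and lh: "((\<lambda>R. nnL2 (\<lambda>x. h' R x - h x)) \<longlongrightarrow> 0) F"
    and le: "\<And>R. nnL2 (f' R) \<le> ennreal c * nnL2 (h' R)"
  shows "nnL2 f \<le> ennreal (4 * c) * nnL2 h"
proof -
  note [measurable] = m
  have *: "nnL2 f \<le> (4 * ennreal c) * nnL2 (\<lambda>x. h' R x - h x) + 4 * ennreal c * nnL2 h
             + 2 * nnL2 (\<lambda>x. f' R x - f x)" for R
  proof -
    have "nnL2 f \<le> 2 * nnL2 (f' R) + 2 * nnL2 (\<lambda>x. f' R x - f x)"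
      using nnL2_diff_le[of "f' R" "\<lambda>x. f' R x - f x"] by simp
    also have "\<dots> \<le> 2 * (ennreal c * nnL2 (h' R)) + 2 * nnL2 (\<lambda>x. f' R x - f x)"
      by (intro add_mono mult_left_mono le) auto
    also have "\<dots> \<le> 2 * (ennreal c * (2 * nnL2 (\<lambda>x. h' R x - h x) + 2 * nnL2 h)) + 2 * nnL2 (\<lambda>x. f' R x - f x)"
      using nnL2_add_le[of "\<lambda>x. h' R x - h x" h]
      by (intro add_mono mult_left_mono) auto
    also have "\<dots> = (4 * ennreal c) * nnL2 (\<lambda>x. h' R x - h x) + 4 * ennreal c * nnL2 h
             + 2 * nnL2 (\<lambda>x. f' R x - f x)"
    proof -
      have "2 * (c' * (2 * a + 2 * b)) + d = (4 * c') * a + 4 * c' * b + d" for a b c' d :: ennreal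
        by (metis (no_types, lifting) distrib_left mult.assoc mult.left_commute mult_numeral_left(1) num_double)
      then show ?thesis .
    qed
    finally show ?thesis .
  qed
  have "((\<lambda>R. (4 * ennreal c) * nnL2 (\<lambda>x. h' R x - h x) + 4 * ennreal c * nnL2 h
             + 2 * nnL2 (\<lambda>x. f' R x - f x)) \<longlongrightarrow> (4 * ennreal c) * 0 + 4 * ennreal c * nnL2 h + 2 * 0) F"
    by (intro tendsto_add tendsto_const ennreal_tendsto_cmult lf lh) (auto simp: ennreal_mult_less_top ennreal_mult_eq_top_iff)
  then have "nnL2 f \<le> (4 * ennreal c) * 0 + 4 * ennreal c * nnL2 h + 2 * 0"
    by (rule tendsto_lowerbound) (use * F in auto)
  \<comment> \<open>For negative c both constants are 0 in the extended reals.\<close>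
  then show ?thesis by (cases "c \<ge> 0") (simp_all add: ennreal_mult ennreal_neg)
qed

section \<open>Plancherel's theorem\<close>

lemma borel_measurable_cis [measurable]: "cis \<in> borel_measurable borel"
  by (intro borel_measurable_continuous_onI continuous_intros)

text \<open>Up to the normalisation sqrt (2 * pi) of the density, the integral is the characteristic
  function of the standard normal distribution.\<close>

lemma gaussian_transform_real:
  fixes a :: real
  shows "integrable lborel (\<lambda>s. cis (a * s) * complex_of_real (exp (- s\<^sup>2 / 2)))"
    and "(LINT s|lborel. cis (a * s) * complex_of_real (exp (- s\<^sup>2 / 2)))
          = complex_of_real (sqrt (2 * pi) * exp (- a\<^sup>2 / 2))"
proof -
  have int: "integrable lborel (\<lambda>s. exp (- s\<^sup>2 / 2) :: real)"
    using integrable_mult_right[OF integrable_std_normal_moment[of 0], of "sqrt (2 * pi)"]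
    by (simp add: std_normal_density_def)
  show "integrable lborel (\<lambda>s. cis (a * s) * complex_of_real (exp (- s\<^sup>2 / 2)))"
    by (rule Bochner_Integration.integrable_bound[OF int]) (auto simp: norm_mult)
  have "char std_normal_distribution a = complex_of_real (exp (- a\<^sup>2 / 2))"
    by (simp add: char_std_normal_distribution)
  moreover have "char std_normal_distribution a
      = (LINT s|lborel. std_normal_density s *\<^sub>R cis (a * s))"
    unfolding char_def by (subst integral_density) (auto simp: cis_conv_exp)
  moreover have "\<dots> = (LINT s|lborel. (1 / sqrt (2 * pi)) * (cis (a * s) * complex_of_real (exp (- s\<^sup>2 / 2))))"
    by (rule Bochner_Integration.integral_cong) (auto simp: std_normal_density_def scaleR_conv_of_real)
  ultimately have "complex_of_real (1 / sqrt (2 * pi)) * (LINT s|lborel. (cis (a * s) * complex_of_real (exp (- s\<^sup>2 / 2)))) =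
    complex_of_real (exp (- a\<^sup>2 / 2))" by simp
  then show "(LINT s|lborel. cis (a * s) * complex_of_real (exp (- s\<^sup>2 / 2)))
          = complex_of_real (sqrt (2 * pi) * exp (- a\<^sup>2 / 2))"
    by (simp add: field_simps)
qed

lemma norm_sq_eq_sum_Basis: "(norm x)\<^sup>2 = (\<Sum>b\<in>Basis. (x \<bullet> b)\<^sup>2)"
  unfolding power2_norm_eq_inner by (subst euclidean_inner) (simp add: power2_eq_square)

text \<open>Both exponentials factor over the basis, and \<open>lborel\<close> is the image of a
  product of one-dimensional Lebesgue measures, so the real case applies coordinate by
  coordinate.\<close>

lemma gaussian_transform:
  fixes z :: "'a::euclidean_space"
  shows "integrable lborel (\<lambda>\<xi>. cis (z \<bullet> \<xi>) * complex_of_real (exp (- (norm \<xi>)\<^sup>2 / 2)))"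
    and "(LINT \<xi>|lborel. cis (z \<bullet> \<xi>) * complex_of_real (exp (- (norm \<xi>)\<^sup>2 / 2)))
          = complex_of_real (sqrt (2 * pi) ^ DIM('a) * exp (- (norm z)\<^sup>2 / 2))"
proof -
  interpret product_sigma_finite "\<lambda>_. lborel :: real measure" ..
  let ?g = "\<lambda>b s. cis ((z \<bullet> b) * s) * complex_of_real (exp (- s\<^sup>2 / 2))"
  let ?G = "\<lambda>\<xi>::'a. cis (z \<bullet> \<xi>) * complex_of_real (exp (- (norm \<xi>)\<^sup>2 / 2))"
  have cis_sum: "cis (\<Sum>b\<in>A. f b) = (\<Prod>b\<in>A. cis (f b))" if "finite A" for A :: "'a set" and f
    using that by induction (auto simp: cis_mult[symmetric])
  have prod_eq: "?G \<xi> = (\<Prod>b\<in>Basis. ?g b (\<xi> \<bullet> b))" for \<xi>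
  proof -
    have "cis (z \<bullet> \<xi>) = (\<Prod>b\<in>Basis. cis ((z \<bullet> b) * (\<xi> \<bullet> b)))"
      by (subst euclidean_inner) (simp add: cis_sum)
    moreover have "exp (- (norm \<xi>)\<^sup>2 / 2) = (\<Prod>b\<in>Basis. exp (- (\<xi> \<bullet> b)\<^sup>2 / 2))"
      by (subst exp_sum[symmetric]) (auto simp: norm_sq_eq_sum_Basis sum_negf sum_divide_distrib)
    ultimately show ?thesis by (simp add: prod.distrib)
  qed
  have G_eq: "?G (\<Sum>b\<in>Basis. f b *\<^sub>R b) = (\<Prod>b\<in>Basis. ?g b (f b))" for f
    unfolding prod_eq by (intro prod.cong) simp_all
  have "integrable (Pi\<^sub>M Basis (\<lambda>_. lborel)) (\<lambda>f. \<Prod>b\<in>Basis. ?g b (f b))"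
    by (intro product_integrable_prod gaussian_transform_real finite_Basis)
  then show "integrable lborel ?G"
    unfolding G_eq[symmetric] by (subst lborel_eq, subst integrable_distr_eq) auto
  have "(LINT \<xi>|lborel. ?G \<xi>) = (LINT f|Pi\<^sub>M Basis (\<lambda>_. lborel). ?G (\<Sum>b\<in>Basis. f b *\<^sub>R b))"
    by (subst lborel_eq, subst integral_distr) auto
  also have "\<dots> = (\<Prod>b\<in>Basis. LINT s|lborel. ?g b s)"
    unfolding G_eq by (intro product_integral_prod gaussian_transform_real finite_Basis)
  also have "\<dots> = (\<Prod>b\<in>Basis. complex_of_real (sqrt (2 * pi) * exp (- (z \<bullet> b)\<^sup>2 / 2)))"
    by (simp only: gaussian_transform_real)
  also have "\<dots> = complex_of_real (sqrt (2 * pi) ^ DIM('a) * exp (- (norm z)\<^sup>2 / 2))"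
  proof -
    have "exp (- (norm z)\<^sup>2 / 2) = (\<Prod>b\<in>Basis. exp (- (z \<bullet> b)\<^sup>2 / 2))"
      by (subst exp_sum[symmetric]) (auto simp: norm_sq_eq_sum_Basis sum_negf sum_divide_distrib)
    then show ?thesis by (simp add: prod.distrib)
  qed
  finally show "(LINT \<xi>|lborel. ?G \<xi>) = complex_of_real (sqrt (2 * pi) ^ DIM('a) * exp (- (norm z)\<^sup>2 / 2))" .
qed

section \<open>Density of continuous functions and continuity of translation in L2\<close>

lemma ennreal_tendsto_0I:
  fixes f :: "'a \<Rightarrow> ennreal"
  assumes "\<And>e::real. e > 0 \<Longrightarrow> eventually (\<lambda>x. f x \<le> ennreal e) F"
  shows "(f \<longlongrightarrow> 0) F"
proof (rule order_tendstoI)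
  fix a :: ennreal assume "0 < a"
  then obtain b where b: "0 < b" "b < a" using dense by blast
  then obtain e where e: "b = ennreal e" "e > 0"
    by (cases b) auto
  show "eventually (\<lambda>x. f x < a) F"
    using assms[OF e(2)] by eventually_elim (use e b in auto)
qed auto

lemmas [measurable] = borel_closed[OF closed_cball]

lemma borel_measurable_cnj [measurable]: "cnj \<in> borel_measurable borel"
  by (intro borel_measurable_continuous_onI continuous_intros)

lemma clip_tendsto_dense:
  fixes f :: "'a::euclidean_space \<Rightarrow> complex"
  assumes f: "f \<in> L2" and e: "e > (0::real)"
  obtains k :: nat where
    "nnL2 (\<lambda>x. f x - (if cmod (f x) \<le> k \<and> norm x \<le> k then f x else 0)) \<le> ennreal e"
proof -
  have [measurable]: "f \<in> borel_measurable lborel" and fin: "nnL2 f < \<infinity>"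
    using f by (auto simp: L2_iff)
  let ?h = "\<lambda>(k::nat) x. if cmod (f x) \<le> k \<and> norm x \<le> k then f x else 0"
  have "(\<lambda>k. \<integral>\<^sup>+x. ennreal ((cmod (f x - ?h k x))\<^sup>2) \<partial>lborel) \<longlonglongrightarrow> integral\<^sup>N lborel (\<lambda>x::'a. 0)"
  proof (rule nn_integral_dominated_convergence[where w="\<lambda>x. ennreal ((cmod (f x))\<^sup>2)"])
    show "(\<integral>\<^sup>+ x. ennreal ((cmod (f x))\<^sup>2) \<partial>lborel) < \<infinity>" using fin by (simp add: nnL2_def)
    show "AE x in lborel. (\<lambda>k. ennreal ((cmod (f x - ?h k x))\<^sup>2)) \<longlonglongrightarrow> 0"
    proof (rule AE_I2)
      fix x
      obtain K :: nat where K: "max (cmod (f x)) (norm x) \<le> real K" using real_arch_simple by blast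
      have "ennreal ((cmod (f x - ?h k x))\<^sup>2) = 0" if "K \<le> k" for k
        using that K by (auto simp: max_def split: if_splits)
      then show "(\<lambda>k. ennreal ((cmod (f x - ?h k x))\<^sup>2)) \<longlonglongrightarrow> 0"
        by (intro tendsto_eventually eventually_sequentiallyI[of K])
    qed
  qed (auto intro!: AE_I2)
  then have "(\<lambda>k. nnL2 (\<lambda>x. f x - ?h k x)) \<longlonglongrightarrow> 0" by (simp add: nnL2_def)
  then have "eventually (\<lambda>k. nnL2 (\<lambda>x. f x - ?h k x) < ennreal e) sequentially"
    by (rule order_tendstoD) (use e in auto)
  then obtain k where "nnL2 (\<lambda>x. f x - ?h k x) < ennreal e"
    by (auto simp: eventually_sequentially)
  then show ?thesis using that[of k] by simp
qed

text \<open>\<open>measurable_on\<close> supplies continuous functions converging almost everywhere,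
  but with no common bound. Clipping f first and then applying a retraction and a cutoff that leave
  the clipped function fixed provides the bound for dominated convergence.\<close>

lemma L2_dense_continuous:
  fixes f :: "'a::euclidean_space \<Rightarrow> complex"
  assumes f: "f \<in> L2" and e: "e > (0::real)"
  obtains g :: "'a \<Rightarrow> complex" and M K :: real where
    "continuous_on UNIV g" "\<And>x. cmod (g x) \<le> M" "\<And>x. norm x > K \<Longrightarrow> g x = 0"
    "nnL2 (\<lambda>x. f x - g x) \<le> ennreal e"
proof -
  have [measurable]: "f \<in> borel_measurable lborel" using f by (auto simp: L2_iff)
  obtain k0 :: nat where k0:
    "nnL2 (\<lambda>x. f x - (if cmod (f x) \<le> k0 \<and> norm x \<le> k0 then f x else 0)) \<le> ennreal (e/4)"
    using clip_tendsto_dense[OF f, of "e/4"] e by auto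
  define k where "k = real k0"
  have k: "k \<ge> 0" by (simp add: k_def)
  define h where "h x = (if cmod (f x) \<le> k \<and> norm x \<le> k then f x else 0)" for x
  have h: "nnL2 (\<lambda>x. f x - h x) \<le> ennreal (e/4)" using k0 by (simp add: h_def k_def)
  have hm[measurable]: "h \<in> borel_measurable lborel" unfolding h_def by measurable
  have "h \<in> borel_measurable lebesgue"
    using hm by (rule measurable_completion)
  then have "h measurable_on UNIV" by (intro lebesgue_measurable_imp_measurable_on) auto
  then obtain N g where N: "negligible N" and gc: "\<And>n::nat. continuous_on UNIV (g n)"
    and gl: "\<And>x. x \<notin> N \<Longrightarrow> (\<lambda>n. g n x) \<longlonglongrightarrow> h x"
    unfolding measurable_on_def by auto
  \<comment> \<open>\<open>c\<close> retracts the plane onto the disc of radius k + 1, and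
    \<open>cut\<close> is 1 on the ball of radius k. Together they fix \<open>h\<close>, which is
    bounded by k and supported in that ball.\<close>
  define c where "c z = complex_of_real ((k+1) / max (k+1) (cmod z)) * z" for z
  define cut where "cut x = max 0 (min 1 (k + 1 - norm x))" for x :: 'a
  define G where "G n x = complex_of_real (cut x) * c (g n x)" for n x
  have c_bd: "cmod (c z) \<le> k + 1" for z
  proof -
    have "cmod (c z) = \<bar>(k + 1) / max (k + 1) (cmod z)\<bar> * cmod z"
      unfolding c_def by (simp only: norm_mult norm_of_real)
    also have "\<dots> = (k + 1) * (cmod z / max (k + 1) (cmod z))"
      using k by (simp add: abs_of_nonneg)
    also have "\<dots> \<le> (k + 1) * 1"
      using k by (intro mult_left_mono) (auto simp: divide_le_eq_1)
    finally show ?thesis by simp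
  qed
  have c_cont: "continuous_on UNIV c"
    unfolding c_def using k by (intro continuous_intros) (auto simp: max_def)
  have Gc: "continuous_on UNIV (G n)" for n
    unfolding G_def cut_def
    by (intro continuous_intros continuous_on_compose2[OF c_cont gc]) auto
  have chi: "0 \<le> cut x" "cut x \<le> 1" for x by (auto simp: cut_def)
  have G_bd: "cmod (G n x) \<le> k + 1" for n x
    using mult_mono[OF chi(2)[of x] c_bd[of "g n x"]] chi[of x] by (simp add: G_def norm_mult)
  have G_supp: "G n x = 0" if "norm x > k + 1" for n x
    using that by (simp add: G_def cut_def)
  have h_bd: "cmod (h x) \<le> k" and h_supp: "norm x > k \<Longrightarrow> h x = 0" for x
    using k by (auto simp: h_def)
  have fix_h: "complex_of_real (cut x) * c (h x) = h x" for x
    using h_bd[of x] k h_supp[of x] by (cases "norm x > k") (auto simp: c_def cut_def max_def)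
  have Glim: "(\<lambda>n. G n x) \<longlonglongrightarrow> h x" if "x \<notin> N" for x
  proof -
    have "(\<lambda>n. complex_of_real (cut x) * c (g n x)) \<longlonglongrightarrow> complex_of_real (cut x) * c (h x)"
      by (intro tendsto_mult tendsto_const continuous_on_tendsto_compose[OF c_cont gl[OF that]]) auto
    then show ?thesis by (simp add: G_def fix_h)
  qed
  have [measurable]: "G n \<in> borel_measurable lborel" for n
    using borel_measurable_continuous_onI[OF Gc] by simp
  have aeN: "AE x in lborel. x \<notin> N"
    using AE_not_in[OF N[unfolded negligible_iff_null_sets]] by (simp add: AE_completion_iff)
  have "(\<lambda>n. \<integral>\<^sup>+x. ennreal ((cmod (h x - G n x))\<^sup>2) \<partial>lborel) \<longlonglongrightarrow> integral\<^sup>N lborel (\<lambda>x::'a. 0)"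
  proof (rule nn_integral_dominated_convergence[where w="\<lambda>x. ennreal ((2*(k+1))\<^sup>2) * indicator (cball 0 (k+1)) x"])
    show "(integral\<^sup>N lborel (\<lambda>x::'a. ennreal ((2*(k+1))\<^sup>2) * indicator (cball 0 (k+1)) x)) < \<infinity>"
      using emeasure_bounded_finite[of "cball (0::'a) (k+1)"]
      by (simp add: nn_integral_cmult_indicator ennreal_mult_less_top)
    show "AE x in lborel. ennreal ((cmod (h x - G j x))\<^sup>2) \<le> ennreal ((2*(k+1))\<^sup>2) * indicator (cball 0 (k+1)) x" for j
    proof (rule AE_I2)
      fix x
      have "cmod (h x - G j x) \<le> 2*(k+1)"
        using norm_triangle_ineq4[of "h x" "G j x"] h_bd[of x] G_bd[of j x] by simp
      then show "ennreal ((cmod (h x - G j x))\<^sup>2) \<le> ennreal ((2*(k+1))\<^sup>2) * indicator (cball 0 (k+1)) x"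
        using h_supp[of x] G_supp[of x j] by (auto split: split_indicator intro!: ennreal_leI power_mono)
    qed
    show "AE x in lborel. (\<lambda>n. ennreal ((cmod (h x - G n x))\<^sup>2)) \<longlonglongrightarrow> 0"
      using aeN
    proof eventually_elim
      case (elim x)
      have "(\<lambda>n. ennreal ((cmod (h x - G n x))\<^sup>2)) \<longlonglongrightarrow> ennreal ((cmod (h x - h x))\<^sup>2)"
        by (intro tendsto_intros Glim elim)
      then show ?case by simp
    qed
  qed auto
  then have "(\<lambda>n. nnL2 (\<lambda>x. h x - G n x)) \<longlonglongrightarrow> 0" by (simp add: nnL2_def)
  then have "eventually (\<lambda>n. nnL2 (\<lambda>x. h x - G n x) < ennreal (e/4)) sequentially"
    by (rule order_tendstoD) (use e in auto)
  then obtain n where n: "nnL2 (\<lambda>x. h x - G n x) < ennreal (e/4)"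
    by (auto simp: eventually_sequentially)
  have "nnL2 (\<lambda>x. f x - G n x) \<le> 2 * nnL2 (\<lambda>x. f x - h x) + 2 * nnL2 (\<lambda>x. h x - G n x)"
    using nnL2_add_le[of "\<lambda>x. f x - h x" "\<lambda>x. h x - G n x"] by simp
  also have "\<dots> \<le> 2 * ennreal (e/4) + 2 * ennreal (e/4)"
    using h n by (intro add_mono mult_left_mono) auto
  also have "\<dots> = ennreal (2 * (e/4) + 2 * (e/4))"
    using e by (simp add: numeral_mult_ennreal flip: ennreal_plus)
  also have "2 * (e/4) + 2 * (e/4) = e" by simp
  finally show ?thesis
    using that[of "G n" "k+1" "k+1"] Gc G_bd G_supp by auto
qed

lemma nn_integral_lborel_translate:
  fixes z :: "'a::euclidean_space"
  assumes [measurable]: "f \<in> borel_measurable borel"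
  shows "(\<integral>\<^sup>+x. f (x + z) \<partial>lborel) = (\<integral>\<^sup>+x. f x \<partial>lborel)"
proof -
  have "(\<integral>\<^sup>+x. f x \<partial>lborel) = (\<integral>\<^sup>+x. f x \<partial>(distr lborel borel ((+) z)))"
    by (simp add: lborel_distr_plus)
  also have "\<dots> = (\<integral>\<^sup>+x. f (x + z) \<partial>lborel)"
    by (subst nn_integral_distr) (auto simp: add.commute)
  finally show ?thesis by simp
qed

lemma nnL2_translate:
  fixes z :: "'a::euclidean_space"
  assumes [measurable]: "f \<in> borel_measurable lborel"
  shows "nnL2 (\<lambda>x. f (x + z)) = nnL2 f"
  unfolding nnL2_def by (rule nn_integral_lborel_translate) simp

lemma L2_translate: "f \<in> L2 \<Longrightarrow> (\<lambda>x. f (x + z)) \<in> L2"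
  by (auto simp: L2_iff nnL2_translate)

text \<open>For a continuous g with bounded support this is dominated convergence; density carries
  it over to f because translation preserves the norm.\<close>

lemma L2_translation_continuous:
  fixes f :: "'a::euclidean_space \<Rightarrow> complex" and X :: "nat \<Rightarrow> 'a"
  assumes f: "f \<in> L2" and X: "X \<longlonglongrightarrow> 0"
  shows "(\<lambda>n. nnL2 (\<lambda>x. f (x + X n) - f x)) \<longlonglongrightarrow> 0"
proof (rule ennreal_tendsto_0I)
  fix e :: real assume e: "e > 0"
  have fm[measurable]: "f \<in> borel_measurable lborel" using f by (auto simp: L2_iff)
  \<comment> \<open>Ten sixteenths of e are spent below, as 2 + 4 + 4.\<close>
  obtain g M K where gc: "continuous_on UNIV g" and gb: "\<And>x. cmod (g x) \<le> M"
    and gs: "\<And>x. norm x > K \<Longrightarrow> g x = 0" and fg: "nnL2 (\<lambda>x. f x - g x) \<le> ennreal (e/16)"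
    using L2_dense_continuous[OF f, of "e/16"] e by auto
  have gm[measurable]: "g \<in> borel_measurable lborel"
    using borel_measurable_continuous_onI[OF gc] by simp
  have M: "M \<ge> 0" using gb[of 0] norm_ge_zero[of "g 0"] by linarith
  \<comment> \<open>Shifts longer than 1 are replaced by 0, so that all translates of g live in one
    ball; this changes only finitely many indices.\<close>
  let ?Y = "\<lambda>n. if norm (X n) \<le> 1 then X n else 0"
  have evX: "eventually (\<lambda>n. norm (X n) \<le> 1) sequentially"
  proof -
    have "(\<lambda>n. norm (X n)) \<longlonglongrightarrow> norm (0::'a)" by (intro tendsto_norm X)
    from order_tendstoD(2)[OF this, of 1] show ?thesis by (auto elim!: eventually_mono)
  qed
  have Y: "?Y \<longlonglongrightarrow> 0"
    by (rule Lim_transform_eventually[OF X]) (use evX in \<open>auto elim!: eventually_mono\<close>)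
  have "(\<lambda>n. \<integral>\<^sup>+x. ennreal ((cmod (g (x + ?Y n) - g x))\<^sup>2) \<partial>lborel) \<longlonglongrightarrow> integral\<^sup>N lborel (\<lambda>x::'a. 0)"
  proof (rule nn_integral_dominated_convergence[where w="\<lambda>x. ennreal ((2*M)\<^sup>2) * indicator (cball 0 (K+1)) x"])
    show "(integral\<^sup>N lborel (\<lambda>x::'a. ennreal ((2*M)\<^sup>2) * indicator (cball 0 (K+1)) x)) < \<infinity>"
      using emeasure_bounded_finite[of "cball (0::'a) (K+1)"]
      by (simp add: nn_integral_cmult_indicator ennreal_mult_less_top)
    show "AE x in lborel. ennreal ((cmod (g (x + ?Y j) - g x))\<^sup>2) \<le> ennreal ((2*M)\<^sup>2) * indicator (cball 0 (K+1)) x" for j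
    proof (rule AE_I2)
      fix x
      have 1: "cmod (g (x + ?Y j) - g x) \<le> 2*M"
        using norm_triangle_ineq4[of "g (x + ?Y j)" "g x"] gb[of x] gb[of "x + ?Y j"] by linarith
      have 2: "g (x + ?Y j) = 0 \<and> g x = 0" if "norm x > K + 1"
      proof -
        have "norm x \<le> norm (x + ?Y j) + norm (?Y j)"
          using norm_triangle_ineq4[of "x + ?Y j" "?Y j"] by simp
        moreover have "norm (?Y j) \<le> 1" by simp
        ultimately have "norm (x + ?Y j) > K" using that by linarith
        then show ?thesis using gs[of x] gs[of "x + ?Y j"] that by auto
      qed
      show "ennreal ((cmod (g (x + ?Y j) - g x))\<^sup>2) \<le> ennreal ((2*M)\<^sup>2) * indicator (cball 0 (K+1)) x"
      proof (cases "norm x > K + 1")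
        case True
        with 2 have "g (x + ?Y j) = 0" "g x = 0" by auto
        then show ?thesis by (simp only:) simp
      next
        case False
        moreover have "ennreal ((cmod (g (x + ?Y j) - g x))\<^sup>2) \<le> ennreal ((2*M)\<^sup>2)"
          using 1 by (intro ennreal_leI power_mono) auto
        ultimately show ?thesis by simp
      qed
    qed
    show "AE x in lborel. (\<lambda>n. ennreal ((cmod (g (x + ?Y n) - g x))\<^sup>2)) \<longlonglongrightarrow> 0"
    proof (rule AE_I2)
      fix x
      have "(\<lambda>n. x + ?Y n) \<longlonglongrightarrow> x + 0" by (intro tendsto_add tendsto_const Y)
      then have "(\<lambda>n. g (x + ?Y n)) \<longlonglongrightarrow> g (x + 0)"
        by (intro continuous_on_tendsto_compose[OF gc]) auto
      then have "(\<lambda>n. ennreal ((cmod (g (x + ?Y n) - g x))\<^sup>2)) \<longlonglongrightarrow> ennreal ((cmod (g (x+0) - g x))\<^sup>2)"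
        by (intro tendsto_intros)
      then show "(\<lambda>n. ennreal ((cmod (g (x + ?Y n) - g x))\<^sup>2)) \<longlonglongrightarrow> 0" by simp
    qed
  qed auto
  then have "(\<lambda>n. nnL2 (\<lambda>x. g (x + ?Y n) - g x)) \<longlonglongrightarrow> 0" by (simp add: nnL2_def)
  then have "eventually (\<lambda>n. nnL2 (\<lambda>x. g (x + ?Y n) - g x) < ennreal (e/16)) sequentially"
    by (rule order_tendstoD) (use e in auto)
  then show "eventually (\<lambda>n. nnL2 (\<lambda>x. f (x + X n) - f x) \<le> ennreal e) sequentially"
    using evX
  proof eventually_elim
    case (elim n)
    then have *: "nnL2 (\<lambda>x. g (x + X n) - g x) \<le> ennreal (e/16)" by simp
    have "nnL2 (\<lambda>x. f (x + X n) - f x)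
      \<le> 2 * nnL2 (\<lambda>x. f (x + X n) - g (x + X n)) + 2 * nnL2 (\<lambda>x. g (x + X n) - f x)"
      using nnL2_add_le[of "\<lambda>x. f (x + X n) - g (x + X n)" "\<lambda>x. g (x + X n) - f x"] by simp
    also have "nnL2 (\<lambda>x. f (x + X n) - g (x + X n)) = nnL2 (\<lambda>x. f x - g x)"
      by (rule nnL2_translate[of "\<lambda>x. f x - g x"]) simp
    also have "nnL2 (\<lambda>x. g (x + X n) - f x) \<le> 2 * nnL2 (\<lambda>x. g (x + X n) - g x) + 2 * nnL2 (\<lambda>x. f x - g x)"
      using nnL2_diff_le[of "\<lambda>x. g (x + X n) - g x" "\<lambda>x. f x - g x"] by simp
    finally have "nnL2 (\<lambda>x. f (x + X n) - f x) \<le> 2 * nnL2 (\<lambda>x. f x - g x)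
       + 2 * (2 * nnL2 (\<lambda>x. g (x + X n) - g x) + 2 * nnL2 (\<lambda>x. f x - g x))"
      by (simp add: mult_left_mono add_mono)
    also have "\<dots> \<le> 2 * ennreal (e/16) + 2 * (2 * ennreal (e/16) + 2 * ennreal (e/16))"
      by (intro add_mono mult_left_mono * fg) auto
    also have "\<dots> = ennreal (2 * (e/16) + 2 * (2 * (e/16) + 2 * (e/16)))"
      using e by (simp add: numeral_mult_ennreal flip: ennreal_plus)
    also have "\<dots> \<le> ennreal e" using e by (intro ennreal_leI) simp
    finally show ?case .
  qed
qed

lemma cmod_cis_mult [simp]: "cmod (cis a * z) = cmod z"
  by (simp add: norm_mult)

section \<open>Translation, dilation and Fubini\<close>

lemma integrable_lborel_translate:
  fixes z :: "'a::euclidean_space" and f :: "'a \<Rightarrow> 'b::{banach, second_countable_topology}"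
  assumes "integrable lborel f"
  shows "integrable lborel (\<lambda>x. f (x + z))"
proof -
  have [measurable]: "f \<in> borel_measurable borel" using assms by auto
  have "integrable (distr lborel borel ((+) z)) f" using assms by (simp add: lborel_distr_plus)
  then show ?thesis by (subst (asm) integrable_distr_eq) (auto simp: add.commute)
qed

lemma integral_lborel_translate:
  fixes z :: "'a::euclidean_space" and f :: "'a \<Rightarrow> 'b::{banach, second_countable_topology}"
  assumes [measurable]: "f \<in> borel_measurable borel"
  shows "(LINT x|lborel. f (x + z)) = (LINT x|lborel. f x)"
proof -
  have "(LINT x|lborel. f x) = (LINT x|distr lborel borel ((+) z). f x)" by (simp add: lborel_distr_plus)
  also have "\<dots> = (LINT x|lborel. f (x + z))"
    by (subst integral_distr) (auto simp: add.commute)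
  finally show ?thesis by simp
qed

lemma integral_lborel_scale:
  fixes f :: "'a::euclidean_space \<Rightarrow> 'b::{banach, second_countable_topology}"
  assumes [measurable]: "f \<in> borel_measurable borel" and c: "c > 0"
  shows "(LINT x|lborel. f x) = c ^ DIM('a) *\<^sub>R (LINT x|lborel. f (c *\<^sub>R x))"
proof -
  have "(LINT x|lborel. f x) = (LINT x|density (distr lborel borel (\<lambda>x. 0 + c *\<^sub>R x)) (\<lambda>_. \<bar>c\<bar>^DIM('a)). f x)"
    using lborel_affine[of c "0::'a"] c by (metis less_irrefl)
  also have "\<dots> = c ^ DIM('a) *\<^sub>R (LINT x|lborel. f (c *\<^sub>R x))"
    using c by (subst integral_density) (auto simp: integral_distr)
  finally show ?thesis .
qed

lemma integrable_pair_mult: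
  fixes f :: "'a::euclidean_space \<Rightarrow> complex" and g :: "'b::euclidean_space \<Rightarrow> complex"
  assumes f: "integrable lborel f" and g: "integrable lborel g"
    and [measurable]: "k \<in> borel_measurable (lborel \<Otimes>\<^sub>M lborel)"
    and k: "\<And>x y. cmod (k (x, y)) \<le> 1"
  shows "integrable (lborel \<Otimes>\<^sub>M lborel) (\<lambda>(x, y). k (x, y) * (f x * g y))"
proof -
  have [measurable]: "f \<in> borel_measurable borel" "g \<in> borel_measurable borel" using f g by auto
  have "integrable (lborel \<Otimes>\<^sub>M lborel) (\<lambda>p. f (fst p) * g (snd p))"
  proof (rule lborel_pair.Fubini_integrable)
    show "integrable lborel (\<lambda>x. LINT y|lborel. norm (f (fst (x, y)) * g (snd (x, y))))"
      using f by (simp add: norm_mult)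
    show "AE x in lborel. integrable lborel (\<lambda>y. f (fst (x, y)) * g (snd (x, y)))"
      using g by simp
  qed measurable
  then show ?thesis
    by (rule Bochner_Integration.integrable_bound)
       (use k in \<open>auto simp: norm_mult split_def intro!: mult_left_le_one_le AE_I2\<close>)
qed

lemma borel_measurable_fourier [measurable]:
  fixes f :: "'a::euclidean_space \<Rightarrow> complex"
  assumes [measurable]: "f \<in> borel_measurable borel"
  shows "fourier f \<in> borel_measurable borel"
proof -
  have "(\<lambda>\<xi>. LINT x|lborel. cis (- (x \<bullet> \<xi>)) * f x) \<in> borel_measurable borel"
    by (rule lborel.borel_measurable_lebesgue_integral) measurable
  then show ?thesis by (simp add: fourier_def[abs_def])
qed

lemma cmod_fourier_le:
  "cmod (fourier f \<xi>) \<le> norm_L1 f"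
  unfolding fourier_def norm_L1_def
  using integral_norm_bound[of lborel "\<lambda>x. cis (- (x \<bullet> \<xi>)) * f x"] by simp

text \<open>Fubini's theorem for a bounded kernel that is symmetric in its two arguments. It moves a
  transform from one factor to the other, both against Gaussians and in the polarised form of
  Plancherel.\<close>

lemma fourier_multiplication:
  fixes f g :: "'a::euclidean_space \<Rightarrow> complex"
  assumes f: "integrable lborel f" and g: "integrable lborel g"
  shows "(LINT \<xi>|lborel. fourier f \<xi> * g \<xi>) = (LINT x|lborel. f x * fourier g x)"
proof -
  have [measurable]: "f \<in> borel_measurable borel" "g \<in> borel_measurable borel" using f g by auto
  have int: "integrable (lborel \<Otimes>\<^sub>M lborel) (\<lambda>(x, \<xi>). cis (- (x \<bullet> \<xi>)) * (f x * g \<xi>))"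
    using integrable_pair_mult[OF f g, of "\<lambda>(x, \<xi>). cis (- (x \<bullet> \<xi>))"] by (simp add: split_def)
  have "(LINT \<xi>|lborel. fourier f \<xi> * g \<xi>) = (LINT \<xi>|lborel. LINT x|lborel. cis (- (x \<bullet> \<xi>)) * (f x * g \<xi>))"
    unfolding fourier_def by (subst integral_mult_left_zero[symmetric]) (simp add: mult.assoc)
  also have "\<dots> = (LINT x|lborel. LINT \<xi>|lborel. cis (- (x \<bullet> \<xi>)) * (f x * g \<xi>))"
    using lborel_pair.Fubini_integral[OF int] by simp
  also have "\<dots> = (LINT x|lborel. f x * fourier g x)"
    unfolding fourier_def
    by (subst integral_mult_right_zero[symmetric]) (simp add: inner_commute mult_ac)
  finally show ?thesis .
qed

section \<open>Autocorrelation, and Plancherel for functions in both L1 and L2\<close>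

definition autocorr :: "('a::euclidean_space \<Rightarrow> complex) \<Rightarrow> 'a \<Rightarrow> complex" where
  "autocorr f z = (LINT x|lborel. f (x + z) * cnj (f x))"

lemma
  fixes f :: "'a::euclidean_space \<Rightarrow> complex"
  assumes f: "integrable lborel f"
  shows integrable_autocorr: "integrable lborel (autocorr f)"
    and fourier_autocorr: "fourier (autocorr f) \<xi> = fourier f \<xi> * cnj (fourier f \<xi>)"
proof -
  have [measurable]: "f \<in> borel_measurable borel" using f by auto
  have intn: "integrable lborel (\<lambda>x. cmod (f x))" using f by simp
  have int: "integrable (lborel \<Otimes>\<^sub>M lborel) (\<lambda>(x, z). f (x + z) * cnj (f x))"
  proof (rule lborel_pair.Fubini_integrable)
    have "(LINT z|lborel. norm (f (x + z) * cnj (f x))) = (LINT z|lborel. norm (f z)) * norm (f x)" for x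
      using integral_lborel_translate[of "\<lambda>x. norm (f x)" x] by (simp add: norm_mult add.commute)
    then show "integrable lborel (\<lambda>x. LINT y|lborel. norm (case (x, y) of (x, z) \<Rightarrow> f (x + z) * cnj (f x)))"
      using intn by simp
    show "AE x in lborel. integrable lborel (\<lambda>y. case (x, y) of (x, z) \<Rightarrow> f (x + z) * cnj (f x))"
      using integrable_lborel_translate[OF f] by (auto simp: add.commute)
  qed measurable
  show "integrable lborel (autocorr f)"
    using lborel_pair.integrable_snd[OF int] by (simp add: autocorr_def[abs_def])
  have int2: "integrable (lborel \<Otimes>\<^sub>M lborel) (\<lambda>(x, z). cis (- (z \<bullet> \<xi>)) * (f (x + z) * cnj (f x)))"
    by (rule Bochner_Integration.integrable_bound[OF int]) auto
  have "fourier (autocorr f) \<xi> = (LINT z|lborel. LINT x|lborel. cis (- (z \<bullet> \<xi>)) * (f (x + z) * cnj (f x)))"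
    unfolding fourier_def autocorr_def by simp
  also have "\<dots> = (LINT x|lborel. LINT z|lborel. cis (- (z \<bullet> \<xi>)) * (f (x + z) * cnj (f x)))"
    using lborel_pair.Fubini_integral[OF int2] by simp
  also have "\<dots> = (LINT x|lborel. cnj (cis (- (x \<bullet> \<xi>)) * f x) * fourier f \<xi>)"
  proof (rule Bochner_Integration.integral_cong[OF refl])
    fix x
    \<comment> \<open>Shifting the integration variable by x pulls out the phase that separates the
      double integral into a product of transforms.\<close>
    have "fourier f \<xi> = (LINT z|lborel. cis (- ((z + x) \<bullet> \<xi>)) * f (z + x))"
      unfolding fourier_def by (subst integral_lborel_translate[of _ x, symmetric]) auto
    also have "\<dots> = (LINT z|lborel. cis (- (x \<bullet> \<xi>)) * (cis (- (z \<bullet> \<xi>)) * f (x + z)))"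
      by (rule Bochner_Integration.integral_cong)
         (auto simp: inner_add_left cis_mult add.commute mult.assoc[symmetric])
    also have "\<dots> = cis (- (x \<bullet> \<xi>)) * (LINT z|lborel. cis (- (z \<bullet> \<xi>)) * f (x + z))"
      by simp
    finally have *: "fourier f \<xi> = cis (- (x \<bullet> \<xi>)) * (LINT z|lborel. cis (- (z \<bullet> \<xi>)) * f (x + z))" .
    have "(LINT z|lborel. cis (- (z \<bullet> \<xi>)) * (f (x + z) * cnj (f x))) =
          (LINT z|lborel. cis (- (z \<bullet> \<xi>)) * f (x + z)) * cnj (f x)"
      by (subst integral_mult_left_zero[symmetric]) (simp add: mult.assoc)
    also have "\<dots> = cnj (cis (- (x \<bullet> \<xi>)) * f x) * fourier f \<xi>"
      unfolding * by (simp add: cis_cnj cis_mult mult_ac flip: mult.assoc)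
    finally show "(LINT z|lborel. cis (- (z \<bullet> \<xi>)) * (f (x + z) * cnj (f x))) =
        cnj (cis (- (x \<bullet> \<xi>)) * f x) * fourier f \<xi>" .
  qed
  also have "\<dots> = cnj (fourier f \<xi>) * fourier f \<xi>"
    unfolding fourier_def using Bochner_Integration.integral_cnj[of lborel "\<lambda>x. cis (- (x \<bullet> \<xi>)) * f x"] by simp
  finally show "fourier (autocorr f) \<xi> = fourier f \<xi> * cnj (fourier f \<xi>)" by simp
qed

text \<open>Young's inequality instead of Cauchy-Schwarz, hence the factor 2; the bound only serves
  as a dominating constant.\<close>

lemma cmod_autocorr_le:
  fixes f :: "'a::euclidean_space \<Rightarrow> complex"
  assumes f: "f \<in> L2"
  shows "cmod (autocorr f z) \<le> 2 * (norm_L2 f)\<^sup>2"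
proof -
  have [measurable]: "f \<in> borel_measurable borel" using f by (simp add: L2_def)
  have i: "integrable lborel (\<lambda>x. (cmod (f x))\<^sup>2)" using f by (simp add: L2_def)
  have n: "(LINT x|lborel. (cmod (f x))\<^sup>2) = (norm_L2 f)\<^sup>2" by (simp add: norm_L2_def)
  have "cmod (autocorr f z) \<le> (LINT x|lborel. cmod (f (x + z) * cnj (f x)))"
    unfolding autocorr_def by (rule integral_norm_bound)
  also have "\<dots> \<le> (LINT x|lborel. (cmod (f (x + z)))\<^sup>2 + (cmod (f x))\<^sup>2)"
  proof (rule integral_mono)
    show "integrable lborel (\<lambda>x. cmod (f (x + z) * cnj (f x)))"
      by (intro integrable_norm integrable_L2_mult L2_translate f) (use f in \<open>simp add: L2_def\<close>)
    show "integrable lborel (\<lambda>x. (cmod (f (x + z)))\<^sup>2 + (cmod (f x))\<^sup>2)"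
      using integrable_lborel_translate[OF i] i by simp
    fix x
    have "2 * (cmod (f (x+z)) * cmod (f x)) \<le> (cmod (f (x+z)))\<^sup>2 + (cmod (f x))\<^sup>2"
      using sum_squares_bound[of "cmod (f (x+z))" "cmod (f x)"] by simp
    moreover have "0 \<le> cmod (f (x+z)) * cmod (f x)" by simp
    ultimately have "cmod (f (x+z)) * cmod (f x) \<le> (cmod (f (x + z)))\<^sup>2 + (cmod (f x))\<^sup>2"
      by linarith
    then show "cmod (f (x + z) * cnj (f x)) \<le> (cmod (f (x + z)))\<^sup>2 + (cmod (f x))\<^sup>2"
      by (simp add: norm_mult)
  qed
  also have "\<dots> = 2 * (norm_L2 f)\<^sup>2"
    using integrable_lborel_translate[OF i] i integral_lborel_translate[of "\<lambda>x. (cmod (f x))\<^sup>2" z]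
    by (simp add: n)
  finally show ?thesis .
qed

lemma autocorr_0:
  "autocorr f 0 = complex_of_real ((norm_L2 f)\<^sup>2)"
proof -
  have "autocorr f 0 = (LINT x|lborel. complex_of_real ((cmod (f x))\<^sup>2))"
    unfolding autocorr_def by (simp only: complex_norm_square add_0_right)
  also have "\<dots> = complex_of_real ((norm_L2 f)\<^sup>2)"
    by (simp only: integral_complex_of_real) (simp add: norm_L2_def)
  finally show ?thesis .
qed

text \<open>With d the translation difference, Young's inequality with weight s splits |d| |f|: the
  term with f is small by the choice of s, the term with d by continuity of translation.\<close>

lemma autocorr_tendsto:
  fixes f :: "'a::euclidean_space \<Rightarrow> complex"
  assumes f: "f \<in> L2" and X: "X \<longlonglongrightarrow> 0"
  shows "(\<lambda>n. autocorr f (X n)) \<longlonglongrightarrow> autocorr f 0"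
proof (rule tendstoI)
  fix e :: real assume e: "e > 0"
  define N where "N = (norm_L2 f)\<^sup>2 + 1"
  have N: "N > 0" by (simp add: N_def add_nonneg_pos)
  \<comment> \<open>With this weight \<open>s * (norm_L2 f)\<^sup>2 \<le> e / 2\<close>; the 1 added
    in \<open>N\<close> keeps the quotient meaningful when f vanishes.\<close>
  define s where "s = e / (2 * N)"
  have s: "s > 0" using e N by (simp add: s_def)
  have [measurable]: "f \<in> borel_measurable borel" using f by (simp add: L2_def)
  have i: "integrable lborel (\<lambda>x. (cmod (f x))\<^sup>2)" using f by (simp add: L2_def)
  have "eventually (\<lambda>n. nnL2 (\<lambda>x. f (x + X n) - f x) < ennreal (s * e / 2)) sequentially"
    by (rule order_tendstoD[OF L2_translation_continuous[OF f X]]) (use e s in auto)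
  then show "eventually (\<lambda>n. dist (autocorr f (X n)) (autocorr f 0) < e) sequentially"
  proof eventually_elim
    case (elim n)
    define d where "d x = f (x + X n) - f x" for x
    have d: "d \<in> L2" unfolding d_def by (intro L2_diff L2_translate f)
    have cf: "(\<lambda>x. cnj (f x)) \<in> L2" using f by (simp add: L2_def)
    have "ennreal ((norm_L2 d)\<^sup>2) < ennreal (s * e / 2)"
      using elim unfolding nnL2_eq_norm_L2[OF d, symmetric] by (simp add: d_def[abs_def])
    then have dn: "(norm_L2 d)\<^sup>2 < s * e / 2" using s e by (simp add: ennreal_less_iff)
    have "autocorr f (X n) - autocorr f 0 = (LINT x|lborel. d x * cnj (f x))"
      unfolding autocorr_def d_def
      using integrable_L2_mult[OF L2_translate[OF f, of "X n"] cf] integrable_L2_mult[OF f cf]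
      by (simp add: left_diff_distrib)
    then have "dist (autocorr f (X n)) (autocorr f 0) \<le> (LINT x|lborel. cmod (d x * cnj (f x)))"
      by (simp only: dist_norm integral_norm_bound)
    also have "\<dots> \<le> (LINT x|lborel. (cmod (d x))\<^sup>2 / s + s * (cmod (f x))\<^sup>2)"
    proof (rule integral_mono)
      show "integrable lborel (\<lambda>x. cmod (d x * cnj (f x)))"
        by (intro integrable_norm integrable_L2_mult d cf)
      show "integrable lborel (\<lambda>x. (cmod (d x))\<^sup>2 / s + s * (cmod (f x))\<^sup>2)"
        using i d by (simp add: L2_def)
      fix x
      have "2 * (cmod (d x) * (s * cmod (f x))) \<le> (cmod (d x))\<^sup>2 + (s * cmod (f x))\<^sup>2"
        using sum_squares_bound[of "cmod (d x)" "s * cmod (f x)"] by simp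
      moreover have "0 \<le> cmod (d x) * (s * cmod (f x))" using s by simp
      ultimately have "cmod (d x) * (s * cmod (f x)) \<le> (cmod (d x))\<^sup>2 + (s * cmod (f x))\<^sup>2"
        by linarith
      then show "cmod (d x * cnj (f x)) \<le> (cmod (d x))\<^sup>2 / s + s * (cmod (f x))\<^sup>2"
        using s by (simp add: norm_mult field_simps power2_eq_square)
    qed
    also have "\<dots> = (norm_L2 d)\<^sup>2 / s + s * (norm_L2 f)\<^sup>2"
      using i d by (simp add: L2_def norm_L2_def)
    also have "\<dots> < e / 2 + e / 2"
    proof (rule add_less_le_mono)
      show "(norm_L2 d)\<^sup>2 / s < e / 2" using dn s by (simp add: field_simps)
      have "s * (norm_L2 f)\<^sup>2 \<le> s * N" using s by (intro mult_left_mono) (auto simp: N_def)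
      also have "\<dots> = e / 2" using N by (simp add: s_def)
      finally show "s * (norm_L2 f)\<^sup>2 \<le> e / 2" .
    qed
    finally show ?case by simp
  qed
qed

lemma fourier_gaussian_scaled:
  fixes z :: "'a::euclidean_space"
  assumes c: "c > 0"
  shows "integrable lborel (\<lambda>\<xi>::'a. complex_of_real (exp (- (norm (\<xi> /\<^sub>R c))\<^sup>2 / 2)))"
    and "fourier (\<lambda>\<xi>. complex_of_real (exp (- (norm (\<xi> /\<^sub>R c))\<^sup>2 / 2))) z
      = complex_of_real (c ^ DIM('a) * (sqrt (2 * pi) ^ DIM('a) * exp (- (norm (c *\<^sub>R z))\<^sup>2 / 2)))"
proof -
  let ?g = "\<lambda>\<xi>::'a. complex_of_real (exp (- (norm (\<xi> /\<^sub>R c))\<^sup>2 / 2))"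
  have [simp]: "c \<noteq> 0" using c by simp
  have i0: "integrable lborel (\<lambda>\<xi>::'a. complex_of_real (exp (- (norm \<xi>)\<^sup>2 / 2)))"
    using gaussian_transform(1)[of "0::'a"] by simp
  have "lborel = density (distr lborel borel (\<lambda>x::'a. 0 + (inverse c) *\<^sub>R x)) (\<lambda>_. \<bar>inverse c\<bar>^DIM('a))"
    by (rule lborel_affine) simp
  with i0 have "integrable (density (distr lborel borel (\<lambda>x::'a. 0 + (inverse c) *\<^sub>R x)) (\<lambda>_. \<bar>inverse c\<bar>^DIM('a)))
     (\<lambda>\<xi>::'a. complex_of_real (exp (- (norm \<xi>)\<^sup>2 / 2)))" by metis
  then have "integrable lborel (\<lambda>\<xi>. \<bar>inverse c\<bar>^DIM('a) *\<^sub>R ?g \<xi>)"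
    by (subst (asm) integrable_density) (auto simp: integrable_distr_eq)
  from integrable_scaleR_right[OF this, of "1 / \<bar>inverse c\<bar>^DIM('a)"]
  show "integrable lborel ?g" by simp
  have "fourier ?g z = c ^ DIM('a) *\<^sub>R (LINT \<xi>|lborel. cis (- ((c *\<^sub>R \<xi>) \<bullet> z)) * ?g (c *\<^sub>R \<xi>))"
    unfolding fourier_def by (rule integral_lborel_scale[OF _ c]) measurable
  also have "(LINT \<xi>|lborel. cis (- ((c *\<^sub>R \<xi>) \<bullet> z)) * ?g (c *\<^sub>R \<xi>))
     = (LINT \<xi>|lborel. cis ((- (c *\<^sub>R z)) \<bullet> \<xi>) * complex_of_real (exp (- (norm \<xi>)\<^sup>2 / 2)))"
    by (rule Bochner_Integration.integral_cong) (auto simp: inner_commute)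
  also have "\<dots> = complex_of_real (sqrt (2 * pi) ^ DIM('a) * exp (- (norm (- (c *\<^sub>R z)))\<^sup>2 / 2))"
    by (rule gaussian_transform)
  finally show "fourier ?g z
      = complex_of_real (c ^ DIM('a) * (sqrt (2 * pi) ^ DIM('a) * exp (- (norm (c *\<^sub>R z))\<^sup>2 / 2)))"
    by (simp add: scaleR_conv_of_real)
qed

text \<open>
  The transform of the autocorrelation of \<open>f\<close> is \<open>|fourier f|\<^sup>2\<close>. Testing it against a Gaussian that
  flattens to \<open>1\<close> recovers the autocorrelation at zero, where it is continuous because translation
  is continuous in \<open>L\<^sup>2\<close>.
\<close>

theorem plancherel_L1_L2:
  fixes f :: "'a::euclidean_space \<Rightarrow> complex"
  assumes f1: "integrable lborel f" and f2: "f \<in> L2"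
  shows "nnL2 (fourier f) = ennreal ((2 * pi) ^ DIM('a)) * nnL2 f"
proof -
  have [measurable]: "f \<in> borel_measurable borel" using f1 by auto
  \<comment> \<open>The widths of the Gaussians: as \<open>c n\<close> grows, \<open>g n\<close>
    increases to 1 and its transform concentrates at zero.\<close>
  define c where "c n = real (Suc n)" for n
  have c: "c n > 0" for n by (simp add: c_def)
  have c_lim: "(\<lambda>n. w /\<^sub>R c n) \<longlonglongrightarrow> 0" for w :: 'a
  proof -
    have "(\<lambda>n. inverse (c n) *\<^sub>R w) \<longlonglongrightarrow> 0 *\<^sub>R w"
      unfolding c_def by (intro tendsto_scaleR tendsto_const LIMSEQ_inverse_real_of_nat)
    then show ?thesis by simp
  qed
  define g where "g n \<xi> = exp (- (norm (\<xi> /\<^sub>R c n))\<^sup>2 / 2)" for n and \<xi> :: 'a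
  have [measurable]: "g n \<in> borel_measurable borel" for n
    unfolding g_def by measurable
  have g_nonneg: "0 \<le> g n \<xi>" for n \<xi> by (simp add: g_def)
  have g_int: "integrable lborel (\<lambda>\<xi>. complex_of_real (g n \<xi>))" for n
    unfolding g_def by (rule fourier_gaussian_scaled(1)[OF c])
  define q where "q = sqrt (2 * pi) ^ DIM('a)"
  have g_fourier: "fourier (\<lambda>\<xi>. complex_of_real (g n \<xi>)) z = complex_of_real (c n ^ DIM('a) * (q * exp (- (norm (c n *\<^sub>R z))\<^sup>2 / 2)))" for n z
    unfolding g_def q_def by (rule fourier_gaussian_scaled(2)[OF c])
  have Am[measurable]: "autocorr f \<in> borel_measurable borel"
    using integrable_autocorr[OF f1] by auto
  have q: "q * q = (2 * pi) ^ DIM('a)"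
    unfolding q_def by (subst power_mult_distrib[symmetric]) simp
  have gint: "integrable lborel (\<lambda>\<xi>. (cmod (fourier f \<xi>))\<^sup>2 * g n \<xi>)" for n
  proof (rule Bochner_Integration.integrable_bound)
    show "integrable lborel (\<lambda>\<xi>. (norm_L1 f)\<^sup>2 * g n \<xi>)"
      using integrable_norm[OF g_int[of n]] g_nonneg by simp
    show "AE \<xi> in lborel. norm ((cmod (fourier f \<xi>))\<^sup>2 * g n \<xi>) \<le> norm ((norm_L1 f)\<^sup>2 * g n \<xi>)"
      using cmod_fourier_le[of f] g_nonneg by (auto intro!: AE_I2 mult_right_mono power_mono simp: abs_mult)
  qed measurable
  have eq: "complex_of_real (LINT \<xi>|lborel. (cmod (fourier f \<xi>))\<^sup>2 * g n \<xi>)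
     = q * (LINT w|lborel. autocorr f (w /\<^sub>R c n) * complex_of_real (exp (- (norm w)\<^sup>2 / 2)))" for n
  proof -
    have "complex_of_real (LINT \<xi>|lborel. (cmod (fourier f \<xi>))\<^sup>2 * g n \<xi>)
       = (LINT \<xi>|lborel. fourier (autocorr f) \<xi> * complex_of_real (g n \<xi>))"
      by (subst integral_complex_of_real[symmetric], rule Bochner_Integration.integral_cong)
         (simp_all add: fourier_autocorr[OF f1] complex_norm_square[symmetric])
    also have "\<dots> = (LINT z|lborel. autocorr f z * fourier (\<lambda>\<xi>. complex_of_real (g n \<xi>)) z)"
      by (rule fourier_multiplication[OF integrable_autocorr[OF f1] g_int])
    also have "\<dots> = (LINT z|lborel. complex_of_real (c n ^ DIM('a) * q) * (autocorr f z * complex_of_real (exp (- (norm (c n *\<^sub>R z))\<^sup>2 / 2))))"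
      unfolding g_fourier
      by (rule Bochner_Integration.integral_cong) (simp_all only: of_real_mult mult_ac)
    also have "\<dots> = complex_of_real (c n ^ DIM('a) * q) * (LINT z|lborel. autocorr f z * complex_of_real (exp (- (norm (c n *\<^sub>R z))\<^sup>2 / 2)))"
      by (rule integral_mult_right_zero)
    \<comment> \<open>Substituting z = w / c n cancels the power of \<open>c n\<close> carried by
      the transform of the Gaussian.\<close>
    also have "(LINT z|lborel. autocorr f z * complex_of_real (exp (- (norm (c n *\<^sub>R z))\<^sup>2 / 2)))
       = (1 / c n) ^ DIM('a) *\<^sub>R (LINT w|lborel. autocorr f ((1 / c n) *\<^sub>R w) * complex_of_real (exp (- (norm (c n *\<^sub>R (1 / c n) *\<^sub>R w))\<^sup>2 / 2)))"
      by (rule integral_lborel_scale) (auto simp: c)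
    also have "\<dots> = (1 / c n) ^ DIM('a) *\<^sub>R (LINT w|lborel. autocorr f (w /\<^sub>R c n) * complex_of_real (exp (- (norm w)\<^sup>2 / 2)))"
    proof -
      have "c n *\<^sub>R (1 / c n) *\<^sub>R w = w" "(1 / c n) *\<^sub>R w = w /\<^sub>R c n" for w :: 'a
        using c[of n] by (simp_all add: inverse_eq_divide)
      then show ?thesis by (simp only:)
    qed
    also have "complex_of_real (c n ^ DIM('a) * q) * ((1 / c n) ^ DIM('a) *\<^sub>R (LINT w|lborel. autocorr f (w /\<^sub>R c n) * complex_of_real (exp (- (norm w)\<^sup>2 / 2))))
      = q * (LINT w|lborel. autocorr f (w /\<^sub>R c n) * complex_of_real (exp (- (norm w)\<^sup>2 / 2)))"
    proof -
      have "complex_of_real (c n ^ DIM('a) * q) * ((1 / c n) ^ DIM('a) *\<^sub>R I) = q * I" for I :: complex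
        using c[of n] by (simp add: scaleR_conv_of_real power_one_over)
      then show ?thesis .
    qed
    finally show ?thesis .
  qed
  have lim: "(\<lambda>n. LINT w|lborel. autocorr f (w /\<^sub>R c n) * complex_of_real (exp (- (norm w)\<^sup>2 / 2)))
     \<longlonglongrightarrow> (LINT w|lborel. autocorr f 0 * complex_of_real (exp (- (norm (w::'a))\<^sup>2 / 2)))"
  proof (rule integral_dominated_convergence[where w="\<lambda>w. (2 * (norm_L2 f)\<^sup>2) * exp (- (norm w)\<^sup>2 / 2)"])
    show "integrable lborel (\<lambda>w::'a. (2 * (norm_L2 f)\<^sup>2) * exp (- (norm w)\<^sup>2 / 2))"
      using integrable_norm[OF gaussian_transform(1)[of "0::'a"]] by simp
    show "AE w in lborel. (\<lambda>n. autocorr f (w /\<^sub>R c n) * complex_of_real (exp (- (norm w)\<^sup>2 / 2)))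
        \<longlonglongrightarrow> autocorr f 0 * complex_of_real (exp (- (norm w)\<^sup>2 / 2))"
      by (intro AE_I2 tendsto_mult tendsto_const autocorr_tendsto[OF f2] c_lim)
    show "AE w in lborel. norm (autocorr f (w /\<^sub>R c n) * complex_of_real (exp (- (norm w)\<^sup>2 / 2)))
        \<le> 2 * (norm_L2 f)\<^sup>2 * exp (- (norm w)\<^sup>2 / 2)" for n
      using cmod_autocorr_le[OF f2] by (auto intro!: AE_I2 mult_right_mono simp: norm_mult)
  qed measurable
  have "(LINT w|lborel. autocorr f 0 * complex_of_real (exp (- (norm (w::'a))\<^sup>2 / 2)))
      = autocorr f 0 * (LINT w|lborel. complex_of_real (exp (- (norm (w::'a))\<^sup>2 / 2)))"
    by (rule integral_mult_right_zero)
  also have "(LINT w|lborel. complex_of_real (exp (- (norm (w::'a))\<^sup>2 / 2))) = complex_of_real q"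
    using gaussian_transform(2)[of "0::'a"] by (simp add: q_def)
  finally have lim_val: "(LINT w|lborel. autocorr f 0 * complex_of_real (exp (- (norm (w::'a))\<^sup>2 / 2)))
      = autocorr f 0 * complex_of_real q" .
  have "(\<lambda>n. complex_of_real (LINT \<xi>|lborel. (cmod (fourier f \<xi>))\<^sup>2 * g n \<xi>))
      \<longlonglongrightarrow> complex_of_real q * (autocorr f 0 * complex_of_real q)"
    unfolding eq by (rule tendsto_mult[OF tendsto_const lim[unfolded lim_val]])
  then have "(\<lambda>n. complex_of_real (LINT \<xi>|lborel. (cmod (fourier f \<xi>))\<^sup>2 * g n \<xi>))
      \<longlonglongrightarrow> complex_of_real ((2 * pi) ^ DIM('a) * (norm_L2 f)\<^sup>2)"
    unfolding autocorr_0 q[symmetric] by (simp only: of_real_mult mult_ac)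
  then have "(\<lambda>n. LINT \<xi>|lborel. (cmod (fourier f \<xi>))\<^sup>2 * g n \<xi>) \<longlonglongrightarrow> (2 * pi) ^ DIM('a) * (norm_L2 f)\<^sup>2"
    by (simp only: tendsto_of_real_iff)
  then have "(\<lambda>n. ennreal (LINT \<xi>|lborel. (cmod (fourier f \<xi>))\<^sup>2 * g n \<xi>)) \<longlonglongrightarrow> ennreal ((2 * pi) ^ DIM('a) * (norm_L2 f)\<^sup>2)"
    by (rule tendsto_ennrealI)
  also have "ennreal ((2 * pi) ^ DIM('a) * (norm_L2 f)\<^sup>2) = ennreal ((2 * pi) ^ DIM('a)) * nnL2 f"
    by (simp add: nnL2_eq_norm_L2[OF f2] ennreal_mult)
  also have "(\<lambda>n. ennreal (LINT \<xi>|lborel. (cmod (fourier f \<xi>))\<^sup>2 * g n \<xi>))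
      = (\<lambda>n. \<integral>\<^sup>+\<xi>. ennreal ((cmod (fourier f \<xi>))\<^sup>2 * g n \<xi>) \<partial>lborel)"
    by (intro ext nn_integral_eq_integral[symmetric] gint AE_I2) (simp add: g_nonneg)
  finally have l1: "(\<lambda>n. \<integral>\<^sup>+\<xi>. ennreal ((cmod (fourier f \<xi>))\<^sup>2 * g n \<xi>) \<partial>lborel)
      \<longlonglongrightarrow> ennreal ((2 * pi) ^ DIM('a)) * nnL2 f" .
  \<comment> \<open>Monotone convergence identifies the limit with the integral of |fourier f|^2
    and, compared with \<open>l1\<close>, yields its finiteness as well.\<close>
  have l2: "(\<lambda>n. \<integral>\<^sup>+\<xi>. ennreal ((cmod (fourier f \<xi>))\<^sup>2 * g n \<xi>) \<partial>lborel)
      \<longlonglongrightarrow> (\<integral>\<^sup>+\<xi>. ennreal ((cmod (fourier f \<xi>))\<^sup>2) \<partial>lborel)"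
  proof (rule nn_integral_LIMSEQ)
    show "incseq (\<lambda>n \<xi>. ennreal ((cmod (fourier f \<xi>))\<^sup>2 * g n \<xi>))"
      unfolding incseq_def le_fun_def
    proof (intro allI impI ennreal_leI mult_left_mono)
      fix m n :: nat and \<xi> :: 'a assume "m \<le> n"
      then have "inverse (c n) \<le> inverse (c m)"
        by (intro le_imp_inverse_le) (auto simp: c_def)
      moreover have "norm (\<xi> /\<^sub>R c k) = inverse (c k) * norm \<xi>" for k
        using c[of k] by simp
      ultimately have "norm (\<xi> /\<^sub>R c n) \<le> norm (\<xi> /\<^sub>R c m)"
        by (simp only: mult_right_mono norm_ge_zero)
      then have "(norm (\<xi> /\<^sub>R c n))\<^sup>2 \<le> (norm (\<xi> /\<^sub>R c m))\<^sup>2" by (intro power_mono) auto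
      then show "g m \<xi> \<le> g n \<xi>" by (simp add: g_def)
    qed auto
    fix \<xi> :: 'a
    have "(\<lambda>n. g n \<xi>) \<longlonglongrightarrow> exp (- (norm (0::'a))\<^sup>2 / 2)"
      unfolding g_def by (intro tendsto_intros c_lim) auto
    then have "(\<lambda>n. ennreal ((cmod (fourier f \<xi>))\<^sup>2 * g n \<xi>)) \<longlonglongrightarrow> ennreal ((cmod (fourier f \<xi>))\<^sup>2 * exp (- (norm (0::'a))\<^sup>2 / 2))"
      by (intro tendsto_intros)
    then show "(\<lambda>n. ennreal ((cmod (fourier f \<xi>))\<^sup>2 * g n \<xi>)) \<longlonglongrightarrow> ennreal ((cmod (fourier f \<xi>))\<^sup>2)"
      by simp
  qed measurable
  show ?thesis
    using LIMSEQ_unique[OF l2 l1] by (simp add: nnL2_def)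
qed

section \<open>The inverse transform and the passage to L2 limits\<close>

lemma nn_integral_lborel_uminus:
  fixes f :: "'a::euclidean_space \<Rightarrow> ennreal"
  assumes [measurable]: "f \<in> borel_measurable borel"
  shows "(\<integral>\<^sup>+x. f (- x) \<partial>lborel) = (\<integral>\<^sup>+x. f x \<partial>lborel)"
proof -
  have "lborel = density (distr lborel borel (\<lambda>x::'a. 0 + (- 1) *\<^sub>R x)) (\<lambda>_. \<bar>- 1 :: real\<bar> ^ DIM('a))"
    by (rule lborel_affine) simp
  then have "(\<integral>\<^sup>+x. f x \<partial>lborel) = (\<integral>\<^sup>+x. f x \<partial>(density (distr lborel borel (\<lambda>x::'a. 0 + (- 1) *\<^sub>R x)) (\<lambda>_. ennreal (\<bar>- 1 :: real\<bar> ^ DIM('a)))))"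
    by metis
  also have "\<dots> = (\<integral>\<^sup>+x. f (- x) \<partial>lborel)"
    by (subst nn_integral_density) (auto simp: nn_integral_distr)
  finally show ?thesis by simp
qed

lemma inv_fourier_eq:
  fixes h :: "'a::euclidean_space \<Rightarrow> complex"
  shows "inv_fourier h x = fourier h (- x) / (2 * pi) ^ DIM('a)"
  by (simp add: inv_fourier_def fourier_def inner_commute)

lemma borel_measurable_inv_fourier [measurable]:
  fixes h :: "'a::euclidean_space \<Rightarrow> complex"
  assumes [measurable]: "h \<in> borel_measurable borel"
  shows "inv_fourier h \<in> borel_measurable borel"
  unfolding inv_fourier_eq[abs_def] by measurable

lemma norm_L2_plancherel:
  fixes f :: "'a::euclidean_space \<Rightarrow> complex"
  assumes "integrable lborel f" "f \<in> L2"
  shows "fourier f \<in> L2"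
    and "(norm_L2 (fourier f))\<^sup>2 = (2 * pi) ^ DIM('a) * (norm_L2 f)\<^sup>2"
proof -
  have [measurable]: "f \<in> borel_measurable borel" using assms by auto
  have "nnL2 f < \<infinity>" using assms by (simp add: L2_iff)
  then show F: "fourier f \<in> L2"
    by (simp add: L2_iff plancherel_L1_L2[OF assms] ennreal_mult_less_top)
  have "ennreal ((norm_L2 (fourier f))\<^sup>2) = ennreal ((2 * pi) ^ DIM('a) * (norm_L2 f)\<^sup>2)"
    using plancherel_L1_L2[OF assms]
    by (simp add: nnL2_eq_norm_L2 F assms ennreal_mult)
  then show "(norm_L2 (fourier f))\<^sup>2 = (2 * pi) ^ DIM('a) * (norm_L2 f)\<^sup>2"
    by (subst (asm) ennreal_inj) auto
qed

lemma plancherel_inv_L1_L2: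
  fixes h :: "'a::euclidean_space \<Rightarrow> complex"
  assumes "integrable lborel h" "h \<in> L2"
  shows "nnL2 (inv_fourier h) = ennreal (1 / (2 * pi) ^ DIM('a)) * nnL2 h"
proof -
  let ?q = "(2 * pi) ^ DIM('a)"
  have [measurable]: "h \<in> borel_measurable borel" using assms by auto
  have q: "?q > 0" by simp
  have "inv_fourier h = (\<lambda>x. complex_of_real (1 / ?q) * fourier h (- x))"
    by (intro ext) (simp add: inv_fourier_eq)
  then have "nnL2 (inv_fourier h) = ennreal ((1 / ?q)\<^sup>2) * nnL2 (\<lambda>x. fourier h (- x))"
    by (simp only:, subst nnL2_cmult) (measurable, simp add: norm_divide norm_mult norm_power power_divide)
  also have "nnL2 (\<lambda>x. fourier h (- x)) = nnL2 (fourier h)"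
    unfolding nnL2_def using nn_integral_lborel_uminus[of "\<lambda>x. ennreal ((cmod (fourier h x))\<^sup>2)"] by simp
  also have "\<dots> = ennreal ?q * nnL2 h" by (rule plancherel_L1_L2[OF assms])
  also have "ennreal ((1 / ?q)\<^sup>2) * (ennreal ?q * nnL2 h) = ennreal ((1 / ?q)\<^sup>2 * ?q) * nnL2 h"
    by (simp only: mult.assoc[symmetric] ennreal_mult'[symmetric] zero_le_power2)
  also have "(1 / ?q)\<^sup>2 * ?q = 1 / ?q" using q by (simp add: power2_eq_square)
  finally show ?thesis .
qed

lemma norm_L2_plancherel_inv:
  fixes h :: "'a::euclidean_space \<Rightarrow> complex"
  assumes "integrable lborel h" "h \<in> L2"
  shows "inv_fourier h \<in> L2"
    and "(norm_L2 (inv_fourier h))\<^sup>2 = (norm_L2 h)\<^sup>2 / (2 * pi) ^ DIM('a)"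
proof -
  have [measurable]: "h \<in> borel_measurable borel" using assms by auto
  have "nnL2 h < \<infinity>" using assms by (simp add: L2_iff)
  then show F: "inv_fourier h \<in> L2"
    by (simp add: L2_iff plancherel_inv_L1_L2[OF assms] ennreal_mult_less_top)
  have "ennreal ((norm_L2 (inv_fourier h))\<^sup>2) = ennreal (1 / (2 * pi) ^ DIM('a)) * ennreal ((norm_L2 h)\<^sup>2)"
    using plancherel_inv_L1_L2[OF assms] by (simp only: nnL2_eq_norm_L2 F assms)
  also have "\<dots> = ennreal (1 / (2 * pi) ^ DIM('a) * (norm_L2 h)\<^sup>2)"
    by (rule ennreal_mult[symmetric]) auto
  finally show "(norm_L2 (inv_fourier h))\<^sup>2 = (norm_L2 h)\<^sup>2 / (2 * pi) ^ DIM('a)"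
    by (subst (asm) ennreal_inj) auto
qed

lemma L2_cnj:
  assumes "f \<in> L2"
  shows "(\<lambda>x. cnj (f x)) \<in> L2"
proof -
  have [measurable]: "f \<in> borel_measurable borel" using assms by (simp add: L2_def)
  show ?thesis using assms by (simp add: L2_def)
qed

lemma norm_L2_diff_sq:
  assumes "f \<in> L2" "k \<in> L2"
  shows "(norm_L2 (\<lambda>x. f x - k x))\<^sup>2
    = (norm_L2 f)\<^sup>2 + (norm_L2 k)\<^sup>2 - 2 * Re (LINT x|lborel. f x * cnj (k x))"
proof -
  have ck: "(\<lambda>x. cnj (k x)) \<in> L2" using assms by (intro L2_cnj)
  have i: "integrable lborel (\<lambda>x. f x * cnj (k x))" by (intro integrable_L2_mult assms ck)
  have i1: "integrable lborel (\<lambda>x. (cmod (f x))\<^sup>2)" "integrable lborel (\<lambda>x. (cmod (k x))\<^sup>2)"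
    using assms by (auto simp: L2_def)
  have n: "(norm_L2 g)\<^sup>2 = (LINT x|lborel. (cmod (g x))\<^sup>2)" for g :: "'a \<Rightarrow> complex"
    by (simp add: norm_L2_def)
  have e: "(cmod (f x - k x))\<^sup>2 = (cmod (f x))\<^sup>2 + (cmod (k x))\<^sup>2 - 2 * Re (f x * cnj (k x))" for x
    unfolding cmod_power2 by (simp add: algebra_simps power2_eq_square)
  have "(LINT x|lborel. (cmod (f x - k x))\<^sup>2)
     = (LINT x|lborel. (cmod (f x))\<^sup>2) + (LINT x|lborel. (cmod (k x))\<^sup>2) - (LINT x|lborel. 2 * Re (f x * cnj (k x)))"
    unfolding e using i i1
    by (subst Bochner_Integration.integral_diff, simp, intro integrable_mult_right integrable_Re, simp,
        subst Bochner_Integration.integral_add) auto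
  also have "(LINT x|lborel. 2 * Re (f x * cnj (k x))) = 2 * Re (LINT x|lborel. f x * cnj (k x))"
    by (subst integral_mult_right_zero) (simp only: integral_Re[OF i])
  finally show ?thesis by (simp add: n)
qed

text \<open>After expanding both squared norms only the cross terms remain. They agree by the
  multiplication formula, because the conjugate of \<open>inv_fourier h\<close> is a multiple of the
  transform of the conjugate of h.\<close>

lemma plancherel_diff:
  fixes f h :: "'a::euclidean_space \<Rightarrow> complex"
  assumes f: "integrable lborel f" "f \<in> L2" and h: "integrable lborel h" "h \<in> L2"
  shows "nnL2 (\<lambda>x. f x - inv_fourier h x)
    = ennreal (1 / (2 * pi) ^ DIM('a)) * nnL2 (\<lambda>\<xi>. fourier f \<xi> - h \<xi>)"
proof -
  let ?q = "(2 * pi) ^ DIM('a)"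
  have q: "?q > 0" by simp
  have c: "cnj (inv_fourier h x) = fourier (\<lambda>\<xi>. cnj (h \<xi>)) x / ?q" for x
    unfolding inv_fourier_def fourier_def
    by (simp add: Bochner_Integration.integral_cnj[symmetric] cis_cnj inner_commute
             del: Bochner_Integration.integral_cnj)
  have hc: "integrable lborel (\<lambda>\<xi>. cnj (h \<xi>))" using h by simp
  have "(LINT x|lborel. f x * cnj (inv_fourier h x)) = (LINT x|lborel. f x * fourier (\<lambda>\<xi>. cnj (h \<xi>)) x) / ?q"
    unfolding c by simp
  also have "(LINT x|lborel. f x * fourier (\<lambda>\<xi>. cnj (h \<xi>)) x) = (LINT \<xi>|lborel. fourier f \<xi> * cnj (h \<xi>))"
    by (rule fourier_multiplication[OF f(1) hc, symmetric])
  finally have ip: "Re (LINT x|lborel. f x * cnj (inv_fourier h x)) = Re (LINT \<xi>|lborel. fourier f \<xi> * cnj (h \<xi>)) / ?q"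
    by (simp only: Re_divide_of_real)
  have "(norm_L2 (\<lambda>x. f x - inv_fourier h x))\<^sup>2 = (1 / ?q) * (norm_L2 (\<lambda>\<xi>. fourier f \<xi> - h \<xi>))\<^sup>2"
    unfolding norm_L2_diff_sq[OF f(2) norm_L2_plancherel_inv(1)[OF h]]
      norm_L2_diff_sq[OF norm_L2_plancherel(1)[OF f] h(2)] ip
      norm_L2_plancherel(2)[OF f] norm_L2_plancherel_inv(2)[OF h]
    using q by (simp add: field_simps)
  moreover have "ennreal (1 / ?q * x\<^sup>2) = ennreal (1 / ?q) * ennreal (x\<^sup>2)" for x
    by (rule ennreal_mult) auto
  ultimately show ?thesis
    by (simp only: nnL2_eq_norm_L2 L2_diff f h norm_L2_plancherel(1) norm_L2_plancherel_inv(1))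
qed

lemma truncate_ball_measurable [measurable]:
  fixes f :: "'a::euclidean_space \<Rightarrow> complex"
  assumes [measurable]: "f \<in> borel_measurable borel"
  shows "truncate_ball R f \<in> borel_measurable borel"
  unfolding truncate_ball_def[abs_def] by measurable

text \<open>On a bounded set |f| is at most |f|^2 + 1, which is integrable there.\<close>

lemma truncate_ball_L1_L2:
  fixes f :: "'a::euclidean_space \<Rightarrow> complex"
  assumes f: "f \<in> L2"
  shows "integrable lborel (truncate_ball R f)" "truncate_ball R f \<in> L2"
proof -
  have [measurable]: "f \<in> borel_measurable borel" using f by (simp add: L2_def)
  have i: "integrable lborel (\<lambda>x. (cmod (f x))\<^sup>2)" using f by (simp add: L2_def)
  have "emeasure lborel (cball (0::'a) R) < \<infinity>" by (intro emeasure_bounded_finite) simp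
  then have b: "integrable lborel (indicator (cball (0::'a) R) :: _ \<Rightarrow> real)"
    by (simp add: integrable_indicator_iff)
  show "integrable lborel (truncate_ball R f)"
  proof (rule Bochner_Integration.integrable_bound)
    show "integrable lborel (\<lambda>x. (cmod (f x))\<^sup>2 + indicator (cball 0 R) x)"
      using i b by simp
    show "AE x in lborel. norm (truncate_ball R f x) \<le> norm ((cmod (f x))\<^sup>2 + indicator (cball 0 R) x :: real)"
    proof (rule AE_I2)
      fix x
      have "2 * cmod (f x) \<le> (cmod (f x))\<^sup>2 + 1" using sum_squares_bound[of "cmod (f x)" 1] by simp
      then have "cmod (f x) \<le> (cmod (f x))\<^sup>2 + 1" using norm_ge_zero[of "f x"] by linarith
      then show "norm (truncate_ball R f x) \<le> norm ((cmod (f x))\<^sup>2 + indicator (cball 0 R) x :: real)"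
        by (auto simp: truncate_ball_def split: split_indicator)
    qed
  qed measurable
  have "integrable lborel (\<lambda>x. (cmod (truncate_ball R f x))\<^sup>2)"
    by (rule Bochner_Integration.integrable_bound[OF i]) (auto simp: truncate_ball_def)
  then show "truncate_ball R f \<in> L2" by (simp add: L2_def)
qed

lemma truncate_ball_tendsto:
  fixes f :: "'a::euclidean_space \<Rightarrow> complex"
  assumes f: "f \<in> L2"
  shows "((\<lambda>R. nnL2 (\<lambda>x. truncate_ball R f x - f x)) \<longlongrightarrow> 0) at_top"
proof -
  have [measurable]: "f \<in> borel_measurable borel" using f by (simp add: L2_def)
  have i: "integrable lborel (\<lambda>x. (cmod (f x))\<^sup>2)" using f by (simp add: L2_def)
  have "((\<lambda>R. LINT x|lborel. (cmod (truncate_ball R f x - f x))\<^sup>2) \<longlongrightarrow> (LINT x|(lborel::'a measure). 0)) at_top"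
  proof (rule integral_dominated_convergence_at_top[where w="\<lambda>x. (cmod (f x))\<^sup>2"])
    show "AE x in lborel. ((\<lambda>R. (cmod (truncate_ball R f x - f x))\<^sup>2) \<longlongrightarrow> 0) at_top"
    proof (rule AE_I2)
      fix x
      show "((\<lambda>R. (cmod (truncate_ball R f x - f x))\<^sup>2) \<longlongrightarrow> 0) at_top"
        by (rule tendsto_eventually, rule eventually_mono[OF eventually_ge_at_top[of "norm x"]])
           (simp add: truncate_ball_def)
    qed
    show "\<forall>\<^sub>F R in at_top. AE x in lborel. norm ((cmod (truncate_ball R f x - f x))\<^sup>2) \<le> (cmod (f x))\<^sup>2"
      by (intro always_eventually allI AE_I2) (simp add: truncate_ball_def)
  qed (use i in auto)
  then have "((\<lambda>R. ennreal (LINT x|lborel. (cmod (truncate_ball R f x - f x))\<^sup>2)) \<longlongrightarrow> ennreal 0) at_top"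
    by (intro tendsto_ennrealI) simp
  also have "(\<lambda>R. ennreal (LINT x|lborel. (cmod (truncate_ball R f x - f x))\<^sup>2)) = (\<lambda>R. nnL2 (\<lambda>x. truncate_ball R f x - f x))"
    using L2_diff[OF truncate_ball_L1_L2(2)[OF f] f]
    by (intro ext) (simp add: nnL2_eq_norm_L2 norm_L2_def)
  finally show ?thesis by simp
qed

text \<open>The profile is a classical inverse transform, whereas the solution is tied to its
  transform only through a limit; this estimates the difference of two such objects.\<close>

lemma is_fourier_L2_diff_le:
  fixes f h :: "'a::euclidean_space \<Rightarrow> complex"
  assumes F: "is_fourier_L2 f F" and h: "integrable lborel h" "h \<in> L2"
  shows "nnL2 (\<lambda>x. f x - inv_fourier h x) \<le> ennreal (4 / (2 * pi) ^ DIM('a)) * nnL2 (\<lambda>\<xi>. F \<xi> - h \<xi>)"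
proof -
  have f: "f \<in> L2" and F2: "F \<in> L2" using F by (auto simp: is_fourier_L2_def)
  have [measurable]: "f \<in> borel_measurable borel" "F \<in> borel_measurable borel" "h \<in> borel_measurable borel"
    using f F2 h by (auto simp: L2_def)
  have "nnL2 (\<lambda>x. f x - inv_fourier h x) \<le> ennreal (4 * (1 / (2 * pi) ^ DIM('a))) * nnL2 (\<lambda>\<xi>. F \<xi> - h \<xi>)"
  proof (rule nnL2_limit_bound[where F = "at_top :: real filter"
        and f' = "\<lambda>R x. truncate_ball R f x - inv_fourier h x"
        and h' = "\<lambda>R \<xi>. fourier (truncate_ball R f) \<xi> - h \<xi>"])
    show "nnL2 (\<lambda>x. truncate_ball R f x - inv_fourier h x)
      \<le> ennreal (1 / (2 * pi) ^ DIM('a)) * nnL2 (\<lambda>\<xi>. fourier (truncate_ball R f) \<xi> - h \<xi>)" for R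
      by (rule eq_refl[OF plancherel_diff[OF truncate_ball_L1_L2[OF f] h]])
    show "((\<lambda>R. nnL2 (\<lambda>x. (truncate_ball R f x - inv_fourier h x) - (f x - inv_fourier h x))) \<longlongrightarrow> 0) at_top"
      using truncate_ball_tendsto[OF f] by simp
    show "((\<lambda>R. nnL2 (\<lambda>\<xi>. (fourier (truncate_ball R f) \<xi> - h \<xi>) - (F \<xi> - h \<xi>))) \<longlongrightarrow> 0) at_top"
      using F by (simp add: is_fourier_L2_def nnL2_def)
  qed auto
  then show ?thesis by simp
qed

lemma is_fourier_L2_le:
  fixes f F :: "'a::euclidean_space \<Rightarrow> complex"
  assumes F: "is_fourier_L2 f F"
  shows "nnL2 f \<le> ennreal (4 / (2 * pi) ^ DIM('a)) * nnL2 F"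
    and "nnL2 F \<le> ennreal (4 * (2 * pi) ^ DIM('a)) * nnL2 f"
proof -
  have f: "f \<in> L2" and F2: "F \<in> L2" using F by (auto simp: is_fourier_L2_def)
  have [measurable]: "f \<in> borel_measurable borel" "F \<in> borel_measurable borel"
    using f F2 by (auto simp: L2_def)
  show "nnL2 f \<le> ennreal (4 / (2 * pi) ^ DIM('a)) * nnL2 F"
    \<comment> \<open>The comparison function is the zero symbol.\<close>
    using is_fourier_L2_diff_le[OF F, of "\<lambda>_. 0"] by (simp add: inv_fourier_def L2_def)
  show "nnL2 F \<le> ennreal (4 * (2 * pi) ^ DIM('a)) * nnL2 f"
  proof (rule nnL2_limit_bound[where F = "at_top :: real filter"
        and h' = "\<lambda>R. truncate_ball R f" and f' = "\<lambda>R. fourier (truncate_ball R f)"])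
    show "((\<lambda>R. nnL2 (\<lambda>x. fourier (truncate_ball R f) x - F x)) \<longlongrightarrow> 0) at_top"
      using F by (simp add: is_fourier_L2_def nnL2_def)
    show "nnL2 (fourier (truncate_ball R f)) \<le> ennreal ((2 * pi) ^ DIM('a)) * nnL2 (truncate_ball R f)" for R
      by (rule eq_refl[OF plancherel_L1_L2[OF truncate_ball_L1_L2[OF f]]])
  qed (use truncate_ball_tendsto[OF f] in auto)
qed

lemma is_inv_fourier_L2_le:
  fixes h f :: "'a::euclidean_space \<Rightarrow> complex"
  assumes F: "is_inv_fourier_L2 h f"
  shows "nnL2 h \<le> ennreal (4 * (2 * pi) ^ DIM('a)) * nnL2 f"
proof -
  have f: "f \<in> L2" and h: "h \<in> L2" using F by (auto simp: is_inv_fourier_L2_def)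
  have [measurable]: "f \<in> borel_measurable borel" "h \<in> borel_measurable borel"
    using f h by (auto simp: L2_def)
  show ?thesis
  proof (rule nnL2_limit_bound[where F = "at_top :: real filter"
        and f' = "\<lambda>R. truncate_ball R h" and h' = "\<lambda>R. inv_fourier (truncate_ball R h)"])
    show "((\<lambda>R. nnL2 (\<lambda>x. inv_fourier (truncate_ball R h) x - f x)) \<longlongrightarrow> 0) at_top"
      using F by (simp add: is_inv_fourier_L2_def nnL2_def)
    show "nnL2 (truncate_ball R h) \<le> ennreal ((2 * pi) ^ DIM('a)) * nnL2 (inv_fourier (truncate_ball R h))" for R
    proof -
      have "ennreal ((2 * pi) ^ DIM('a)) * ennreal (1 / (2 * pi) ^ DIM('a)) = 1"
        by (subst ennreal_mult'[symmetric]) auto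
      then show ?thesis
        unfolding plancherel_inv_L1_L2[OF truncate_ball_L1_L2[OF h]] mult.assoc[symmetric] by simp
    qed
  qed (use truncate_ball_tendsto[OF h] in auto)
qed

text \<open>\<open>norm_Hneg\<close> evaluates a representative obtained by choice; membership in
  \<open>Hneg_L1\<close> guarantees that the chosen one satisfies the defining relation.\<close>

lemma nnL2_bessel_symbol_le:
  fixes f :: "'a::euclidean_space \<Rightarrow> complex"
  assumes "f \<in> Hneg_L1 s"
  shows "nnL2 (bessel_symbol s f) \<le> ennreal (4 * (2 * pi) ^ DIM('a) * (norm_Hneg s f)\<^sup>2)"
proof -
  define g where "g = (SOME g. is_inv_fourier_L2 (bessel_symbol s f) g)"
  have "\<exists>g. is_inv_fourier_L2 (bessel_symbol s f) g" using assms by (simp add: Hneg_L1_def)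
  from someI_ex[OF this] have g: "is_inv_fourier_L2 (bessel_symbol s f) g" unfolding g_def .
  then have g2: "g \<in> L2" by (simp add: is_inv_fourier_L2_def)
  have "nnL2 (bessel_symbol s f) \<le> ennreal (4 * (2 * pi) ^ DIM('a)) * ennreal ((norm_L2 g)\<^sup>2)"
    using is_inv_fourier_L2_le[OF g] by (simp only: nnL2_eq_norm_L2[OF g2])
  also have "\<dots> = ennreal (4 * (2 * pi) ^ DIM('a) * (norm_L2 g)\<^sup>2)"
    by (rule ennreal_mult[symmetric]) auto
  also have "norm_L2 g = norm_Hneg s f" by (simp add: norm_Hneg_def g_def)
  finally show ?thesis .
qed

section \<open>Energy estimates at a fixed frequency\<close>

text \<open>Gronwall's inequality for derivatives that are one-sided at zero:
  \<open>exp (k * t) * L t\<close> is nonincreasing.\<close>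

lemma exp_decay:
  fixes L L' :: "real \<Rightarrow> real"
  assumes d: "\<And>t. t \<ge> 0 \<Longrightarrow> (L has_real_derivative L' t) (at t within {0..})"
    and le: "\<And>t. t \<ge> 0 \<Longrightarrow> L' t \<le> - k * L t"
    and t: "t \<ge> 0"
  shows "L t \<le> exp (- k * t) * L 0"
proof -
  define G where "G s = exp (k * s) * L s" for s
  have dG: "(G has_real_derivative exp (k * s) * (k * L s + L' s)) (at s within {0..})" if "s \<ge> 0" for s
    unfolding G_def using that
    by (auto intro!: derivative_eq_intros d simp: algebra_simps)
  have "G t \<le> G 0"
  proof (cases "t = 0")
    case False
    then have t0: "0 < t" using t by simp
    show ?thesis
    proof (rule DERIV_nonpos_imp_decreasing_open[OF less_imp_le[OF t0]])
      fix x assume x: "0 < x" "x < t"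
      have "at x within {0..} = at x" using x by (intro at_within_interior) (simp add: interior_real_atLeast)
      then have "(G has_real_derivative exp (k * x) * (k * L x + L' x)) (at x)"
        using dG[of x] x by simp
      moreover have "exp (k * x) * (k * L x + L' x) \<le> 0"
        using le[of x] x by (intro mult_nonneg_nonpos) auto
      ultimately show "\<exists>y. (G has_real_derivative y) (at x) \<and> y \<le> 0" by blast
    next
      show "continuous_on {0..t} G"
        by (rule continuous_on_subset[of "{0..}"])
           (auto simp: continuous_on_eq_continuous_within intro!: DERIV_continuous[OF dG])
    qed
  qed simp
  then have "exp (- k * t) * (exp (k * t) * L t) \<le> exp (- k * t) * L 0"
    by (intro mult_left_mono) (auto simp: G_def)
  then show ?thesis by (simp add: mult.assoc[symmetric] exp_add[symmetric])
qed

lemma has_real_derivative_inner: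
  fixes x y :: "real \<Rightarrow> 'a::real_inner"
  assumes "(x has_vector_derivative x') (at t within S)" "(y has_vector_derivative y') (at t within S)"
  shows "((\<lambda>t. x t \<bullet> y t) has_real_derivative (x t \<bullet> y' + x' \<bullet> y t)) (at t within S)"
  unfolding has_real_derivative_iff_has_vector_derivative
  by (rule bounded_bilinear.has_vector_derivative[OF bounded_bilinear_inner assms])

lemma has_vector_derivative_const_scaleR:
  "(f has_vector_derivative f') F \<Longrightarrow> ((\<lambda>t. c *\<^sub>R f t) has_vector_derivative c *\<^sub>R f') F"
  by (rule bounded_linear.has_vector_derivative[OF bounded_linear_scaleR_right])

lemma inner_young:
  fixes x y :: "'a::real_inner"
  assumes "e > 0"
  shows "2 * \<bar>x \<bullet> y\<bar> \<le> e * (x \<bullet> x) + (y \<bullet> y) / e"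
proof -
  have "2 * (a * (x \<bullet> y)) \<le> e * (x \<bullet> x) + (y \<bullet> y) / e" if "a\<^sup>2 = 1" for a :: real
  proof -
    have "0 \<le> (e *\<^sub>R x - a *\<^sub>R y) \<bullet> (e *\<^sub>R x - a *\<^sub>R y)" by simp
    also have "\<dots> = e * (e * (x \<bullet> x)) - 2 * (e * (a * (x \<bullet> y))) + a\<^sup>2 * (y \<bullet> y)"
      by (simp add: inner_diff_left inner_diff_right inner_commute power2_eq_square algebra_simps)
    finally have "e * (2 * (a * (x \<bullet> y))) \<le> e * (e * (x \<bullet> x) + (y \<bullet> y) / e)"
      using assms that by (simp add: distrib_left)
    then show ?thesis using assms by (simp only: mult_le_cancel_left_pos)
  qed
  from this[of 1] this[of "-1"] show ?thesis by (simp add: abs_if)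
qed

text \<open>The hypothesis says that the form e |x|^2 - c x \<bullet> y + d |y|^2 has nonpositive
  discriminant. Most cross terms of the energy estimates are absorbed in this way.\<close>

lemma inner_young_mult:
  fixes x y :: "'a::real_inner"
  assumes "e > 0" and "c\<^sup>2 \<le> 4 * e * d"
  shows "c * (x \<bullet> y) \<le> e * (x \<bullet> x) + d * (y \<bullet> y)"
proof -
  have "c * (x \<bullet> y) = x \<bullet> (c *\<^sub>R y)" by simp
  also have "\<dots> \<le> ((2 * e) * (x \<bullet> x) + ((c *\<^sub>R y) \<bullet> (c *\<^sub>R y)) / (2 * e)) / 2"
    using inner_young[of "2 * e" x "c *\<^sub>R y"] assms(1) abs_ge_self[of "x \<bullet> (c *\<^sub>R y)"] by argo
  also have "((c *\<^sub>R y) \<bullet> (c *\<^sub>R y)) = c\<^sup>2 * (y \<bullet> y)" by (simp add: power2_eq_square)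
  also have "((2 * e) * (x \<bullet> x) + (c\<^sup>2 * (y \<bullet> y)) / (2 * e)) / 2 = e * (x \<bullet> x) + (c\<^sup>2 / (4 * e)) * (y \<bullet> y)"
    by (simp add: field_simps)
  also have "\<dots> \<le> e * (x \<bullet> x) + d * (y \<bullet> y)"
    using assms by (intro add_left_mono mult_right_mono) (simp_all add: divide_le_eq mult_ac)
  finally show ?thesis .
qed

lemma sq_bound_imp_bound:
  fixes a x y z :: real
  assumes "a\<^sup>2 \<le> C * exp (- k) * (x\<^sup>2 + y\<^sup>2 + z\<^sup>2)" "0 \<le> C" "0 \<le> x" "0 \<le> y" "0 \<le> z"
  shows "a \<le> sqrt C * exp (- k / 2) * (x + y + z)"
proof (rule power2_le_imp_le)
  have e: "exp (- k / 2) ^ 2 = exp (- k)" by (simp add: power2_eq_square exp_add[symmetric])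
  have "a\<^sup>2 \<le> C * exp (- k) * (x\<^sup>2 + y\<^sup>2 + z\<^sup>2)" by (rule assms)
  also have "\<dots> \<le> C * exp (- k) * (x + y + z)\<^sup>2"
    using assms by (intro mult_left_mono) (auto simp: power2_eq_square algebra_simps)
  also have "\<dots> = (sqrt C * exp (- k / 2) * (x + y + z))\<^sup>2"
    using assms by (simp only: power_mult_distrib e real_sqrt_pow2)
  finally show "a\<^sup>2 \<le> (sqrt C * exp (- k / 2) * (x + y + z))\<^sup>2" .
qed (use assms in auto)

text \<open>
  The Fourier-transformed equation as a first-order system in \<open>u\<close>, \<open>v = u'\<close> and
  \<open>w = u'' + r\<^sup>2 u + \<delta> r\<^sup>2 u'\<close>, with a source \<open>f\<close>.
\<close>

locale freq_system =
  fixes \<delta> \<kappa> m r :: real and u v w f :: "real \<Rightarrow> 'a::real_inner"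
  assumes u': "\<And>t. t \<ge> 0 \<Longrightarrow> (u has_vector_derivative v t) (at t within {0..})"
    and v': "\<And>t. t \<ge> 0 \<Longrightarrow> (v has_vector_derivative
            w t - r\<^sup>2 *\<^sub>R u t - (\<delta> * r\<^sup>2) *\<^sub>R v t) (at t within {0..})"
    and w': "\<And>t. t \<ge> 0 \<Longrightarrow> (w has_vector_derivative
            f t - (\<kappa> * r\<^sup>2) *\<^sub>R w t - (m * r ^ 4) *\<^sub>R v t) (at t within {0..})"
    and pos: "\<delta> > 0" "\<kappa> > 0" "m > 0" "r > 0"
begin

text \<open>The estimate holds for all r \<ge> r0 but measures the data by v 0 / r and w 0 / r^3,
  one factor r more than the high-frequency sizes v 0 / r^2 and w 0 / r^4. It is therefore applied
  on a bounded range of r.\<close>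

lemma mid_energy:
  assumes f: "\<And>t. t \<ge> 0 \<Longrightarrow> f t = 0" and r0: "0 < r0" "r0 \<le> r"
    and \<eta>: "0 < \<eta>" "\<eta> \<le> \<kappa> / (2 * m)" "\<eta> * \<delta> \<le> 1 / 4" "\<eta> \<le> \<delta> * r0\<^sup>2 / 4" "\<eta> \<le> r0 / 2"
    and k: "2 * k \<le> \<delta> * r0\<^sup>2" "2 * k \<le> \<eta>" "2 * k \<le> \<kappa> * r0\<^sup>2" "0 < k"
    and t: "t \<ge> 0"
  shows "(norm (u t))\<^sup>2 \<le> 4 * exp (- k * t) * ((norm (v 0))\<^sup>2 / r\<^sup>2 + (norm (u 0))\<^sup>2 + (norm (w 0))\<^sup>2 / (m * r ^ 6))"
proof -
  \<comment> \<open>The first three terms of \<open>L\<close> do not see the decay of \<open>u\<close>; the small cross term supplies it.\<close>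
  define L where "L t = v t \<bullet> v t + r\<^sup>2 * (u t \<bullet> u t) + (w t \<bullet> w t) / (m * r ^ 4) + 2 * \<eta> * (v t \<bullet> u t)" for t
  \<comment> \<open>The weights \<open>r\<^sup>2\<close> and \<open>1 / (m * r ^ 4)\<close> are
    those for which the products v \<bullet> u and v \<bullet> w produced by the first three
    summands cancel.\<close>
  define L' where "L' t = - 2 * \<delta> * r\<^sup>2 * (v t \<bullet> v t) - 2 * \<kappa> / (m * r\<^sup>2) * (w t \<bullet> w t) - 2 * \<eta> * r\<^sup>2 * (u t \<bullet> u t)
     + 2 * \<eta> * (v t \<bullet> v t) + 2 * \<eta> * (w t \<bullet> u t) - 2 * \<eta> * \<delta> * r\<^sup>2 * (v t \<bullet> u t)" for t
  have r2: "r0\<^sup>2 \<le> r\<^sup>2" using r0 by (intro power_mono) auto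
  have rp: "r\<^sup>2 > 0" "r ^ 4 > 0" using pos by auto
  have r4: "r ^ 4 = r\<^sup>2 * r\<^sup>2" by (simp add: power2_eq_square numeral_eq_Suc)
  have dL: "(L has_real_derivative L' t) (at t within {0..})" if "t \<ge> 0" for t
  proof -
    have "(L has_real_derivative
       (v t \<bullet> (w t - r\<^sup>2 *\<^sub>R u t - (\<delta> * r\<^sup>2) *\<^sub>R v t) + (w t - r\<^sup>2 *\<^sub>R u t - (\<delta> * r\<^sup>2) *\<^sub>R v t) \<bullet> v t)
       + r\<^sup>2 * (u t \<bullet> v t + v t \<bullet> u t)
       + (w t \<bullet> (f t - (\<kappa> * r\<^sup>2) *\<^sub>R w t - (m * r ^ 4) *\<^sub>R v t) + (f t - (\<kappa> * r\<^sup>2) *\<^sub>R w t - (m * r ^ 4) *\<^sub>R v t) \<bullet> w t) / (m * r ^ 4)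
       + 2 * \<eta> * (v t \<bullet> v t + (w t - r\<^sup>2 *\<^sub>R u t - (\<delta> * r\<^sup>2) *\<^sub>R v t) \<bullet> u t)) (at t within {0..})"
      unfolding L_def using that
      by (intro DERIV_add DERIV_cmult DERIV_cdivide has_real_derivative_inner u' v' w')
    also have "(v t \<bullet> (w t - r\<^sup>2 *\<^sub>R u t - (\<delta> * r\<^sup>2) *\<^sub>R v t) + (w t - r\<^sup>2 *\<^sub>R u t - (\<delta> * r\<^sup>2) *\<^sub>R v t) \<bullet> v t)
       + r\<^sup>2 * (u t \<bullet> v t + v t \<bullet> u t)
       + (w t \<bullet> (f t - (\<kappa> * r\<^sup>2) *\<^sub>R w t - (m * r ^ 4) *\<^sub>R v t) + (f t - (\<kappa> * r\<^sup>2) *\<^sub>R w t - (m * r ^ 4) *\<^sub>R v t) \<bullet> w t) / (m * r ^ 4)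
       + 2 * \<eta> * (v t \<bullet> v t + (w t - r\<^sup>2 *\<^sub>R u t - (\<delta> * r\<^sup>2) *\<^sub>R v t) \<bullet> u t) = L' t"
      unfolding L'_def f[OF that] r4 using rp pos
      by (simp add: inner_diff_left inner_diff_right inner_add_left inner_add_right inner_commute field_simps)
    finally show ?thesis .
  qed
  \<comment> \<open>\<open>\<eta> \<le> r0 / 2\<close> keeps the cross term below half of the first
    two summands, so that L remains comparable with the plain energy.\<close>
  have cross: "\<bar>2 * \<eta> * (v t \<bullet> u t)\<bar> \<le> (v t \<bullet> v t + r\<^sup>2 * (u t \<bullet> u t)) / 2" for t
  proof -
    have "\<bar>2 * \<eta> * (v t \<bullet> u t)\<bar> = (2 * \<eta> / r) * \<bar>v t \<bullet> (r *\<^sub>R u t)\<bar>"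
      using \<eta> pos by (simp add: abs_mult)
    also have "\<dots> \<le> 1 * \<bar>v t \<bullet> (r *\<^sub>R u t)\<bar>"
      using \<eta> r0 pos by (intro mult_right_mono) (auto simp: divide_le_eq)
    also have "\<dots> \<le> (v t \<bullet> v t + (r *\<^sub>R u t) \<bullet> (r *\<^sub>R u t)) / 2"
      using inner_young[of 1 "v t" "r *\<^sub>R u t"] by simp
    also have "\<dots> = (v t \<bullet> v t + r\<^sup>2 * (u t \<bullet> u t)) / 2" by (simp add: power2_eq_square)
    finally show ?thesis .
  qed
  have energy_up: "a + b + q + x \<le> 2 * (a + b + q)"
    if "0 \<le> a" "0 \<le> b" "0 \<le> q" "\<bar>x\<bar> \<le> (a + b) / 2" for a b q x :: real
    using that by argo
  have energy_low: "b \<le> 2 * (a + b + q + x)"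
    if "0 \<le> a" "0 \<le> q" "\<bar>x\<bar> \<le> (a + b) / 2" for a b q x :: real
    using that by argo
  have le: "L' t \<le> - k * L t" if "t \<ge> 0" for t
  proof -
    define P U Q where "P = v t \<bullet> v t" "U = u t \<bullet> u t" "Q = w t \<bullet> w t"
    have nn: "P \<ge> 0" "U \<ge> 0" "Q \<ge> 0" by (auto simp: P_U_Q_def)
    have "2 * (w t \<bullet> u t) \<le> (2 / r\<^sup>2) * Q + (r\<^sup>2 / 2) * U"
      unfolding P_U_Q_def using rp by (intro inner_young_mult) (auto simp: field_simps)
    then have y1: "2 * \<eta> * (w t \<bullet> u t) \<le> \<eta> * ((2 / r\<^sup>2) * Q + (r\<^sup>2 / 2) * U)"
      using mult_left_mono[of _ _ \<eta>] \<eta> by fastforce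
    have "(- 2 * \<delta>) * (v t \<bullet> u t) \<le> (2 * \<delta>\<^sup>2) * P + (1 / 2) * U"
      unfolding P_U_Q_def using pos by (intro inner_young_mult) (auto simp: field_simps)
    then have "(\<eta> * r\<^sup>2) * ((- 2 * \<delta>) * (v t \<bullet> u t)) \<le> (\<eta> * r\<^sup>2) * ((2 * \<delta>\<^sup>2) * P + (1 / 2) * U)"
      using \<eta> rp by (intro mult_left_mono) auto
    then have y2: "- 2 * \<eta> * \<delta> * r\<^sup>2 * (v t \<bullet> u t) \<le> (\<eta> * r\<^sup>2) * ((2 * \<delta>\<^sup>2) * P + (1 / 2) * U)"
      by (simp add: mult_ac)
    \<comment> \<open>Each condition on \<eta> pays for one term: \<open>c1\<close> uses
      \<open>\<eta> \<le> \<delta> * r0\<^sup>2 / 4\<close>, \<open>c2\<close> uses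
      \<open>\<eta> * \<delta> \<le> 1 / 4\<close>, \<open>c3\<close> uses
      \<open>\<eta> \<le> \<kappa> / (2 * m)\<close>. Half of the damping of each component
      survives.\<close>
    have c1: "2 * \<eta> * P \<le> (\<delta> * r\<^sup>2 / 2) * P"
    proof (rule mult_right_mono[OF _ nn(1)])
      have "2 * \<eta> \<le> \<delta> * r0\<^sup>2 / 2" using \<eta> by simp
      also have "\<dots> \<le> \<delta> * r\<^sup>2 / 2" using r2 pos by simp
      finally show "2 * \<eta> \<le> \<delta> * r\<^sup>2 / 2" .
    qed
    have c2: "(\<eta> * r\<^sup>2) * ((2 * \<delta>\<^sup>2) * P) \<le> (\<delta> * r\<^sup>2 / 2) * P"
    proof -
      have "(\<eta> * \<delta>) * (2 * \<delta> * r\<^sup>2 * P) \<le> (1/4) * (2 * \<delta> * r\<^sup>2 * P)"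
        using \<eta> pos nn by (intro mult_right_mono) auto
      then show ?thesis by (simp add: power2_eq_square mult_ac)
    qed
    have c3: "\<eta> * ((2 / r\<^sup>2) * Q) \<le> (\<kappa> / (m * r\<^sup>2)) * Q"
    proof -
      have "\<eta> * ((2 / r\<^sup>2) * Q) \<le> (\<kappa> / (2 * m)) * ((2 / r\<^sup>2) * Q)"
        using \<eta> nn rp by (intro mult_right_mono) auto
      then show ?thesis by simp
    qed
    have "L' t = - 2 * \<delta> * r\<^sup>2 * P - 2 * \<kappa> / (m * r\<^sup>2) * Q - 2 * \<eta> * r\<^sup>2 * U
     + 2 * \<eta> * P + 2 * \<eta> * (w t \<bullet> u t) - 2 * \<eta> * \<delta> * r\<^sup>2 * (v t \<bullet> u t)"
      by (simp add: L'_def P_U_Q_def)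
    also have "\<dots> \<le> - 2 * \<delta> * r\<^sup>2 * P - 2 * (\<kappa> / (m * r\<^sup>2) * Q) - 2 * \<eta> * r\<^sup>2 * U
     + 2 * \<eta> * P + \<eta> * ((2 / r\<^sup>2) * Q + (r\<^sup>2 / 2) * U) + (\<eta> * r\<^sup>2) * ((2 * \<delta>\<^sup>2) * P + (1 / 2) * U)"
      using y1 y2 by simp
    also have "\<dots> = - 2 * (\<delta> * r\<^sup>2 * P) - 2 * (\<kappa> / (m * r\<^sup>2) * Q) - \<eta> * r\<^sup>2 * U
     + 2 * \<eta> * P + \<eta> * ((2 / r\<^sup>2) * Q) + (\<eta> * r\<^sup>2) * ((2 * \<delta>\<^sup>2) * P)"
      by (simp add: algebra_simps)
    also have "\<dots> \<le> - (\<delta> * r\<^sup>2 * P) - (\<kappa> / (m * r\<^sup>2) * Q) - \<eta> * r\<^sup>2 * U"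
    proof -
      have "- 2 * x - 2 * y - z + a + b + c \<le> - x - y - z"
        if "a \<le> x / 2" "b \<le> c'" "c' \<le> y" "c \<le> x / 2" "c' = b" for a b c c' x y z :: real
        using that by linarith
      from this[of "2 * \<eta> * P" "\<delta> * r\<^sup>2 * P" _ _ "\<kappa> / (m * r\<^sup>2) * Q", OF _ order_refl c3 _ refl]
      show ?thesis using c1 c2 by simp
    qed
    also have "\<dots> \<le> - (2 * k) * (P + r\<^sup>2 * U + Q / (m * r ^ 4))"
    proof -
      have "2 * k \<le> \<delta> * r\<^sup>2" using k mult_left_mono[OF r2, of \<delta>] pos by linarith
      then have "2 * k * P \<le> \<delta> * r\<^sup>2 * P" using nn by (intro mult_right_mono)
      moreover have "2 * k * (r\<^sup>2 * U) \<le> \<eta> * (r\<^sup>2 * U)" using nn rp k by (intro mult_right_mono) auto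
      moreover have "2 * k * (Q / (m * r ^ 4)) \<le> (\<kappa> * r\<^sup>2) * (Q / (m * r ^ 4))"
      proof (rule mult_right_mono)
        show "2 * k \<le> \<kappa> * r\<^sup>2" using k mult_left_mono[OF r2, of \<kappa>] pos by linarith
      qed (use nn pos in auto)
      moreover have "(\<kappa> * r\<^sup>2) * (Q / (m * r ^ 4)) = \<kappa> / (m * r\<^sup>2) * Q" using rp pos by (simp add: divide_simps power2_eq_square numeral_eq_Suc)
      ultimately show ?thesis by (simp add: algebra_simps)
    qed
    also have "\<dots> \<le> - k * L t"
    proof -
      have "L t \<le> 2 * (P + r\<^sup>2 * U + Q / (m * r ^ 4))"
      proof -
        have "0 \<le> P" "0 \<le> r\<^sup>2 * U" "0 \<le> Q / (m * r ^ 4)" using nn pos by auto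
        then show ?thesis unfolding L_def P_U_Q_def by (rule energy_up[OF _ _ _ cross])
      qed
      from mult_left_mono[OF this, of k] show ?thesis using k by simp
    qed
    finally show ?thesis .
  qed
  have "r\<^sup>2 * (u t \<bullet> u t) \<le> 2 * L t"
  proof -
    have "0 \<le> v t \<bullet> v t" "0 \<le> (w t \<bullet> w t) / (m * r ^ 4)" using pos by auto
    then show ?thesis unfolding L_def by (rule energy_low[OF _ _ cross])
  qed
  also have "\<dots> \<le> 2 * (exp (- k * t) * L 0)"
    using exp_decay[OF dL le t] by simp
  also have "\<dots> \<le> 2 * (exp (- k * t) * (2 * (v 0 \<bullet> v 0 + r\<^sup>2 * (u 0 \<bullet> u 0) + (w 0 \<bullet> w 0) / (m * r ^ 4))))"
  proof (intro mult_left_mono)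
    have "0 \<le> v 0 \<bullet> v 0" "0 \<le> r\<^sup>2 * (u 0 \<bullet> u 0)" "0 \<le> (w 0 \<bullet> w 0) / (m * r ^ 4)" using pos by auto
    then show "L 0 \<le> 2 * (v 0 \<bullet> v 0 + r\<^sup>2 * (u 0 \<bullet> u 0) + (w 0 \<bullet> w 0) / (m * r ^ 4))"
      unfolding L_def by (rule energy_up[OF _ _ _ cross])
  qed auto
  also have "\<dots> = r\<^sup>2 * (4 * exp (- k * t) * ((norm (v 0))\<^sup>2 / r\<^sup>2 + (norm (u 0))\<^sup>2 + (norm (w 0))\<^sup>2 / (m * r ^ 6)))"
  proof -
    have r6: "r ^ 6 = r\<^sup>2 * r ^ 4" by (simp flip: power_add)
    have "2 * (e * (2 * (P + s * U + Q / (m * q)))) = s * (4 * e * (P / s + U + Q / (m * (s * q))))"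
      if "s > 0" "q > 0" for e P U Q s q :: real
      using that pos by (simp add: field_simps)
    from this[OF rp] show ?thesis unfolding power2_norm_eq_inner r6 .
  qed
  finally show ?thesis using rp by (simp add: power2_norm_eq_inner)
qed

text \<open>For large r the sizes r^2 of v and r^4 of w are natural, and the rescaled components are
  damped at a rate of order r^2. The remaining mode is slow: keeping \<lambda> bounded in the
  characteristic equation and letting r tend to infinity leaves
  \<open>\<kappa> + (\<kappa> * \<delta> + m) * \<lambda> = 0\<close>, so the bounded root tends to
  - \<alpha>.\<close>

lemma high_energy:
  assumes f: "\<And>t. t \<ge> 0 \<Longrightarrow> f t = 0"
    and \<alpha>\<beta>: "\<alpha> = \<kappa> / (\<kappa> * \<delta> + m)" "\<beta> = 1 / (\<kappa> * \<delta> + m)"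
    and big: "(2 * \<alpha>\<^sup>2 + 2 * m)\<^sup>2 / (2 * \<alpha>) + 2 * m * \<alpha> + m * \<beta> \<le> m * \<delta> * r\<^sup>2"
             "2 * \<alpha> * \<beta>\<^sup>2 + m * \<beta> \<le> \<kappa> * r\<^sup>2" "\<alpha> \<le> \<delta> * r\<^sup>2" "\<alpha> \<le> \<kappa> * r\<^sup>2"
    and t: "t \<ge> 0"
  shows "(norm (u t))\<^sup>2 \<le> 3 * (1 + \<alpha>\<^sup>2 / m + \<beta>\<^sup>2) * exp (- \<alpha> * t) *
     ((norm (u 0 + (\<alpha> / r\<^sup>2) *\<^sub>R v 0 + (\<beta> / r ^ 4) *\<^sub>R w 0))\<^sup>2 + m * (norm (v 0))\<^sup>2 / r ^ 4 + (norm (w 0))\<^sup>2 / r ^ 8)"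
proof -
  define Y where "Y t = (1 / r\<^sup>2) *\<^sub>R v t" for t
  define W where "W t = (1 / r ^ 4) *\<^sub>R w t" for t
  \<comment> \<open>\<open>\<alpha>\<close> and \<open>\<beta>\<close> are such that \<open>U\<close> has derivative \<open>- \<alpha> u\<close>, of order zero in \<open>r\<close>.\<close>
  define U where "U t = u t + \<alpha> *\<^sub>R Y t + \<beta> *\<^sub>R W t" for t
  \<comment> \<open>The weight m on Y cancels the coupling of order r^2 between Y and W.\<close>
  define M where "M t = U t \<bullet> U t + m * (Y t \<bullet> Y t) + W t \<bullet> W t" for t
  have rp: "r\<^sup>2 > 0" "r ^ 4 > 0" using pos by auto
  have den: "\<kappa> * \<delta> + m > 0" using pos by (simp add: add_pos_pos)
  have ab: "\<alpha> > 0" "\<beta> > 0" using den pos by (auto simp: \<alpha>\<beta>)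
  have "\<alpha> * \<delta> + \<beta> * m = (\<kappa> * \<delta> + m) / (\<kappa> * \<delta> + m)"
    unfolding \<alpha>\<beta> add_divide_distrib by simp
  then have ab1: "\<alpha> * \<delta> + \<beta> * m = 1" "\<alpha> = \<beta> * \<kappa>" using den by (simp, simp add: \<alpha>\<beta>)
  have uU: "u t = U t - \<alpha> *\<^sub>R Y t - \<beta> *\<^sub>R W t" for t by (simp add: U_def)
  have dY: "(Y has_vector_derivative (r\<^sup>2 *\<^sub>R W t - u t - (\<delta> * r\<^sup>2) *\<^sub>R Y t)) (at t within {0..})" if "t \<ge> 0" for t
  proof -
    have "(Y has_vector_derivative (1 / r\<^sup>2) *\<^sub>R (w t - r\<^sup>2 *\<^sub>R u t - (\<delta> * r\<^sup>2) *\<^sub>R v t)) (at t within {0..})"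
      unfolding Y_def using v'[OF that] by (intro has_vector_derivative_const_scaleR)
    also have "(1 / r\<^sup>2) *\<^sub>R (w t - r\<^sup>2 *\<^sub>R u t - (\<delta> * r\<^sup>2) *\<^sub>R v t) = r\<^sup>2 *\<^sub>R W t - u t - (\<delta> * r\<^sup>2) *\<^sub>R Y t"
    proof -
      have "1 / r\<^sup>2 * r\<^sup>2 = 1" "1 / r\<^sup>2 * (\<delta> * r\<^sup>2) = \<delta> * r\<^sup>2 * (1 / r\<^sup>2)" "1 / r\<^sup>2 = r\<^sup>2 * (1 / r ^ 4)"
        using pos by (simp_all add: divide_simps power2_eq_square numeral_eq_Suc)
      then show ?thesis
        unfolding W_def Y_def by (simp only: scaleR_diff_right scaleR_scaleR scaleR_one)
    qed
    finally show ?thesis .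
  qed
  have dW: "(W has_vector_derivative (- (\<kappa> * r\<^sup>2) *\<^sub>R W t - (m * r\<^sup>2) *\<^sub>R Y t)) (at t within {0..})" if "t \<ge> 0" for t
  proof -
    have "(W has_vector_derivative (1 / r ^ 4) *\<^sub>R (f t - (\<kappa> * r\<^sup>2) *\<^sub>R w t - (m * r ^ 4) *\<^sub>R v t)) (at t within {0..})"
      unfolding W_def using w'[OF that] by (intro has_vector_derivative_const_scaleR)
    also have "(1 / r ^ 4) *\<^sub>R (f t - (\<kappa> * r\<^sup>2) *\<^sub>R w t - (m * r ^ 4) *\<^sub>R v t) = - (\<kappa> * r\<^sup>2) *\<^sub>R W t - (m * r\<^sup>2) *\<^sub>R Y t"
    proof -
      have "1 / r ^ 4 * (\<kappa> * r\<^sup>2) = \<kappa> * r\<^sup>2 * (1 / r ^ 4)" "1 / r ^ 4 * (m * r ^ 4) = m * r\<^sup>2 * (1 / r\<^sup>2)"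
        using rp by simp_all
      then show ?thesis
        unfolding W_def Y_def f[OF that]
        by (simp only: scaleR_diff_right scaleR_scaleR scaleR_zero_right scaleR_minus_left scaleR_minus_right mult_minus_left diff_0)
    qed
    finally show ?thesis .
  qed
  have dU: "(U has_vector_derivative (- \<alpha>) *\<^sub>R u t) (at t within {0..})" if "t \<ge> 0" for t
  proof -
    have "(U has_vector_derivative (v t + \<alpha> *\<^sub>R (r\<^sup>2 *\<^sub>R W t - u t - (\<delta> * r\<^sup>2) *\<^sub>R Y t)
        + \<beta> *\<^sub>R (- (\<kappa> * r\<^sup>2) *\<^sub>R W t - (m * r\<^sup>2) *\<^sub>R Y t))) (at t within {0..})"
      unfolding U_def using that
      by (intro has_vector_derivative_add has_vector_derivative_const_scaleR u' dY dW)
    also have "v t + \<alpha> *\<^sub>R (r\<^sup>2 *\<^sub>R W t - u t - (\<delta> * r\<^sup>2) *\<^sub>R Y t) + \<beta> *\<^sub>R (- (\<kappa> * r\<^sup>2) *\<^sub>R W t - (m * r\<^sup>2) *\<^sub>R Y t)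
        = (r\<^sup>2 * (1 - (\<alpha> * \<delta> + \<beta> * m))) *\<^sub>R Y t + (r\<^sup>2 * (\<alpha> - \<beta> * \<kappa>)) *\<^sub>R W t - \<alpha> *\<^sub>R u t"
    proof -
      have "v t = r\<^sup>2 *\<^sub>R Y t" using rp by (simp add: Y_def)
      then show ?thesis by (simp add: algebra_simps)
    qed
    also have "\<dots> = (- \<alpha>) *\<^sub>R u t" using ab1 by simp
    finally show ?thesis .
  qed
  have le: "U t \<bullet> ((- \<alpha>) *\<^sub>R u t) + ((- \<alpha>) *\<^sub>R u t) \<bullet> U t
      + m * (Y t \<bullet> (r\<^sup>2 *\<^sub>R W t - u t - (\<delta> * r\<^sup>2) *\<^sub>R Y t) + (r\<^sup>2 *\<^sub>R W t - u t - (\<delta> * r\<^sup>2) *\<^sub>R Y t) \<bullet> Y t)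
      + (W t \<bullet> (- (\<kappa> * r\<^sup>2) *\<^sub>R W t - (m * r\<^sup>2) *\<^sub>R Y t) + (- (\<kappa> * r\<^sup>2) *\<^sub>R W t - (m * r\<^sup>2) *\<^sub>R Y t) \<bullet> W t)
      \<le> - \<alpha> * M t" (is "?L \<le> _") for t
  proof -
    define P Q S where "P = U t \<bullet> U t" "Q = Y t \<bullet> Y t" "S = W t \<bullet> W t"
    have nn: "P \<ge> 0" "Q \<ge> 0" "S \<ge> 0" by (auto simp: P_Q_S_def)
    \<comment> \<open>Of the damping 2 \<alpha> |U|^2 a quarter goes to each of the two cross terms
      with U. What these leave on Y and W has bounded coefficients, which damping of order r^2
      absorbs once r is large.\<close>
    define B where "B = (2 * \<alpha>\<^sup>2 + 2 * m)\<^sup>2 / (2 * \<alpha>)"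
    have "?L = - 2 * \<alpha> * P + (2 * \<alpha>\<^sup>2 - 2 * m) * (U t \<bullet> Y t) + (2 * \<alpha> * \<beta>) * (U t \<bullet> W t)
        + 2 * m * \<alpha> * Q + (2 * m * \<beta>) * (Y t \<bullet> W t) - 2 * m * \<delta> * r\<^sup>2 * Q - 2 * \<kappa> * r\<^sup>2 * S"
      unfolding uU[of t] P_Q_S_def
      by (simp add: inner_diff_left inner_diff_right inner_add_left inner_add_right inner_commute algebra_simps power2_eq_square)
    also have "(2 * \<alpha>\<^sup>2 - 2 * m) * (U t \<bullet> Y t) \<le> (\<alpha> / 2) * P + B * Q"
      unfolding P_Q_S_def
    proof (rule inner_young_mult)
      have "(2 * \<alpha>\<^sup>2 - 2 * m)\<^sup>2 \<le> (2 * \<alpha>\<^sup>2 + 2 * m)\<^sup>2"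
        using pos ab by (simp add: power2_eq_square algebra_simps zero_le_mult_iff less_imp_le)
      also have "\<dots> = 4 * (\<alpha> / 2) * B" using ab by (simp add: B_def)
      finally show "(2 * \<alpha>\<^sup>2 - 2 * m)\<^sup>2 \<le> 4 * (\<alpha> / 2) * B" .
    qed (use ab in simp)
    also have "(2 * \<alpha> * \<beta>) * (U t \<bullet> W t) \<le> (\<alpha> / 2) * P + (2 * \<alpha> * \<beta>\<^sup>2) * S"
      unfolding P_Q_S_def using ab by (intro inner_young_mult) (auto simp: power2_eq_square)
    also have "(2 * m * \<beta>) * (Y t \<bullet> W t) \<le> (m * \<beta>) * Q + (m * \<beta>) * S"
      unfolding P_Q_S_def using ab pos by (intro inner_young_mult) (auto simp: power2_eq_square)
    finally have "?L \<le> - \<alpha> * P + (B + 2 * m * \<alpha> + m * \<beta>) * Q + (2 * \<alpha> * \<beta>\<^sup>2 + m * \<beta>) * S - 2 * m * \<delta> * r\<^sup>2 * Q - 2 * \<kappa> * r\<^sup>2 * S"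
      by (simp add: algebra_simps)
    also have "(B + 2 * m * \<alpha> + m * \<beta>) * Q \<le> (m * \<delta> * r\<^sup>2) * Q"
      using big(1) nn unfolding B_def by (intro mult_right_mono) auto
    also have "(2 * \<alpha> * \<beta>\<^sup>2 + m * \<beta>) * S \<le> (\<kappa> * r\<^sup>2) * S"
      using big(2) nn by (intro mult_right_mono) auto
    also have "- \<alpha> * P + (m * \<delta> * r\<^sup>2) * Q + (\<kappa> * r\<^sup>2) * S - 2 * m * \<delta> * r\<^sup>2 * Q - 2 * \<kappa> * r\<^sup>2 * S
        = - \<alpha> * P - m * ((\<delta> * r\<^sup>2) * Q) - (\<kappa> * r\<^sup>2) * S" by simp
    also have "\<dots> \<le> - \<alpha> * P - m * (\<alpha> * Q) - \<alpha> * S"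
      using big(3,4) nn pos by (intro diff_mono mult_left_mono mult_right_mono order_refl) auto
    also have "\<dots> = - \<alpha> * M t" by (simp add: M_def P_Q_S_def algebra_simps)
    finally show ?thesis by simp
  qed
  have dM: "(M has_real_derivative U t \<bullet> ((- \<alpha>) *\<^sub>R u t) + ((- \<alpha>) *\<^sub>R u t) \<bullet> U t
      + m * (Y t \<bullet> (r\<^sup>2 *\<^sub>R W t - u t - (\<delta> * r\<^sup>2) *\<^sub>R Y t) + (r\<^sup>2 *\<^sub>R W t - u t - (\<delta> * r\<^sup>2) *\<^sub>R Y t) \<bullet> Y t)
      + (W t \<bullet> (- (\<kappa> * r\<^sup>2) *\<^sub>R W t - (m * r\<^sup>2) *\<^sub>R Y t) + (- (\<kappa> * r\<^sup>2) *\<^sub>R W t - (m * r\<^sup>2) *\<^sub>R Y t) \<bullet> W t)) (at t within {0..})"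
    if "t \<ge> 0" for t
    unfolding M_def using that
    by (intro DERIV_add DERIV_cmult has_real_derivative_inner dU dY dW)
  have "M t \<le> exp (- \<alpha> * t) * M 0"
    by (rule exp_decay[OF dM le t])
  have "(norm (u t))\<^sup>2 \<le> 3 * (1 + \<alpha>\<^sup>2 / m + \<beta>\<^sup>2) * M t"
  proof -
    have "norm (u t) \<le> norm (U t) + \<alpha> * norm (Y t) + \<beta> * norm (W t)"
      unfolding uU[of t] using norm_triangle_ineq4[of "U t - \<alpha> *\<^sub>R Y t" "\<beta> *\<^sub>R W t"] norm_triangle_ineq4[of "U t" "\<alpha> *\<^sub>R Y t"] ab by simp
    then have "(norm (u t))\<^sup>2 \<le> (norm (U t) + \<alpha> * norm (Y t) + \<beta> * norm (W t))\<^sup>2"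
      by (intro power_mono) auto
    also have "\<dots> \<le> 3 * ((norm (U t))\<^sup>2 + (\<alpha> * norm (Y t))\<^sup>2 + (\<beta> * norm (W t))\<^sup>2)"
    proof -
      have "(a + b + c)\<^sup>2 \<le> 3 * (a\<^sup>2 + b\<^sup>2 + c\<^sup>2)" for a b c :: real
        using sum_squares_bound[of a b] sum_squares_bound[of a c] sum_squares_bound[of b c]
        by (simp add: power2_eq_square algebra_simps)
      then show ?thesis .
    qed
    also have "\<dots> = 3 * (1 * (U t \<bullet> U t) + (\<alpha>\<^sup>2 / m) * (m * (Y t \<bullet> Y t)) + \<beta>\<^sup>2 * (W t \<bullet> W t))"
      using pos by (simp add: power_mult_distrib power2_norm_eq_inner)
    also have "\<dots> \<le> 3 * ((1 + \<alpha>\<^sup>2 / m + \<beta>\<^sup>2) * (U t \<bullet> U t) + (1 + \<alpha>\<^sup>2 / m + \<beta>\<^sup>2) * (m * (Y t \<bullet> Y t)) + (1 + \<alpha>\<^sup>2 / m + \<beta>\<^sup>2) * (W t \<bullet> W t))"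
      using pos by (intro mult_left_mono add_mono mult_right_mono) auto
    also have "\<dots> = 3 * (1 + \<alpha>\<^sup>2 / m + \<beta>\<^sup>2) * M t" unfolding M_def by algebra
    finally show ?thesis .
  qed
  also have "\<dots> \<le> 3 * (1 + \<alpha>\<^sup>2 / m + \<beta>\<^sup>2) * (exp (- \<alpha> * t) * M 0)"
    using pos by (intro mult_left_mono exp_decay[OF dM le t]) auto
  also have "M 0 = (norm (u 0 + (\<alpha> / r\<^sup>2) *\<^sub>R v 0 + (\<beta> / r ^ 4) *\<^sub>R w 0))\<^sup>2 + m * (norm (v 0))\<^sup>2 / r ^ 4 + (norm (w 0))\<^sup>2 / r ^ 8"
    unfolding M_def U_def Y_def W_def by (simp add: power2_norm_eq_inner[symmetric] power_divide power_mult_distrib)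
  finally show ?thesis by (simp only: mult.assoc)
qed

text \<open>The combination r u - w / r is r times the deviation of u from its quasi-static value w
  / r^2. A source of size r^3 acts, after division by r, with strength r^2, the same order as the
  damping, so its effect is bounded without loss in r.\<close>

lemma low_energy:
  assumes f: "\<And>t. t \<ge> 0 \<Longrightarrow> norm (f t) \<le> F * r ^ 3 * exp (- \<kappa> * r\<^sup>2 * t)" and F: "F \<ge> 0"
    and \<eta>: "\<eta> = \<delta> / 4" and K: "K = 2 * \<kappa> / \<eta>"
    and small: "r \<le> 1" "m * r\<^sup>2 \<le> 1" "\<eta> * r \<le> 1 / 2"
      "r * J \<le> \<delta> / 8" "r * J \<le> \<eta> / 4" "r * J \<le> K * \<kappa> / 4" "m + \<eta> * \<delta> + \<eta> * \<kappa> + K * m \<le> J"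
    and k: "0 < k" "k * (1 + \<eta>) \<le> \<delta> / 2" "k * (1 + \<eta>) \<le> \<eta>" "k \<le> \<kappa> / 2"
    and B: "B = 4 * K / \<kappa> + 4 / \<eta> + 4 * \<eta>\<^sup>2 / \<delta>"
    and t: "t \<ge> 0"
  shows "(norm (v t))\<^sup>2 + (norm (r *\<^sub>R u t - (1 / r) *\<^sub>R w t))\<^sup>2 + 2 * K * (norm (w t) / r)\<^sup>2
    \<le> 2 * exp (- (k * r\<^sup>2) * t) * ((1 + \<eta>) * ((norm (v 0))\<^sup>2 + (norm (r *\<^sub>R u 0 - (1 / r) *\<^sub>R w 0))\<^sup>2)
         + K * (norm (w 0) / r)\<^sup>2 + B * F\<^sup>2 / \<kappa>)"
proof -
  define Z where "Z t = r *\<^sub>R u t - (1 / r) *\<^sub>R w t" for t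
  define W where "W t = (1 / r) *\<^sub>R w t" for t
  define g where "g t = (1 / r ^ 3) *\<^sub>R f t" for t
  \<comment> \<open>\<open>v\<close> and \<open>Z\<close> rotate with speed \<open>r\<close> and only \<open>v\<close> is damped; the cross term damps \<open>Z\<close> as well.\<close>
  define L where "L t = v t \<bullet> v t + Z t \<bullet> Z t + K * (W t \<bullet> W t) + (2 * \<eta> * r) * (v t \<bullet> Z t)" for t
  have rp: "r\<^sup>2 > 0" "r > 0" using pos by auto
  have \<eta>p: "\<eta> > 0" and Kp: "K > 0" using pos by (auto simp: \<eta> K)
  have Bp: "B \<ge> 0" using pos \<eta>p Kp by (simp add: B)
  define v1 where "v1 t = - (\<delta> * r\<^sup>2) *\<^sub>R v t - r *\<^sub>R Z t" for t
  define Z1 where "Z1 t = (r * (1 + m * r\<^sup>2)) *\<^sub>R v t + (\<kappa> * r\<^sup>2) *\<^sub>R W t - r\<^sup>2 *\<^sub>R g t" for t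
  define W1 where "W1 t = r\<^sup>2 *\<^sub>R g t - (\<kappa> * r\<^sup>2) *\<^sub>R W t - (m * r ^ 3) *\<^sub>R v t" for t
  have r3: "(1 / r) *\<^sub>R f t = r\<^sup>2 *\<^sub>R g t" for t
    using rp by (simp add: g_def power2_eq_square numeral_eq_Suc)
  have dv: "(v has_vector_derivative v1 t) (at t within {0..})" if "t \<ge> 0" for t
  proof -
    have "w t - r\<^sup>2 *\<^sub>R u t - (\<delta> * r\<^sup>2) *\<^sub>R v t = v1 t"
      using rp by (simp add: v1_def Z_def algebra_simps power2_eq_square)
    then show ?thesis using v'[OF that] by simp
  qed
  have dW: "(W has_vector_derivative W1 t) (at t within {0..})" if "t \<ge> 0" for t
  proof -
    have "(W has_vector_derivative (1 / r) *\<^sub>R (f t - (\<kappa> * r\<^sup>2) *\<^sub>R w t - (m * r ^ 4) *\<^sub>R v t)) (at t within {0..})"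
      unfolding W_def using w'[OF that] by (intro has_vector_derivative_const_scaleR)
    also have "(1 / r) *\<^sub>R (f t - (\<kappa> * r\<^sup>2) *\<^sub>R w t - (m * r ^ 4) *\<^sub>R v t) = W1 t"
    proof -
      have "1 / r * (\<kappa> * r\<^sup>2) = \<kappa> * r\<^sup>2 * (1 / r)" "1 / r * (m * r ^ 4) = m * r ^ 3"
        using rp by (simp_all add: numeral_eq_Suc)
      then show ?thesis
        unfolding W1_def r3[symmetric] W_def by (simp only: scaleR_diff_right scaleR_scaleR)
    qed
    finally show ?thesis .
  qed
  have dZ: "(Z has_vector_derivative Z1 t) (at t within {0..})" if "t \<ge> 0" for t
  proof -
    have "(Z has_vector_derivative r *\<^sub>R v t - (1 / r) *\<^sub>R (f t - (\<kappa> * r\<^sup>2) *\<^sub>R w t - (m * r ^ 4) *\<^sub>R v t)) (at t within {0..})"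
      unfolding Z_def using w'[OF that] u'[OF that]
      by (intro has_vector_derivative_diff has_vector_derivative_const_scaleR)
    also have "r *\<^sub>R v t - (1 / r) *\<^sub>R (f t - (\<kappa> * r\<^sup>2) *\<^sub>R w t - (m * r ^ 4) *\<^sub>R v t) = Z1 t"
    proof -
      have "1 / r * (\<kappa> * r\<^sup>2) = \<kappa> * r\<^sup>2 * (1 / r)" "1 / r * (m * r ^ 4) = m * r ^ 3"
        "r * (1 + m * r\<^sup>2) = r + m * r ^ 3"
        using rp by (simp_all add: numeral_eq_Suc distrib_left)
      then show ?thesis
        unfolding Z1_def r3[symmetric] W_def
        by (simp only: scaleR_diff_right scaleR_scaleR scaleR_add_left) simp
    qed
    finally show ?thesis .
  qed
  define L' where "L' t = v t \<bullet> v1 t + v1 t \<bullet> v t + (Z t \<bullet> Z1 t + Z1 t \<bullet> Z t) + K * (W t \<bullet> W1 t + W1 t \<bullet> W t)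
     + (2 * \<eta> * r) * (v t \<bullet> Z1 t + v1 t \<bullet> Z t)" for t
  have dL: "(L has_real_derivative L' t) (at t within {0..})" if "t \<ge> 0" for t
    unfolding L_def L'_def using that
    by (intro DERIV_add DERIV_cmult has_real_derivative_inner dv dZ dW)
  have cross: "\<bar>(2 * \<eta> * r) * (v t \<bullet> Z t)\<bar> \<le> (\<eta> * r) * (v t \<bullet> v t + Z t \<bullet> Z t)" for t
  proof -
    have "\<bar>(2 * \<eta> * r) * (v t \<bullet> Z t)\<bar> = (\<eta> * r) * (2 * \<bar>v t \<bullet> Z t\<bar>)"
      using \<eta>p rp by (simp add: abs_mult)
    also have "\<dots> \<le> (\<eta> * r) * (v t \<bullet> v t + Z t \<bullet> Z t)"
      using inner_young[of 1 "v t" "Z t"] \<eta>p rp by (intro mult_left_mono) auto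
    finally show ?thesis .
  qed
  have L_up: "L t \<le> (1 + \<eta>) * (v t \<bullet> v t + Z t \<bullet> Z t) + K * (W t \<bullet> W t)" for t
  proof -
    have "(\<eta> * r) * (v t \<bullet> v t + Z t \<bullet> Z t) \<le> \<eta> * (v t \<bullet> v t + Z t \<bullet> Z t)"
      using small(1) \<eta>p by (intro mult_right_mono) auto
    with cross[of t] show ?thesis by (simp add: L_def distrib_right abs_le_iff)
  qed
  have L_low: "v t \<bullet> v t + Z t \<bullet> Z t + 2 * K * (W t \<bullet> W t) \<le> 2 * L t" for t
  proof -
    have "(\<eta> * r) * (v t \<bullet> v t + Z t \<bullet> Z t) \<le> (1/2) * (v t \<bullet> v t + Z t \<bullet> Z t)"
      using small(3) by (intro mult_right_mono) auto
    with cross[of t] have "- ((1/2) * (v t \<bullet> v t + Z t \<bullet> Z t)) \<le> (2 * \<eta> * r) * (v t \<bullet> Z t)"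
      by linarith
    moreover have "a + b + 2 * K * s \<le> 2 * (a + b + K * s + x)" if "- (1/2 * (a + b)) \<le> x" for a b s x :: real
    proof -
      have "0 \<le> a + b + 2 * x" using that by argo
      then show ?thesis by (simp add: algebra_simps)
    qed
    ultimately show ?thesis unfolding L_def by blast
  qed
  have L'le: "L' t \<le> r\<^sup>2 * (- k * L t + B * (g t \<bullet> g t))" for t
  proof -
    define P Q S G where "P = v t \<bullet> v t" "Q = Z t \<bullet> Z t" "S = W t \<bullet> W t" "G = g t \<bullet> g t"
    have nn: "P \<ge> 0" "Q \<ge> 0" "S \<ge> 0" "G \<ge> 0" by (auto simp: P_Q_S_G_def)
    have "L' t = r\<^sup>2 * (- 2 * \<delta> * P - 2 * \<eta> * Q - 2 * (K * \<kappa>) * S + 2 * \<eta> * (1 + m * r\<^sup>2) * P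
       + 2 * \<kappa> * (Z t \<bullet> W t) + (r * (2 * m - 2 * \<eta> * \<delta>)) * (v t \<bullet> Z t) + (r * (2 * \<eta> * \<kappa> - 2 * K * m)) * (v t \<bullet> W t)
       + 2 * K * (W t \<bullet> g t) + (- 2) * (Z t \<bullet> g t) + (- 2 * \<eta> * r) * (v t \<bullet> g t))"
      unfolding L'_def v1_def Z1_def W1_def P_Q_S_G_def
      by (simp add: inner_diff_left inner_diff_right inner_add_left inner_add_right inner_commute algebra_simps power2_eq_square numeral_eq_Suc)
    also have "\<dots> \<le> r\<^sup>2 * (- 2 * \<delta> * P - 2 * \<eta> * Q - 2 * (K * \<kappa>) * S + \<delta> * P
       + ((\<eta> / 2) * Q + (K * \<kappa>) * S) + ((\<delta> / 8) * P + (\<eta> / 4) * Q) + ((\<delta> / 8) * P + (K * \<kappa> / 4) * S)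
       + ((K * \<kappa> / 4) * S + (4 * K / \<kappa>) * G) + ((\<eta> / 4) * Q + (4 / \<eta>) * G) + ((\<delta> / 4) * P + (4 * \<eta>\<^sup>2 / \<delta>) * G))"
    proof (intro order_refl mult_left_mono add_mono diff_mono)
      \<comment> \<open>Here \<eta> = \<delta> / 4 enters: what the cross term produces on v stays
        below half of the damping of v.\<close>
      have "2 * \<eta> * (1 + m * r\<^sup>2) \<le> 2 * \<eta> * 2" using small(2) \<eta>p by (intro mult_left_mono) auto
      then show "2 * \<eta> * (1 + m * r\<^sup>2) * P \<le> \<delta> * P" using nn by (intro mult_right_mono) (auto simp: \<eta>)
      \<comment> \<open>Young's condition holds with equality for
        \<open>K = 2 * \<kappa> / \<eta>\<close>; this is the origin of K.\<close>
      show "2 * \<kappa> * (Z t \<bullet> W t) \<le> (\<eta> / 2) * Q + (K * \<kappa>) * S"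
        unfolding P_Q_S_G_def using \<eta>p pos by (intro inner_young_mult) (auto simp: K power2_eq_square field_simps)
      have rJ: "\<bar>r * (2 * x)\<bar> \<le> 2 * (r * J)" if "\<bar>x\<bar> \<le> J" for x
        using that rp by (simp add: abs_mult)
      have pp: "0 \<le> m" "0 \<le> \<eta> * \<delta>" "0 \<le> \<eta> * \<kappa>" "0 \<le> K * m" using pos \<eta>p Kp by auto
      have rJ0: "0 \<le> r * J" using pp small(7) rp by auto
      \<comment> \<open>For the two cross terms with a spare factor r: their coefficients are at
        most 2 r J, and r J is small.\<close>
      have yy: "c * (x \<bullet> y) \<le> d * (x \<bullet> x) + e * (y \<bullet> y)"
        if "\<bar>c\<bar> \<le> 2 * (r * J)" "r * J \<le> d" "r * J \<le> e" for c d e and x y :: 'a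
      proof -
        have "c * (x \<bullet> y) \<le> \<bar>c\<bar> * \<bar>x \<bullet> y\<bar>" by (metis abs_ge_self abs_mult)
        also have "\<dots> \<le> (2 * (r * J)) * \<bar>x \<bullet> y\<bar>" using that by (intro mult_right_mono) auto
        also have "\<dots> = (r * J) * (2 * \<bar>x \<bullet> y\<bar>)" by simp
        also have "\<dots> \<le> (r * J) * (x \<bullet> x + y \<bullet> y)"
          using inner_young[of 1 x y] rJ0 by (intro mult_left_mono) auto
        also have "\<dots> \<le> d * (x \<bullet> x) + e * (y \<bullet> y)"
          unfolding distrib_left using that by (intro add_mono mult_right_mono) auto
        finally show ?thesis .
      qed
      have "\<bar>m - \<eta> * \<delta>\<bar> \<le> J" "\<bar>\<eta> * \<kappa> - K * m\<bar> \<le> J"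
        using pp small(7) by (auto simp: abs_le_iff)
      from rJ[OF this(1)] rJ[OF this(2)]
      have J12: "\<bar>r * (2 * m - 2 * \<eta> * \<delta>)\<bar> \<le> 2 * (r * J)" "\<bar>r * (2 * \<eta> * \<kappa> - 2 * K * m)\<bar> \<le> 2 * (r * J)"
        by (simp_all only: right_diff_distrib mult.assoc)
      show "(r * (2 * m - 2 * \<eta> * \<delta>)) * (v t \<bullet> Z t) \<le> (\<delta> / 8) * P + (\<eta> / 4) * Q"
        unfolding P_Q_S_G_def by (rule yy[OF J12(1) small(4) small(5)])
      show "(r * (2 * \<eta> * \<kappa> - 2 * K * m)) * (v t \<bullet> W t) \<le> (\<delta> / 8) * P + (K * \<kappa> / 4) * S"
        unfolding P_Q_S_G_def by (rule yy[OF J12(2) small(4) small(6)])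
      show "2 * K * (W t \<bullet> g t) \<le> (K * \<kappa> / 4) * S + (4 * K / \<kappa>) * G"
        unfolding P_Q_S_G_def using Kp pos by (intro inner_young_mult) (auto simp: power2_eq_square)
      show "(- 2) * (Z t \<bullet> g t) \<le> (\<eta> / 4) * Q + (4 / \<eta>) * G"
        unfolding P_Q_S_G_def using \<eta>p by (intro inner_young_mult) auto
      have "(r * r) \<le> 1" using small(1) rp by (simp add: mult_le_one)
      then have "4 * \<eta>\<^sup>2 * (r * r) \<le> 4 * \<eta>\<^sup>2 * 1" by (intro mult_left_mono) auto
      then show "(- 2 * \<eta> * r) * (v t \<bullet> g t) \<le> (\<delta> / 4) * P + (4 * \<eta>\<^sup>2 / \<delta>) * G"
        unfolding P_Q_S_G_def using pos by (intro inner_young_mult) (auto simp: power2_eq_square mult_ac)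
    qed (use rp in auto)
    also have "\<dots> = r\<^sup>2 * (- ((\<delta> / 2) * P) - \<eta> * Q - (K * \<kappa> / 2) * S + B * G)"
      by (simp add: B algebra_simps)
    also have "\<dots> \<le> r\<^sup>2 * (- k * L t + B * G)"
    proof (intro mult_left_mono add_right_mono)
      have "k * L t \<le> k * ((1 + \<eta>) * (P + Q) + K * S)"
        using L_up[of t] k by (intro mult_left_mono) (auto simp: P_Q_S_G_def)
      also have "\<dots> = (k * (1 + \<eta>)) * P + (k * (1 + \<eta>)) * Q + K * (k * S)" by (simp add: algebra_simps)
      also have "\<dots> \<le> (\<delta> / 2) * P + \<eta> * Q + K * ((\<kappa> / 2) * S)"
        using k nn Kp by (intro add_mono mult_right_mono mult_left_mono) auto
      finally show "- ((\<delta> / 2) * P) - \<eta> * Q - (K * \<kappa> / 2) * S \<le> - k * L t" by simp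
    qed (use rp in auto)
    finally show ?thesis by (simp add: P_Q_S_G_def)
  qed
  define E where "E t = exp (- (2 * \<kappa> * r\<^sup>2) * t)" for t
  \<comment> \<open>The added multiple of E is a reservoir for the source. It loses
    \<open>2 * B * F\<^sup>2 * r\<^sup>2 * E\<close>; half of this cancels the source, and the other
    half, since k \<le> \<kappa>, sustains the decay rate of N.\<close>
  define N where "N t = L t + (B * F\<^sup>2 / \<kappa>) * E t" for t
  have gE: "g t \<bullet> g t \<le> F\<^sup>2 * E t" if "t \<ge> 0" for t
  proof -
    have "norm (g t) = norm (f t) / r ^ 3" using rp by (simp add: g_def)
    also have "\<dots> \<le> (F * r ^ 3 * exp (- \<kappa> * r\<^sup>2 * t)) / r ^ 3" using f[OF that] rp by (intro divide_right_mono) auto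
    also have "\<dots> = F * exp (- \<kappa> * r\<^sup>2 * t)" using rp by simp
    finally have "(norm (g t))\<^sup>2 \<le> (F * exp (- \<kappa> * r\<^sup>2 * t))\<^sup>2" by (intro power_mono) auto
    also have "\<dots> = F\<^sup>2 * E t"
      by (simp add: power_mult_distrib E_def power2_eq_square[of "exp _"] exp_add[symmetric] algebra_simps)
    finally show ?thesis by (simp add: power2_norm_eq_inner)
  qed
  have dN: "(N has_real_derivative L' t + (B * F\<^sup>2 / \<kappa>) * (- (2 * \<kappa> * r\<^sup>2) * E t)) (at t within {0..})" if "t \<ge> 0" for t
    unfolding N_def E_def using that
    by (auto intro!: derivative_eq_intros dL)
  have "N t \<le> exp (- (k * r\<^sup>2) * t) * N 0"
  proof (rule exp_decay[OF dN _ t])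
    fix t :: real assume t: "t \<ge> 0"
    have E0: "0 \<le> E t" by (simp add: E_def)
    have "L' t \<le> r\<^sup>2 * (- k * L t + B * (F\<^sup>2 * E t))"
      using L'le[of t] mult_left_mono[OF mult_left_mono[OF gE[OF t] Bp], of "r\<^sup>2"] rp
      by (simp add: algebra_simps)
    then have "L' t + (B * F\<^sup>2 / \<kappa>) * (- (2 * \<kappa> * r\<^sup>2) * E t) \<le> - k * r\<^sup>2 * L t - r\<^sup>2 * (B * (F\<^sup>2 * E t))"
      using pos by (simp add: algebra_simps)
    also have "\<dots> \<le> - k * r\<^sup>2 * L t - r\<^sup>2 * ((k / \<kappa>) * (B * (F\<^sup>2 * E t)))"
    proof -
      have "(k / \<kappa>) * (B * (F\<^sup>2 * E t)) \<le> 1 * (B * (F\<^sup>2 * E t))"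
        using k pos Bp E0 by (intro mult_right_mono) (auto simp: divide_le_eq)
      then show ?thesis using rp by (intro diff_left_mono mult_left_mono) auto
    qed
    also have "\<dots> = - (k * r\<^sup>2) * N t" by (simp add: N_def algebra_simps)
    finally show "L' t + (B * F\<^sup>2 / \<kappa>) * (- (2 * \<kappa> * r\<^sup>2) * E t) \<le> - (k * r\<^sup>2) * N t" .
  qed
  moreover have "L t \<le> N t" using Bp pos by (simp add: N_def E_def)
  moreover have "N 0 \<le> (1 + \<eta>) * (v 0 \<bullet> v 0 + Z 0 \<bullet> Z 0) + K * (W 0 \<bullet> W 0) + B * F\<^sup>2 / \<kappa>"
    using L_up[of 0] by (simp add: N_def E_def)
  ultimately have "L t \<le> exp (- (k * r\<^sup>2) * t) * ((1 + \<eta>) * (v 0 \<bullet> v 0 + Z 0 \<bullet> Z 0) + K * (W 0 \<bullet> W 0) + B * F\<^sup>2 / \<kappa>)"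
    by (meson exp_ge_zero mult_left_mono order_trans)
  with L_low[of t] have "v t \<bullet> v t + Z t \<bullet> Z t + 2 * K * (W t \<bullet> W t) \<le> 2 * (exp (- (k * r\<^sup>2) * t) * ((1 + \<eta>) * (v 0 \<bullet> v 0 + Z 0 \<bullet> Z 0) + K * (W 0 \<bullet> W 0) + B * F\<^sup>2 / \<kappa>))"
    by linarith
  moreover have "(norm (w t) / r)\<^sup>2 = W t \<bullet> W t" for t
    using rp by (simp add: W_def power2_norm_eq_inner[symmetric])
  ultimately show ?thesis
    by (simp add: power2_norm_eq_inner Z_def[symmetric] mult.assoc)
qed

end

section \<open>The transformed equation as a system, and the profile as an approximate
  solution\<close>

lemma solves_freq_ode_imp_system:
  assumes "solves_freq_ode \<gamma> b \<nu> \<kappa> r a0 a1 a2 u"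
    and \<delta>: "\<delta> = diffusion_coeff \<gamma> b \<nu> \<kappa>" and m: "m = \<kappa> * (\<gamma> - 1) * (b * \<nu> - \<kappa>)"
    and pos: "\<delta> > 0" "\<kappa> > 0" "m > 0" "r > 0"
  obtains v w where "freq_system \<delta> \<kappa> m r u v w (\<lambda>_. 0)" "u 0 = a0" "v 0 = a1"
    "w 0 = a2 + r\<^sup>2 *\<^sub>R a0 + (\<delta> * r\<^sup>2) *\<^sub>R a1"
proof -
  from assms(1)[unfolded solves_freq_ode_def Let_def, folded \<delta> m] obtain u1 u2 w w' where
    init: "u 0 = a0" "u1 0 = a1" "u2 0 = a2" and
    eq: "\<And>t. t \<ge> 0 \<Longrightarrow> (u has_vector_derivative u1 t) (at t within {0..})"
      "\<And>t. t \<ge> 0 \<Longrightarrow> (u1 has_vector_derivative u2 t) (at t within {0..})"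
      "\<And>t. t \<ge> 0 \<Longrightarrow> w t = u2 t + r\<^sup>2 *\<^sub>R u t + (\<delta> * r\<^sup>2) *\<^sub>R u1 t"
      "\<And>t. t \<ge> 0 \<Longrightarrow> (w has_vector_derivative w' t) (at t within {0..})"
      "\<And>t. t \<ge> 0 \<Longrightarrow> (w' t + (\<kappa> * r\<^sup>2) *\<^sub>R w t) + (m * r ^ 4) *\<^sub>R u1 t = 0"
    by blast
  have "freq_system \<delta> \<kappa> m r u u1 w (\<lambda>_. 0)"
  proof
    fix t :: real assume t: "t \<ge> 0"
    show "(u has_vector_derivative u1 t) (at t within {0..})" by (rule eq(1)[OF t])
    have "u2 t = w t - r\<^sup>2 *\<^sub>R u t - (\<delta> * r\<^sup>2) *\<^sub>R u1 t" using eq(3)[OF t] by simp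
    with eq(2)[OF t] show "(u1 has_vector_derivative w t - r\<^sup>2 *\<^sub>R u t - (\<delta> * r\<^sup>2) *\<^sub>R u1 t) (at t within {0..})"
      by simp
    have "w' t = 0 - (\<kappa> * r\<^sup>2) *\<^sub>R w t - (m * r ^ 4) *\<^sub>R u1 t"
      using eq(5)[OF t] by (metis add_implies_diff diff_0 diff_diff_eq2 diff_minus_eq_add add.commute)
    with eq(4)[OF t] show "(w has_vector_derivative 0 - (\<kappa> * r\<^sup>2) *\<^sub>R w t - (m * r ^ 4) *\<^sub>R u1 t) (at t within {0..})"
      by (simp only:)
  qed (use pos in auto)
  then show ?thesis using that[of u1 w] init eq(3)[of 0] by simp
qed

definition prof :: "real \<Rightarrow> real \<Rightarrow> real \<Rightarrow> real \<Rightarrow> real" where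
  "prof \<kappa> \<delta> t r = 1 / r\<^sup>2 * (exp (- \<kappa> * r\<^sup>2 * t) - cos (r * t) * exp (- (\<delta> / 2) * r\<^sup>2 * t))"

lemma profile_symbol_eq: "profile_symbol \<kappa> \<delta> t \<xi> = complex_of_real (prof \<kappa> \<delta> t (norm \<xi>))"
  by (simp add: profile_symbol_def prof_def)

text \<open>The mean value inequality with a one-sided derivative at zero. It later turns the bound
  on the velocity into one on u that does not degenerate as r tends to 0.\<close>

lemma norm_diff_le_of_deriv_bound:
  fixes f :: "real \<Rightarrow> 'a::real_normed_vector"
  assumes d: "\<And>s. s \<ge> 0 \<Longrightarrow> (f has_vector_derivative f' s) (at s within {0..})"
    and b: "\<And>s. s \<ge> 0 \<Longrightarrow> norm (f' s) \<le> M" and t: "t \<ge> 0"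
  shows "norm (f t - f 0) \<le> M * t"
proof (cases "t = 0")
  case False
  then have t0: "0 < t" using t by simp
  have "norm (f t - f 0) \<le> M * t - M * 0"
  proof (rule differentiable_bound_general[OF t0])
    show "continuous_on {0..t} f"
      by (rule continuous_on_subset[of "{0..}"])
         (auto simp: continuous_on_eq_continuous_within intro!: has_vector_derivative_continuous[OF d])
    show "continuous_on {0..t} (\<lambda>s. M * s)" by (intro continuous_intros)
    fix x assume x: "0 < x" "x < t"
    have "at x within {0..} = at x" using x by (intro at_within_interior) (simp add: interior_real_atLeast)
    then show "(f has_vector_derivative f' x) (at x)" using d[of x] x by simp
    show "((\<lambda>s. M * s) has_vector_derivative M) (at x)"
      unfolding has_real_derivative_iff_has_vector_derivative[symmetric]
      by (auto intro!: derivative_eq_intros)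
    show "norm (f' x) \<le> M" using b x by simp
  qed
  then show ?thesis by simp
qed simp

text \<open>
  The profile is an approximate solution of the system: the residual is of order \<open>r\<^sup>3\<close>, one power
  of \<open>r\<close> better than what comparing the two first-order systems componentwise would give.
\<close>

lemma prof_system:
  fixes a :: "'a::real_inner"
  assumes sys: "freq_system \<delta> \<kappa> m r u v w (\<lambda>_. 0)" and kd: "\<kappa> \<le> \<delta> / 2" and r: "r \<le> 1"
  obtains V W f where
    "freq_system \<delta> \<kappa> m r (\<lambda>t. u t - prof \<kappa> \<delta> t r *\<^sub>R a) V W f"
    "V 0 = v 0 - (\<delta> / 2 - \<kappa>) *\<^sub>R a"
    "W 0 = w 0 - (1 + (\<kappa>\<^sup>2 - \<kappa> * \<delta> + \<delta>\<^sup>2 / 4) * r\<^sup>2) *\<^sub>R a"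
    "\<And>t. t \<ge> 0 \<Longrightarrow> norm (f t) \<le> ((\<delta>\<^sup>2 / 4 * (1 + \<bar>\<kappa> - \<delta> / 2\<bar>) + m * (\<kappa> + 1 + \<delta> / 2)) * norm a) * r ^ 3 * exp (- \<kappa> * r\<^sup>2 * t)"
proof -
  interpret freq_system \<delta> \<kappa> m r u v w "\<lambda>_. 0" by (rule sys)
  define e1 where "e1 t = exp (- \<kappa> * r\<^sup>2 * t)" for t
  define e2 where "e2 t = exp (- (\<delta> / 2) * r\<^sup>2 * t)" for t
  define c where "c t = cos (r * t)" for t
  define s where "s t = sin (r * t)" for t
  have d: "(e1 has_real_derivative - (\<kappa> * r\<^sup>2) * e1 t) (at t within S)"
    "(e2 has_real_derivative - (\<delta> / 2 * r\<^sup>2) * e2 t) (at t within S)"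
    "(c has_real_derivative - (r * s t)) (at t within S)"
    "(s has_real_derivative r * c t) (at t within S)" for t S
    unfolding e1_def e2_def c_def s_def by (auto intro!: derivative_eq_intros)
  have rp: "r > 0" using pos by simp
  define g where "g t = 1 / r\<^sup>2 * (e1 t - c t * e2 t)" for t
  define gv where "gv t = - \<kappa> * e1 t + (s t / r + \<delta> / 2 * c t) * e2 t" for t
  \<comment> \<open>This equals \<open>gv' + r\<^sup>2 g + \<delta> r\<^sup>2 gv\<close>, so the
    first two equations hold exactly and the whole residual \<open>h\<close> sits in the
    third.\<close>
  define gw where "gw t = (1 + (\<kappa>\<^sup>2 - \<kappa> * \<delta>) * r\<^sup>2) * e1 t + \<delta>\<^sup>2 / 4 * r\<^sup>2 * (c t * e2 t)" for t
  define h where "h t = r ^ 3 * (\<delta>\<^sup>2 / 4 * (- s t + (\<kappa> - \<delta> / 2) * (r * c t)) * e2 t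
       + m * (- \<kappa> * (r * e1 t) + (s t + \<delta> / 2 * (r * c t)) * e2 t))" for t
  have g: "g t = prof \<kappa> \<delta> t r" for t by (simp add: g_def prof_def e1_def e2_def c_def)
  have dg: "(g has_real_derivative gv t) (at t within S)" for t S
  proof -
    have "(g has_real_derivative 1 / r\<^sup>2 * (- (\<kappa> * r\<^sup>2) * e1 t - (c t * (- (\<delta> / 2 * r\<^sup>2) * e2 t) + - (r * s t) * e2 t))) (at t within S)"
      unfolding g_def by (intro DERIV_cmult DERIV_diff DERIV_mult' d)
    also have "1 / r\<^sup>2 * (- (\<kappa> * r\<^sup>2) * e1 t - (c t * (- (\<delta> / 2 * r\<^sup>2) * e2 t) + - (r * s t) * e2 t)) = gv t"
      unfolding gv_def using rp by (simp add: field_simps power2_eq_square)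
    finally show ?thesis .
  qed
  have dgv: "(gv has_real_derivative gw t - r\<^sup>2 * g t - (\<delta> * r\<^sup>2) * gv t) (at t within S)" for t S
  proof -
    have "(gv has_real_derivative - \<kappa> * (- (\<kappa> * r\<^sup>2) * e1 t) + ((s t / r + \<delta> / 2 * c t) * (- (\<delta> / 2 * r\<^sup>2) * e2 t)
        + ((r * c t) / r + \<delta> / 2 * (- (r * s t))) * e2 t)) (at t within S)"
      unfolding gv_def by (intro DERIV_cmult DERIV_add DERIV_mult' DERIV_cdivide d)
    also have "- \<kappa> * (- (\<kappa> * r\<^sup>2) * e1 t) + ((s t / r + \<delta> / 2 * c t) * (- (\<delta> / 2 * r\<^sup>2) * e2 t)
        + ((r * c t) / r + \<delta> / 2 * (- (r * s t))) * e2 t) = gw t - r\<^sup>2 * g t - (\<delta> * r\<^sup>2) * gv t"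
      unfolding gv_def gw_def g_def using rp by (simp add: field_simps power2_eq_square)
    finally show ?thesis .
  qed
  have dgw: "(gw has_real_derivative h t - (\<kappa> * r\<^sup>2) * gw t - (m * r ^ 4) * gv t) (at t within S)" for t S
  proof -
    have "(gw has_real_derivative (1 + (\<kappa>\<^sup>2 - \<kappa> * \<delta>) * r\<^sup>2) * (- (\<kappa> * r\<^sup>2) * e1 t)
       + \<delta>\<^sup>2 / 4 * r\<^sup>2 * (c t * (- (\<delta> / 2 * r\<^sup>2) * e2 t) + - (r * s t) * e2 t)) (at t within S)"
      unfolding gw_def by (intro DERIV_cmult DERIV_add DERIV_mult' d)
    also have "(1 + (\<kappa>\<^sup>2 - \<kappa> * \<delta>) * r\<^sup>2) * (- (\<kappa> * r\<^sup>2) * e1 t)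
       + \<delta>\<^sup>2 / 4 * r\<^sup>2 * (c t * (- (\<delta> / 2 * r\<^sup>2) * e2 t) + - (r * s t) * e2 t)
       = h t - (\<kappa> * r\<^sup>2) * gw t - (m * r ^ 4) * gv t"
    proof -
      have "r ^ 4 * (s t / r) = r ^ 3 * s t" using rp by (simp add: numeral_eq_Suc)
      then have gv4: "(m * r ^ 4) * gv t = m * (- \<kappa> * r ^ 4 * e1 t + (r ^ 3 * s t + r ^ 4 * (\<delta> / 2 * c t)) * e2 t)"
      proof -
        have "(m * r ^ 4) * (- \<kappa> * x + (q + \<delta> / 2 * y) * z) = m * (- \<kappa> * r ^ 4 * x + (p + r ^ 4 * (\<delta> / 2 * y)) * z)"
          if "r ^ 4 * q = p" for p q x y z
          unfolding that[symmetric] by (simp add: algebra_simps)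
        then show ?thesis using \<open>r ^ 4 * (s t / r) = r ^ 3 * s t\<close> unfolding gv_def by blast
      qed
      show ?thesis unfolding gv4 h_def gw_def
        by (simp add: algebra_simps power2_eq_square numeral_eq_Suc)
    qed
    finally show ?thesis .
  qed
  have vd: "((\<lambda>t. q t *\<^sub>R a) has_vector_derivative q' *\<^sub>R a) (at t within S)"
    if "(q has_real_derivative q') (at t within S)" for q :: "real \<Rightarrow> real" and q' t S
    using that has_vector_derivative_scaleR[of q q' t S "\<lambda>_. a" 0] by simp
  have "freq_system \<delta> \<kappa> m r (\<lambda>t. u t - g t *\<^sub>R a) (\<lambda>t. v t - gv t *\<^sub>R a) (\<lambda>t. w t - gw t *\<^sub>R a) (\<lambda>t. - (h t *\<^sub>R a))"
  proof
    fix t :: real assume t: "t \<ge> 0"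
    show "((\<lambda>t. u t - g t *\<^sub>R a) has_vector_derivative v t - gv t *\<^sub>R a) (at t within {0..})"
      by (intro has_vector_derivative_diff u' t vd dg)
    have "((\<lambda>t. v t - gv t *\<^sub>R a) has_vector_derivative (w t - r\<^sup>2 *\<^sub>R u t - (\<delta> * r\<^sup>2) *\<^sub>R v t)
        - (gw t - r\<^sup>2 * g t - (\<delta> * r\<^sup>2) * gv t) *\<^sub>R a) (at t within {0..})"
      by (intro has_vector_derivative_diff v' t vd dgv)
    also have "(w t - r\<^sup>2 *\<^sub>R u t - (\<delta> * r\<^sup>2) *\<^sub>R v t) - (gw t - r\<^sup>2 * g t - (\<delta> * r\<^sup>2) * gv t) *\<^sub>R a
       = w t - gw t *\<^sub>R a - r\<^sup>2 *\<^sub>R (u t - g t *\<^sub>R a) - (\<delta> * r\<^sup>2) *\<^sub>R (v t - gv t *\<^sub>R a)"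
      by (simp add: algebra_simps)
    finally show "((\<lambda>t. v t - gv t *\<^sub>R a) has_vector_derivative w t - gw t *\<^sub>R a - r\<^sup>2 *\<^sub>R (u t - g t *\<^sub>R a) - (\<delta> * r\<^sup>2) *\<^sub>R (v t - gv t *\<^sub>R a)) (at t within {0..})" .
    have "((\<lambda>t. w t - gw t *\<^sub>R a) has_vector_derivative (0 - (\<kappa> * r\<^sup>2) *\<^sub>R w t - (m * r ^ 4) *\<^sub>R v t)
        - (h t - (\<kappa> * r\<^sup>2) * gw t - (m * r ^ 4) * gv t) *\<^sub>R a) (at t within {0..})"
      by (intro has_vector_derivative_diff w' t vd dgw)
    also have "(0 - (\<kappa> * r\<^sup>2) *\<^sub>R w t - (m * r ^ 4) *\<^sub>R v t) - (h t - (\<kappa> * r\<^sup>2) * gw t - (m * r ^ 4) * gv t) *\<^sub>R a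
       = - (h t *\<^sub>R a) - (\<kappa> * r\<^sup>2) *\<^sub>R (w t - gw t *\<^sub>R a) - (m * r ^ 4) *\<^sub>R (v t - gv t *\<^sub>R a)"
      by (simp add: algebra_simps)
    finally show "((\<lambda>t. w t - gw t *\<^sub>R a) has_vector_derivative - (h t *\<^sub>R a) - (\<kappa> * r\<^sup>2) *\<^sub>R (w t - gw t *\<^sub>R a) - (m * r ^ 4) *\<^sub>R (v t - gv t *\<^sub>R a)) (at t within {0..})" .
  qed (use pos in auto)
  then have sys': "freq_system \<delta> \<kappa> m r (\<lambda>t. u t - prof \<kappa> \<delta> t r *\<^sub>R a) (\<lambda>t. v t - gv t *\<^sub>R a) (\<lambda>t. w t - gw t *\<^sub>R a) (\<lambda>t. - (h t *\<^sub>R a))"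
    unfolding g .
  have hb: "norm (- (h t *\<^sub>R a)) \<le> ((\<delta>\<^sup>2 / 4 * (1 + \<bar>\<kappa> - \<delta> / 2\<bar>) + m * (\<kappa> + 1 + \<delta> / 2)) * norm a) * r ^ 3 * exp (- \<kappa> * r\<^sup>2 * t)"
    if t: "t \<ge> 0" for t
  proof -
    \<comment> \<open>\<kappa> \<le> \<delta> / 2 makes the wave factor decay at least as fast as
      the heat factor, so a single exponential bounds the residual.\<close>
    have e21: "0 \<le> e2 t" "e2 t \<le> e1 t" "0 \<le> e1 t"
    proof -
      have "\<kappa> * (r\<^sup>2 * t) \<le> (\<delta> / 2) * (r\<^sup>2 * t)" using kd t by (intro mult_right_mono) auto
      then show "e2 t \<le> e1 t" by (simp add: e1_def e2_def mult.assoc)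
    qed (auto simp: e1_def e2_def)
    have sc: "\<bar>s t\<bar> \<le> 1" "\<bar>c t\<bar> \<le> 1" by (auto simp: s_def c_def)
    have rc: "\<bar>r * c t\<bar> \<le> 1" using sc(2) rp r by (simp add: abs_mult mult_le_one)
    have re: "\<bar>r * e1 t\<bar> \<le> e1 t" using rp r e21 by (simp add: abs_mult mult_left_le_one_le)
    have k1: "\<bar>(- s t + (\<kappa> - \<delta> / 2) * (r * c t)) * e2 t\<bar> \<le> (1 + \<bar>\<kappa> - \<delta> / 2\<bar>) * e1 t"
    proof -
      have "\<bar>- s t + (\<kappa> - \<delta> / 2) * (r * c t)\<bar> \<le> \<bar>- s t\<bar> + \<bar>\<kappa> - \<delta> / 2\<bar> * \<bar>r * c t\<bar>"
        by (metis abs_mult abs_triangle_ineq)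
      also have "\<dots> \<le> 1 + \<bar>\<kappa> - \<delta> / 2\<bar> * 1" using sc rc by (intro add_mono mult_left_mono) auto
      finally have "\<bar>- s t + (\<kappa> - \<delta> / 2) * (r * c t)\<bar> * e2 t \<le> (1 + \<bar>\<kappa> - \<delta> / 2\<bar> * 1) * e1 t"
        using e21 by (intro mult_mono) auto
      then show ?thesis using e21 by (simp add: abs_mult)
    qed
    have k2: "\<bar>- \<kappa> * (r * e1 t) + (s t + \<delta> / 2 * (r * c t)) * e2 t\<bar> \<le> (\<kappa> + 1 + \<delta> / 2) * e1 t"
    proof -
      have "\<bar>s t + \<delta> / 2 * (r * c t)\<bar> \<le> \<bar>s t\<bar> + \<bar>\<delta> / 2 * (r * c t)\<bar>"
        by (rule abs_triangle_ineq)
      also have "\<bar>\<delta> / 2 * (r * c t)\<bar> = \<delta> / 2 * \<bar>r * c t\<bar>"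
        using pos by (simp add: abs_mult)
      also have "\<bar>s t\<bar> + \<delta> / 2 * \<bar>r * c t\<bar> \<le> 1 + \<delta> / 2 * 1" using sc rc pos by (intro add_mono mult_left_mono) auto
      finally have "\<bar>s t + \<delta> / 2 * (r * c t)\<bar> * e2 t \<le> (1 + \<delta> / 2 * 1) * e1 t"
        using e21 pos by (intro mult_mono) auto
      then have 1: "\<bar>(s t + \<delta> / 2 * (r * c t)) * e2 t\<bar> \<le> (1 + \<delta> / 2) * e1 t"
        using e21 by (simp add: abs_mult)
      have 2: "\<bar>- \<kappa> * (r * e1 t)\<bar> \<le> \<kappa> * e1 t"
        using mult_left_mono[OF re, of \<kappa>] pos by (simp add: abs_mult)
      have "\<bar>- \<kappa> * (r * e1 t) + (s t + \<delta> / 2 * (r * c t)) * e2 t\<bar> \<le> \<kappa> * e1 t + (1 + \<delta> / 2) * e1 t"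
        by (rule order_trans[OF abs_triangle_ineq add_mono[OF 2 1]])
      then show ?thesis by (simp add: algebra_simps)
    qed
    have "\<bar>h t\<bar> = r ^ 3 * \<bar>\<delta>\<^sup>2 / 4 * ((- s t + (\<kappa> - \<delta> / 2) * (r * c t)) * e2 t)
       + m * (- \<kappa> * (r * e1 t) + (s t + \<delta> / 2 * (r * c t)) * e2 t)\<bar>"
      unfolding h_def using rp by (simp only: abs_mult mult.assoc) simp
    also have "\<dots> \<le> r ^ 3 * (\<delta>\<^sup>2 / 4 * ((1 + \<bar>\<kappa> - \<delta> / 2\<bar>) * e1 t) + m * ((\<kappa> + 1 + \<delta> / 2) * e1 t))"
    proof (intro mult_left_mono)
      have "\<bar>\<delta>\<^sup>2 / 4 * ((- s t + (\<kappa> - \<delta> / 2) * (r * c t)) * e2 t)\<bar> \<le> \<delta>\<^sup>2 / 4 * ((1 + \<bar>\<kappa> - \<delta> / 2\<bar>) * e1 t)"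
        using mult_left_mono[OF k1, of "\<delta>\<^sup>2 / 4"] by (simp only: abs_mult) simp
      moreover have "\<bar>m * (- \<kappa> * (r * e1 t) + (s t + \<delta> / 2 * (r * c t)) * e2 t)\<bar> \<le> m * ((\<kappa> + 1 + \<delta> / 2) * e1 t)"
        using mult_left_mono[OF k2, of m] pos by (simp only: abs_mult) simp
      ultimately show "\<bar>\<delta>\<^sup>2 / 4 * ((- s t + (\<kappa> - \<delta> / 2) * (r * c t)) * e2 t)
       + m * (- \<kappa> * (r * e1 t) + (s t + \<delta> / 2 * (r * c t)) * e2 t)\<bar> \<le> \<delta>\<^sup>2 / 4 * ((1 + \<bar>\<kappa> - \<delta> / 2\<bar>) * e1 t) + m * ((\<kappa> + 1 + \<delta> / 2) * e1 t)"
        by (rule order_trans[OF abs_triangle_ineq add_mono])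
    qed (use rp in auto)
    finally have "\<bar>h t\<bar> * norm a \<le> (r ^ 3 * (\<delta>\<^sup>2 / 4 * ((1 + \<bar>\<kappa> - \<delta> / 2\<bar>) * e1 t) + m * ((\<kappa> + 1 + \<delta> / 2) * e1 t))) * norm a"
      by (intro mult_right_mono) auto
    also have "\<dots> = ((\<delta>\<^sup>2 / 4 * (1 + \<bar>\<kappa> - \<delta> / 2\<bar>) + m * (\<kappa> + 1 + \<delta> / 2)) * norm a) * r ^ 3 * e1 t"
      by algebra
    finally show ?thesis unfolding e1_def by simp
  qed
  show ?thesis
    using that[OF sys'] hb by (simp add: gv_def gw_def e1_def e2_def c_def s_def algebra_simps)
qed

section \<open>Pointwise bounds at low and high frequencies\<close>

lemma sq_bound_imp_bound1:
  fixes a x :: real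
  assumes "a\<^sup>2 \<le> C * exp (- k) * x\<^sup>2" "0 \<le> C" "0 \<le> x"
  shows "a \<le> sqrt C * exp (- k / 2) * x"
  using sq_bound_imp_bound[of a C k x 0 0] assms by simp

text \<open>The first bound costs a factor 1 / r, whose square is not integrable at the origin in
  dimensions one and two. The second integrates the bound on the velocity from time zero and stays
  finite there.\<close>

lemma low_freq_bound:
  fixes \<delta> \<kappa> m :: real
  assumes pos: "0 < \<kappa>" "0 < m" and kd: "\<kappa> \<le> \<delta> / 2"
  obtains r0 C c :: real where "0 < r0" "r0 \<le> 1" "0 < C" "0 < c"
    "\<And>r t a0 a1 a2 u v w. \<lbrakk>0 < r; r \<le> r0; 0 \<le> t; freq_system \<delta> \<kappa> m r u v w (\<lambda>_. 0 :: 'a::real_inner);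
       u 0 = a0; v 0 = a1; w 0 = a2 + r\<^sup>2 *\<^sub>R a0 + (\<delta> * r\<^sup>2) *\<^sub>R a1\<rbrakk> \<Longrightarrow>
       norm (u t - prof \<kappa> \<delta> t r *\<^sub>R a2) \<le> C * (norm a0 + norm a1 + norm a2) * exp (- (c * r\<^sup>2 * t)) / r \<and>
       norm (u t - prof \<kappa> \<delta> t r *\<^sub>R a2) \<le> C * (norm a0 + norm a1 + norm a2) * (1 + t)"
proof -
  have dp: "\<delta> > 0" using pos kd by simp
  define \<eta> where "\<eta> = \<delta> / 4"
  define K where "K = 2 * \<kappa> / \<eta>"
  define J where "J = m + \<eta> * \<delta> + \<eta> * \<kappa> + K * m"
  define B where "B = 4 * K / \<kappa> + 4 / \<eta> + 4 * \<eta>\<^sup>2 / \<delta>"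
  define k where "k = Min {\<kappa> / 2, \<delta> / 2 / (1 + \<eta>), \<eta> / (1 + \<eta>)}"
  define r0 where "r0 = Min {1, 1 / (1 + m), 1 / (2 * \<eta>), \<delta> / 8 / J, \<eta> / 4 / J, K * \<kappa> / 4 / J}"
  define Cf where "Cf = \<delta>\<^sup>2 / 4 * (1 + \<bar>\<kappa> - \<delta> / 2\<bar>) + m * (\<kappa> + 1 + \<delta> / 2)"
  define q where "q = \<kappa>\<^sup>2 - \<kappa> * \<delta> + \<delta>\<^sup>2 / 4"
  define c1 where "c1 = 1 + \<bar>\<delta> / 2 - \<kappa>\<bar>"
  define c2 where "c2 = 1 + \<delta> + \<bar>q\<bar>"
  define M where "M = (1 + \<eta>) * (c1\<^sup>2 + (1 + c2)\<^sup>2) + K * c2\<^sup>2 + B * Cf\<^sup>2 / \<kappa>"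
  \<comment> \<open>\<open>M\<close> bounds the initial energy and the source relative to the
    squared data size. sqrt (2 * M) comes from V and from the rotating combination, sqrt (M / K)
    from W, and 1 from the value at time zero.\<close>
  define C where "C = sqrt (2 * M) + sqrt (M / K) + 1"
  have p1: "\<eta> > 0" using dp by (simp add: \<eta>_def)
  have p2: "K > 0" using p1 pos by (simp add: K_def)
  have p3: "J > 0" using p1 p2 pos dp by (simp add: J_def add_pos_pos)
  have p4: "B > 0" using p1 p2 pos dp by (simp add: B_def add_pos_pos)
  have p5: "k > 0" using p1 pos dp by (simp add: k_def)
  have p6: "r0 > 0" using p1 p2 p3 pos dp by (simp add: r0_def)
  have p7: "Cf \<ge> 0" using pos dp by (simp add: Cf_def)
  have p8: "c1 \<ge> 0" "c2 \<ge> 0" using dp by (auto simp: c1_def c2_def)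
  have p9: "M \<ge> 0" using p1 p2 p4 pos by (simp add: M_def)
  have p10: "C > 0" using p9 p2 by (simp add: C_def add_nonneg_pos)
  have r0_le: "r0 \<le> 1" "r0 \<le> 1 / (1 + m)" "r0 \<le> 1 / (2 * \<eta>)" "r0 \<le> \<delta> / 8 / J" "r0 \<le> \<eta> / 4 / J" "r0 \<le> K * \<kappa> / 4 / J"
    unfolding r0_def by (rule Min_le; simp)+
  have k_le: "k \<le> \<kappa> / 2" "k \<le> \<delta> / 2 / (1 + \<eta>)" "k \<le> \<eta> / (1 + \<eta>)"
    unfolding k_def by (rule Min_le; simp)+
  show ?thesis
  proof (rule that[OF p6 r0_le(1) p10, of "k / 2"])
    show "0 < k / 2" using p5 by simp
    fix r t :: real and a0 a1 a2 :: 'a and u v w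
    assume r: "0 < r" "r \<le> r0" and t: "0 \<le> t" and sys: "freq_system \<delta> \<kappa> m r u v w (\<lambda>_. 0)"
      and init: "u 0 = a0" "v 0 = a1" "w 0 = a2 + r\<^sup>2 *\<^sub>R a0 + (\<delta> * r\<^sup>2) *\<^sub>R a1"
    define S where "S = norm a0 + norm a1 + norm a2"
    have S: "norm a0 \<le> S" "norm a1 \<le> S" "norm a2 \<le> S" "0 \<le> S" by (auto simp: S_def)
    have r1: "r \<le> 1" using r r0_le by simp
    obtain V W f where sys': "freq_system \<delta> \<kappa> m r (\<lambda>t. u t - prof \<kappa> \<delta> t r *\<^sub>R a2) V W f"
      and V0: "V 0 = v 0 - (\<delta> / 2 - \<kappa>) *\<^sub>R a2"
      and W0: "W 0 = w 0 - (1 + (\<kappa>\<^sup>2 - \<kappa> * \<delta> + \<delta>\<^sup>2 / 4) * r\<^sup>2) *\<^sub>R a2"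
      and fb: "\<And>t. t \<ge> 0 \<Longrightarrow> norm (f t) \<le> (Cf * norm a2) * r ^ 3 * exp (- \<kappa> * r\<^sup>2 * t)"
      by (rule prof_system[OF sys kd r1, of a2, folded Cf_def]) (rule that)
    define d where "d t = u t - prof \<kappa> \<delta> t r *\<^sub>R a2" for t
    interpret freq_system \<delta> \<kappa> m r d V W f using sys' by (simp add: d_def[abs_def])
    have d0: "d 0 = a0" by (simp add: d_def prof_def init)
    have energy: "(norm (V t))\<^sup>2 + (norm (r *\<^sub>R d t - (1 / r) *\<^sub>R W t))\<^sup>2 + 2 * K * (norm (W t) / r)\<^sup>2
      \<le> 2 * exp (- (k * r\<^sup>2) * t) * ((1 + \<eta>) * ((norm (V 0))\<^sup>2 + (norm (r *\<^sub>R d 0 - (1 / r) *\<^sub>R W 0))\<^sup>2)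
         + K * (norm (W 0) / r)\<^sup>2 + B * (Cf * norm a2)\<^sup>2 / \<kappa>)" if "t \<ge> 0" for t
    proof (rule low_energy[OF fb _ \<eta>_def K_def r1 _ _ _ _ _ _ p5 _ _ k_le(1) B_def that])
      show "0 \<le> Cf * norm a2" using p7 by simp
      have "r * (1 + m) \<le> 1" using r r0_le(2) pos by (simp add: pos_le_divide_eq[of "1 + m"] add_pos_pos order_trans[OF mult_right_mono])
      then have "m * r \<le> 1" using r pos by (simp add: algebra_simps)
      then have "(m * r) * r \<le> 1 * 1" using r r1 pos by (intro mult_mono) auto
      then show "m * r\<^sup>2 \<le> 1" by (simp add: power2_eq_square mult.assoc)
      show "\<eta> * r \<le> 1 / 2" using order_trans[OF r(2) r0_le(3)] p1 by (simp add: field_simps)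
      show "r * J \<le> \<delta> / 8" using order_trans[OF r(2) r0_le(4)] p3 by (simp add: pos_le_divide_eq)
      show "r * J \<le> \<eta> / 4" using order_trans[OF r(2) r0_le(5)] p3 by (simp add: pos_le_divide_eq)
      show "r * J \<le> K * \<kappa> / 4" using order_trans[OF r(2) r0_le(6)] p3 by (simp add: pos_le_divide_eq)
      show "m + \<eta> * \<delta> + \<eta> * \<kappa> + K * m \<le> J" by (simp add: J_def)
      show "k * (1 + \<eta>) \<le> \<delta> / 2" using k_le(2) p1 pos_le_divide_eq[of "1 + \<eta>" k "\<delta> / 2"] by simp
      show "k * (1 + \<eta>) \<le> \<eta>" using k_le(3) p1 pos_le_divide_eq[of "1 + \<eta>" k "\<eta>"] by simp
    qed
    have b1: "norm (V 0) \<le> c1 * S"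
    proof -
      have "norm (V 0) \<le> norm a1 + \<bar>\<delta> / 2 - \<kappa>\<bar> * norm a2"
        unfolding V0 init by (rule order_trans[OF norm_triangle_ineq4]) simp
      also have "\<dots> \<le> S + \<bar>\<delta> / 2 - \<kappa>\<bar> * S" using S by (intro add_mono mult_left_mono) auto
      finally show ?thesis by (simp add: c1_def algebra_simps)
    qed
    \<comment> \<open>The a2 in w 0 is cancelled by the leading part of the profile; what remains is
      of order r^2 and survives the division by r in the energy.\<close>
    have b2: "norm (W 0) \<le> r\<^sup>2 * (c2 * S)"
    proof -
      have "W 0 = r\<^sup>2 *\<^sub>R (a0 + \<delta> *\<^sub>R a1 - q *\<^sub>R a2)"
        unfolding W0 init q_def by (simp add: algebra_simps)
      then have "norm (W 0) = r\<^sup>2 * norm (a0 + \<delta> *\<^sub>R a1 - q *\<^sub>R a2)" by simp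
      also have "\<dots> \<le> r\<^sup>2 * (norm a0 + \<delta> * norm a1 + \<bar>q\<bar> * norm a2)"
        using dp norm_triangle_ineq4[of "a0 + \<delta> *\<^sub>R a1" "q *\<^sub>R a2"] norm_triangle_ineq[of a0 "\<delta> *\<^sub>R a1"]
        by (intro mult_left_mono) auto
      also have "\<dots> \<le> r\<^sup>2 * (S + \<delta> * S + \<bar>q\<bar> * S)" using S dp by (intro mult_left_mono add_mono) auto
      finally show ?thesis by (simp add: c2_def algebra_simps)
    qed
    have b3: "norm (W 0) / r \<le> r * (c2 * S)"
      using b2 r by (simp add: divide_le_eq power2_eq_square mult_ac)
    have rc: "r * (c2 * S) \<le> c2 * S"
      using r r1 p8 S by (intro mult_left_le_one_le) auto
    have b4: "norm (r *\<^sub>R d 0 - (1 / r) *\<^sub>R W 0) \<le> (1 + c2) * S"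
    proof -
      have "norm (r *\<^sub>R d 0 - (1 / r) *\<^sub>R W 0) \<le> r * norm a0 + norm (W 0) / r"
        using norm_triangle_ineq4[of "r *\<^sub>R d 0" "(1 / r) *\<^sub>R W 0"] r by (simp add: d0)
      also have "\<dots> \<le> 1 * S + c2 * S"
        using b3 rc S r r1 by (intro add_mono mult_mono) auto
      finally show ?thesis by (simp add: algebra_simps)
    qed
    have RHS: "(1 + \<eta>) * ((norm (V 0))\<^sup>2 + (norm (r *\<^sub>R d 0 - (1 / r) *\<^sub>R W 0))\<^sup>2)
         + K * (norm (W 0) / r)\<^sup>2 + B * (Cf * norm a2)\<^sup>2 / \<kappa> \<le> M * S\<^sup>2"
    proof -
      have "(1 + \<eta>) * ((norm (V 0))\<^sup>2 + (norm (r *\<^sub>R d 0 - (1 / r) *\<^sub>R W 0))\<^sup>2)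
         + K * (norm (W 0) / r)\<^sup>2 + B * (Cf * norm a2)\<^sup>2 / \<kappa>
       \<le> (1 + \<eta>) * ((c1 * S)\<^sup>2 + ((1 + c2) * S)\<^sup>2) + K * (c2 * S)\<^sup>2 + B * (Cf * S)\<^sup>2 / \<kappa>"
        using b1 b4 order_trans[OF b3 rc] p1 p2 p4 p7 S r pos
        by (intro add_mono mult_left_mono power_mono divide_right_mono) auto
      also have "\<dots> = M * S\<^sup>2"
        by (simp add: M_def power2_eq_square algebra_simps add_divide_distrib)
      finally show ?thesis .
    qed
    have tot: "(norm (V t))\<^sup>2 + (norm (r *\<^sub>R d t - (1 / r) *\<^sub>R W t))\<^sup>2 + 2 * K * (norm (W t) / r)\<^sup>2
        \<le> 2 * M * exp (- (k * r\<^sup>2 * t)) * S\<^sup>2" if "t \<ge> 0" for t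
      using order_trans[OF energy[OF that] mult_left_mono[OF RHS, of "2 * exp (- (k * r\<^sup>2) * t)"]]
      by (simp add: mult_ac)
    have nn: "0 \<le> 2 * K * (norm (W t) / r)\<^sup>2" for t using p2 by simp
    have Vb: "norm (V t) \<le> sqrt (2 * M) * exp (- (k * r\<^sup>2 * t) / 2) * S" if "t \<ge> 0" for t
      using tot[OF that] nn[of t] p9 S by (intro sq_bound_imp_bound1) (auto intro: order_trans[rotated] simp: add_nonneg_nonneg)
    have Zb: "norm (r *\<^sub>R d t - (1 / r) *\<^sub>R W t) \<le> sqrt (2 * M) * exp (- (k * r\<^sup>2 * t) / 2) * S"
    proof (rule sq_bound_imp_bound1)
      have "0 \<le> (norm (V t))\<^sup>2" by simp
      then show "(norm (r *\<^sub>R d t - (1 / r) *\<^sub>R W t))\<^sup>2 \<le> 2 * M * exp (- (k * r\<^sup>2 * t)) * S\<^sup>2"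
        using tot[OF t] nn[of t] by linarith
    qed (use p9 S in auto)
    have Wb: "norm (W t) / r \<le> sqrt (M / K) * exp (- (k * r\<^sup>2 * t) / 2) * S"
    proof (rule sq_bound_imp_bound1)
      have "0 \<le> (norm (V t))\<^sup>2" "0 \<le> (norm (r *\<^sub>R d t - (1 / r) *\<^sub>R W t))\<^sup>2" by simp_all
      then have "(2 * K) * (norm (W t) / r)\<^sup>2 \<le> 2 * M * exp (- (k * r\<^sup>2 * t)) * S\<^sup>2"
        using tot[OF t] by linarith
      also have "\<dots> = (2 * K) * (M / K * exp (- (k * r\<^sup>2 * t)) * S\<^sup>2)" using p2 by simp
      finally show "(norm (W t) / r)\<^sup>2 \<le> M / K * exp (- (k * r\<^sup>2 * t)) * S\<^sup>2"
        by (rule mult_left_le_imp_le) (use p2 in simp)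
    qed (use p9 p2 S in auto)
    \<comment> \<open>The difference is recovered from the two energy components; here the factor 1
      / r is lost.\<close>
    have "d t = (1 / r) *\<^sub>R ((r *\<^sub>R d t - (1 / r) *\<^sub>R W t) + (1 / r) *\<^sub>R W t)" using r by simp
    then have "norm (d t) = norm ((r *\<^sub>R d t - (1 / r) *\<^sub>R W t) + (1 / r) *\<^sub>R W t) / r"
      using r by (metis abs_of_pos divide_inverse_commute inverse_eq_divide norm_scaleR zero_less_divide_1_iff)
    also have "\<dots> \<le> (norm (r *\<^sub>R d t - (1 / r) *\<^sub>R W t) + norm (W t) / r) / r"
      using r norm_triangle_ineq[of "r *\<^sub>R d t - (1 / r) *\<^sub>R W t" "(1 / r) *\<^sub>R W t"]
      by (intro divide_right_mono) auto
    also have "\<dots> \<le> (sqrt (2 * M) * exp (- (k * r\<^sup>2 * t) / 2) * S + sqrt (M / K) * exp (- (k * r\<^sup>2 * t) / 2) * S) / r"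
      using Zb Wb r by (intro divide_right_mono add_mono) auto
    also have "\<dots> = (sqrt (2 * M) + sqrt (M / K)) * (S * exp (- (k * r\<^sup>2 * t) / 2)) / r"
      by (simp add: algebra_simps)
    also have "\<dots> \<le> C * (S * exp (- (k * r\<^sup>2 * t) / 2)) / r"
      using r S by (intro divide_right_mono mult_right_mono) (auto simp: C_def)
    finally have 1: "norm (d t) \<le> C * S * exp (- (k / 2 * r\<^sup>2 * t)) / r" by (simp add: mult_ac)
    have "norm (d t - d 0) \<le> (sqrt (2 * M) * S) * t"
    proof (rule norm_diff_le_of_deriv_bound[OF u' _ t])
      fix s :: real assume s: "s \<ge> 0"
      have "sqrt (2 * M) * exp (- (k * r\<^sup>2 * s) / 2) * S \<le> sqrt (2 * M) * 1 * S"
        using s p5 p9 S by (intro mult_right_mono mult_left_mono) auto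
      then show "norm (V s) \<le> sqrt (2 * M) * S" using Vb[OF s] by simp
    qed
    then have "norm (d t) \<le> S + (sqrt (2 * M) * S) * t"
      using norm_triangle_ineq[of "d t - d 0" "d 0"] S(1) d0 by simp
    also have "\<dots> \<le> C * S * 1 + C * S * t"
    proof (rule add_mono)
      have "1 \<le> C" "sqrt (2 * M) \<le> C" using p9 p2 by (auto simp: C_def)
      then show "S \<le> C * S * 1" "sqrt (2 * M) * S * t \<le> C * S * t"
        using S t mult_right_mono[of 1 C S] by (auto intro!: mult_right_mono)
    qed
    finally have 2: "norm (d t) \<le> C * S * (1 + t)" by (simp add: algebra_simps)
    show "norm (u t - prof \<kappa> \<delta> t r *\<^sub>R a2) \<le> C * (norm a0 + norm a1 + norm a2) * exp (- (k / 2 * r\<^sup>2 * t)) / r \<and>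
       norm (u t - prof \<kappa> \<delta> t r *\<^sub>R a2) \<le> C * (norm a0 + norm a1 + norm a2) * (1 + t)"
      using 1 2 unfolding d_def S_def by blast
  qed
qed

text \<open>The range is cut at R: beyond it \<open>high_energy\<close> applies with the right
  powers of r, and between r0 and R the powers lost by \<open>mid_energy\<close> are bounded by
  constants.\<close>

lemma high_freq_bound:
  fixes \<delta> \<kappa> m r0 :: real
  assumes pos: "0 < \<kappa>" "0 < m" "0 < \<delta>" "0 < r0"
  obtains C c :: real where "0 < C" "0 < c"
    "\<And>r t a0 a1 a2 u v w. \<lbrakk>r0 \<le> r; 0 \<le> t; freq_system \<delta> \<kappa> m r u v w (\<lambda>_. 0 :: 'a::real_inner);
       u 0 = a0; v 0 = a1; w 0 = a2 + r\<^sup>2 *\<^sub>R a0 + (\<delta> * r\<^sup>2) *\<^sub>R a1\<rbrakk> \<Longrightarrow>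
       norm (u t) \<le> C * exp (- (c * t)) * (norm a0 + norm a1 / r\<^sup>2 + norm a2 / r ^ 4)"
proof -
  have r0p: "r0 > 0" by (rule pos)
  define D where "D = \<kappa> * \<delta> + m"
  have D: "D > 0" using pos by (simp add: D_def add_pos_pos)
  define \<alpha> where "\<alpha> = \<kappa> / D"
  define \<beta> where "\<beta> = 1 / D"
  have ab: "\<alpha> > 0" "\<beta> > 0" using D pos by (auto simp: \<alpha>_def \<beta>_def)
  define b1 where "b1 = (2 * \<alpha>\<^sup>2 + 2 * m)\<^sup>2 / (2 * \<alpha>) + 2 * m * \<alpha> + m * \<beta>"
  define b2 where "b2 = 2 * \<alpha> * \<beta>\<^sup>2 + m * \<beta>"
  have b: "0 \<le> b1" "0 \<le> b2" using ab pos by (auto simp: b1_def b2_def)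
  \<comment> \<open>Each of the last four summands secures one largeness condition of
    \<open>high_energy\<close>; the 1 ensures that R \<le> r implies R \<le> r^2.\<close>
  define R where "R = 1 + b1 / (m * \<delta>) + b2 / \<kappa> + \<alpha> / \<delta> + \<alpha> / \<kappa>"
  have R1: "R \<ge> 1" "b1 / (m * \<delta>) \<le> R" "b2 / \<kappa> \<le> R" "\<alpha> / \<delta> \<le> R" "\<alpha> / \<kappa> \<le> R"
    using ab b pos by (auto simp: R_def)
  define \<eta> where "\<eta> = Min {\<kappa> / (2 * m), 1 / (4 * \<delta>), \<delta> * r0\<^sup>2 / 4, r0 / 2}"
  have \<eta>: "0 < \<eta>" "\<eta> \<le> \<kappa> / (2 * m)" "\<eta> \<le> 1 / (4 * \<delta>)" "\<eta> \<le> \<delta> * r0\<^sup>2 / 4" "\<eta> \<le> r0 / 2"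
  proof -
    show "0 < \<eta>" using pos by (simp add: \<eta>_def)
  qed (unfold \<eta>_def, (rule Min_le; simp)+)
  have \<eta>3: "\<eta> * \<delta> \<le> 1 / 4" using \<eta>(3) pos by (simp add: field_simps)
  define k where "k = Min {\<delta> * r0\<^sup>2 / 2, \<eta> / 2, \<kappa> * r0\<^sup>2 / 2}"
  have k: "2 * k \<le> \<delta> * r0\<^sup>2" "2 * k \<le> \<eta>" "2 * k \<le> \<kappa> * r0\<^sup>2" "0 < k"
  proof -
    have "k \<le> \<delta> * r0\<^sup>2 / 2" "k \<le> \<eta> / 2" "k \<le> \<kappa> * r0\<^sup>2 / 2" unfolding k_def by (rule Min_le; simp)+
    then show "2 * k \<le> \<delta> * r0\<^sup>2" "2 * k \<le> \<eta>" "2 * k \<le> \<kappa> * r0\<^sup>2" by simp_all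
    show "0 < k" using pos \<eta> by (simp add: k_def)
  qed
  define Ch where "Ch = 3 * (1 + \<alpha>\<^sup>2 / m + \<beta>\<^sup>2)"
  define c where "c = min (\<alpha> / 2) (k / 2)"
  define sm where "sm = sqrt m"
  have sm: "sm > 0" "sm\<^sup>2 = m" using pos by (auto simp: sm_def)
  define C1 where "C1 = sqrt Ch * ((1 + \<beta>) + (\<alpha> + \<beta> * \<delta>) + \<beta> + sm + (1 + \<delta> + 1))"
  define C2 where "C2 = 2 * (R + 1 + (R + 1 / r0 + \<delta> * R) / sm)"
  define C where "C = C1 + C2 + 1"
  have Cp: "0 \<le> C1" "0 \<le> C2" "0 < C"
  proof -
    show "0 \<le> C1" using ab sm pos by (auto simp: C1_def Ch_def intro!: mult_nonneg_nonneg)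
    show "0 \<le> C2" using R1 sm pos by (auto simp: C2_def)
    then show "0 < C" using \<open>0 \<le> C1\<close> by (simp add: C_def)
  qed
  show ?thesis
  proof (rule that[OF Cp(3), of c])
    show "0 < c" using ab k by (simp add: c_def)
    fix r t :: real and a0 a1 a2 :: 'a and u v w
    assume r: "r0 \<le> r" and t: "0 \<le> t" and sys: "freq_system \<delta> \<kappa> m r u v w (\<lambda>_. 0)"
      and init: "u 0 = a0" "v 0 = a1" "w 0 = a2 + r\<^sup>2 *\<^sub>R a0 + (\<delta> * r\<^sup>2) *\<^sub>R a1"
    interpret freq_system \<delta> \<kappa> m r u v w "\<lambda>_. 0" by (rule sys)
    \<comment> \<open>The data rescaled to their high-frequency sizes; everything is then compared
      with their sum \<open>S\<close>.\<close>
    define A0 A1 A2 where "A0 = norm a0" "A1 = norm a1 / r\<^sup>2" "A2 = norm a2 / r ^ 4"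
    have A: "0 \<le> A0" "0 \<le> A1" "0 \<le> A2" by (auto simp: A0_A1_A2_def)
    have rp: "r > 0" using pos r by simp
    have a: "norm a0 = A0" "norm a1 = r\<^sup>2 * A1" "norm a2 = r ^ 4 * A2" using rp by (auto simp: A0_A1_A2_def)
    define S where "S = A0 + A1 + A2"
    have AS: "A0 \<le> S" "A1 \<le> S" "A2 \<le> S" "0 \<le> S" using A by (auto simp: S_def)
    have w0: "norm (w 0) \<le> r ^ 4 * A2 + r\<^sup>2 * A0 + \<delta> * r ^ 4 * A1"
    proof -
      have "norm (w 0) \<le> norm a2 + r\<^sup>2 * norm a0 + (\<delta> * r\<^sup>2) * norm a1"
        unfolding init using norm_triangle_ineq[of "a2 + r\<^sup>2 *\<^sub>R a0" "(\<delta> * r\<^sup>2) *\<^sub>R a1"]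
          norm_triangle_ineq[of a2 "r\<^sup>2 *\<^sub>R a0"] pos by (simp add: abs_mult)
      also have "\<dots> = r ^ 4 * A2 + r\<^sup>2 * A0 + \<delta> * r ^ 4 * A1"
        unfolding a by (simp add: power2_eq_square numeral_eq_Suc)
      finally show ?thesis .
    qed
    have dec: "exp (- (\<alpha> * t) / 2) \<le> exp (- (c * t))" "exp (- (k * t) / 2) \<le> exp (- (c * t))"
    proof -
      have "c * t \<le> (\<alpha> / 2) * t" "c * t \<le> (k / 2) * t" using t by (intro mult_right_mono; simp add: c_def)+
      then show "exp (- (\<alpha> * t) / 2) \<le> exp (- (c * t))" "exp (- (k * t) / 2) \<le> exp (- (c * t))" by auto
    qed
    have "norm (u t) \<le> (C1 + C2) * exp (- (c * t)) * S"
    proof (cases "R \<le> r")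
      case True
      have r1: "r \<ge> 1" using True R1 by simp
      have r2: "R \<le> r\<^sup>2" using True r1 mult_mono[of R r 1 r] by (simp add: power2_eq_square)
      have big: "b1 \<le> m * \<delta> * r\<^sup>2" "b2 \<le> \<kappa> * r\<^sup>2" "\<alpha> \<le> \<delta> * r\<^sup>2" "\<alpha> \<le> \<kappa> * r\<^sup>2"
        using order_trans[OF R1(2) r2] order_trans[OF R1(3) r2] order_trans[OF R1(4) r2] order_trans[OF R1(5) r2] pos
        by (simp_all add: pos_divide_le_eq mult_ac)
      define x where "x = norm (u 0 + (\<alpha> / r\<^sup>2) *\<^sub>R v 0 + (\<beta> / r ^ 4) *\<^sub>R w 0)"
      define y where "y = sm * (norm (v 0) / r\<^sup>2)"
      define z where "z = norm (w 0) / r ^ 4"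
      have z1: "z \<le> A2 + A0 + \<delta> * A1"
      proof -
        have "z \<le> (r ^ 4 * A2 + r\<^sup>2 * A0 + \<delta> * r ^ 4 * A1) / r ^ 4"
          unfolding z_def using w0 rp by (intro divide_right_mono) auto
        also have "\<dots> = A2 + A0 / r\<^sup>2 + \<delta> * A1"
          using rp by (simp add: add_divide_distrib power2_eq_square numeral_eq_Suc)
        also have "A0 / r\<^sup>2 \<le> A0 / 1" using A r1 by (intro divide_left_mono) auto
        finally show ?thesis by simp
      qed
      have z: "z \<le> (1 + \<delta> + 1) * S"
      proof -
        note z1
        also have "A2 + A0 + \<delta> * A1 \<le> S + S + \<delta> * S" using AS pos by (intro add_mono mult_left_mono) auto
        also have "\<dots> = (1 + \<delta> + 1) * S" by (simp add: algebra_simps)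
        finally show ?thesis .
      qed
      have y: "y \<le> sm * S" unfolding y_def init a using rp sm AS by simp
      have x: "x \<le> ((1 + \<beta>) + (\<alpha> + \<beta> * \<delta>) + \<beta>) * S"
      proof -
        have "x \<le> norm (u 0) + norm ((\<alpha> / r\<^sup>2) *\<^sub>R v 0) + norm ((\<beta> / r ^ 4) *\<^sub>R w 0)"
          unfolding x_def using norm_triangle_ineq[of "u 0 + (\<alpha> / r\<^sup>2) *\<^sub>R v 0" "(\<beta> / r ^ 4) *\<^sub>R w 0"]
            norm_triangle_ineq[of "u 0" "(\<alpha> / r\<^sup>2) *\<^sub>R v 0"] by linarith
        also have "\<dots> = A0 + \<alpha> * A1 + \<beta> * z"
          unfolding z_def init a(1) using ab rp a(2) by simp
        also have "\<dots> \<le> A0 + \<alpha> * A1 + \<beta> * (A2 + A0 + \<delta> * A1)"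
          using z1 ab by (intro add_left_mono mult_left_mono) auto
        also have "\<dots> = (1 + \<beta>) * A0 + (\<alpha> + \<beta> * \<delta>) * A1 + \<beta> * A2" by (simp add: algebra_simps)
        also have "\<dots> \<le> (1 + \<beta>) * S + (\<alpha> + \<beta> * \<delta>) * S + \<beta> * S"
          using AS ab pos by (intro add_mono mult_left_mono) auto
        finally show ?thesis by (simp only: distrib_right)
      qed
      have "(norm (u t))\<^sup>2 \<le> Ch * exp (- \<alpha> * t) * (x\<^sup>2 + m * (norm (v 0))\<^sup>2 / r ^ 4 + (norm (w 0))\<^sup>2 / r ^ 8)"
        unfolding Ch_def x_def
        by (rule high_energy[OF refl _ _ big(1)[unfolded b1_def] big(2)[unfolded b2_def] big(3,4) t])
           (simp_all add: \<alpha>_def \<beta>_def D_def)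
      also have "m * (norm (v 0))\<^sup>2 / r ^ 4 = y\<^sup>2"
        unfolding y_def using sm by (simp add: power_mult_distrib power_divide flip: power_mult)
      also have "(norm (w 0))\<^sup>2 / r ^ 8 = z\<^sup>2"
        unfolding z_def by (simp add: power_divide flip: power_mult)
      finally have "(norm (u t))\<^sup>2 \<le> Ch * exp (- (\<alpha> * t)) * (x\<^sup>2 + y\<^sup>2 + z\<^sup>2)" by simp
      then have "norm (u t) \<le> sqrt Ch * exp (- (\<alpha> * t) / 2) * (x + y + z)"
        by (rule sq_bound_imp_bound) (use pos sm in \<open>auto simp: Ch_def x_def y_def z_def\<close>)
      also have "\<dots> \<le> sqrt Ch * exp (- (c * t)) * ((((1 + \<beta>) + (\<alpha> + \<beta> * \<delta>) + \<beta>) * S) + sm * S + (1 + \<delta> + 1) * S)"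
        using dec x y z sm rp pos by (intro mult_mono add_mono mult_nonneg_nonneg add_nonneg_nonneg) (auto simp: Ch_def x_def y_def z_def)
      also have "\<dots> = C1 * (exp (- (c * t)) * S)" by (simp add: C1_def algebra_simps)
      also have "\<dots> \<le> (C1 + C2) * (exp (- (c * t)) * S)" using Cp AS by (intro mult_right_mono) auto
      finally show ?thesis by (simp add: mult.assoc)
    next
      case False
      then have rR: "r \<le> R" by simp
      have "(norm (u t))\<^sup>2 \<le> 4 * exp (- k * t) * ((norm (v 0))\<^sup>2 / r\<^sup>2 + (norm (u 0))\<^sup>2 + (norm (w 0))\<^sup>2 / (m * r ^ 6))"
        by (rule mid_energy[OF refl r0p r \<eta>(1,2) \<eta>3 \<eta>(4,5) k t])
      also have "(norm (v 0))\<^sup>2 / r\<^sup>2 = (norm (v 0) / r)\<^sup>2" by (simp add: power_divide)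
      also have "(norm (w 0))\<^sup>2 / (m * r ^ 6) = (norm (w 0) / r ^ 3 / sm)\<^sup>2"
        unfolding sm(2)[symmetric] by (simp add: power_divide power_mult_distrib mult.commute flip: power_mult)
      finally have "(norm (u t))\<^sup>2 \<le> 4 * exp (- (k * t)) * ((norm (v 0) / r)\<^sup>2 + (norm (u 0))\<^sup>2 + (norm (w 0) / r ^ 3 / sm)\<^sup>2)"
        by simp
      then have "norm (u t) \<le> sqrt 4 * exp (- (k * t) / 2) * (norm (v 0) / r + norm (u 0) + norm (w 0) / r ^ 3 / sm)"
        by (rule sq_bound_imp_bound) (use rp sm in auto)
      also have "\<dots> \<le> 2 * exp (- (c * t)) * (R * S + S + ((R + 1 / r0 + \<delta> * R) * S) / sm)"
      proof (intro mult_mono add_mono divide_right_mono)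
        have "norm (v 0) / r = r * A1" unfolding init a using rp by (simp add: power2_eq_square)
        also have "\<dots> \<le> R * S" using rR AS A rp by (intro mult_mono) auto
        finally show "norm (v 0) / r \<le> R * S" .
        show "norm (u 0) \<le> S" using AS by (simp add: init a)
        have "norm (w 0) / r ^ 3 \<le> (r ^ 4 * A2 + r\<^sup>2 * A0 + \<delta> * r ^ 4 * A1) / r ^ 3"
          using w0 rp by (intro divide_right_mono) auto
        also have "\<dots> = r * A2 + (1 / r) * A0 + (\<delta> * r) * A1"
          using rp by (simp add: add_divide_distrib power2_eq_square numeral_eq_Suc)
        also have "\<dots> \<le> R * S + (1 / r0) * S + (\<delta> * R) * S"
          using rR r AS A rp pos r0p by (intro add_mono mult_mono divide_left_mono) auto
        finally show "norm (w 0) / r ^ 3 \<le> (R + 1 / r0 + \<delta> * R) * S" by (simp add: algebra_simps)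
      qed (use dec rp sm R1 AS in \<open>auto intro!: add_nonneg_nonneg\<close>)
      also have "\<dots> = C2 * (exp (- (c * t)) * S)" by (simp add: C2_def algebra_simps add_divide_distrib)
      also have "\<dots> \<le> (C1 + C2) * (exp (- (c * t)) * S)" using Cp AS by (intro mult_right_mono) auto
      finally show ?thesis by (simp add: mult.assoc)
    qed
    also have "\<dots> \<le> C * exp (- (c * t)) * S"
      using AS by (intro mult_right_mono) (auto simp: C_def)
    finally show "norm (u t) \<le> C * exp (- (c * t)) * (norm a0 + norm a1 / r\<^sup>2 + norm a2 / r ^ 4)"
      by (simp add: S_def A0_A1_A2_def)
  qed
qed

section \<open>Radial integrals\<close>

definition sphere_area :: "'a::euclidean_space itself \<Rightarrow> real" where
  "sphere_area _ = DIM('a) * unit_ball_vol (real DIM('a))"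

lemma sphere_area_pos: "sphere_area TYPE('a::euclidean_space) > 0"
  by (simp add: sphere_area_def)

text \<open>Polar coordinates reduced to volumes of balls: both measures agree and are finite on the
  half-lines \<open>{..a}\<close>, which form an intersection-stable generator.\<close>

lemma distr_norm_lborel:
  "distr lborel borel (norm :: 'a::euclidean_space \<Rightarrow> real)
    = density lborel (\<lambda>r. ennreal (sphere_area TYPE('a) * r ^ (DIM('a) - 1)) * indicator {0..} r)"
proof (rule measure_eqI_generator_eq[where E = "range (\<lambda>a::real. {..a})" and \<Omega> = UNIV and A = "\<lambda>i. {..real i}"])
  let ?n = "DIM('a)" and ?w = "unit_ball_vol (real DIM('a))"
  let ?D = "density lborel (\<lambda>r. ennreal (sphere_area TYPE('a) * r ^ (DIM('a) - 1)) * indicator {0..} r)"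
  show "Int_stable (range (\<lambda>a::real. {..a}))"
    by (auto simp: Int_stable_def)
  show "sets (distr lborel borel (norm :: 'a \<Rightarrow> real)) = sigma_sets UNIV (range (\<lambda>a::real. {..a}))"
    "sets ?D = sigma_sets UNIV (range (\<lambda>a::real. {..a}))"
    by (simp_all add: borel_eq_atMost)
  show "(\<Union>i. {..real i}) = UNIV" by (auto intro: real_arch_simple)
  have dl: "emeasure (distr lborel borel (norm :: 'a \<Rightarrow> real)) {..a} = ennreal (if a \<ge> 0 then ?w * a ^ ?n else 0)" for a
  proof -
    have "emeasure (distr lborel borel (norm :: 'a \<Rightarrow> real)) {..a} = emeasure lborel (cball (0::'a) a)"
      by (subst emeasure_distr) (auto intro!: arg_cong2[where f=emeasure] simp: cball_def)
    also have "\<dots> = ennreal (if a \<ge> 0 then ?w * a ^ ?n else 0)"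
      by (auto simp: emeasure_cball)
    finally show ?thesis .
  qed
  show "emeasure (distr lborel borel (norm :: 'a \<Rightarrow> real)) {..real i} \<noteq> \<infinity>" for i
    unfolding dl by simp
  fix X :: "real set" assume "X \<in> range (\<lambda>a::real. {..a})"
  then obtain a where X: "X = {..a}" by auto
  have "emeasure ?D {..a} = (\<integral>\<^sup>+r. ennreal (sphere_area TYPE('a) * r ^ (?n - 1)) * indicator {0..} r * indicator {..a} r \<partial>lborel)"
    by (subst emeasure_density) auto
  also have "\<dots> = (\<integral>\<^sup>+r. ennreal (sphere_area TYPE('a) * r ^ (?n - 1)) * indicator {0..a} r \<partial>lborel)"
    by (intro nn_integral_cong) (auto split: split_indicator)
  also have "\<dots> = ennreal (if a \<ge> 0 then ?w * a ^ ?n else 0)"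
  proof (cases "a \<ge> 0")
    case True
    have "(\<integral>\<^sup>+r. ennreal (sphere_area TYPE('a) * r ^ (?n - 1)) * indicator {0..a} r \<partial>lborel) = ennreal (?w * a ^ ?n - ?w * 0 ^ ?n)"
      using True
      by (intro nn_integral_FTC_Icc)
         (auto intro!: derivative_eq_intros simp: sphere_area_def)
    then show ?thesis using True by simp
  next
    case False
    then show ?thesis by simp
  qed
  finally show "emeasure (distr lborel borel (norm :: 'a \<Rightarrow> real)) X = emeasure ?D X"
    unfolding X dl by simp
qed auto

lemma nn_integral_radial:
  fixes F :: "real \<Rightarrow> ennreal"
  assumes [measurable]: "F \<in> borel_measurable borel"
  shows "(\<integral>\<^sup>+\<xi>. F (norm (\<xi>::'a::euclidean_space)) \<partial>lborel)
    = (\<integral>\<^sup>+r. ennreal (sphere_area TYPE('a) * r ^ (DIM('a) - 1)) * indicator {0..} r * F r \<partial>lborel)"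
proof -
  have "(\<integral>\<^sup>+\<xi>. F (norm (\<xi>::'a)) \<partial>lborel) = (\<integral>\<^sup>+r. F r \<partial>distr lborel borel (norm :: 'a \<Rightarrow> real))"
    by (subst nn_integral_distr) auto
  also have "\<dots> = (\<integral>\<^sup>+r. ennreal (sphere_area TYPE('a) * r ^ (DIM('a) - 1)) * indicator {0..} r * F r \<partial>lborel)"
    unfolding distr_norm_lborel by (subst nn_integral_density) auto
  finally show ?thesis .
qed

lemma nn_integral_inverse_power_ball:
  assumes p: "p < DIM('a::euclidean_space)" and a: "a \<ge> 0"
  shows "(\<integral>\<^sup>+\<xi>. ennreal (1 / norm (\<xi>::'a) ^ p) * indicator {..a} (norm \<xi>) \<partial>lborel)
    \<le> ennreal (sphere_area TYPE('a) * a ^ (DIM('a) - p))"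
proof -
  let ?n = "DIM('a)" and ?A = "sphere_area TYPE('a)"
  have A: "?A > 0" by (rule sphere_area_pos)
  define k where "k = ?n - p"
  have k: "k > 0" "?n - 1 = (k - 1) + p" using p by (auto simp: k_def)
  have "(\<integral>\<^sup>+\<xi>. ennreal (1 / norm (\<xi>::'a) ^ p) * indicator {..a} (norm \<xi>) \<partial>lborel)
    = (\<integral>\<^sup>+r. ennreal (?A * r ^ (?n - 1)) * indicator {0..} r * (ennreal (1 / r ^ p) * indicator {..a} r) \<partial>lborel)"
    by (rule nn_integral_radial) measurable
  also have "\<dots> \<le> (\<integral>\<^sup>+r. ennreal (?A * r ^ (k - 1)) * indicator {0..a} r \<partial>lborel)"
  proof (rule nn_integral_mono)
    fix r :: real
    have "ennreal (?A * r ^ (?n - 1)) * ennreal (1 / r ^ p) \<le> ennreal (?A * r ^ (k - 1))" if "r \<ge> 0"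
    proof -
      have "ennreal (?A * r ^ (?n - 1)) * ennreal (1 / r ^ p) = ennreal (?A * r ^ (?n - 1) * (1 / r ^ p))"
        using that A by (intro ennreal_mult[symmetric]) auto
      also have "\<dots> \<le> ennreal (?A * r ^ (k - 1))"
      proof (rule ennreal_leI)
        have "r ^ (?n - 1) * (1 / r ^ p) \<le> r ^ (k - 1)"
          unfolding k(2) power_add using that by (cases "r = 0") auto
        then show "?A * r ^ (?n - 1) * (1 / r ^ p) \<le> ?A * r ^ (k - 1)"
          using A mult_left_mono[of "r ^ (?n - 1) * (1 / r ^ p)" "r ^ (k - 1)" ?A] by (simp only: mult.assoc less_imp_le)
      qed
      finally show ?thesis .
    qed
    then show "ennreal (?A * r ^ (?n - 1)) * indicator {0..} r * (ennreal (1 / r ^ p) * indicator {..a} r)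
      \<le> ennreal (?A * r ^ (k - 1)) * indicator {0..a} r"
      by (auto split: split_indicator)
  qed
  also have "\<dots> = ennreal (?A / k * a ^ k - ?A / k * 0 ^ k)"
    using a A k by (intro nn_integral_FTC_Icc) (auto intro!: derivative_eq_intros)
  also have "\<dots> \<le> ennreal (?A * a ^ k)"
  proof (rule ennreal_leI)
    have "?A / k * a ^ k \<le> ?A / 1 * a ^ k"
      using A a k by (intro mult_right_mono divide_left_mono) auto
    then show "?A / k * a ^ k - ?A / k * 0 ^ k \<le> ?A * a ^ k" using k(1) by (simp add: zero_power)
  qed
  finally show ?thesis by (simp add: k_def)
qed

lemma nn_integral_inverse_power_outside:
  assumes q: "q > DIM('a::euclidean_space)" and a: "a > 0"
  shows "(\<integral>\<^sup>+\<xi>. ennreal (1 / norm (\<xi>::'a) ^ q) * indicator {a..} (norm \<xi>) \<partial>lborel)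
    \<le> ennreal (sphere_area TYPE('a) / a ^ (q - DIM('a)))"
proof -
  let ?n = "DIM('a)" and ?A = "sphere_area TYPE('a)"
  have A: "?A > 0" by (rule sphere_area_pos)
  define k where "k = q - ?n"
  have k: "k > 0" "q = (?n - 1) + (k + 1)" using q DIM_positive[where 'a='a] by (auto simp: k_def)
  have "(\<integral>\<^sup>+\<xi>. ennreal (1 / norm (\<xi>::'a) ^ q) * indicator {a..} (norm \<xi>) \<partial>lborel)
    = (\<integral>\<^sup>+r. ennreal (?A * r ^ (?n - 1)) * indicator {0..} r * (ennreal (1 / r ^ q) * indicator {a..} r) \<partial>lborel)"
    by (rule nn_integral_radial) measurable
  also have "\<dots> = (\<integral>\<^sup>+r. ennreal (?A / r ^ (k + 1)) * indicator {a..} r \<partial>lborel)"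
  proof (rule nn_integral_cong)
    fix r :: real
    have "ennreal (?A * r ^ (?n - 1)) * ennreal (1 / r ^ q) = ennreal (?A / r ^ (k + 1))" if "r \<ge> a"
    proof -
      have "ennreal (?A * r ^ (?n - 1)) * ennreal (1 / r ^ q) = ennreal (?A * r ^ (?n - 1) * (1 / r ^ q))"
        using that a A by (intro ennreal_mult[symmetric]) auto
      also have "?A * r ^ (?n - 1) * (1 / r ^ q) = ?A / r ^ (k + 1)"
        unfolding k(2) power_add using that a by simp
      finally show ?thesis .
    qed
    then show "ennreal (?A * r ^ (?n - 1)) * indicator {0..} r * (ennreal (1 / r ^ q) * indicator {a..} r)
      = ennreal (?A / r ^ (k + 1)) * indicator {a..} r"
      using a by (auto split: split_indicator)
  qed
  also have "\<dots> = ennreal (0 - (- (?A / k) / a ^ k))"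
  proof (rule nn_integral_FTC_atLeast)
    show "(\<lambda>r. ?A / r ^ (k + 1)) \<in> borel_measurable borel" by measurable
    fix r assume r: "a \<le> r"
    then show "0 \<le> ?A / r ^ (k + 1)" using A a by simp
    have "((\<lambda>r. - (?A / k) / r ^ k) has_real_derivative (0 * r ^ k - - (?A / k) * (real k * r ^ (k - 1))) / (r ^ k * r ^ k)) (at r)"
      using r a by (auto intro!: derivative_eq_intros)
    also have "(0 * r ^ k - - (?A / k) * (real k * r ^ (k - 1))) / (r ^ k * r ^ k) = ?A / r ^ (k + 1)"
    proof -
      have rk: "r ^ k = r ^ (k - 1) * r" using k(1) by (cases k) auto
      have "(0 * (X * r) - - (?A / k) * (real k * X)) / (X * r * (X * r)) = ?A / (X * r * r)" if "X > 0" for X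
        using that r a k(1) by (simp add: divide_simps)
      from this[of "r ^ (k - 1)"] show ?thesis using r a by (simp add: rk)
    qed
    finally show "((\<lambda>r. - (?A / k) / r ^ k) has_real_derivative ?A / r ^ (k + 1)) (at r)" .
  next
    have "((\<lambda>r. (- (?A / k)) * inverse (r ^ k)) \<longlongrightarrow> (- (?A / k)) * 0) at_top"
      using k(1) by (intro tendsto_mult tendsto_const tendsto_inverse_0_at_top filterlim_pow_at_top filterlim_ident)
    then show "((\<lambda>r. - (?A / k) / r ^ k) \<longlongrightarrow> 0) at_top" by (simp add: divide_inverse)
  qed
  also have "\<dots> \<le> ennreal (?A / a ^ k)"
  proof (rule ennreal_leI)
    have "?A / k / a ^ k \<le> ?A / 1 / a ^ k"
      using A a k by (intro divide_right_mono divide_left_mono) auto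
    then show "0 - (- (?A / k) / a ^ k) \<le> ?A / a ^ k" by simp
  qed
  finally show ?thesis by (simp add: k_def)
qed

text \<open>The scale-invariant power, for which every dyadic shell contributes equally: the origin
  of the logarithm in dimension four.\<close>

lemma nn_integral_inverse_power_annulus:
  assumes a: "0 < a" "a \<le> b"
  shows "(\<integral>\<^sup>+\<xi>. ennreal (1 / norm (\<xi>::'a::euclidean_space) ^ DIM('a)) * indicator {a..b} (norm \<xi>) \<partial>lborel)
    = ennreal (sphere_area TYPE('a) * (ln b - ln a))"
proof -
  let ?n = "DIM('a)" and ?A = "sphere_area TYPE('a)"
  have A: "?A > 0" by (rule sphere_area_pos)
  have n: "?n = (?n - 1) + 1" using DIM_positive[where 'a='a] by simp
  have "(\<integral>\<^sup>+\<xi>. ennreal (1 / norm (\<xi>::'a) ^ ?n) * indicator {a..b} (norm \<xi>) \<partial>lborel)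
    = (\<integral>\<^sup>+r. ennreal (?A * r ^ (?n - 1)) * indicator {0..} r * (ennreal (1 / r ^ ?n) * indicator {a..b} r) \<partial>lborel)"
    by (rule nn_integral_radial) measurable
  also have "\<dots> = (\<integral>\<^sup>+r. ennreal (?A / r) * indicator {a..b} r \<partial>lborel)"
  proof (rule nn_integral_cong)
    fix r :: real
    have "ennreal (?A * r ^ (?n - 1)) * ennreal (1 / r ^ ?n) = ennreal (?A / r)" if "r \<ge> a"
    proof -
      have "ennreal (?A * r ^ (?n - 1)) * ennreal (1 / r ^ ?n) = ennreal (?A * r ^ (?n - 1) * (1 / r ^ ?n))"
        using that a A by (intro ennreal_mult[symmetric]) auto
      also have "?A * r ^ (?n - 1) * (1 / r ^ ?n) = ?A / r"
      proof -
        have "r ^ ?n = r ^ (?n - 1) * r" by (metis n power_add power_one_right)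
        then show ?thesis using that a by simp
      qed
      finally show ?thesis .
    qed
    then show "ennreal (?A * r ^ (?n - 1)) * indicator {0..} r * (ennreal (1 / r ^ ?n) * indicator {a..b} r)
      = ennreal (?A / r) * indicator {a..b} r"
      using a by (auto split: split_indicator)
  qed
  also have "\<dots> = ennreal (?A * ln b - ?A * ln a)"
    using a A by (intro nn_integral_FTC_Icc) (auto intro!: derivative_eq_intros)
  finally show ?thesis by (simp add: right_diff_distrib)
qed

lemma emeasure_annulus_ge:
  assumes "0 \<le> a" "a \<le> b"
  shows "emeasure lborel {\<xi>::'a::euclidean_space. norm \<xi> \<in> {a..b}}
    \<ge> ennreal (unit_ball_vol (real DIM('a)) * (b ^ DIM('a) - a ^ DIM('a)))"
proof -
  let ?n = "DIM('a)" and ?w = "unit_ball_vol (real DIM('a))"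
  have "cball 0 b = ball 0 a \<union> {\<xi>::'a. norm \<xi> \<in> {a..b}}" using assms by auto
  then have "emeasure lborel (cball (0::'a) b) \<le> emeasure lborel (ball (0::'a) a) + emeasure lborel {\<xi>::'a. norm \<xi> \<in> {a..b}}"
    by (simp only:) (intro emeasure_subadditive, auto)
  then have "ennreal (?w * b ^ ?n) \<le> ennreal (?w * a ^ ?n) + emeasure lborel {\<xi>::'a. norm \<xi> \<in> {a..b}}"
    using assms by (simp add: emeasure_cball emeasure_ball)
  then have "ennreal (?w * b ^ ?n) - ennreal (?w * a ^ ?n) \<le> emeasure lborel {\<xi>::'a. norm \<xi> \<in> {a..b}}"
    by (simp add: ennreal_minus_le_iff)
  then show ?thesis using assms by (simp add: ennreal_minus right_diff_distrib)
qed

text \<open>Trades exponential decay for an inverse power of any order N, so that all integrals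
  reduce to powers of the radius. It is the N-th power of x / N \<le> exp (x / N); for N = 0 the
  right-hand side is 1.\<close>

lemma exp_minus_le_power:
  assumes "x > 0"
  shows "exp (- x) \<le> (real N / x) ^ N"
proof (cases "N = 0")
  case False
  have "x / real N \<le> exp (x / real N)" using exp_ge_add_one_self[of "x / real N"] by linarith
  then have "(x / real N) ^ N \<le> exp (x / real N) ^ N" using assms by (intro power_mono) auto
  also have "\<dots> = exp x" using False by (simp flip: exp_of_nat_mult)
  finally have "inverse (exp x) \<le> inverse ((x / real N) ^ N)"
    using assms False by (intro le_imp_inverse_le) auto
  then show ?thesis by (simp add: exp_minus power_inverse[symmetric])
qed (use assms in simp)

section \<open>The size of the profile\<close>

text \<open>Inserting 1 and the cosine writes \<open>r\<^sup>2 * prof\<close> as a sum of three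
  differences, each vanishing to order r^2, which compensates the factor 1 / r^2.\<close>

lemma prof_le_polynomial:
  assumes r: "r > 0" and t: "t \<ge> 0" and pos: "\<kappa> > 0" "\<delta> > 0"
  shows "\<bar>prof \<kappa> \<delta> t r\<bar> \<le> \<kappa> * t + t\<^sup>2 / 2 + \<delta> / 2 * t"
proof -
  define e1 where "e1 = exp (- \<kappa> * r\<^sup>2 * t)"
  define e2 where "e2 = exp (- (\<delta> / 2) * r\<^sup>2 * t)"
  have rt: "0 \<le> r\<^sup>2 * t" using t by simp
  have e1: "1 - \<kappa> * (r\<^sup>2 * t) \<le> e1" "e1 \<le> 1"
    using exp_ge_add_one_self[of "- \<kappa> * r\<^sup>2 * t"] pos rt by (auto simp: e1_def mult.assoc)
  have e2: "1 - \<delta> / 2 * (r\<^sup>2 * t) \<le> e2" "e2 \<le> 1"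
    using exp_ge_add_one_self[of "- (\<delta> / 2) * r\<^sup>2 * t"] pos rt by (auto simp: e2_def mult.assoc)
  have c: "0 \<le> 1 - cos (r * t)" "1 - cos (r * t) \<le> (r * t)\<^sup>2 / 2"
  proof -
    have "cos (r * t) = 1 - 2 * (sin (r * t / 2))\<^sup>2" using cos_double_sin[of "r * t / 2"] by simp
    moreover have "(sin (r * t / 2))\<^sup>2 \<le> (r * t / 2)\<^sup>2"
      using abs_sin_x_le_abs_x[of "r * t / 2"] by (intro abs_le_square_iff[THEN iffD1])
    ultimately show "1 - cos (r * t) \<le> (r * t)\<^sup>2 / 2" by (simp add: power_divide)
  qed simp
  have "\<bar>cos (r * t) * (1 - e2)\<bar> \<le> 1 * (\<delta> / 2 * (r\<^sup>2 * t))"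
    unfolding abs_mult using e2 by (intro mult_mono) auto
  then have "\<bar>(e1 - 1) + (1 - cos (r * t)) + cos (r * t) * (1 - e2)\<bar>
      \<le> \<kappa> * (r\<^sup>2 * t) + (r * t)\<^sup>2 / 2 + \<delta> / 2 * (r\<^sup>2 * t)"
    using e1 c by linarith
  also have "(e1 - 1) + (1 - cos (r * t)) + cos (r * t) * (1 - e2) = r\<^sup>2 * prof \<kappa> \<delta> t r"
    using r by (simp add: prof_def e1_def e2_def algebra_simps)
  also have "\<kappa> * (r\<^sup>2 * t) + (r * t)\<^sup>2 / 2 + \<delta> / 2 * (r\<^sup>2 * t) = r\<^sup>2 * (\<kappa> * t + t\<^sup>2 / 2 + \<delta> / 2 * t)"
    by (simp add: algebra_simps power2_eq_square)
  finally show ?thesis using r by (simp add: abs_mult)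
qed

lemma prof_le_t2:
  assumes r: "r > 0" and t: "t \<ge> 1" and pos: "\<kappa> > 0" "\<delta> > 0"
  shows "\<bar>prof \<kappa> \<delta> t r\<bar> \<le> (1 / 2 + \<kappa> + \<delta> / 2) * t\<^sup>2"
proof -
  have "\<bar>prof \<kappa> \<delta> t r\<bar> \<le> \<kappa> * t + t\<^sup>2 / 2 + \<delta> / 2 * t"
    using assms by (intro prof_le_polynomial) auto
  also have "\<dots> \<le> \<kappa> * t\<^sup>2 + t\<^sup>2 / 2 + \<delta> / 2 * t\<^sup>2"
    using t pos by (intro add_mono mult_left_mono order_refl) (auto simp: power2_eq_square)
  also have "\<dots> = (1 / 2 + \<kappa> + \<delta> / 2) * t\<^sup>2" by (simp add: algebra_simps)
  finally show ?thesis .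
qed

lemma prof_le_exp:
  assumes r: "r > 0" and t: "t \<ge> 0" and kd: "\<kappa> \<le> \<delta> / 2"
  shows "\<bar>prof \<kappa> \<delta> t r\<bar> \<le> 2 / r\<^sup>2 * exp (- (\<kappa> * r\<^sup>2 * t))"
proof -
  have "\<kappa> * (r\<^sup>2 * t) \<le> \<delta> / 2 * (r\<^sup>2 * t)" using kd t by (intro mult_right_mono) auto
  then have e: "exp (- (\<delta> / 2) * r\<^sup>2 * t) \<le> exp (- (\<kappa> * r\<^sup>2 * t))" by (simp add: mult.assoc)
  have "\<bar>cos (r * t) * exp (- (\<delta> / 2) * r\<^sup>2 * t)\<bar> \<le> 1 * exp (- (\<kappa> * r\<^sup>2 * t))"
    unfolding abs_mult using e by (intro mult_mono) auto
  then have "\<bar>exp (- \<kappa> * r\<^sup>2 * t) - cos (r * t) * exp (- (\<delta> / 2) * r\<^sup>2 * t)\<bar> \<le> 2 * exp (- (\<kappa> * r\<^sup>2 * t))"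
    using abs_triangle_ineq4[of "exp (- \<kappa> * r\<^sup>2 * t)" "cos (r * t) * exp (- (\<delta> / 2) * r\<^sup>2 * t)"] by simp
  then have "1 / r\<^sup>2 * \<bar>exp (- \<kappa> * r\<^sup>2 * t) - cos (r * t) * exp (- (\<delta> / 2) * r\<^sup>2 * t)\<bar> \<le> 1 / r\<^sup>2 * (2 * exp (- (\<kappa> * r\<^sup>2 * t)))"
    by (intro mult_left_mono) auto
  then show ?thesis unfolding prof_def abs_mult by simp
qed

text \<open>N = 0 gives the bare 1 / r^4 for moderate r; a larger N supplies integrability at
  infinity together with powers of 1 / t.\<close>

lemma prof_sq_le_power:
  assumes r: "r > 0" and t: "t > 0" and kd: "\<kappa> \<le> \<delta> / 2" and k: "\<kappa> > 0"
  shows "(prof \<kappa> \<delta> t r)\<^sup>2 \<le> 4 * (real N / (2 * \<kappa> * t)) ^ N * (1 / r ^ (4 + 2 * N))"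
proof -
  have "(prof \<kappa> \<delta> t r)\<^sup>2 \<le> (2 / r\<^sup>2 * exp (- (\<kappa> * r\<^sup>2 * t)))\<^sup>2"
    using prof_le_exp[OF r _ kd, of t] t by (intro abs_le_square_iff[THEN iffD1]) auto
  also have "\<dots> = 4 * (1 / r ^ 4) * exp (- (2 * \<kappa> * t * r\<^sup>2))"
    by (simp add: power_mult_distrib power_divide power2_eq_square[of "exp _"] exp_add[symmetric] algebra_simps flip: power_mult)
  also have "\<dots> \<le> 4 * (1 / r ^ 4) * (real N / (2 * \<kappa> * t * r\<^sup>2)) ^ N"
    using r t k by (intro mult_left_mono exp_minus_le_power) auto
  also have "(real N / (2 * \<kappa> * t * r\<^sup>2)) ^ N = (real N / (2 * \<kappa> * t)) ^ N * (1 / r ^ (2 * N))"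
    by (simp add: power_mult_distrib power_divide power_mult)
  also have "4 * (1 / r ^ 4) * ((real N / (2 * \<kappa> * t)) ^ N * (1 / r ^ (2 * N))) = 4 * (real N / (2 * \<kappa> * t)) ^ N * (1 / r ^ (4 + 2 * N))"
    by (simp only: power_add) simp
  finally show ?thesis .
qed

lemma borel_measurable_prof [measurable]: "prof \<kappa> \<delta> t \<in> borel_measurable borel"
  unfolding prof_def[abs_def] by measurable

text \<open>Natural powers match the output of the polar integrals; for n > 4 the base 1 / sqrt t is
  the radius at which those integrals are cut.\<close>

lemma rate_sq:
  assumes "t > 1"
  shows "(rate n t)\<^sup>2 = (if n \<le> 3 then t ^ (4 - n) else if n = 4 then ln t else (1 / sqrt t) ^ (n - 4))"
proof -
  have t: "t > 0" "ln t > 0" using assms by auto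
  have sq: "(x powr a)\<^sup>2 = x powr (2 * a)" if "x > 0" for x a :: real
    using that by (simp add: power2_eq_square powr_add[symmetric])
  have 1: "t powr (2 * (2 - real n / 2)) = t ^ (4 - n)" if "n \<le> 3"
  proof -
    have "2 * (2 - real n / 2) = real (4 - n)" using that by simp
    then show ?thesis using t by (simp only: powr_realpow)
  qed
  have 2: "t powr (2 * (1 - real n / 4)) = (1 / sqrt t) ^ (n - 4)" if "n > 4"
  proof -
    have "1 / sqrt t = t powr (- (1 / 2))" using t by (simp add: powr_half_sqrt[symmetric] powr_minus_divide)
    then have "(1 / sqrt t) ^ (n - 4) = (t powr (- (1 / 2))) powr real (n - 4)"
      using t by (simp only: powr_realpow[symmetric] powr_gt_zero)
    also have "\<dots> = t powr (- (1 / 2) * real (n - 4))" by (simp add: powr_powr)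
    also have "- (1 / 2) * real (n - 4) = 2 * (1 - real n / 4)" using that by (simp add: field_simps)
    finally show ?thesis by simp
  qed
  show ?thesis
    unfolding rate_def using t 1 2 by (auto simp: sq)
qed

lemma rate_nonneg: "0 \<le> rate n t"
  by (simp add: rate_def)

text \<open>The source of the threshold 3 in the estimates: ln t is at least 1, so dividing a
  nonnegative quantity by it never increases it.\<close>

lemma ln_ge_1: "t \<ge> 3 \<Longrightarrow> ln t \<ge> (1::real)"
  using exp_le ln_ge_iff[of t 1] by auto

lemma ln_le_self: "t \<ge> 3 \<Longrightarrow> ln t \<le> (t::real)"
  using ln_le_minus_one[of t] by simp

lemma inverse_sqrt_power_sq: "t > 0 \<Longrightarrow> (1 / sqrt t) ^ (2 * k) = (1 / t) ^ k"
  by (simp add: power_mult power_divide)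

text \<open>Frequencies away from zero will contribute at most a multiple of t^(-n); this places
  them below the squared rate with a logarithm to spare.\<close>

lemma power_le_rate_sq:
  assumes t: "t \<ge> 3"
  shows "1 / t ^ n \<le> (rate n t)\<^sup>2 / ln t"
proof -
  have l: "ln t \<ge> 1" "ln t \<le> t" using ln_ge_1 ln_le_self t by auto
  have "ln t / t ^ n \<le> (rate n t)\<^sup>2"
  proof (cases "n \<le> 3")
    case True
    have "ln t / t ^ n \<le> t / 1" using l t by (intro frac_le) auto
    also have "\<dots> \<le> t ^ (4 - n)" using True t power_increasing[of 1 "4 - n" t] by simp
    finally show ?thesis using True t by (simp add: rate_sq)
  next
    case False
    show ?thesis
    proof (cases "n = 4")
      case True
      have "ln t / t ^ n \<le> ln t / 1" using l t by (intro divide_left_mono) auto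
      then show ?thesis using True t by (simp add: rate_sq)
    next
      case n4: False
      have "ln t / t ^ n \<le> t / t ^ n" using l t by (intro divide_right_mono) auto
      also have "\<dots> = (1 / t) ^ (n - 1)" using t False by (simp add: power_divide power_diff)
      also have "\<dots> = (1 / sqrt t) ^ (2 * (n - 1))" using t by (simp only: inverse_sqrt_power_sq)
      also have "\<dots> \<le> (1 / sqrt t) ^ (n - 4)"
        using t by (intro power_decreasing) auto
      finally show ?thesis using False n4 t by (simp add: rate_sq)
    qed
  qed
  then have "ln t / t ^ n / ln t \<le> (rate n t)\<^sup>2 / ln t" using l by (intro divide_right_mono) auto
  then show ?thesis using l t by (simp split: if_splits)
qed

lemma AE_norm_pos: "AE \<xi> in lborel. norm (\<xi>::'a::euclidean_space) > 0"
  using AE_lborel_singleton[of "0::'a"] by eventually_elim simp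

section \<open>Comparison of radial integrals with powers\<close>

lemma nn_integral_ball_le:
  assumes p: "p < DIM('a::euclidean_space)" and a: "a \<ge> 0" and C: "C \<ge> 0"
    and g: "\<And>r. 0 < r \<Longrightarrow> r \<le> a \<Longrightarrow> g r \<le> C * (1 / r ^ p)"
  shows "(\<integral>\<^sup>+\<xi>. ennreal (g (norm (\<xi>::'a))) * indicator {..a} (norm \<xi>) \<partial>lborel)
    \<le> ennreal (C * (sphere_area TYPE('a) * a ^ (DIM('a) - p)))"
proof -
  have "(\<integral>\<^sup>+\<xi>. ennreal (g (norm (\<xi>::'a))) * indicator {..a} (norm \<xi>) \<partial>lborel)
    \<le> (\<integral>\<^sup>+\<xi>. ennreal C * (ennreal (1 / norm (\<xi>::'a) ^ p) * indicator {..a} (norm \<xi>)) \<partial>lborel)"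
  proof (rule nn_integral_mono_AE, use AE_norm_pos in eventually_elim)
    case (elim \<xi>)
    show ?case using g[OF elim] C
      by (auto simp: ennreal_mult[symmetric] split: split_indicator intro!: ennreal_leI)
  qed
  also have "\<dots> = ennreal C * (\<integral>\<^sup>+\<xi>. ennreal (1 / norm (\<xi>::'a) ^ p) * indicator {..a} (norm \<xi>) \<partial>lborel)"
    by (rule nn_integral_cmult) measurable
  also have "\<dots> \<le> ennreal C * ennreal (sphere_area TYPE('a) * a ^ (DIM('a) - p))"
    by (intro mult_left_mono nn_integral_inverse_power_ball p a) auto
  also have "\<dots> = ennreal (C * (sphere_area TYPE('a) * a ^ (DIM('a) - p)))"
    using C a sphere_area_pos[where 'a='a] by (intro ennreal_mult[symmetric]) auto
  finally show ?thesis .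
qed

lemma nn_integral_outside_le:
  assumes q: "q > DIM('a::euclidean_space)" and a: "a > 0" and C: "C \<ge> 0"
    and g: "\<And>r. a \<le> r \<Longrightarrow> g r \<le> C * (1 / r ^ q)"
  shows "(\<integral>\<^sup>+\<xi>. ennreal (g (norm (\<xi>::'a))) * indicator {a..} (norm \<xi>) \<partial>lborel)
    \<le> ennreal (C * (sphere_area TYPE('a) / a ^ (q - DIM('a))))"
proof -
  have "(\<integral>\<^sup>+\<xi>. ennreal (g (norm (\<xi>::'a))) * indicator {a..} (norm \<xi>) \<partial>lborel)
    \<le> (\<integral>\<^sup>+\<xi>. ennreal C * (ennreal (1 / norm (\<xi>::'a) ^ q) * indicator {a..} (norm \<xi>)) \<partial>lborel)"
    by (rule nn_integral_mono)
       (use g C in \<open>auto simp: ennreal_mult[symmetric] split: split_indicator intro!: ennreal_leI\<close>)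
  also have "\<dots> = ennreal C * (\<integral>\<^sup>+\<xi>. ennreal (1 / norm (\<xi>::'a) ^ q) * indicator {a..} (norm \<xi>) \<partial>lborel)"
    by (rule nn_integral_cmult) measurable
  also have "\<dots> \<le> ennreal C * ennreal (sphere_area TYPE('a) / a ^ (q - DIM('a)))"
    by (intro mult_left_mono nn_integral_inverse_power_outside q a) auto
  also have "\<dots> = ennreal (C * (sphere_area TYPE('a) / a ^ (q - DIM('a))))"
    using C a sphere_area_pos[where 'a='a] by (intro ennreal_mult[symmetric]) auto
  finally show ?thesis .
qed

lemma nn_integral_annulus_le:
  assumes a: "0 < a" "a \<le> b" and C: "C \<ge> 0"
    and g: "\<And>r. a \<le> r \<Longrightarrow> r \<le> b \<Longrightarrow> g r \<le> C * (1 / r ^ DIM('a::euclidean_space))"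
  shows "(\<integral>\<^sup>+\<xi>. ennreal (g (norm (\<xi>::'a))) * indicator {a..b} (norm \<xi>) \<partial>lborel)
    \<le> ennreal (C * (sphere_area TYPE('a) * (ln b - ln a)))"
proof -
  have "(\<integral>\<^sup>+\<xi>. ennreal (g (norm (\<xi>::'a))) * indicator {a..b} (norm \<xi>) \<partial>lborel)
    \<le> (\<integral>\<^sup>+\<xi>. ennreal C * (ennreal (1 / norm (\<xi>::'a) ^ DIM('a)) * indicator {a..b} (norm \<xi>)) \<partial>lborel)"
    by (rule nn_integral_mono)
       (use g C in \<open>auto simp: ennreal_mult[symmetric] split: split_indicator intro!: ennreal_leI\<close>)
  also have "\<dots> = ennreal C * (\<integral>\<^sup>+\<xi>. ennreal (1 / norm (\<xi>::'a) ^ DIM('a)) * indicator {a..b} (norm \<xi>) \<partial>lborel)"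
    by (rule nn_integral_cmult) measurable
  also have "\<dots> = ennreal C * ennreal (sphere_area TYPE('a) * (ln b - ln a))"
    by (simp only: nn_integral_inverse_power_annulus[OF a])
  also have "\<dots> = ennreal (C * (sphere_area TYPE('a) * (ln b - ln a)))"
    using C a sphere_area_pos[where 'a='a] by (intro ennreal_mult[symmetric]) auto
  finally show ?thesis .
qed

lemma nn_integral_split_norm:
  assumes [measurable]: "g \<in> borel_measurable borel" "A \<in> sets borel" "B \<in> sets borel" and "S \<subseteq> A \<union> B"
  shows "(\<integral>\<^sup>+\<xi>. ennreal (g (norm (\<xi>::'a::euclidean_space))) * indicator S (norm \<xi>) \<partial>lborel)
    \<le> (\<integral>\<^sup>+\<xi>. ennreal (g (norm (\<xi>::'a))) * indicator A (norm \<xi>) \<partial>lborel)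
      + (\<integral>\<^sup>+\<xi>. ennreal (g (norm (\<xi>::'a))) * indicator B (norm \<xi>) \<partial>lborel)"
proof -
  have "(\<integral>\<^sup>+\<xi>. ennreal (g (norm (\<xi>::'a))) * indicator S (norm \<xi>) \<partial>lborel)
    \<le> (\<integral>\<^sup>+\<xi>. ennreal (g (norm (\<xi>::'a))) * indicator A (norm \<xi>) + ennreal (g (norm (\<xi>::'a))) * indicator B (norm \<xi>) \<partial>lborel)"
    by (rule nn_integral_mono) (use assms(4) in \<open>auto split: split_indicator\<close>)
  also have "\<dots> = (\<integral>\<^sup>+\<xi>. ennreal (g (norm (\<xi>::'a))) * indicator A (norm \<xi>) \<partial>lborel)
      + (\<integral>\<^sup>+\<xi>. ennreal (g (norm (\<xi>::'a))) * indicator B (norm \<xi>) \<partial>lborel)"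
    by (rule nn_integral_add) measurable
  finally show ?thesis .
qed

section \<open>Upper bounds for the profile and for the low-frequency error\<close>

lemma nn_integral_prof_tail:
  assumes k: "\<kappa> > 0" "\<kappa> \<le> \<delta> / 2" and \<eta>: "\<eta> > 0"
  obtains C where "C \<ge> 0" "\<And>t. t \<ge> 3 \<Longrightarrow>
    (\<integral>\<^sup>+\<xi>. ennreal ((prof \<kappa> \<delta> t (norm (\<xi>::'a::euclidean_space)))\<^sup>2) * indicator {\<eta>..} (norm \<xi>) \<partial>lborel)
      \<le> ennreal (C * ((rate DIM('a) t)\<^sup>2 / ln t))"
proof
  let ?n = "DIM('a)" and ?A = "sphere_area TYPE('a)"
  let ?C = "4 * (real ?n / (2 * \<kappa>)) ^ ?n * (?A / \<eta> ^ (4 + 2 * ?n - ?n))"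
  have A: "?A > 0" by (rule sphere_area_pos)
  show "0 \<le> ?C" using A k \<eta> by simp
  fix t :: real assume t: "t \<ge> 3"
  have "(\<integral>\<^sup>+\<xi>. ennreal ((prof \<kappa> \<delta> t (norm (\<xi>::'a)))\<^sup>2) * indicator {\<eta>..} (norm \<xi>) \<partial>lborel)
    \<le> ennreal (4 * (real ?n / (2 * \<kappa> * t)) ^ ?n * (?A / \<eta> ^ (4 + 2 * ?n - ?n)))"
    using t k \<eta> by (intro nn_integral_outside_le prof_sq_le_power) auto
  also have "4 * (real ?n / (2 * \<kappa> * t)) ^ ?n * (?A / \<eta> ^ (4 + 2 * ?n - ?n)) = ?C * (1 / t ^ ?n)"
    by (simp add: power_divide power_mult_distrib)
  also have "ennreal (?C * (1 / t ^ ?n)) \<le> ennreal (?C * ((rate ?n t)\<^sup>2 / ln t))"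
    using A k \<eta> by (intro ennreal_leI mult_left_mono power_le_rate_sq t) auto
  finally show "(\<integral>\<^sup>+\<xi>. ennreal ((prof \<kappa> \<delta> t (norm (\<xi>::'a)))\<^sup>2) * indicator {\<eta>..} (norm \<xi>) \<partial>lborel)
      \<le> ennreal (?C * ((rate ?n t)\<^sup>2 / ln t))" .
qed

text \<open>As long as 1 / r^4 is integrable at infinity, the cut is at 1 / t, where the bounds t^2
  and 1 / r^2 on the symbol balance. Once it is integrable at zero, the cut is at 1 / sqrt t, where
  the exponential sets in. In dimension four it is neither, and an annulus lies in between.\<close>

lemma nn_integral_prof_upper:
  assumes k: "\<kappa> > 0" "\<kappa> \<le> \<delta> / 2"
  obtains C where "C \<ge> 0" "\<And>t. t \<ge> 3 \<Longrightarrow>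
    (\<integral>\<^sup>+\<xi>. ennreal ((prof \<kappa> \<delta> t (norm (\<xi>::'a::euclidean_space)))\<^sup>2) \<partial>lborel)
      \<le> ennreal (C * (rate DIM('a) t)\<^sup>2)"
proof -
  let ?n = "DIM('a)" and ?A = "sphere_area TYPE('a)"
  let ?I = "\<lambda>t S. (\<integral>\<^sup>+\<xi>. ennreal ((prof \<kappa> \<delta> t (norm (\<xi>::'a)))\<^sup>2) * indicator S (norm \<xi>) \<partial>lborel)"
  have A: "?A > 0" by (rule sphere_area_pos)
  have d: "\<delta> > 0" using k by simp
  define c where "c = 1 / 2 + \<kappa> + \<delta> / 2"
  have c: "c > 0" using k d by (simp add: c_def add_pos_pos)
  have low: "(prof \<kappa> \<delta> t r)\<^sup>2 \<le> (c\<^sup>2 * t ^ 4) * (1 / r ^ 0)" if "r > 0" "t \<ge> 3" for r t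
  proof -
    have "(prof \<kappa> \<delta> t r)\<^sup>2 \<le> (c * t\<^sup>2)\<^sup>2"
      using prof_le_t2[of r t \<kappa> \<delta>] that k d c unfolding c_def[symmetric]
      by (intro abs_le_square_iff[THEN iffD1]) auto
    then show ?thesis by (simp add: power_mult_distrib flip: power_mult)
  qed
  have mid: "(prof \<kappa> \<delta> t r)\<^sup>2 \<le> 4 * (1 / r ^ 4)" if "r > 0" "t \<ge> 3" for r t
    using prof_sq_le_power[of r t \<kappa> \<delta> 0] that k by simp
  have all: "(\<integral>\<^sup>+\<xi>. ennreal ((prof \<kappa> \<delta> t (norm (\<xi>::'a)))\<^sup>2) \<partial>lborel) \<le> ?I t {..a} + ?I t {a..}" for t a
  proof -
    have "UNIV \<subseteq> {..a} \<union> {a..}" by auto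
    then show ?thesis
      using nn_integral_split_norm[of "\<lambda>r. (prof \<kappa> \<delta> t r)\<^sup>2" "{..a}" "{a..}" UNIV, where 'a='a] by simp
  qed
  consider "?n \<le> 3" | "?n = 4" | "?n > 4" by linarith
  then show ?thesis
  proof cases
    case 1
    show ?thesis
    proof (rule that[of "c\<^sup>2 * ?A + 4 * ?A"])
      show "0 \<le> c\<^sup>2 * ?A + 4 * ?A" using A by simp
      fix t :: real assume t: "t \<ge> 3"
      have "?I t {..1/t} + ?I t {1/t..} \<le> ennreal ((c\<^sup>2 * t ^ 4) * (?A * (1/t) ^ (?n - 0))) + ennreal (4 * (?A / (1/t) ^ (4 - ?n)))"
        using t 1 by (intro add_mono nn_integral_ball_le nn_integral_outside_le low mid) (auto intro: less_le_trans[of 0 "1 / t"])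
      also have "\<dots> = ennreal ((c\<^sup>2 * t ^ 4) * (?A * (1/t) ^ (?n - 0)) + 4 * (?A / (1/t) ^ (4 - ?n)))"
        using A t by (intro ennreal_plus[symmetric]) auto
      also have "(c\<^sup>2 * t ^ 4) * (?A * (1/t) ^ (?n - 0)) + 4 * (?A / (1/t) ^ (4 - ?n)) = (c\<^sup>2 * ?A + 4 * ?A) * t ^ (4 - ?n)"
      proof -
        have "t ^ 4 * (1 / t) ^ ?n = t ^ (4 - ?n)"
          using t 1 by (simp add: power_divide power_diff)
        moreover have "?A / (1/t) ^ (4 - ?n) = ?A * t ^ (4 - ?n)" by (simp add: power_divide)
        moreover have "(c\<^sup>2 * t ^ 4) * (?A * (1/t) ^ (?n - 0)) = c\<^sup>2 * ?A * (t ^ 4 * (1 / t) ^ ?n)" by simp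
        ultimately show ?thesis by (simp add: distrib_right)
      qed
      finally show "(\<integral>\<^sup>+\<xi>. ennreal ((prof \<kappa> \<delta> t (norm (\<xi>::'a)))\<^sup>2) \<partial>lborel) \<le> ennreal ((c\<^sup>2 * ?A + 4 * ?A) * (rate ?n t)\<^sup>2)"
        using order_trans[OF all] t 1 by (simp add: rate_sq)
    qed
  next
    case 2
    let ?C = "c\<^sup>2 * ?A + 4 * ?A + 4 * (1 / (2 * \<kappa>)) * ?A"
    show ?thesis
    proof (rule that[of ?C])
      show "0 \<le> ?C" using A k by simp
      fix t :: real assume t: "t \<ge> 3"
      have l: "ln t \<ge> 1" by (rule ln_ge_1[OF t])
      have rpos: "0 < r" if "1 / t \<le> r" for r
        using t that by (auto intro: less_le_trans[of 0 "1 / t"])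
      \<comment> \<open>Ending the annulus at 1 instead of 1 / sqrt t costs only a factor two in the
        logarithm; beyond it the choice N = 1 makes the tail integrable.\<close>
      have "?I t {..1/t} + ?I t {1/t..} \<le> ?I t {..1/t} + (?I t {1/t..1} + ?I t {1..})"
        by (intro add_left_mono nn_integral_split_norm) auto
      also have "\<dots> \<le> ennreal ((c\<^sup>2 * t ^ 4) * (?A * (1/t) ^ (?n - 0)))
           + (ennreal (4 * (?A * (ln 1 - ln (1/t)))) + ennreal ((4 * (real 1 / (2 * \<kappa> * t)) ^ 1) * (?A / 1 ^ (4 + 2 * 1 - ?n))))"
        using t 2 k by (intro add_mono nn_integral_ball_le nn_integral_annulus_le nn_integral_outside_le low prof_sq_le_power) (auto simp: mid[simplified] rpos)
      also have "\<dots> = ennreal ((c\<^sup>2 * t ^ 4) * (?A * (1/t) ^ (?n - 0))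
           + (4 * (?A * (ln 1 - ln (1/t))) + (4 * (real 1 / (2 * \<kappa> * t)) ^ 1) * (?A / 1 ^ (4 + 2 * 1 - ?n))))"
        using A t k l by (simp add: ln_div)
      also have "\<dots> \<le> ennreal (?C * ln t)"
      proof (rule ennreal_leI)
        have "(c\<^sup>2 * t ^ 4) * (?A * (1/t) ^ (?n - 0)) = c\<^sup>2 * ?A * 1" using t 2 by (simp add: power_divide)
        also have "\<dots> \<le> c\<^sup>2 * ?A * ln t" using l A by (intro mult_left_mono) auto
        finally have i1: "(c\<^sup>2 * t ^ 4) * (?A * (1/t) ^ (?n - 0)) \<le> c\<^sup>2 * ?A * ln t" .
        have i2: "4 * (?A * (ln 1 - ln (1/t))) = 4 * ?A * ln t" using t by (simp add: ln_div)
        have "1 / (2 * \<kappa> * t) \<le> 1 / (2 * \<kappa>) * ln t"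
        proof -
          have "1 / t \<le> ln t" using t l by (simp add: divide_le_eq mult_mono[of 1 "ln t" 1 t, simplified])
          then have "1 / (2 * \<kappa>) * (1 / t) \<le> 1 / (2 * \<kappa>) * ln t" using k by (intro mult_left_mono) auto
          then show ?thesis by simp
        qed
        then have "(4 * ?A) * (1 / (2 * \<kappa> * t)) \<le> (4 * ?A) * (1 / (2 * \<kappa>) * ln t)" using A by (intro mult_left_mono) auto
        then have i3: "(4 * (real 1 / (2 * \<kappa> * t)) ^ 1) * (?A / 1 ^ (4 + 2 * 1 - ?n)) \<le> 4 * (1 / (2 * \<kappa>)) * ?A * ln t"
          by (simp add: mult_ac)
        show "(c\<^sup>2 * t ^ 4) * (?A * (1/t) ^ (?n - 0)) + (4 * (?A * (ln 1 - ln (1/t))) + (4 * (real 1 / (2 * \<kappa> * t)) ^ 1) * (?A / 1 ^ (4 + 2 * 1 - ?n))) \<le> ?C * ln t"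
          unfolding i2 distrib_right using i1 i3 by linarith
      qed
      finally show "(\<integral>\<^sup>+\<xi>. ennreal ((prof \<kappa> \<delta> t (norm (\<xi>::'a)))\<^sup>2) \<partial>lborel) \<le> ennreal (?C * (rate ?n t)\<^sup>2)"
        using order_trans[OF all] t 2 by (simp add: rate_sq)
    qed
  next
    case 3
    let ?C = "4 * ?A + 4 * (real ?n / (2 * \<kappa>)) ^ ?n * ?A"
    show ?thesis
    proof (rule that[of ?C])
      show "0 \<le> ?C" using A k by simp
      fix t :: real assume t: "t \<ge> 3"
      define a where "a = 1 / sqrt t"
      have a: "a > 0" using t by (simp add: a_def)
      have a2: "1 / t = a\<^sup>2" using t by (simp add: a_def power_divide)
      \<comment> \<open>Since 1 / t is the square of a, the outer part with N = n scales with the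
        same power of a as the inner part.\<close>
      have "?I t {..a} + ?I t {a..} \<le> ennreal (4 * (?A * a ^ (?n - 4))) + ennreal ((4 * (real ?n / (2 * \<kappa> * t)) ^ ?n) * (?A / a ^ (4 + 2 * ?n - ?n)))"
        using t 3 a k by (intro add_mono nn_integral_ball_le nn_integral_outside_le prof_sq_le_power mid) auto
      also have "\<dots> = ennreal (4 * (?A * a ^ (?n - 4)) + (4 * (real ?n / (2 * \<kappa> * t)) ^ ?n) * (?A / a ^ (4 + 2 * ?n - ?n)))"
        using A t a k by (intro ennreal_plus[symmetric]) auto
      also have "4 * (?A * a ^ (?n - 4)) + (4 * (real ?n / (2 * \<kappa> * t)) ^ ?n) * (?A / a ^ (4 + 2 * ?n - ?n)) = ?C * a ^ (?n - 4)"
      proof -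
        have "(real ?n / (2 * \<kappa> * t)) ^ ?n = (real ?n / (2 * \<kappa>) * a\<^sup>2) ^ ?n" unfolding a2[symmetric] by simp
        also have "\<dots> = (real ?n / (2 * \<kappa>)) ^ ?n * a ^ (2 * ?n)" by (simp only: power_mult_distrib power_mult)
        finally have 1: "(real ?n / (2 * \<kappa> * t)) ^ ?n = (real ?n / (2 * \<kappa>)) ^ ?n * a ^ (2 * ?n)" .
        have "2 * ?n = (?n - 4) + (4 + 2 * ?n - ?n)" using 3 by simp
        then have 2: "a ^ (2 * ?n) = a ^ (?n - 4) * a ^ (4 + 2 * ?n - ?n)" by (metis power_add)
        show ?thesis unfolding 1 2 using a by (simp add: algebra_simps)
      qed
      finally show "(\<integral>\<^sup>+\<xi>. ennreal ((prof \<kappa> \<delta> t (norm (\<xi>::'a)))\<^sup>2) \<partial>lborel) \<le> ennreal (?C * (rate ?n t)\<^sup>2)"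
        using order_trans[OF all] t 3 by (simp add: rate_sq a_def)
    qed
  qed
qed

text \<open>The error is one power of r better than the profile, which gains at least a factor t in
  the square outside dimension four. The factor 1 / ln t is what dimension four permits: there the
  error stays bounded and the squared rate is just ln t.\<close>

lemma nn_integral_low_err:
  fixes r0 :: real
  assumes c: "c > 0" and r0: "0 < r0" "r0 \<le> 1"
  obtains C where "C \<ge> 0" "\<And>t. t \<ge> 3 \<Longrightarrow>
    (\<integral>\<^sup>+\<xi>. ennreal ((min (1 + t) (exp (- (c * (norm (\<xi>::'a::euclidean_space))\<^sup>2 * t)) / norm \<xi>))\<^sup>2) * indicator {..r0} (norm \<xi>) \<partial>lborel)
      \<le> ennreal (C * ((rate DIM('a) t)\<^sup>2 / ln t))"
proof -
  note result = that
  let ?n = "DIM('a)" and ?A = "sphere_area TYPE('a)"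
  have A: "?A > 0" by (rule sphere_area_pos)
  define h where "h t r = min (1 + t) (exp (- (c * r\<^sup>2 * t)) / r)" for t r :: real
  let ?I = "\<lambda>t S. (\<integral>\<^sup>+\<xi>. ennreal ((h t (norm (\<xi>::'a)))\<^sup>2) * indicator S (norm \<xi>) \<partial>lborel)"
  have [measurable]: "h t \<in> borel_measurable borel" for t unfolding h_def by measurable
  have h0: "0 \<le> h t r" "h t r \<le> 2 * t" "h t r \<le> exp (- (c * r\<^sup>2 * t)) / r" "h t r \<le> 1 / r"
    if "r > 0" "t \<ge> 3" for t r
  proof -
    show "0 \<le> h t r" "h t r \<le> 2 * t" "h t r \<le> exp (- (c * r\<^sup>2 * t)) / r" using that by (auto simp: h_def)
    moreover have "exp (- (c * r\<^sup>2 * t)) / r \<le> 1 / r" using that c by (intro divide_right_mono) auto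
    ultimately show "h t r \<le> 1 / r" by linarith
  qed
  have hA: "(h t r)\<^sup>2 \<le> (4 * t\<^sup>2) * (1 / r ^ 0)" if "r > 0" "t \<ge> 3" for t r
    using power_mono[OF h0(2)[OF that] h0(1)[OF that], of 2] by (simp add: power_mult_distrib)
  have hB: "(h t r)\<^sup>2 \<le> 1 * (1 / r\<^sup>2)" if "r > 0" "t \<ge> 3" for t r
    using power_mono[OF h0(4)[OF that] h0(1)[OF that], of 2] by (simp add: power_divide)
  \<comment> \<open>One copy of each bound multiplied together. This serves dimension two, where 1 /
    r^2 just fails to be integrable at the origin.\<close>
  have hC: "(h t r)\<^sup>2 \<le> (2 * t) * (1 / r ^ 1)" if "r > 0" "t \<ge> 3" for t r
    unfolding power2_eq_square using mult_mono[OF h0(2)[OF that] h0(4)[OF that] _ h0(1)[OF that]] that by simp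
  have hD: "(h t r)\<^sup>2 \<le> (real N / (2 * c * t)) ^ N * (1 / r ^ (2 + 2 * N))" if "r > 0" "t \<ge> 3" for t r N
  proof -
    have "(h t r)\<^sup>2 \<le> (exp (- (c * r\<^sup>2 * t)) / r)\<^sup>2" using h0[OF that] by (intro power_mono)
    also have "\<dots> = 1 / r\<^sup>2 * exp (- (2 * c * t * r\<^sup>2))"
      by (simp add: power_divide power2_eq_square[of "exp _"] exp_add[symmetric] algebra_simps)
    also have "\<dots> \<le> 1 / r\<^sup>2 * (real N / (2 * c * t * r\<^sup>2)) ^ N"
      using that c by (intro mult_left_mono exp_minus_le_power) auto
    also have "(real N / (2 * c * t * r\<^sup>2)) ^ N = (real N / (2 * c * t)) ^ N * (1 / r ^ (2 * N))"
      by (simp add: power_mult_distrib power_divide power_mult)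
    also have "1 / r\<^sup>2 * ((real N / (2 * c * t)) ^ N * (1 / r ^ (2 * N))) = (real N / (2 * c * t)) ^ N * (1 / r ^ (2 + 2 * N))"
      by (simp only: power_add) simp
    finally show ?thesis .
  qed
  have goal: thesis if "C \<ge> 0" "\<And>t. t \<ge> 3 \<Longrightarrow> ?I t {..r0} \<le> ennreal (C * ((rate ?n t)\<^sup>2 / ln t))" for C
    by (rule result[OF that(1)]) (use that(2) in \<open>simp only: h_def\<close>)
  have split: "?I t {..r0} \<le> ?I t {..a} + ?I t {a..}" for t a
    by (rule nn_integral_split_norm) auto
  \<comment> \<open>A spare factor t in an estimate is converted into the required factor ln
    t.\<close>
  have lt: "x \<le> y / ln t" if "x * t \<le> y" "x \<ge> 0" "t \<ge> 3" for x y t :: real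
  proof -
    have "x * ln t \<le> x * t" using that ln_le_self[of t] by (intro mult_left_mono) auto
    then have "x * ln t \<le> y" using that by linarith
    then show ?thesis using ln_ge_1[of t] that by (simp add: field_simps)
  qed
  consider "?n = 1" | "?n = 2" | "?n = 3 \<or> ?n = 4" | "?n > 4"
    using DIM_positive[where 'a='a] by linarith
  then show thesis
  proof cases
    case 1
    show thesis
    proof (rule goal[of "5 * ?A"])
      show "0 \<le> 5 * ?A" using A by simp
      fix t :: real assume t: "t \<ge> 3"
      have "?I t {..1/t} + ?I t {1/t..} \<le> ennreal ((4 * t\<^sup>2) * (?A * (1/t) ^ (?n - 0))) + ennreal (1 * (?A / (1/t) ^ (2 - ?n)))"
        using t 1 by (intro add_mono nn_integral_ball_le nn_integral_outside_le hA hB)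
          (auto intro: less_le_trans[of 0 "1 / t"])
      also have "\<dots> = ennreal ((4 * t\<^sup>2) * (?A * (1/t) ^ (?n - 0)) + 1 * (?A / (1/t) ^ (2 - ?n)))"
        using A t by (intro ennreal_plus[symmetric]) auto
      also have "(4 * t\<^sup>2) * (?A * (1/t) ^ (?n - 0)) + 1 * (?A / (1/t) ^ (2 - ?n)) = 5 * ?A * t"
        using 1 t by (simp add: power2_eq_square)
      also have "ennreal (5 * ?A * t) \<le> ennreal (5 * ?A * ((rate ?n t)\<^sup>2 / ln t))"
      proof (intro ennreal_leI mult_left_mono lt)
        have "t * t \<le> t * (t * t)" using t by (intro mult_left_mono) auto
        moreover have "(rate ?n t)\<^sup>2 = t ^ 3" using 1 t by (simp add: rate_sq)
        ultimately show "t * t \<le> (rate ?n t)\<^sup>2" by (simp only: power3_eq_cube mult.assoc)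
      qed (use A t in auto)
      finally show "?I t {..r0} \<le> ennreal (5 * ?A * ((rate ?n t)\<^sup>2 / ln t))"
        using order_trans[OF split] by blast
    qed
  next
    case 2
    show thesis
    proof (rule goal[of "2 * ?A"])
      show "0 \<le> 2 * ?A" using A by simp
      fix t :: real assume t: "t \<ge> 3"
      have "?I t {..r0} \<le> ennreal ((2 * t) * (?A * r0 ^ (?n - 1)))"
        using t 2 r0 by (intro nn_integral_ball_le hC) auto
      also have "\<dots> \<le> ennreal (2 * ?A * ((rate ?n t)\<^sup>2 / ln t))"
      proof (rule ennreal_leI)
        have "(2 * t) * (?A * r0 ^ (?n - 1)) \<le> (2 * t) * (?A * 1)"
          using A t 2 r0 by (intro mult_left_mono) auto
        also have "\<dots> = 2 * ?A * t" by simp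
        also have "\<dots> \<le> 2 * ?A * ((rate ?n t)\<^sup>2 / ln t)"
        proof (intro mult_left_mono lt)
          have "(rate ?n t)\<^sup>2 = t ^ 2" using 2 t by (simp add: rate_sq)
          then show "t * t \<le> (rate ?n t)\<^sup>2" by (simp only: power2_eq_square)
        qed (use A t in auto)
        finally show "(2 * t) * (?A * r0 ^ (?n - 1)) \<le> 2 * ?A * ((rate ?n t)\<^sup>2 / ln t)" .
      qed
      finally show "?I t {..r0} \<le> ennreal (2 * ?A * ((rate ?n t)\<^sup>2 / ln t))" .
    qed
  next
    case 3
    show thesis
    proof (rule goal[of ?A])
      show "0 \<le> ?A" using A by simp
      fix t :: real assume t: "t \<ge> 3"
      have "?I t {..r0} \<le> ennreal (1 * (?A * r0 ^ (?n - 2)))"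
        using t 3 r0 by (intro nn_integral_ball_le hB) auto
      also have "\<dots> \<le> ennreal (?A * ((rate ?n t)\<^sup>2 / ln t))"
      proof (rule ennreal_leI)
        have "1 * (?A * r0 ^ (?n - 2)) \<le> ?A * 1"
          using A r0 by (simp add: power_le_one)
        also have "\<dots> \<le> ?A * ((rate ?n t)\<^sup>2 / ln t)"
          using A t 3 ln_ge_1[OF t] ln_le_self[OF t] by (intro mult_left_mono) (auto simp: rate_sq)
        finally show "1 * (?A * r0 ^ (?n - 2)) \<le> ?A * ((rate ?n t)\<^sup>2 / ln t)" .
      qed
      finally show "?I t {..r0} \<le> ennreal (?A * ((rate ?n t)\<^sup>2 / ln t))" .
    qed
  next
    case 4
    let ?C = "?A + (real ?n / (2 * c)) ^ ?n * ?A"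
    show thesis
    proof (rule goal[of ?C])
      show "0 \<le> ?C" using A c by simp
      fix t :: real assume t: "t \<ge> 3"
      define a where "a = 1 / sqrt t"
      have a: "a > 0" using t by (simp add: a_def)
      have a2: "1 / t = a\<^sup>2" using t by (simp add: a_def power_divide)
      have "?I t {..a} + ?I t {a..} \<le> ennreal (1 * (?A * a ^ (?n - 2))) + ennreal ((real ?n / (2 * c * t)) ^ ?n * (?A / a ^ (2 + 2 * ?n - ?n)))"
        using t 4 a c by (intro add_mono nn_integral_ball_le nn_integral_outside_le hB hD) auto
      also have "\<dots> = ennreal (1 * (?A * a ^ (?n - 2)) + (real ?n / (2 * c * t)) ^ ?n * (?A / a ^ (2 + 2 * ?n - ?n)))"
        using A t a c by (intro ennreal_plus[symmetric]) auto
      also have "1 * (?A * a ^ (?n - 2)) + (real ?n / (2 * c * t)) ^ ?n * (?A / a ^ (2 + 2 * ?n - ?n)) = ?C * a ^ (?n - 2)"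
      proof -
        have "(real ?n / (2 * c * t)) ^ ?n = (real ?n / (2 * c) * a\<^sup>2) ^ ?n" unfolding a2[symmetric] by simp
        also have "\<dots> = (real ?n / (2 * c)) ^ ?n * a ^ (2 * ?n)" by (simp only: power_mult_distrib power_mult)
        finally have 1: "(real ?n / (2 * c * t)) ^ ?n = (real ?n / (2 * c)) ^ ?n * a ^ (2 * ?n)" .
        have "2 * ?n = (?n - 2) + (2 + 2 * ?n - ?n)" using 4 by simp
        then have 2: "a ^ (2 * ?n) = a ^ (?n - 2) * a ^ (2 + 2 * ?n - ?n)" by (metis power_add)
        show ?thesis unfolding 1 2 using a by (simp add: algebra_simps)
      qed
      also have "ennreal (?C * a ^ (?n - 2)) \<le> ennreal (?C * ((rate ?n t)\<^sup>2 / ln t))"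
      proof (intro ennreal_leI mult_left_mono lt)
        have "?n - 2 = (?n - 4) + 2" using 4 by simp
        then have "a ^ (?n - 2) * t = a ^ (?n - 4) * (a\<^sup>2 * t)" by (simp only: power_add mult.assoc)
        also have "a\<^sup>2 * t = 1" unfolding a2[symmetric] using t by simp
        finally show "a ^ (?n - 2) * t \<le> (rate ?n t)\<^sup>2" using 4 t by (simp add: rate_sq a_def)
      qed (use A c a t in auto)
      finally show "?I t {..r0} \<le> ennreal (?C * ((rate ?n t)\<^sup>2 / ln t))"
        using order_trans[OF split] by blast
    qed
  qed
qed

section \<open>Lower bounds for the profile\<close>

lemma nn_integral_ge_annulus:
  assumes [measurable]: "g \<in> borel_measurable borel" and ab: "0 \<le> a" "a \<le> b" and L: "0 \<le> L"
    and g: "\<And>r. a \<le> r \<Longrightarrow> r \<le> b \<Longrightarrow> L \<le> g r"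
  shows "ennreal (L * (unit_ball_vol (real DIM('a)) * (b ^ DIM('a) - a ^ DIM('a))))
    \<le> (\<integral>\<^sup>+\<xi>. ennreal (g (norm (\<xi>::'a::euclidean_space))) \<partial>lborel)"
proof -
  let ?S = "{\<xi>::'a. norm \<xi> \<in> {a..b}}"
  have S: "?S \<in> sets lborel" by measurable
  have "ennreal (L * (unit_ball_vol (real DIM('a)) * (b ^ DIM('a) - a ^ DIM('a))))
    = ennreal L * ennreal (unit_ball_vol (real DIM('a)) * (b ^ DIM('a) - a ^ DIM('a)))"
    using L ab by (intro ennreal_mult) (auto intro!: mult_nonneg_nonneg power_mono)
  also have "\<dots> \<le> ennreal L * emeasure lborel ?S"
    by (intro mult_left_mono emeasure_annulus_ge ab) auto
  also have "\<dots> = (\<integral>\<^sup>+\<xi>. ennreal L * indicator ?S \<xi> \<partial>lborel)"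
    using S by (simp add: nn_integral_cmult_indicator)
  also have "\<dots> \<le> (\<integral>\<^sup>+\<xi>. ennreal (g (norm (\<xi>::'a))) \<partial>lborel)"
    by (rule nn_integral_mono) (use g in \<open>auto split: split_indicator intro!: ennreal_leI\<close>)
  finally show ?thesis .
qed

text \<open>The integrand may change sign, and \<open>ennreal\<close> discards its negative part;
  this admits an oscillating minorant in dimension four.\<close>

lemma ennreal_integral_le_nn_integral:
  fixes f :: "'a \<Rightarrow> real"
  assumes "integrable M f"
  shows "ennreal (integral\<^sup>L M f) \<le> (\<integral>\<^sup>+x. ennreal (f x) \<partial>M)"
proof -
  have "integral\<^sup>L M f \<le> enn2real (\<integral>\<^sup>+x. ennreal (f x) \<partial>M)"
    unfolding real_lebesgue_integral_def[OF assms] by simp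
  then have "ennreal (integral\<^sup>L M f) \<le> ennreal (enn2real (\<integral>\<^sup>+x. ennreal (f x) \<partial>M))" by (rule ennreal_leI)
  also have "\<dots> \<le> (\<integral>\<^sup>+x. ennreal (f x) \<partial>M)"
    by (simp add: ennreal_enn2real_if)
  finally show ?thesis .
qed

text \<open>
  In dimension four the oscillating term must be integrated rather than bounded: on
  \<open>1/t \<le> r \<le> \<epsilon>/\<surd>t\<close> the integrand dominates \<open>(1/4 - cos (r t)) / r\<close>, which in turn dominates the
  derivative of \<open>ln r / 4 - sin (r t) / (r t) + 1 / (r t)\<close>.
\<close>

lemma nn_integral_prof_lower_4:
  assumes k: "\<kappa> > 0" "\<delta> > 0" and n: "DIM('a::euclidean_space) = 4"
  obtains T where "\<And>t. t \<ge> T \<Longrightarrow> ennreal (sphere_area TYPE('a) / 16 * ln t)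
    \<le> (\<integral>\<^sup>+\<xi>. ennreal ((prof \<kappa> \<delta> t (norm (\<xi>::'a)))\<^sup>2) \<partial>lborel)"
proof -
  let ?A = "sphere_area TYPE('a)"
  have A: "?A > 0" by (rule sphere_area_pos)
  \<comment> \<open>Chosen so that for r \<le> \<epsilon> / sqrt t the deviations of the two
    exponentials from 1 add up to at most 1 / 2.\<close>
  define \<epsilon> where "\<epsilon> = sqrt (1 / (2 * (\<kappa> + \<delta> / 2)))"
  have \<epsilon>: "\<epsilon> > 0" "(\<kappa> + \<delta> / 2) * \<epsilon>\<^sup>2 = 1 / 2" using k by (auto simp: \<epsilon>_def add_pos_pos divide_simps)
  \<comment> \<open>\<open>1 / \<epsilon>\<^sup>2\<close> ensures a \<le> b. The exponential makes
    the constants 1 + |ln \<epsilon>| / 4 at most ln t / 16, half of the logarithmic gain ln t / 8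
    of F between a and b.\<close>
  define T where "T = max 3 (max (1 / \<epsilon>\<^sup>2) (exp (16 * (1 + \<bar>ln \<epsilon>\<bar> / 4))))"
  show thesis
  proof (rule that[of T])
    fix t assume "T \<le> t"
    then have t: "t \<ge> 3" "1 / \<epsilon>\<^sup>2 \<le> t" "exp (16 * (1 + \<bar>ln \<epsilon>\<bar> / 4)) \<le> t" by (auto simp: T_def)
    have tp: "t > 0" using t by simp
    have lt: "16 * (1 + \<bar>ln \<epsilon>\<bar> / 4) \<le> ln t" using t(3) tp by (simp add: ln_ge_iff)
    define a where "a = 1 / t"
    define b where "b = \<epsilon> / sqrt t"
    have a: "a > 0" using tp by (simp add: a_def)
    have b: "b > 0" using tp \<epsilon> by (simp add: b_def)
    have ab: "a \<le> b"
    proof -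
      have "1 \<le> \<epsilon>\<^sup>2 * t" using t(2) \<epsilon>(1) by (simp add: field_simps)
      then have "sqrt 1 \<le> sqrt (\<epsilon>\<^sup>2 * t)" by (rule real_sqrt_le_mono)
      then have "1 \<le> \<epsilon> * sqrt t" using \<epsilon> by (simp add: real_sqrt_mult)
      then have "1 / t \<le> (\<epsilon> * sqrt t) / t" using tp by (intro divide_right_mono) auto
      also have "\<dots> = \<epsilon> / sqrt t" using tp by (simp add: field_simps)
      finally show ?thesis by (simp add: a_def b_def)
    qed
    \<comment> \<open>Integrating cos (r t) / r by parts leaves sin (r t) / (r^2 t). Subtracting 1 /
      (r^2 t) makes this remainder nonpositive and keeps the antiderivative elementary.\<close>
    define F where "F r = ln r / 4 - sin (r * t) / (r * t) + 1 / (r * t)" for r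
    define f where "f r = 1 / (4 * r) - cos (r * t) / r + sin (r * t) / (r\<^sup>2 * t) - 1 / (r\<^sup>2 * t)" for r
    have dF: "DERIV F r :> f r" if "r > 0" for r
      unfolding F_def f_def using that tp
      by (auto intro!: derivative_eq_intros simp: field_simps power2_eq_square)
    have fc: "isCont f r" if "r > 0" for r
      unfolding f_def using that tp by (intro continuous_intros) auto
    have pw: "f r \<le> r ^ 3 * (prof \<kappa> \<delta> t r)\<^sup>2" if r: "a \<le> r" "r \<le> b" for r
    proof -
      have rp: "r > 0" using r a by simp
      define e1 where "e1 = exp (- \<kappa> * r\<^sup>2 * t)"
      define e2 where "e2 = exp (- (\<delta> / 2) * r\<^sup>2 * t)"
      define c where "c = cos (r * t)"
      have c: "\<bar>c\<bar> \<le> 1" by (simp add: c_def)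
      have e1: "1 - \<kappa> * (r\<^sup>2 * t) \<le> e1" "e1 \<le> 1"
        using exp_ge_add_one_self[of "- \<kappa> * r\<^sup>2 * t"] k tp by (auto simp: e1_def mult.assoc)
      have e2: "1 - \<delta> / 2 * (r\<^sup>2 * t) \<le> e2" "e2 \<le> 1"
        using exp_ge_add_one_self[of "- (\<delta> / 2) * r\<^sup>2 * t"] k tp by (auto simp: e2_def mult.assoc)
      have "r\<^sup>2 \<le> b\<^sup>2" using r rp by (intro power_mono) auto
      then have "r\<^sup>2 * t \<le> b\<^sup>2 * t" using tp by simp
      also have "b\<^sup>2 * t = \<epsilon>\<^sup>2" using tp by (simp add: b_def power_divide)
      finally have "(\<kappa> + \<delta> / 2) * (r\<^sup>2 * t) \<le> (\<kappa> + \<delta> / 2) * \<epsilon>\<^sup>2" using k by (intro mult_left_mono) auto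
      then have sm: "\<kappa> * (r\<^sup>2 * t) + \<delta> / 2 * (r\<^sup>2 * t) \<le> 1 / 2" using \<epsilon> by (simp add: distrib_right)
      define x where "x = (1 - e2) * c"
      \<comment> \<open>The total effect of the exponentials: \<open>r\<^sup>2 * prof\<close> is 1 -
        c - z, and |z| \<le> 1 / 2 leaves its square at least 1 / 4 - c.\<close>
      define z where "z = (1 - e1) - x"
      have "\<bar>x\<bar> \<le> (1 - e2) * 1" unfolding x_def abs_mult using e2 c by (intro mult_mono) auto
      then have "\<bar>x\<bar> \<le> 1 - e2" by simp
      then have "\<bar>z\<bar> \<le> 1 / 2" unfolding z_def using e1 e2 sm by linarith
      then have z2: "z\<^sup>2 \<le> (1 / 2)\<^sup>2" using abs_le_square_iff[of z "1 / 2"] by simp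
      have "1 / 4 - c \<le> (1 - c)\<^sup>2 / 2 - z\<^sup>2"
      proof -
        have "(1 - c)\<^sup>2 / 2 = 1 / 2 - c + c\<^sup>2 / 2" by (simp add: power2_eq_square field_simps)
        moreover have "z\<^sup>2 \<le> 1 / 4" using z2 by (simp add: power_divide)
        ultimately show ?thesis using zero_le_power2[of c] by linarith
      qed
      also have "\<dots> \<le> ((1 - c) - z)\<^sup>2"
      proof -
        have "a\<^sup>2 / 2 - z\<^sup>2 \<le> (a - z)\<^sup>2" for a
          using zero_le_power2[of "a - 2 * z"] by (simp add: power2_eq_square algebra_simps)
        then show ?thesis .
      qed
      also have "(1 - c) - z = r\<^sup>2 * prof \<kappa> \<delta> t r"
        using rp by (simp add: z_def x_def prof_def e1_def e2_def c_def algebra_simps)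
      finally have "(1 / 4 - c) / r \<le> (r\<^sup>2 * prof \<kappa> \<delta> t r)\<^sup>2 / r" using rp by (intro divide_right_mono) auto
      also have "\<dots> = r ^ 3 * (prof \<kappa> \<delta> t r)\<^sup>2" using rp by (simp add: power2_eq_square numeral_eq_Suc)
      finally have 1: "(1 / 4 - c) / r \<le> r ^ 3 * (prof \<kappa> \<delta> t r)\<^sup>2" .
      have "sin (r * t) / (r\<^sup>2 * t) \<le> 1 / (r\<^sup>2 * t)" using tp by (intro divide_right_mono) auto
      then have "f r \<le> (1 / 4 - c) / r" by (simp add: f_def c_def diff_divide_distrib)
      with 1 show ?thesis by simp
    qed
    have int: "integrable lborel (\<lambda>r. f r * indicator {a..b} r)"
      and val: "(LINT r|lborel. f r * indicator {a..b} r) = F b - F a"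
      using has_bochner_integral_FTC_Icc_real[OF ab, of F f] dF fc a by (auto simp: has_bochner_integral_iff)
    have "ennreal (?A / 16 * ln t) \<le> ennreal (?A * (F b - F a))"
    proof (rule ennreal_leI)
      have "F a = - ln t / 4 - sin 1 + 1" using tp by (simp add: F_def a_def ln_div)
      moreover have "F b \<ge> (ln \<epsilon> - ln t / 2) / 4"
      proof -
        have "ln b = ln \<epsilon> - ln t / 2" using tp \<epsilon> by (simp add: b_def ln_div ln_sqrt)
        moreover have "sin (b * t) / (b * t) \<le> 1 / (b * t)" using b tp by (intro divide_right_mono) auto
        moreover have "q / 4 \<le> p / 4 - x + y" if "p = q" "x \<le> y" for p q x y :: real
          using that by simp
        ultimately show ?thesis unfolding F_def by blast
      qed
      moreover have "sin (1::real) \<ge> 0" by (intro sin_ge_zero) (use pi_gt3 in auto)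
      ultimately have "F b - F a \<ge> ln t / 16" using lt by (simp add: field_simps abs_if split: if_splits)
      then have "?A * (ln t / 16) \<le> ?A * (F b - F a)" using A by (intro mult_left_mono) auto
      then show "?A / 16 * ln t \<le> ?A * (F b - F a)" by simp
    qed
    also have "\<dots> = ennreal (LINT r|lborel. ?A * (f r * indicator {a..b} r))" using val by simp
    also have "\<dots> \<le> (\<integral>\<^sup>+r. ennreal (?A * (f r * indicator {a..b} r)) \<partial>lborel)"
      using int by (intro ennreal_integral_le_nn_integral) simp
    also have "\<dots> \<le> (\<integral>\<^sup>+r. ennreal (?A * r ^ (DIM('a) - 1)) * indicator {0..} r * ennreal ((prof \<kappa> \<delta> t r)\<^sup>2) \<partial>lborel)"
    proof (rule nn_integral_mono)
      fix r :: real
      show "ennreal (?A * (f r * indicator {a..b} r)) \<le> ennreal (?A * r ^ (DIM('a) - 1)) * indicator {0..} r * ennreal ((prof \<kappa> \<delta> t r)\<^sup>2)"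
      proof (cases "r \<in> {a..b}")
        case True
        then have "?A * f r \<le> ?A * (r ^ 3 * (prof \<kappa> \<delta> t r)\<^sup>2)" using A by (intro mult_left_mono pw) auto
        then have "ennreal (?A * f r) \<le> ennreal (?A * r ^ 3 * (prof \<kappa> \<delta> t r)\<^sup>2)" by (intro ennreal_leI) (simp add: mult.assoc)
        also have "\<dots> = ennreal (?A * r ^ 3) * ennreal ((prof \<kappa> \<delta> t r)\<^sup>2)"
          using A True a by (intro ennreal_mult) auto
        finally show ?thesis using True a n by simp
      qed simp
    qed
    also have "\<dots> = (\<integral>\<^sup>+\<xi>. ennreal ((prof \<kappa> \<delta> t (norm (\<xi>::'a)))\<^sup>2) \<partial>lborel)"
      by (rule nn_integral_radial[symmetric]) measurable
    finally show "ennreal (?A / 16 * ln t) \<le> (\<integral>\<^sup>+\<xi>. ennreal ((prof \<kappa> \<delta> t (norm (\<xi>::'a)))\<^sup>2) \<partial>lborel)" .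
  qed
qed

text \<open>Outside dimension four a single annulus from a to 2 a carries the rate: a = 1 / t, where
  the cosine stays away from 1, or a = 1 / sqrt t, where the heat factor exceeds the wave factor by
  a fixed amount. The latter rests on the strict inequality \<kappa> < \<delta> / 2. In dimension
  four one annulus would yield a constant only.\<close>

lemma nn_integral_prof_lower:
  assumes k: "\<kappa> > 0" "\<kappa> < \<delta> / 2"
  obtains c T where "c > 0" "\<And>t. t \<ge> T \<Longrightarrow> ennreal (c * (rate DIM('a) t)\<^sup>2)
    \<le> (\<integral>\<^sup>+\<xi>. ennreal ((prof \<kappa> \<delta> t (norm (\<xi>::'a::euclidean_space)))\<^sup>2) \<partial>lborel)"
proof -
  let ?n = "DIM('a)" and ?w = "unit_ball_vol (real DIM('a))"
  have w: "?w > 0" by simp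
  have d: "\<delta> > 0" using k by simp
  have ball: "ennreal (L * (?w * a ^ ?n)) \<le> (\<integral>\<^sup>+\<xi>. ennreal ((prof \<kappa> \<delta> t (norm (\<xi>::'a)))\<^sup>2) \<partial>lborel)"
    if "a > 0" "L \<ge> 0" "\<And>r. a \<le> r \<Longrightarrow> r \<le> 2 * a \<Longrightarrow> L \<le> (prof \<kappa> \<delta> t r)\<^sup>2" for a L t
  proof -
    have "2 * a ^ ?n \<le> 2 ^ ?n * a ^ ?n"
      using power_increasing[of 1 ?n "2::real"] that(1) DIM_positive[where 'a='a] by (intro mult_right_mono) auto
    then have "a ^ ?n \<le> (2 * a) ^ ?n - a ^ ?n" by (simp add: power_mult_distrib)
    then have "ennreal (L * (?w * a ^ ?n)) \<le> ennreal (L * (?w * ((2 * a) ^ ?n - a ^ ?n)))"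
      using that w by (intro ennreal_leI mult_left_mono) auto
    also have "\<dots> \<le> (\<integral>\<^sup>+\<xi>. ennreal ((prof \<kappa> \<delta> t (norm (\<xi>::'a)))\<^sup>2) \<partial>lborel)"
      using that by (intro nn_integral_ge_annulus) auto
    finally show ?thesis .
  qed
  have sqb: "g\<^sup>2 / (2 * a) ^ 4 \<le> (prof \<kappa> \<delta> t r)\<^sup>2" if "0 < r" "r \<le> 2 * a" "0 \<le> g" "g \<le> r\<^sup>2 * prof \<kappa> \<delta> t r" for g a r t
  proof -
    have "g\<^sup>2 / (2 * a) ^ 4 \<le> g\<^sup>2 / r ^ 4" using that by (intro divide_left_mono power_mono) auto
    also have "\<dots> \<le> (r\<^sup>2 * prof \<kappa> \<delta> t r)\<^sup>2 / r ^ 4" using that by (intro divide_right_mono power_mono) auto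
    also have "\<dots> = (prof \<kappa> \<delta> t r)\<^sup>2" using that by (simp add: power_mult_distrib flip: power_mult)
    finally show ?thesis .
  qed
  have r2prof: "r\<^sup>2 * prof \<kappa> \<delta> t r = exp (- (\<kappa> * (r\<^sup>2 * t))) - cos (r * t) * exp (- (\<delta> / 2 * (r\<^sup>2 * t)))" if "r > 0" for r t
    using that by (simp add: prof_def mult.assoc)
  consider "?n \<le> 3" | "?n = 4" | "?n > 4" by linarith
  then show thesis
  proof cases
    case 1
    \<comment> \<open>The gap 1 - cos 1 is halved: one half remains, the other absorbs the loss in
      the heat factor, which is at most 4 \<kappa> / t when r t \<le> 2.\<close>
    define g where "g = (1 - cos (1::real)) / 2"
    have c1: "0 < cos (1::real)" "cos (1::real) < 1"
      using cos_gt_zero[of 1] cos_monotone_0_pi[of 0 1] pi_gt3 by auto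
    have g: "g > 0" using c1 by (simp add: g_def)
    define T where "T = max 3 (4 * \<kappa> / g)"
    show thesis
    proof (rule that[of "g\<^sup>2 / 16 * ?w" T])
      show "0 < g\<^sup>2 / 16 * ?w" using g w by simp
      fix t assume "T \<le> t"
      then have t: "t \<ge> 3" "4 * \<kappa> / t \<le> g" using g by (auto simp: T_def field_simps)
      have pw: "g \<le> r\<^sup>2 * prof \<kappa> \<delta> t r" if r: "1 / t \<le> r" "r \<le> 2 * (1 / t)" for r
      proof -
        have rp: "r > 0" using r t by (intro less_le_trans[OF _ r(1)]) auto
        have x: "1 \<le> r * t" "r * t \<le> 2" using r t by (auto simp: field_simps)
        have "cos (r * t) \<le> cos 1" using x pi_gt3 by (intro cos_monotone_0_pi_le) auto
        then have "cos (r * t) * exp (- (\<delta> / 2 * (r\<^sup>2 * t))) \<le> cos 1 * 1"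
        proof (cases "cos (r * t) \<le> 0")
          case True
          then have "cos (r * t) * exp (- (\<delta> / 2 * (r\<^sup>2 * t))) \<le> 0" by (intro mult_nonpos_nonneg) auto
          then show ?thesis using c1 by simp
        next
          case False
          then show ?thesis using \<open>cos (r * t) \<le> cos 1\<close> d t c1 by (intro mult_mono) auto
        qed
        moreover have "1 - \<kappa> * (r\<^sup>2 * t) \<le> exp (- (\<kappa> * (r\<^sup>2 * t)))"
          using exp_ge_add_one_self[of "- (\<kappa> * (r\<^sup>2 * t))"] by simp
        moreover have "\<kappa> * (r\<^sup>2 * t) \<le> g"
        proof -
          have "r\<^sup>2 * t = (r * t) * (r * t) / t" using t by (simp add: power2_eq_square)
          also have "\<dots> \<le> (2 * 2) / t" using x t by (intro divide_right_mono mult_mono) auto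
          finally have "\<kappa> * (r\<^sup>2 * t) \<le> \<kappa> * (4 / t)" using k by (intro mult_left_mono) auto
          also have "\<dots> \<le> g" using t by (simp add: mult.commute)
          finally show ?thesis .
        qed
        ultimately show ?thesis unfolding r2prof[OF rp] by (simp add: g_def)
      qed
      have "ennreal (g\<^sup>2 / (2 * (1 / t)) ^ 4 * (?w * (1 / t) ^ ?n)) \<le> (\<integral>\<^sup>+\<xi>. ennreal ((prof \<kappa> \<delta> t (norm (\<xi>::'a)))\<^sup>2) \<partial>lborel)"
      proof (rule ball)
        fix r assume r: "1 / t \<le> r" "r \<le> 2 * (1 / t)"
        have "r > 0" using r t by (intro less_le_trans[OF _ r(1)]) auto
        then show "g\<^sup>2 / (2 * (1 / t)) ^ 4 \<le> (prof \<kappa> \<delta> t r)\<^sup>2" using pw[OF r] g r by (intro sqb) auto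
      qed (use t g in auto)
      also have "g\<^sup>2 / (2 * (1 / t)) ^ 4 * (?w * (1 / t) ^ ?n) = g\<^sup>2 / 16 * ?w * t ^ (4 - ?n)"
        using t 1 by (simp add: power_divide power_diff)
      finally show "ennreal (g\<^sup>2 / 16 * ?w * (rate ?n t)\<^sup>2) \<le> (\<integral>\<^sup>+\<xi>. ennreal ((prof \<kappa> \<delta> t (norm (\<xi>::'a)))\<^sup>2) \<partial>lborel)"
        using t 1 by (simp add: rate_sq)
    qed
  next
    case 2
    obtain T where T: "\<And>t. t \<ge> T \<Longrightarrow> ennreal (sphere_area TYPE('a) / 16 * ln t)
        \<le> (\<integral>\<^sup>+\<xi>. ennreal ((prof \<kappa> \<delta> t (norm (\<xi>::'a)))\<^sup>2) \<partial>lborel)"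
      using nn_integral_prof_lower_4[OF k(1) d 2] by blast
    show thesis
      by (rule that[of "sphere_area TYPE('a) / 16" "max 3 T"])
         (use T sphere_area_pos[where 'a='a] 2 in \<open>auto simp: rate_sq\<close>)
  next
    case 3
    \<comment> \<open>A lower bound for the heat factor minus the wave envelope when
      \<open>r\<^sup>2 * t\<close> lies between 1 and 4; the cosine is replaced by 1.\<close>
    define g where "g = exp (- (4 * \<kappa>)) * (1 - exp (- (\<delta> / 2 - \<kappa>)))"
    have g: "g > 0" using k by (simp add: g_def)
    show thesis
    proof (rule that[of "g\<^sup>2 / 16 * ?w" 3])
      show "0 < g\<^sup>2 / 16 * ?w" using g w by simp
      fix t :: real assume t: "3 \<le> t"
      define a where "a = 1 / sqrt t"
      have a: "a > 0" using t by (simp add: a_def)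
      have a2: "a\<^sup>2 * t = 1" using t by (simp add: a_def power_divide)
      have pw: "g \<le> r\<^sup>2 * prof \<kappa> \<delta> t r" if r: "a \<le> r" "r \<le> 2 * a" for r
      proof -
        have rp: "r > 0" using r a by simp
        define y where "y = r\<^sup>2 * t"
        have y: "1 \<le> y" "y \<le> 4"
        proof -
          have "a\<^sup>2 * t \<le> r\<^sup>2 * t" using r a t by (intro mult_right_mono power_mono) auto
          then show "1 \<le> y" by (simp add: y_def a2)
          have "r\<^sup>2 * t \<le> (2 * a)\<^sup>2 * t" using r a t by (intro mult_right_mono power_mono) auto
          also have "\<dots> = 4" using a2 by (simp add: power_mult_distrib)
          finally show "y \<le> 4" by (simp add: y_def)
        qed
        have "exp (- (4 * \<kappa>)) \<le> exp (- (\<kappa> * y))" using y k mult_left_mono[OF y(2), of \<kappa>] by simp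
        moreover have "1 - exp (- (\<delta> / 2 - \<kappa>)) \<le> 1 - exp (- ((\<delta> / 2 - \<kappa>) * y))"
        proof -
          have "(\<delta> / 2 - \<kappa>) * 1 \<le> (\<delta> / 2 - \<kappa>) * y" using k y by (intro mult_left_mono) auto
          then show ?thesis by (simp only: exp_le_cancel_iff neg_le_iff_le mult_1_right diff_left_mono)
        qed
        ultimately have "g \<le> exp (- (\<kappa> * y)) * (1 - exp (- ((\<delta> / 2 - \<kappa>) * y)))"
          unfolding g_def using k by (intro mult_mono) auto
        also have "\<dots> = exp (- (\<kappa> * y)) - 1 * exp (- (\<delta> / 2 * y))"
          by (simp add: algebra_simps flip: exp_add)
        also have "\<dots> \<le> exp (- (\<kappa> * y)) - cos (r * t) * exp (- (\<delta> / 2 * y))"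
          by (intro diff_left_mono mult_right_mono) auto
        finally show ?thesis unfolding r2prof[OF rp] y_def .
      qed
      have "ennreal (g\<^sup>2 / (2 * a) ^ 4 * (?w * a ^ ?n)) \<le> (\<integral>\<^sup>+\<xi>. ennreal ((prof \<kappa> \<delta> t (norm (\<xi>::'a)))\<^sup>2) \<partial>lborel)"
      proof (rule ball[OF a])
        fix r assume r: "a \<le> r" "r \<le> 2 * a"
        then show "g\<^sup>2 / (2 * a) ^ 4 \<le> (prof \<kappa> \<delta> t r)\<^sup>2" using pw[OF r] g a by (intro sqb) auto
      qed (use a in auto)
      also have "g\<^sup>2 / (2 * a) ^ 4 * (?w * a ^ ?n) = g\<^sup>2 / 16 * ?w * a ^ (?n - 4)"
        using a 3 by (simp add: power_mult_distrib power_diff)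
      finally show "ennreal (g\<^sup>2 / 16 * ?w * (rate ?n t)\<^sup>2) \<le> (\<integral>\<^sup>+\<xi>. ennreal ((prof \<kappa> \<delta> t (norm (\<xi>::'a)))\<^sup>2) \<partial>lborel)"
        using t 3 by (simp add: rate_sq a_def)
    qed
  qed
qed

section \<open>Freezing the transform of the datum at frequency zero\<close>

lemma integrable_profile_symbol:
  assumes k: "\<kappa> > 0" "\<kappa> \<le> \<delta> / 2" and t: "t > 0"
  shows "integrable lborel (profile_symbol \<kappa> \<delta> t :: 'a::euclidean_space \<Rightarrow> complex)"
    and "(profile_symbol \<kappa> \<delta> t :: 'a \<Rightarrow> complex) \<in> L2"
proof -
  let ?n = "DIM('a)"
  have d: "\<delta> > 0" using k by simp
  have [measurable]: "(profile_symbol \<kappa> \<delta> t :: 'a \<Rightarrow> complex) \<in> borel_measurable borel"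
    unfolding profile_symbol_eq[abs_def] by measurable
  define B where "B = \<kappa> * t + t\<^sup>2 / 2 + \<delta> / 2 * t"
  have B: "B > 0" using k d t by (simp add: B_def add_pos_pos)
  have b: "\<bar>prof \<kappa> \<delta> t r\<bar> \<le> B * (1 / r ^ 0)" if "r > 0" for r
    using prof_le_polynomial[of r t \<kappa> \<delta>] that t k d by (simp add: B_def)
  define E where "E = 2 * (real ?n / (\<kappa> * t)) ^ ?n"
  have E: "E \<ge> 0" using k t by (simp add: E_def)
  have e: "\<bar>prof \<kappa> \<delta> t r\<bar> \<le> E * (1 / r ^ (2 + 2 * ?n))" if "1 \<le> r" for r
  proof -
    have "\<bar>prof \<kappa> \<delta> t r\<bar> \<le> 2 / r\<^sup>2 * exp (- (\<kappa> * r\<^sup>2 * t))"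
      using that t k by (intro prof_le_exp) auto
    also have "\<dots> \<le> 2 / r\<^sup>2 * (real ?n / (\<kappa> * r\<^sup>2 * t)) ^ ?n"
      using that t k by (intro mult_left_mono exp_minus_le_power) auto
    also have "\<dots> = E * (1 / r ^ (2 + 2 * ?n))"
      by (simp add: E_def power_divide power_mult_distrib power_add power_mult power2_eq_square)
    finally show ?thesis .
  qed
  have fin: "(\<integral>\<^sup>+\<xi>. ennreal \<bar>prof \<kappa> \<delta> t (norm (\<xi>::'a))\<bar> \<partial>lborel) < \<infinity>"
  proof -
    have "(\<integral>\<^sup>+\<xi>. ennreal \<bar>prof \<kappa> \<delta> t (norm (\<xi>::'a))\<bar> * indicator UNIV (norm \<xi>) \<partial>lborel)
      \<le> (\<integral>\<^sup>+\<xi>. ennreal \<bar>prof \<kappa> \<delta> t (norm (\<xi>::'a))\<bar> * indicator {..1} (norm \<xi>) \<partial>lborel)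
        + (\<integral>\<^sup>+\<xi>. ennreal \<bar>prof \<kappa> \<delta> t (norm (\<xi>::'a))\<bar> * indicator {1..} (norm \<xi>) \<partial>lborel)"
      by (rule nn_integral_split_norm) auto
    also have "\<dots> \<le> ennreal (B * (sphere_area TYPE('a) * 1 ^ (?n - 0))) + ennreal (E * (sphere_area TYPE('a) / 1 ^ (2 + 2 * ?n - ?n)))"
      using B E b e by (intro add_mono nn_integral_ball_le nn_integral_outside_le) auto
    also have "\<dots> < \<infinity>" by simp
    finally show ?thesis by simp
  qed
  show int: "integrable lborel (profile_symbol \<kappa> \<delta> t :: 'a \<Rightarrow> complex)"
    using fin by (intro integrableI_bounded) (simp_all add: profile_symbol_eq)
  have "integrable lborel (\<lambda>\<xi>. (cmod (profile_symbol \<kappa> \<delta> t (\<xi>::'a)))\<^sup>2)"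
  proof (rule Bochner_Integration.integrable_bound)
    show "integrable lborel (\<lambda>\<xi>. B * cmod (profile_symbol \<kappa> \<delta> t (\<xi>::'a)))" using int by simp
    show "AE \<xi> in lborel. norm ((cmod (profile_symbol \<kappa> \<delta> t (\<xi>::'a)))\<^sup>2) \<le> norm (B * cmod (profile_symbol \<kappa> \<delta> t \<xi>))"
      using AE_norm_pos
    proof eventually_elim
      case (elim \<xi>)
      show ?case
        using mult_right_mono[OF b[OF elim], of "\<bar>prof \<kappa> \<delta> t (norm \<xi>)\<bar>"] B
        by (simp add: profile_symbol_eq power2_eq_square abs_mult)
    qed
  qed measurable
  then show "(profile_symbol \<kappa> \<delta> t :: 'a \<Rightarrow> complex) \<in> L2" by (simp add: L2_def)
qed

lemma inv_fourier_mult_right: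
  "inv_fourier (\<lambda>\<xi>. h \<xi> * P) x = inv_fourier h x * P"
proof -
  have "(LINT \<xi>|lborel. cis (x \<bullet> \<xi>) * (h \<xi> * P)) = (LINT \<xi>|lborel. cis (x \<bullet> \<xi>) * h \<xi>) * P"
    by (subst integral_mult_left_zero[symmetric]) (simp add: mult.assoc)
  then show ?thesis by (simp add: inv_fourier_def)
qed

lemma profile_eq_inv_fourier:
  "profile \<kappa> \<delta> f t x = inv_fourier (\<lambda>\<xi>. profile_symbol \<kappa> \<delta> t \<xi> * total_integral f) x"
  by (simp add: profile_def G0_def inv_fourier_mult_right)

lemma fourier_near_0:
  fixes f :: "'a::euclidean_space \<Rightarrow> complex"
  assumes f: "integrable lborel f" and e: "e > 0"
  obtains \<eta> where "\<eta> > 0" "\<And>\<xi>. norm \<xi> \<le> \<eta> \<Longrightarrow> cmod (fourier f \<xi> - total_integral f) \<le> e"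
proof -
  have [measurable]: "f \<in> borel_measurable borel" using f by auto
  have "isCont (fourier f) 0"
    unfolding continuous_at_sequentially
  proof (intro allI impI)
    fix X :: "nat \<Rightarrow> 'a" assume X: "X \<longlonglongrightarrow> 0"
    have "(\<lambda>i. LINT x|lborel. cis (- (x \<bullet> X i)) * f x) \<longlonglongrightarrow> (LINT x|lborel. cis (- (x \<bullet> 0)) * f x)"
    proof (rule integral_dominated_convergence[where w="\<lambda>x. cmod (f x)"])
      show "AE x in lborel. (\<lambda>i. cis (- (x \<bullet> X i)) * f x) \<longlonglongrightarrow> cis (- (x \<bullet> 0)) * f x"
      proof (rule AE_I2)
        fix x
        have "continuous_on UNIV cis" by (intro continuous_intros)
        then have c: "isCont cis y" for y by (simp add: continuous_on_eq_continuous_at)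
        have "(\<lambda>i. - (x \<bullet> X i)) \<longlonglongrightarrow> - (x \<bullet> 0)" by (intro tendsto_intros X)
        then show "(\<lambda>i. cis (- (x \<bullet> X i)) * f x) \<longlonglongrightarrow> cis (- (x \<bullet> 0)) * f x"
          by (intro tendsto_mult tendsto_const isCont_tendsto_compose[OF c])
      qed
    qed (use f in auto)
    then show "(fourier f \<circ> X) \<longlonglongrightarrow> fourier f 0" by (simp add: fourier_def o_def)
  qed
  then obtain \<eta> where \<eta>: "\<eta> > 0" "\<And>\<xi>. dist \<xi> 0 < \<eta> \<Longrightarrow> dist (fourier f \<xi>) (fourier f 0) < e"
    using e unfolding continuous_at_eps_delta by (auto simp: dist_norm)
  have "fourier f 0 = total_integral f" by (simp add: fourier_def total_integral_def)
  then show ?thesis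
    using \<eta> by (intro that[of "\<eta> / 2"]) (auto simp: dist_norm less_imp_le)
qed

text \<open>An approximate-identity argument: near zero the factor is small by continuity of the
  transform, and away from zero the mass of the profile is lower by a factor ln t. As f is merely
  integrable no speed comes out, which is the source of the little-o.\<close>

lemma profile_symbol_freeze:
  fixes f :: "'a::euclidean_space \<Rightarrow> complex"
  assumes k: "\<kappa> > 0" "\<kappa> \<le> \<delta> / 2" and f: "integrable lborel f" and e: "e > 0"
  shows "eventually (\<lambda>t. nnL2 (\<lambda>\<xi>. profile_symbol \<kappa> \<delta> t \<xi> * (fourier f \<xi> - total_integral f))
     \<le> ennreal (e * (rate DIM('a) t)\<^sup>2)) at_top"
proof -
  have [measurable]: "f \<in> borel_measurable borel" using f by auto
  obtain C1 where C1: "C1 \<ge> 0" "\<And>t. t \<ge> 3 \<Longrightarrow>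
    (\<integral>\<^sup>+\<xi>. ennreal ((prof \<kappa> \<delta> t (norm (\<xi>::'a)))\<^sup>2) \<partial>lborel) \<le> ennreal (C1 * (rate DIM('a) t)\<^sup>2)"
    using nn_integral_prof_upper[OF k, where 'a='a] by blast
  \<comment> \<open>Calibrated so that the part near zero, e1^2 * C1 relative to the squared rate,
    takes at most half of e.\<close>
  define e1 where "e1 = sqrt (e / (2 * (C1 + 1)))"
  have e1: "e1 > 0" "e1\<^sup>2 * C1 \<le> e / 2"
  proof -
    show "e1 > 0" using e C1 by (simp add: e1_def)
    have "e1\<^sup>2 = e / (2 * (C1 + 1))" using e C1 by (simp add: e1_def)
    moreover have "e / (2 * (C1 + 1)) * C1 \<le> e / (2 * (C1 + 1)) * (C1 + 1)"
      using e C1 by (intro mult_left_mono) auto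
    moreover have "e / (2 * x) * x = e / 2" if "x > 0" for x using that by simp
    then have "e / (2 * (C1 + 1)) * (C1 + 1) = e / 2" using C1 by (simp only: add_nonneg_pos zero_less_one)
    ultimately show "e1\<^sup>2 * C1 \<le> e / 2" by (simp only:)
  qed
  obtain \<eta> where \<eta>: "\<eta> > 0" "\<And>\<xi>. norm \<xi> \<le> \<eta> \<Longrightarrow> cmod (fourier f \<xi> - total_integral f) \<le> e1"
    using fourier_near_0[OF f e1(1)] by blast
  obtain C3 where C3: "C3 \<ge> 0" "\<And>t. t \<ge> 3 \<Longrightarrow>
    (\<integral>\<^sup>+\<xi>. ennreal ((prof \<kappa> \<delta> t (norm (\<xi>::'a)))\<^sup>2) * indicator {\<eta>..} (norm \<xi>) \<partial>lborel)
      \<le> ennreal (C3 * ((rate DIM('a) t)\<^sup>2 / ln t))"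
    using nn_integral_prof_tail[OF k \<eta>(1), where 'a='a] by blast
  define N where "N = 2 * norm_L1 f"
  have P: "cmod (total_integral f) \<le> norm_L1 f"
    unfolding total_integral_def norm_L1_def by (rule integral_norm_bound)
  have N: "cmod (fourier f \<xi> - total_integral f) \<le> N" for \<xi>
    using norm_triangle_ineq4[of "fourier f \<xi>" "total_integral f"] cmod_fourier_le[of f \<xi>] P by (simp add: N_def)
  have bound: "nnL2 (\<lambda>\<xi>. profile_symbol \<kappa> \<delta> t \<xi> * (fourier f \<xi> - total_integral f))
     \<le> ennreal ((e / 2 + N\<^sup>2 * C3 / ln t) * (rate DIM('a) t)\<^sup>2)" if t: "t \<ge> 3" for t
  proof -
    have l: "ln t \<ge> 1" by (rule ln_ge_1[OF t])
    let ?p = "\<lambda>\<xi>::'a. ennreal ((prof \<kappa> \<delta> t (norm \<xi>))\<^sup>2)"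
    have "nnL2 (\<lambda>\<xi>. profile_symbol \<kappa> \<delta> t \<xi> * (fourier f \<xi> - total_integral f))
      \<le> (\<integral>\<^sup>+\<xi>. ennreal (e1\<^sup>2) * ?p \<xi> + ennreal (N\<^sup>2) * (?p \<xi> * indicator {\<eta>..} (norm \<xi>)) \<partial>lborel)"
      unfolding nnL2_def
    proof (rule nn_integral_mono)
      fix \<xi> :: 'a
      define D where "D = cmod (fourier f \<xi> - total_integral f)"
      have "(cmod (profile_symbol \<kappa> \<delta> t \<xi> * (fourier f \<xi> - total_integral f)))\<^sup>2 = D\<^sup>2 * (prof \<kappa> \<delta> t (norm \<xi>))\<^sup>2"
        by (simp add: profile_symbol_eq norm_mult power_mult_distrib D_def)
      moreover have "ennreal (D\<^sup>2 * (prof \<kappa> \<delta> t (norm \<xi>))\<^sup>2) \<le> ennreal (e1\<^sup>2) * ?p \<xi> + ennreal (N\<^sup>2) * (?p \<xi> * indicator {\<eta>..} (norm \<xi>))"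
      proof (cases "norm \<xi> \<le> \<eta>")
        case True
        have "D\<^sup>2 \<le> e1\<^sup>2" using \<eta>(2)[OF True] by (intro power_mono) (auto simp: D_def)
        then have "ennreal (D\<^sup>2 * (prof \<kappa> \<delta> t (norm \<xi>))\<^sup>2) \<le> ennreal (e1\<^sup>2 * (prof \<kappa> \<delta> t (norm \<xi>))\<^sup>2)"
          by (intro ennreal_leI mult_right_mono) auto
        also have "\<dots> = ennreal (e1\<^sup>2) * ?p \<xi>" by (intro ennreal_mult) auto
        finally show ?thesis by (rule order_trans) simp
      next
        case False
        have "D\<^sup>2 \<le> N\<^sup>2" using N[of \<xi>] by (intro power_mono) (auto simp: D_def)
        then have "ennreal (D\<^sup>2 * (prof \<kappa> \<delta> t (norm \<xi>))\<^sup>2) \<le> ennreal (N\<^sup>2 * (prof \<kappa> \<delta> t (norm \<xi>))\<^sup>2)"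
          by (intro ennreal_leI mult_right_mono) auto
        also have "\<dots> = ennreal (N\<^sup>2) * ?p \<xi>" by (intro ennreal_mult) auto
        finally show ?thesis using False by (simp add: add_increasing)
      qed
      ultimately show "ennreal ((cmod (profile_symbol \<kappa> \<delta> t \<xi> * (fourier f \<xi> - total_integral f)))\<^sup>2)
        \<le> ennreal (e1\<^sup>2) * ?p \<xi> + ennreal (N\<^sup>2) * (?p \<xi> * indicator {\<eta>..} (norm \<xi>))" by simp
    qed
    also have "\<dots> = ennreal (e1\<^sup>2) * (\<integral>\<^sup>+\<xi>. ?p \<xi> \<partial>lborel) + ennreal (N\<^sup>2) * (\<integral>\<^sup>+\<xi>. ?p \<xi> * indicator {\<eta>..} (norm \<xi>) \<partial>lborel)"
      by (subst nn_integral_add) (auto simp: nn_integral_cmult)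
    also have "\<dots> \<le> ennreal (e1\<^sup>2) * ennreal (C1 * (rate DIM('a) t)\<^sup>2) + ennreal (N\<^sup>2) * ennreal (C3 * ((rate DIM('a) t)\<^sup>2 / ln t))"
      by (intro add_mono mult_left_mono C1 C3 t) auto
    also have "\<dots> = ennreal (e1\<^sup>2 * (C1 * (rate DIM('a) t)\<^sup>2) + N\<^sup>2 * (C3 * ((rate DIM('a) t)\<^sup>2 / ln t)))"
    proof -
      have "0 \<le> e1\<^sup>2 * (C1 * (rate DIM('a) t)\<^sup>2)" "0 \<le> C3 * ((rate DIM('a) t)\<^sup>2 / ln t)" "0 \<le> N\<^sup>2 * (C3 * ((rate DIM('a) t)\<^sup>2 / ln t))" "0 \<le> C1 * (rate DIM('a) t)\<^sup>2"
        using C1 C3 l by auto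
      then show ?thesis by (simp only: ennreal_mult[symmetric] ennreal_plus[symmetric] zero_le_power2)
    qed
    also have "\<dots> \<le> ennreal ((e / 2 + N\<^sup>2 * C3 / ln t) * (rate DIM('a) t)\<^sup>2)"
    proof (rule ennreal_leI)
      have "e1\<^sup>2 * C1 * (rate DIM('a) t)\<^sup>2 \<le> e / 2 * (rate DIM('a) t)\<^sup>2"
        using e1 by (intro mult_right_mono) auto
      then show "e1\<^sup>2 * (C1 * (rate DIM('a) t)\<^sup>2) + N\<^sup>2 * (C3 * ((rate DIM('a) t)\<^sup>2 / ln t)) \<le> (e / 2 + N\<^sup>2 * C3 / ln t) * (rate DIM('a) t)\<^sup>2"
        by (simp add: distrib_right mult.assoc)
    qed
    finally show ?thesis .
  qed
  have "((\<lambda>t. N\<^sup>2 * C3 / ln t) \<longlongrightarrow> 0) at_top"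
    by (intro real_tendsto_divide_at_top[OF tendsto_const] ln_at_top)
  then have "eventually (\<lambda>t. N\<^sup>2 * C3 / ln t < e / 2) at_top"
    by (rule order_tendstoD) (use e in simp)
  then show ?thesis
    using eventually_ge_at_top[of 3]
  proof eventually_elim
    case (elim t)
    have "(e / 2 + N\<^sup>2 * C3 / ln t) * (rate DIM('a) t)\<^sup>2 \<le> e * (rate DIM('a) t)\<^sup>2"
    proof (rule mult_right_mono)
      show "e / 2 + N\<^sup>2 * C3 / ln t \<le> e" using elim(1) by linarith
    qed simp
    then show ?case using order_trans[OF bound[OF elim(2)] ennreal_leI] by blast
  qed
qed

section \<open>Distance of the solution from the profile\<close>

lemma cmod_bessel_symbol:
  "cmod (bessel_symbol (2 * real j) f \<xi>) = cmod (fourier f \<xi>) / (1 + (norm \<xi>)\<^sup>2) ^ j"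
proof -
  have p: "1 + (norm \<xi>)\<^sup>2 > 0" by (simp add: add_pos_nonneg)
  have "sqrt (1 + (norm \<xi>)\<^sup>2) powr (- (2 * real j)) = inverse (sqrt (1 + (norm \<xi>)\<^sup>2) powr real (2 * j))"
    by (simp add: powr_minus)
  also have "sqrt (1 + (norm \<xi>)\<^sup>2) powr real (2 * j) = sqrt (1 + (norm \<xi>)\<^sup>2) ^ (2 * j)"
    using p by (intro powr_realpow) simp
  also have "\<dots> = (1 + (norm \<xi>)\<^sup>2) ^ j" using p by (simp add: power_mult)
  finally have "japanese_bracket \<xi> powr (- (2 * real j)) = inverse ((1 + (norm \<xi>)\<^sup>2) ^ j)"
    by (simp add: japanese_bracket_def)
  then show ?thesis
    using p unfolding bessel_symbol_def norm_mult norm_of_real by (simp add: divide_inverse mult.commute)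
qed

definition data_norm :: "(nat \<Rightarrow> 'a::euclidean_space \<Rightarrow> complex) \<Rightarrow> real" where
  "data_norm \<phi> = (\<Sum>j\<in>{0,1,2}. norm_Hneg_L1 (2 * real j) (\<phi> j))"

lemma norm_L1_nonneg: "0 \<le> norm_L1 f"
  by (simp add: norm_L1_def)

lemma norm_Hneg_nonneg: "0 \<le> norm_Hneg s f"
  by (simp add: norm_Hneg_def norm_L2_nonneg)

lemma data_norm_ge:
  shows "norm_L1 (\<phi> 0) + norm_L1 (\<phi> 1) + norm_L1 (\<phi> 2) \<le> data_norm \<phi>"
    and "j \<in> {0,1,2} \<Longrightarrow> norm_Hneg (2 * real j) (\<phi> j) \<le> data_norm \<phi>"
    and "0 \<le> data_norm \<phi>"
  using norm_L1_nonneg[of "\<phi> 0"] norm_L1_nonneg[of "\<phi> 1"] norm_L1_nonneg[of "\<phi> 2"]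
    norm_Hneg_nonneg[of "2 * real 0" "\<phi> 0"] norm_Hneg_nonneg[of "2 * real 1" "\<phi> 1"] norm_Hneg_nonneg[of "2 * real 2" "\<phi> 2"]
  by (auto simp: data_norm_def norm_Hneg_L1_def)

text \<open>The transform of \<phi> 2 is kept as a function of \<xi>. This makes the bound
  quantitative, with C fixed before the data; replacing the transform by its value at zero depends
  on the data and is done separately.\<close>

lemma solution_error:
  fixes \<gamma> b \<nu> \<kappa> \<delta> m :: real
  assumes \<delta>: "\<delta> = diffusion_coeff \<gamma> b \<nu> \<kappa>" and m: "m = \<kappa> * (\<gamma> - 1) * (b * \<nu> - \<kappa>)"
    and pos: "\<kappa> > 0" "m > 0" and kd: "\<kappa> \<le> \<delta> / 2"
  obtains C where "C \<ge> 0"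
    "\<And>(\<phi> :: nat \<Rightarrow> 'a::euclidean_space \<Rightarrow> complex) u t.
       \<lbrakk>\<And>j. j \<in> {0,1,2} \<Longrightarrow> \<phi> j \<in> Hneg_L1 (2 * real j);
        \<And>\<xi>. solves_freq_ode \<gamma> b \<nu> \<kappa> (norm \<xi>) (fourier (\<phi> 0) \<xi>) (fourier (\<phi> 1) \<xi>) (fourier (\<phi> 2) \<xi>) (\<lambda>t. u t \<xi>);
        u t \<in> borel_measurable borel; t \<ge> 3\<rbrakk> \<Longrightarrow>
       nnL2 (\<lambda>\<xi>. u t \<xi> - profile_symbol \<kappa> \<delta> t \<xi> * fourier (\<phi> 2) \<xi>)
         \<le> ennreal (C * (data_norm \<phi>)\<^sup>2 * ((rate DIM('a) t)\<^sup>2 / ln t))"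
proof -
  let ?n = "DIM('a)"
  have dp: "\<delta> > 0" using kd pos by simp
  obtain r0 Cl cl where r0: "0 < r0" "r0 \<le> 1" and Cl: "0 < Cl" "0 < cl"
    and low: "\<And>r t (a0::complex) a1 a2 u v w. \<lbrakk>0 < r; r \<le> r0; 0 \<le> t; freq_system \<delta> \<kappa> m r u v w (\<lambda>_. 0);
       u 0 = a0; v 0 = a1; w 0 = a2 + r\<^sup>2 *\<^sub>R a0 + (\<delta> * r\<^sup>2) *\<^sub>R a1\<rbrakk> \<Longrightarrow>
       norm (u t - prof \<kappa> \<delta> t r *\<^sub>R a2) \<le> Cl * (norm a0 + norm a1 + norm a2) * exp (- (cl * r\<^sup>2 * t)) / r \<and>
       norm (u t - prof \<kappa> \<delta> t r *\<^sub>R a2) \<le> Cl * (norm a0 + norm a1 + norm a2) * (1 + t)"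
    by (rule low_freq_bound[OF pos kd, where 'a=complex]) (rule that)
  obtain Ch ch where Ch: "0 < Ch" "0 < ch"
    and high: "\<And>r t (a0::complex) a1 a2 u v w. \<lbrakk>r0 \<le> r; 0 \<le> t; freq_system \<delta> \<kappa> m r u v w (\<lambda>_. 0);
       u 0 = a0; v 0 = a1; w 0 = a2 + r\<^sup>2 *\<^sub>R a0 + (\<delta> * r\<^sup>2) *\<^sub>R a1\<rbrakk> \<Longrightarrow>
       norm (u t) \<le> Ch * exp (- (ch * t)) * (norm a0 + norm a1 / r\<^sup>2 + norm a2 / r ^ 4)"
    by (rule high_freq_bound[OF pos dp r0(1), where 'a=complex]) (rule that)
  obtain C4 where C4: "C4 \<ge> 0" "\<And>t. t \<ge> 3 \<Longrightarrow>
    (\<integral>\<^sup>+\<xi>. ennreal ((min (1 + t) (exp (- (cl * (norm (\<xi>::'a))\<^sup>2 * t)) / norm \<xi>))\<^sup>2) * indicator {..r0} (norm \<xi>) \<partial>lborel)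
      \<le> ennreal (C4 * ((rate ?n t)\<^sup>2 / ln t))"
    using nn_integral_low_err[OF Cl(2) r0, where 'a='a] by blast
  obtain C3 where C3: "C3 \<ge> 0" "\<And>t. t \<ge> 3 \<Longrightarrow>
    (\<integral>\<^sup>+\<xi>. ennreal ((prof \<kappa> \<delta> t (norm (\<xi>::'a)))\<^sup>2) * indicator {r0..} (norm \<xi>) \<partial>lborel)
      \<le> ennreal (C3 * ((rate ?n t)\<^sup>2 / ln t))"
    using nn_integral_prof_tail[OF pos(1) kd r0(1), where 'a='a] by blast
  \<comment> \<open>For r \<ge> r0 this constant turns 1 / r^2 into a multiple of the Bessel weight
    1 / (1 + r^2).\<close>
  define K where "K = 1 + 1 / r0\<^sup>2"
  have K: "K \<ge> 1" using r0 by (simp add: K_def)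
  \<comment> \<open>6 = 2 * 3: the 2 separates solution and profile, the 3 the three data terms; K ^
    4 is the square of the amplitude factor K^2.\<close>
  define Q where "Q = 6 * Ch\<^sup>2 * K ^ 4"
  have Q: "Q \<ge> 0" using K by (simp add: Q_def)
  define G where "G = (real ?n / (2 * ch)) ^ ?n"
  have G: "G \<ge> 0" using Ch by (simp add: G_def)
  define H where "H = 4 * (2 * pi) ^ ?n"
  have H: "H \<ge> 0" by (simp add: H_def)
  define C where "C = Cl\<^sup>2 * C4 + Q * G * (3 * H) + 2 * C3"
  show ?thesis
  proof (rule that[of C])
    show "0 \<le> C" using C4 C3 Q G H by (simp add: C_def)
    fix \<phi> :: "nat \<Rightarrow> 'a \<Rightarrow> complex" and u t
    assume \<phi>: "\<And>j. j \<in> {0,1,2} \<Longrightarrow> \<phi> j \<in> Hneg_L1 (2 * real j)"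
      and ode: "\<And>\<xi>. solves_freq_ode \<gamma> b \<nu> \<kappa> (norm \<xi>) (fourier (\<phi> 0) \<xi>) (fourier (\<phi> 1) \<xi>) (fourier (\<phi> 2) \<xi>) (\<lambda>t. u t \<xi>)"
      and um[measurable]: "u t \<in> borel_measurable borel" and t: "t \<ge> 3"
    have l: "ln t \<ge> 1" by (rule ln_ge_1[OF t])
    have "integrable lborel (\<phi> 0)" "integrable lborel (\<phi> 1)" "integrable lborel (\<phi> 2)"
      using \<phi> by (auto simp: Hneg_L1_def L1_def)
    then have [measurable]: "\<phi> 0 \<in> borel_measurable borel" "\<phi> 1 \<in> borel_measurable borel" "\<phi> 2 \<in> borel_measurable borel"
      by auto
    have [measurable]: "bessel_symbol s (\<phi> 0) \<in> borel_measurable borel" "bessel_symbol s (\<phi> 1) \<in> borel_measurable borel"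
      "bessel_symbol s (\<phi> 2) \<in> borel_measurable borel" for s
      unfolding bessel_symbol_def[abs_def] japanese_bracket_def by measurable
    define S where "S = data_norm \<phi>"
    have S: "0 \<le> S" by (simp add: S_def data_norm_ge)
    define h where "h \<xi> = min (1 + t) (exp (- (cl * (norm \<xi>)\<^sup>2 * t)) / norm \<xi>)" for \<xi> :: 'a
    define B where "B j \<xi> = (cmod (bessel_symbol (2 * real j) (\<phi> j) \<xi>))\<^sup>2" for j \<xi>
    define E where "E = exp (- (2 * ch * t))"
    let ?p = "\<lambda>\<xi>::'a. (prof \<kappa> \<delta> t (norm \<xi>))\<^sup>2"
    have a_le: "cmod (fourier (\<phi> 0) \<xi>) + cmod (fourier (\<phi> 1) \<xi>) + cmod (fourier (\<phi> 2) \<xi>) \<le> S" for \<xi>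
      using cmod_fourier_le[of "\<phi> 0" \<xi>] cmod_fourier_le[of "\<phi> 1" \<xi>] cmod_fourier_le[of "\<phi> 2" \<xi>] data_norm_ge(1)[of \<phi>]
      by (simp add: S_def)
    \<comment> \<open>Up to r0 the error bound is used; above r0 solution and profile are estimated
      separately, each being small there on its own.\<close>
    have pw: "ennreal ((cmod (u t \<xi> - profile_symbol \<kappa> \<delta> t \<xi> * fourier (\<phi> 2) \<xi>))\<^sup>2)
      \<le> ennreal (Cl\<^sup>2 * S\<^sup>2) * (ennreal ((h \<xi>)\<^sup>2) * indicator {..r0} (norm \<xi>))
        + (ennreal (Q * E) * (ennreal (B 0 \<xi>) + ennreal (B 1 \<xi>) + ennreal (B 2 \<xi>))
        + ennreal (2 * S\<^sup>2) * (ennreal (?p \<xi>) * indicator {r0..} (norm \<xi>)))" if \<xi>: "norm \<xi> > 0" for \<xi>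
    proof -
      define r where "r = norm \<xi>"
      define a0 a1 a2 where "a0 = fourier (\<phi> 0) \<xi>" "a1 = fourier (\<phi> 1) \<xi>" "a2 = fourier (\<phi> 2) \<xi>"
      note a_def = a0_a1_a2_def
      have r: "r > 0" using \<xi> by (simp add: r_def)
      have aS: "cmod a0 + cmod a1 + cmod a2 \<le> S" using a_le[of \<xi>] by (simp add: a_def)
      then have aS2: "cmod a2 \<le> S" using norm_ge_zero[of a0] norm_ge_zero[of a1] by linarith
      obtain v w where sys: "freq_system \<delta> \<kappa> m r (\<lambda>t. u t \<xi>) v w (\<lambda>_. 0)"
        and init: "u 0 \<xi> = a0" "v 0 = a1" "w 0 = a2 + r\<^sup>2 *\<^sub>R a0 + (\<delta> * r\<^sup>2) *\<^sub>R a1"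
        by (rule solves_freq_ode_imp_system[OF ode[of \<xi>, folded r_def a_def] \<delta> m dp pos r]) (rule that)
      define d where "d = cmod (u t \<xi> - prof \<kappa> \<delta> t r *\<^sub>R a2)"
      have d: "cmod (u t \<xi> - profile_symbol \<kappa> \<delta> t \<xi> * fourier (\<phi> 2) \<xi>) = d"
        by (simp add: d_def profile_symbol_eq r_def a_def scaleR_conv_of_real)
      have d0: "0 \<le> d" by (simp add: d_def)
      show ?thesis
      proof (cases "r \<le> r0")
        case True
        have "d \<le> Cl * (cmod a0 + cmod a1 + cmod a2) * exp (- (cl * r\<^sup>2 * t)) / r"
          "d \<le> Cl * (cmod a0 + cmod a1 + cmod a2) * (1 + t)"
          using low[OF r True _ sys init] t by (auto simp: d_def)
        moreover have "Cl * (cmod a0 + cmod a1 + cmod a2) * exp (- (cl * r\<^sup>2 * t)) / r \<le> Cl * S * exp (- (cl * r\<^sup>2 * t)) / r"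
          using aS Cl r by (intro divide_right_mono mult_right_mono mult_left_mono) auto
        moreover have "Cl * (cmod a0 + cmod a1 + cmod a2) * (1 + t) \<le> Cl * S * (1 + t)"
          using aS Cl t by (intro mult_right_mono mult_left_mono) auto
        ultimately have "d \<le> Cl * S * (exp (- (cl * r\<^sup>2 * t)) / r)" "d \<le> Cl * S * (1 + t)" by auto
        then have "d \<le> Cl * S * h \<xi>" unfolding h_def r_def[symmetric] by (simp add: min_def)
        then have "d\<^sup>2 \<le> (Cl * S * h \<xi>)\<^sup>2" using d0 by (intro power_mono)
        also have "\<dots> = (Cl\<^sup>2 * S\<^sup>2) * (h \<xi>)\<^sup>2" by (simp add: power_mult_distrib)
        finally have "ennreal (d\<^sup>2) \<le> ennreal ((Cl\<^sup>2 * S\<^sup>2) * (h \<xi>)\<^sup>2)" by (rule ennreal_leI)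
        also have "\<dots> = ennreal (Cl\<^sup>2 * S\<^sup>2) * ennreal ((h \<xi>)\<^sup>2)" by (rule ennreal_mult) auto
        finally show ?thesis
          unfolding d using True by (simp add: r_def add_increasing2)
      next
        case False
        then have rr: "r0 \<le> r" by simp
        define x where "x = 1 + r\<^sup>2"
        have x: "x \<ge> 1" by (simp add: x_def)
        have rx: "1 / r\<^sup>2 \<le> K / x"
        proof -
          have "1 / r\<^sup>2 \<le> 1 / r0\<^sup>2" using rr r0 by (intro divide_left_mono power_mono) auto
          then have "x / r\<^sup>2 \<le> K" using r by (simp add: x_def K_def add_divide_distrib)
          then show ?thesis using x r by (simp add: field_simps)
        qed
        define b0 b1 b2 where "b0 = cmod (bessel_symbol (2 * real 0) (\<phi> 0) \<xi>)" "b1 = cmod (bessel_symbol (2 * real 1) (\<phi> 1) \<xi>)" "b2 = cmod (bessel_symbol (2 * real 2) (\<phi> 2) \<xi>)"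
        note b_def = b0_b1_b2_def
        have b: "b0 = cmod a0" "b1 = cmod a1 / x" "b2 = cmod a2 / x\<^sup>2"
          unfolding b_def cmod_bessel_symbol a_def x_def r_def by simp_all
        have bb: "0 \<le> b0" "0 \<le> b1" "0 \<le> b2" by (simp_all add: b_def)
        have "cmod (u t \<xi>) \<le> Ch * exp (- (ch * t)) * (cmod a0 + cmod a1 / r\<^sup>2 + cmod a2 / r ^ 4)"
          using high[OF rr _ sys init] t by simp
        also have "\<dots> \<le> Ch * exp (- (ch * t)) * (K\<^sup>2 * b0 + K\<^sup>2 * b1 + K\<^sup>2 * b2)"
        proof (intro mult_left_mono add_mono)
          have "1 \<le> K\<^sup>2" "K \<le> K\<^sup>2"
            using one_le_power[OF K, of 2] mult_left_mono[OF K, of K] K by (simp_all add: power2_eq_square)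
          then show "cmod a0 \<le> K\<^sup>2 * b0" using b bb mult_right_mono[of 1 "K\<^sup>2" b0] by simp
          have "cmod a1 / r\<^sup>2 \<le> K * b1"
            using mult_left_mono[OF rx, of "cmod a1"] b by (simp add: mult.commute)
          also have "\<dots> \<le> K\<^sup>2 * b1" using \<open>K \<le> K\<^sup>2\<close> bb by (intro mult_right_mono)
          finally show "cmod a1 / r\<^sup>2 \<le> K\<^sup>2 * b1" .
          have "(1 / r\<^sup>2)\<^sup>2 \<le> (K / x)\<^sup>2" using rx by (intro power_mono) auto
          then have "cmod a2 * (1 / r\<^sup>2)\<^sup>2 \<le> cmod a2 * (K / x)\<^sup>2" by (intro mult_left_mono) auto
          then show "cmod a2 / r ^ 4 \<le> K\<^sup>2 * b2" using b by (simp add: power_divide mult.commute flip: power_mult)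
        qed (use Ch in auto)
        also have "\<dots> = Ch * K\<^sup>2 * exp (- (ch * t)) * (b0 + b1 + b2)" by (simp add: algebra_simps)
        finally have "(cmod (u t \<xi>))\<^sup>2 \<le> (Ch * K\<^sup>2 * exp (- (ch * t)) * (b0 + b1 + b2))\<^sup>2" by (intro power_mono) auto
        also have "\<dots> = Ch\<^sup>2 * K ^ 4 * E * (b0 + b1 + b2)\<^sup>2"
          unfolding E_def by (simp add: power_mult_distrib power2_eq_square[of "exp _"] exp_add[symmetric] flip: power_mult)
        also have "\<dots> \<le> Ch\<^sup>2 * K ^ 4 * E * (3 * (b0\<^sup>2 + b1\<^sup>2 + b2\<^sup>2))"
        proof (rule mult_left_mono)
          show "(b0 + b1 + b2)\<^sup>2 \<le> 3 * (b0\<^sup>2 + b1\<^sup>2 + b2\<^sup>2)"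
            using sum_squares_bound[of b0 b1] sum_squares_bound[of b0 b2] sum_squares_bound[of b1 b2]
            by (simp add: power2_eq_square algebra_simps)
        qed (auto simp: E_def)
        finally have "2 * (cmod (u t \<xi>))\<^sup>2 \<le> 2 * (Ch\<^sup>2 * K ^ 4 * E * (3 * (b0\<^sup>2 + b1\<^sup>2 + b2\<^sup>2)))"
          by (rule mult_left_mono) simp
        moreover have "2 * (Ch\<^sup>2 * K ^ 4 * E * (3 * X)) = Q * E * X" for X
          by (simp add: Q_def)
        ultimately have u2: "2 * (cmod (u t \<xi>))\<^sup>2 \<le> Q * E * (b0\<^sup>2 + b1\<^sup>2 + b2\<^sup>2)"
          by (simp only:)
        have "d\<^sup>2 \<le> 2 * (cmod (u t \<xi>))\<^sup>2 + 2 * (cmod (prof \<kappa> \<delta> t r *\<^sub>R a2))\<^sup>2"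
          using norm_add_sq_le[of "u t \<xi>" "- (prof \<kappa> \<delta> t r *\<^sub>R a2)"] by (simp add: d_def)
        also have "(cmod (prof \<kappa> \<delta> t r *\<^sub>R a2))\<^sup>2 = (cmod a2)\<^sup>2 * ?p \<xi>"
          by (simp add: power_mult_distrib r_def)
        also have "2 * (cmod (u t \<xi>))\<^sup>2 + 2 * ((cmod a2)\<^sup>2 * ?p \<xi>) \<le> Q * E * (B 0 \<xi> + B 1 \<xi> + B 2 \<xi>) + (2 * S\<^sup>2) * ?p \<xi>"
        proof (rule add_mono)
          show "2 * (cmod (u t \<xi>))\<^sup>2 \<le> Q * E * (B 0 \<xi> + B 1 \<xi> + B 2 \<xi>)"
            using u2 by (simp add: B_def b_def)
          have "(cmod a2)\<^sup>2 * ?p \<xi> \<le> S\<^sup>2 * ?p \<xi>" using aS2 by (intro mult_right_mono power_mono) auto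
          then show "2 * ((cmod a2)\<^sup>2 * ?p \<xi>) \<le> (2 * S\<^sup>2) * ?p \<xi>" by simp
        qed
        finally have "ennreal (d\<^sup>2) \<le> ennreal (Q * E * (B 0 \<xi> + B 1 \<xi> + B 2 \<xi>) + (2 * S\<^sup>2) * ?p \<xi>)"
          by (rule ennreal_leI)
        also have "\<dots> = ennreal (Q * E) * (ennreal (B 0 \<xi>) + ennreal (B 1 \<xi>) + ennreal (B 2 \<xi>)) + ennreal (2 * S\<^sup>2) * ennreal (?p \<xi>)"
        proof -
          have n: "0 \<le> Q * E" "0 \<le> 2 * S\<^sup>2" "0 \<le> ?p \<xi>" "0 \<le> B 0 \<xi>" "0 \<le> B 1 \<xi>" "0 \<le> B 2 \<xi>" "0 \<le> B 0 \<xi> + B 1 \<xi>"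
            "0 \<le> B 0 \<xi> + B 1 \<xi> + B 2 \<xi>" "0 \<le> Q * E * (B 0 \<xi> + B 1 \<xi> + B 2 \<xi>)" "0 \<le> (2 * S\<^sup>2) * ?p \<xi>"
            using Q by (auto simp: E_def B_def)
          show ?thesis using n by (simp only: ennreal_plus ennreal_mult)
        qed
        finally show ?thesis
          unfolding d using rr by (simp add: r_def add_increasing)
      qed
    qed
    have hm[measurable]: "h \<in> borel_measurable borel" unfolding h_def by measurable
    have B01[measurable]: "B 0 \<in> borel_measurable borel" "B 1 \<in> borel_measurable borel" "B 2 \<in> borel_measurable borel"
      unfolding B_def by measurable
    have [measurable]: "B (Suc 0) \<in> borel_measurable borel" using B01(2) by simp
    have Bint: "(\<integral>\<^sup>+\<xi>. ennreal (B j \<xi>) \<partial>lborel) \<le> ennreal (H * S\<^sup>2)" if j: "j \<in> {0,1,2}" for j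
    proof -
      have "(\<integral>\<^sup>+\<xi>. ennreal (B j \<xi>) \<partial>lborel) \<le> ennreal (H * (norm_Hneg (2 * real j) (\<phi> j))\<^sup>2)"
        using nnL2_bessel_symbol_le[OF \<phi>[OF j]] by (simp add: nnL2_def B_def H_def)
      also have "\<dots> \<le> ennreal (H * S\<^sup>2)"
        using H data_norm_ge(2)[OF j, of \<phi>] norm_Hneg_nonneg[of "2 * real j" "\<phi> j"]
        by (intro ennreal_leI mult_left_mono power_mono) (auto simp: S_def)
      finally show ?thesis .
    qed
    define R where "R = (rate ?n t)\<^sup>2 / ln t"
    have R: "0 \<le> R" using l by (simp add: R_def)
    have ER: "E \<le> G * R"
    proof -
      have "E \<le> (real ?n / (2 * ch * t)) ^ ?n" unfolding E_def using Ch t by (intro exp_minus_le_power) auto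
      also have "\<dots> = G * (1 / t ^ ?n)" by (simp add: G_def power_divide power_mult_distrib)
      also have "\<dots> \<le> G * R" unfolding R_def by (intro mult_left_mono power_le_rate_sq t G)
      finally show ?thesis .
    qed
    have "nnL2 (\<lambda>\<xi>. u t \<xi> - profile_symbol \<kappa> \<delta> t \<xi> * fourier (\<phi> 2) \<xi>)
      \<le> (\<integral>\<^sup>+\<xi>. ennreal (Cl\<^sup>2 * S\<^sup>2) * (ennreal ((h \<xi>)\<^sup>2) * indicator {..r0} (norm \<xi>))
        + (ennreal (Q * E) * (ennreal (B 0 \<xi>) + ennreal (B 1 \<xi>) + ennreal (B 2 \<xi>))
        + ennreal (2 * S\<^sup>2) * (ennreal (?p \<xi>) * indicator {r0..} (norm \<xi>))) \<partial>lborel)"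
      unfolding nnL2_def by (rule nn_integral_mono_AE, use AE_norm_pos in eventually_elim) (rule pw)
    also have "\<dots> = ennreal (Cl\<^sup>2 * S\<^sup>2) * (\<integral>\<^sup>+\<xi>. ennreal ((h \<xi>)\<^sup>2) * indicator {..r0} (norm \<xi>) \<partial>lborel)
        + (ennreal (Q * E) * ((\<integral>\<^sup>+\<xi>. ennreal (B 0 \<xi>) \<partial>lborel) + (\<integral>\<^sup>+\<xi>. ennreal (B 1 \<xi>) \<partial>lborel) + (\<integral>\<^sup>+\<xi>. ennreal (B 2 \<xi>) \<partial>lborel))
        + ennreal (2 * S\<^sup>2) * (\<integral>\<^sup>+\<xi>. ennreal (?p \<xi>) * indicator {r0..} (norm \<xi>) \<partial>lborel))"
      by (simp add: nn_integral_add nn_integral_cmult)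
    also have "\<dots> \<le> ennreal (Cl\<^sup>2 * S\<^sup>2) * ennreal (C4 * R)
        + (ennreal (Q * E) * (ennreal (H * S\<^sup>2) + ennreal (H * S\<^sup>2) + ennreal (H * S\<^sup>2))
        + ennreal (2 * S\<^sup>2) * ennreal (C3 * R))"
      unfolding R_def h_def by (intro add_mono mult_left_mono C4(2) C3(2) t Bint) auto
    also have "\<dots> = ennreal ((Cl\<^sup>2 * S\<^sup>2) * (C4 * R) + ((Q * E) * (H * S\<^sup>2 + H * S\<^sup>2 + H * S\<^sup>2) + (2 * S\<^sup>2) * (C3 * R)))"
    proof -
      have n: "0 \<le> Cl\<^sup>2 * S\<^sup>2" "0 \<le> C4 * R" "0 \<le> Q * E" "0 \<le> H * S\<^sup>2" "0 \<le> H * S\<^sup>2 + H * S\<^sup>2" "0 \<le> H * S\<^sup>2 + H * S\<^sup>2 + H * S\<^sup>2"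
         "0 \<le> 2 * S\<^sup>2" "0 \<le> C3 * R" "0 \<le> (Cl\<^sup>2 * S\<^sup>2) * (C4 * R)" "0 \<le> (Q * E) * (H * S\<^sup>2 + H * S\<^sup>2 + H * S\<^sup>2)" "0 \<le> (2 * S\<^sup>2) * (C3 * R)"
         "0 \<le> (Q * E) * (H * S\<^sup>2 + H * S\<^sup>2 + H * S\<^sup>2) + (2 * S\<^sup>2) * (C3 * R)"
        using C4 C3 R Q H by (auto simp: E_def intro!: add_nonneg_nonneg mult_nonneg_nonneg)
      show ?thesis using n by (simp only: ennreal_plus ennreal_mult)
    qed
    also have "\<dots> \<le> ennreal (C * S\<^sup>2 * R)"
    proof (rule ennreal_leI)
      have "(Q * E) * (H * S\<^sup>2 + H * S\<^sup>2 + H * S\<^sup>2) \<le> (Q * (G * R)) * (H * S\<^sup>2 + H * S\<^sup>2 + H * S\<^sup>2)"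
        using ER Q H by (intro mult_right_mono mult_left_mono) auto
      then show "(Cl\<^sup>2 * S\<^sup>2) * (C4 * R) + ((Q * E) * (H * S\<^sup>2 + H * S\<^sup>2 + H * S\<^sup>2) + (2 * S\<^sup>2) * (C3 * R)) \<le> C * S\<^sup>2 * R"
        by (simp add: C_def algebra_simps)
    qed
    finally show "nnL2 (\<lambda>\<xi>. u t \<xi> - profile_symbol \<kappa> \<delta> t \<xi> * fourier (\<phi> 2) \<xi>)
         \<le> ennreal (C * (data_norm \<phi>)\<^sup>2 * ((rate ?n t)\<^sup>2 / ln t))" by (simp add: S_def R_def)
  qed
qed

lemma norm_L2_le:
  assumes "f \<in> L2" "nnL2 f \<le> ennreal (x\<^sup>2)" "0 \<le> x"
  shows "norm_L2 f \<le> x"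
proof (rule power2_le_imp_le)
  show "(norm_L2 f)\<^sup>2 \<le> x\<^sup>2"
    using assms(2) by (simp add: nnL2_eq_norm_L2[OF assms(1)])
qed (rule assms(3))

lemma nnL2_profile_symbol_mult:
  "nnL2 (\<lambda>\<xi>::'a::euclidean_space. profile_symbol \<kappa> \<delta> t \<xi> * P)
    = ennreal ((cmod P)\<^sup>2) * (\<integral>\<^sup>+\<xi>. ennreal ((prof \<kappa> \<delta> t (norm (\<xi>::'a)))\<^sup>2) \<partial>lborel)"
proof -
  have "nnL2 (\<lambda>\<xi>::'a. profile_symbol \<kappa> \<delta> t \<xi> * P)
    = (\<integral>\<^sup>+\<xi>. ennreal ((cmod P)\<^sup>2) * ennreal ((prof \<kappa> \<delta> t (norm (\<xi>::'a)))\<^sup>2) \<partial>lborel)"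
    unfolding nnL2_def
    by (intro nn_integral_cong) (simp add: profile_symbol_eq norm_mult power_mult_distrib ennreal_mult mult.commute)
  also have "\<dots> = ennreal ((cmod P)\<^sup>2) * (\<integral>\<^sup>+\<xi>. ennreal ((prof \<kappa> \<delta> t (norm (\<xi>::'a)))\<^sup>2) \<partial>lborel)"
    by (rule nn_integral_cmult) measurable
  finally show ?thesis .
qed

section \<open>The Cauchy problem\<close>

locale cauchy_parameters =
  fixes \<gamma> b \<nu> \<kappa> \<delta> :: real
  assumes gamma: "1 < \<gamma>" "\<gamma> \<le> 5 / 3" and pos: "0 < b" "0 < \<nu>" "0 < \<kappa>"
    and delta: "\<delta> = diffusion_coeff \<gamma> b \<nu> \<kappa>" and small: "\<kappa> / \<delta> < 1 / 2"
begin

lemma \<kappa>_less: "\<kappa> < \<delta> / 2"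
proof -
  have "\<delta> > 0" using gamma pos by (simp add: delta diffusion_coeff_def add_pos_pos)
  then show ?thesis using small by (simp add: field_simps)
qed

text \<open>Since \<gamma> - 1 \<le> 1, \<delta> is at most b \<nu> + \<kappa>; together with 2
  \<kappa> < \<delta> this gives \<kappa> < b \<nu>.\<close>

lemma m_pos: "0 < \<kappa> * (\<gamma> - 1) * (b * \<nu> - \<kappa>)"
proof -
  have "(\<gamma> - 1) * \<kappa> \<le> 1 * \<kappa>" using gamma pos by (intro mult_right_mono) auto
  then have "\<kappa> < b * \<nu>" using \<kappa>_less by (simp add: delta diffusion_coeff_def)
  then show ?thesis using gamma pos by simp
qed

end

text \<open>The frequency-side solution, existentially bound in \<open>is_solution\<close>, is fixed
  as a parameter so that estimates can refer to it.\<close>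

locale cauchy_solution = cauchy_parameters +
  fixes \<phi> :: "nat \<Rightarrow> 'a::euclidean_space \<Rightarrow> complex" and \<psi> u :: "real \<Rightarrow> 'a \<Rightarrow> complex"
  assumes data: "\<And>j. j \<in> {0,1,2} \<Longrightarrow> \<phi> j \<in> Hneg_L1 (2 * real j)"
    and ode: "\<And>\<xi>. solves_freq_ode \<gamma> b \<nu> \<kappa> (norm \<xi>) (fourier (\<phi> 0) \<xi>) (fourier (\<phi> 1) \<xi>)
            (fourier (\<phi> 2) \<xi>) (\<lambda>t. u t \<xi>)"
    and transform: "\<And>t. t \<ge> 0 \<Longrightarrow> is_fourier_L2 (\<psi> t) (u t)"
begin

abbreviation (input) P :: complex where "P \<equiv> total_integral (\<phi> 2)"

lemma \<psi>_L2: "t \<ge> 0 \<Longrightarrow> \<psi> t \<in> L2" and u_L2: "t \<ge> 0 \<Longrightarrow> u t \<in> L2"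
  using transform by (auto simp: is_fourier_L2_def)

lemma u_measurable: "t \<ge> 0 \<Longrightarrow> u t \<in> borel_measurable borel"
  using u_L2[THEN L2_measurable] by simp

lemma data_integrable: "integrable lborel (\<phi> 2)"
  using data[of 2] by (simp add: Hneg_L1_def L1_def)

lemma profile_symbol_L1_L2:
  assumes "t > 0"
  shows "integrable lborel (\<lambda>\<xi>::'a. profile_symbol \<kappa> \<delta> t \<xi> * P)" "(\<lambda>\<xi>::'a. profile_symbol \<kappa> \<delta> t \<xi> * P) \<in> L2"
  using integrable_profile_symbol[OF pos(3) less_imp_le[OF \<kappa>_less] assms, where 'a='a]
    L2_cmult[of "profile_symbol \<kappa> \<delta> t :: 'a \<Rightarrow> complex" P] by (simp_all add: mult.commute)

end

context cauchy_parameters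
begin

text \<open>The existential form puts C before the data and the time, as the constant of the upper
  bound may depend on the parameters only.\<close>

lemma frequency_error:
  "\<exists>C\<ge>0. \<forall>(\<phi> :: nat \<Rightarrow> 'a::euclidean_space \<Rightarrow> complex) \<psi> u t. cauchy_solution \<gamma> b \<nu> \<kappa> \<delta> \<phi> \<psi> u \<longrightarrow> t \<ge> 3 \<longrightarrow>
       nnL2 (\<lambda>\<xi>. u t \<xi> - profile_symbol \<kappa> \<delta> t \<xi> * fourier (\<phi> 2) \<xi>)
         \<le> ennreal (C * (data_norm \<phi>)\<^sup>2 * ((rate DIM('a) t)\<^sup>2 / ln t))"
proof (rule solution_error[OF delta refl pos(3) m_pos less_imp_le[OF \<kappa>_less], where 'a='a], intro exI conjI allI impI)
  fix C :: real and \<phi> :: "nat \<Rightarrow> 'a \<Rightarrow> complex" and \<psi> u and t :: real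
  assume C: "C \<ge> 0" and le: "\<And>(\<phi> :: nat \<Rightarrow> 'a \<Rightarrow> complex) u t.
       \<lbrakk>\<And>j. j \<in> {0,1,2} \<Longrightarrow> \<phi> j \<in> Hneg_L1 (2 * real j);
        \<And>\<xi>. solves_freq_ode \<gamma> b \<nu> \<kappa> (norm \<xi>) (fourier (\<phi> 0) \<xi>) (fourier (\<phi> 1) \<xi>) (fourier (\<phi> 2) \<xi>) (\<lambda>t. u t \<xi>);
        u t \<in> borel_measurable borel; t \<ge> 3\<rbrakk> \<Longrightarrow>
       nnL2 (\<lambda>\<xi>. u t \<xi> - profile_symbol \<kappa> \<delta> t \<xi> * fourier (\<phi> 2) \<xi>)
         \<le> ennreal (C * (data_norm \<phi>)\<^sup>2 * ((rate DIM('a) t)\<^sup>2 / ln t))"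
  show "C \<ge> 0" by (rule C)
  assume sol: "cauchy_solution \<gamma> b \<nu> \<kappa> \<delta> \<phi> \<psi> u" and t: "3 \<le> t"
  interpret cauchy_solution \<gamma> b \<nu> \<kappa> \<delta> \<phi> \<psi> u by (rule sol)
  have "u t \<in> borel_measurable borel" using t by (simp add: u_measurable)
  from le[OF data ode this t]
  show "nnL2 (\<lambda>\<xi>. u t \<xi> - profile_symbol \<kappa> \<delta> t \<xi> * fourier (\<phi> 2) \<xi>)
       \<le> ennreal (C * (data_norm \<phi>)\<^sup>2 * ((rate DIM('a) t)\<^sup>2 / ln t))" .
qed

end

context cauchy_solution
begin

text \<open>Combines the two sources of error. The one from the equation is uniform in the data, the
  one from freezing is not, which is why the bound is only eventual.\<close>

lemma freq_asymptotics:
  assumes e: "e > 0"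
  shows "eventually (\<lambda>t. nnL2 (\<lambda>\<xi>. u t \<xi> - profile_symbol \<kappa> \<delta> t \<xi> * P)
     \<le> ennreal (e * (rate DIM('a) t)\<^sup>2)) at_top"
proof -
  have k: "\<kappa> \<le> \<delta> / 2" using \<kappa>_less by simp
  obtain C where C: "C \<ge> 0" and err: "\<And>t. t \<ge> 3 \<Longrightarrow>
       nnL2 (\<lambda>\<xi>. u t \<xi> - profile_symbol \<kappa> \<delta> t \<xi> * fourier (\<phi> 2) \<xi>)
         \<le> ennreal (C * (data_norm \<phi>)\<^sup>2 * ((rate DIM('a) t)\<^sup>2 / ln t))"
    using frequency_error[where 'a='a] cauchy_solution_axioms by blast
  have fr: "eventually (\<lambda>t. nnL2 (\<lambda>\<xi>. profile_symbol \<kappa> \<delta> t \<xi> * (fourier (\<phi> 2) \<xi> - P))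
     \<le> ennreal (e / 4 * (rate DIM('a) t)\<^sup>2)) at_top"
    by (rule profile_symbol_freeze[OF pos(3) k data_integrable]) (use e in simp)
  have "((\<lambda>t. C * (data_norm \<phi>)\<^sup>2 / ln t) \<longlongrightarrow> 0) at_top"
    by (intro real_tendsto_divide_at_top[OF tendsto_const] ln_at_top)
  then have "eventually (\<lambda>t. C * (data_norm \<phi>)\<^sup>2 / ln t < e / 4) at_top"
    by (rule order_tendstoD) (use e in simp)
  then show ?thesis
    using fr eventually_ge_at_top[of 3]
  proof eventually_elim
    case (elim t)
    have [measurable]: "\<phi> 2 \<in> borel_measurable borel" using data_integrable by auto
    have [measurable]: "u t \<in> borel_measurable borel" using u_measurable elim by simp
    have [measurable]: "(profile_symbol \<kappa> \<delta> t :: 'a \<Rightarrow> complex) \<in> borel_measurable borel"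
      unfolding profile_symbol_eq[abs_def] by measurable
    have "nnL2 (\<lambda>\<xi>. u t \<xi> - profile_symbol \<kappa> \<delta> t \<xi> * P)
      \<le> 2 * nnL2 (\<lambda>\<xi>. u t \<xi> - profile_symbol \<kappa> \<delta> t \<xi> * fourier (\<phi> 2) \<xi>)
        + 2 * nnL2 (\<lambda>\<xi>. profile_symbol \<kappa> \<delta> t \<xi> * (fourier (\<phi> 2) \<xi> - P))"
      using nnL2_add_le[of "\<lambda>\<xi>. u t \<xi> - profile_symbol \<kappa> \<delta> t \<xi> * fourier (\<phi> 2) \<xi>"
          "\<lambda>\<xi>. profile_symbol \<kappa> \<delta> t \<xi> * (fourier (\<phi> 2) \<xi> - P)"]
      by (simp add: right_diff_distrib)
    also have "\<dots> \<le> 2 * ennreal (C * (data_norm \<phi>)\<^sup>2 * ((rate DIM('a) t)\<^sup>2 / ln t)) + 2 * ennreal (e / 4 * (rate DIM('a) t)\<^sup>2)"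
      by (intro add_mono mult_left_mono err elim) auto
    also have "\<dots> \<le> 2 * ennreal (e / 4 * (rate DIM('a) t)\<^sup>2) + 2 * ennreal (e / 4 * (rate DIM('a) t)\<^sup>2)"
    proof (intro add_right_mono mult_left_mono ennreal_leI)
      have "C * (data_norm \<phi>)\<^sup>2 * ((rate DIM('a) t)\<^sup>2 / ln t) = C * (data_norm \<phi>)\<^sup>2 / ln t * (rate DIM('a) t)\<^sup>2" by simp
      also have "\<dots> \<le> e / 4 * (rate DIM('a) t)\<^sup>2" using elim(1) by (intro mult_right_mono) auto
      finally show "C * (data_norm \<phi>)\<^sup>2 * ((rate DIM('a) t)\<^sup>2 / ln t) \<le> e / 4 * (rate DIM('a) t)\<^sup>2" .
    qed simp
    also have "\<dots> = ennreal (e * (rate DIM('a) t)\<^sup>2)"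
      using e by (simp add: numeral_mult_ennreal flip: ennreal_plus)
    finally show ?case .
  qed
qed

lemma solution_minus_profile_L2:
  assumes "t > 0"
  shows "(\<lambda>x. \<psi> t x - profile \<kappa> \<delta> (\<phi> 2) t x) \<in> L2"
  unfolding profile_eq_inv_fourier
  using assms by (intro L2_diff \<psi>_L2 norm_L2_plancherel_inv profile_symbol_L1_L2) auto

lemma solution_minus_profile_smallo:
  "(\<lambda>t. norm_L2 (\<lambda>x. \<psi> t x - profile \<kappa> \<delta> (\<phi> 2) t x)) \<in> o[at_top](rate DIM('a))"
proof (rule landau_o.smallI)
  fix c :: real assume c: "c > 0"
  define q where "q = (2 * pi) ^ DIM('a)"
  have q: "q > 0" by (simp add: q_def)
  \<comment> \<open>The factor q / 4 compensates the constant 4 / q of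
    \<open>is_fourier_L2_diff_le\<close>.\<close>
  have "eventually (\<lambda>t. nnL2 (\<lambda>\<xi>. u t \<xi> - profile_symbol \<kappa> \<delta> t \<xi> * P)
     \<le> ennreal (c\<^sup>2 * q / 4 * (rate DIM('a) t)\<^sup>2)) at_top"
    by (rule freq_asymptotics) (use c q in simp)
  then show "eventually (\<lambda>t. norm (norm_L2 (\<lambda>x. \<psi> t x - profile \<kappa> \<delta> (\<phi> 2) t x)) \<le> c * norm (rate DIM('a) t)) at_top"
    using eventually_gt_at_top[of 0]
  proof eventually_elim
    case (elim t)
    have "nnL2 (\<lambda>x. \<psi> t x - profile \<kappa> \<delta> (\<phi> 2) t x)
      \<le> ennreal (4 / q) * nnL2 (\<lambda>\<xi>. u t \<xi> - profile_symbol \<kappa> \<delta> t \<xi> * P)"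
      unfolding profile_eq_inv_fourier q_def
      using elim by (intro is_fourier_L2_diff_le transform profile_symbol_L1_L2) auto
    also have "\<dots> \<le> ennreal (4 / q) * ennreal (c\<^sup>2 * q / 4 * (rate DIM('a) t)\<^sup>2)"
      by (intro mult_left_mono elim) auto
    also have "\<dots> = ennreal (4 / q * (c\<^sup>2 * q / 4 * (rate DIM('a) t)\<^sup>2))"
      using q by (intro ennreal_mult[symmetric]) auto
    also have "4 / q * (c\<^sup>2 * q / 4 * (rate DIM('a) t)\<^sup>2) = (c * rate DIM('a) t)\<^sup>2"
      using q by (simp add: power_mult_distrib)
    finally have "norm_L2 (\<lambda>x. \<psi> t x - profile \<kappa> \<delta> (\<phi> 2) t x) \<le> c * rate DIM('a) t"
      using c elim by (intro norm_L2_le solution_minus_profile_L2) (auto simp: rate_nonneg)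
    then show ?case by (simp add: norm_L2_nonneg rate_nonneg)
  qed
qed

end

context cauchy_parameters
begin

lemma is_solution_imp:
  assumes "\<forall>j\<in>{0,1,2}. \<phi> j \<in> Hneg_L1 (2 * real j)" "is_solution \<gamma> b \<nu> \<kappa> \<phi> \<psi>"
  obtains u where "cauchy_solution \<gamma> b \<nu> \<kappa> \<delta> \<phi> \<psi> u"
proof -
  from assms(2) obtain u where
    "\<And>\<xi>. solves_freq_ode \<gamma> b \<nu> \<kappa> (norm \<xi>) (fourier (\<phi> 0) \<xi>) (fourier (\<phi> 1) \<xi>) (fourier (\<phi> 2) \<xi>) (\<lambda>t. u t \<xi>)"
    "\<And>t. t \<ge> 0 \<Longrightarrow> is_fourier_L2 (\<psi> t) (u t)"
    unfolding is_solution_def by blast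
  then have "cauchy_solution \<gamma> b \<nu> \<kappa> \<delta> \<phi> \<psi> u"
    by unfold_locales (use assms(1) in blast)+
  then show ?thesis by (rule that)
qed

text \<open>The squared profile is at least c |P|^2 times the squared rate, and the error is
  eventually at most a quarter of that; doubled by the triangle inequality, it is absorbed on the
  left. The starting time depends on the data through the error, the constant does not.\<close>

lemma solution_lower_bound:
  obtains C where "C > 0"
    "\<And>(\<phi> :: nat \<Rightarrow> 'a::euclidean_space \<Rightarrow> complex) \<psi> u. \<lbrakk>cauchy_solution \<gamma> b \<nu> \<kappa> \<delta> \<phi> \<psi> u; total_integral (\<phi> 2) \<noteq> 0\<rbrakk> \<Longrightarrow>
       \<exists>T. \<forall>t\<ge>T. rate DIM('a) t * cmod (total_integral (\<phi> 2)) \<le> C * norm_L2 (\<psi> t)"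
proof -
  define q where "q = (2 * pi) ^ DIM('a)"
  have q: "q > 0" by (simp add: q_def)
  obtain c T0 where c: "c > 0" and lower: "\<And>t. t \<ge> T0 \<Longrightarrow> ennreal (c * (rate DIM('a) t)\<^sup>2)
    \<le> (\<integral>\<^sup>+\<xi>. ennreal ((prof \<kappa> \<delta> t (norm (\<xi>::'a)))\<^sup>2) \<partial>lborel)"
    using nn_integral_prof_lower[OF pos(3) \<kappa>_less, where 'a='a] by blast
  show ?thesis
  \<comment> \<open>Two inequalities give 8 q, and absorbing half of the main term doubles
    it.\<close>
  proof (rule that[of "sqrt (16 * q / c)"])
    show "0 < sqrt (16 * q / c)" using q c by simp
    fix \<phi> :: "nat \<Rightarrow> 'a \<Rightarrow> complex" and \<psi> u
    assume sol: "cauchy_solution \<gamma> b \<nu> \<kappa> \<delta> \<phi> \<psi> u" and P0: "total_integral (\<phi> 2) \<noteq> 0"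
    interpret cauchy_solution \<gamma> b \<nu> \<kappa> \<delta> \<phi> \<psi> u by (rule sol)
    define p where "p = cmod P"
    have p: "p > 0" using P0 by (simp add: p_def)
    have "eventually (\<lambda>t. nnL2 (\<lambda>\<xi>. u t \<xi> - profile_symbol \<kappa> \<delta> t \<xi> * P)
       \<le> ennreal (p\<^sup>2 * c / 4 * (rate DIM('a) t)\<^sup>2)) at_top"
      by (rule freq_asymptotics) (use p c in simp)
    then have "eventually (\<lambda>t. rate DIM('a) t * p \<le> sqrt (16 * q / c) * norm_L2 (\<psi> t)) at_top"
      using eventually_ge_at_top[of T0] eventually_gt_at_top[of 0]
    proof eventually_elim
      case (elim t)
      let ?R = "(rate DIM('a) t)\<^sup>2"
      have uL: "u t \<in> L2" "\<psi> t \<in> L2" using elim u_L2 \<psi>_L2 by auto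
      have sL: "(\<lambda>\<xi>::'a. profile_symbol \<kappa> \<delta> t \<xi> * P) \<in> L2" using elim profile_symbol_L1_L2 by auto
      have "ennreal (p\<^sup>2 * (c * ?R)) = ennreal (p\<^sup>2) * ennreal (c * ?R)"
        using c by (intro ennreal_mult) auto
      also have "\<dots> \<le> nnL2 (\<lambda>\<xi>::'a. profile_symbol \<kappa> \<delta> t \<xi> * P)"
        unfolding nnL2_profile_symbol_mult p_def by (intro mult_left_mono lower elim) auto
      also have "\<dots> \<le> 2 * nnL2 (u t) + 2 * nnL2 (\<lambda>\<xi>. u t \<xi> - profile_symbol \<kappa> \<delta> t \<xi> * P)"
        using nnL2_diff_le[of "u t" "\<lambda>\<xi>. u t \<xi> - profile_symbol \<kappa> \<delta> t \<xi> * P"] L2_measurable[OF uL(1)] L2_measurable[OF L2_diff[OF uL(1) sL]]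
        by simp
      also have "\<dots> \<le> 2 * (ennreal (4 * q) * nnL2 (\<psi> t)) + 2 * ennreal (p\<^sup>2 * c / 4 * ?R)"
        unfolding q_def using elim by (intro add_mono mult_left_mono is_fourier_L2_le transform) auto
      also have "\<dots> = ennreal (2 * (4 * q * (norm_L2 (\<psi> t))\<^sup>2) + 2 * (p\<^sup>2 * c / 4 * ?R))"
      proof -
        have "ennreal (4 * q) * nnL2 (\<psi> t) = ennreal (4 * q * (norm_L2 (\<psi> t))\<^sup>2)"
          unfolding nnL2_eq_norm_L2[OF uL(2)] using q by (intro ennreal_mult[symmetric]) auto
        then show ?thesis using q c by (simp add: numeral_mult_ennreal)
      qed
      finally have "p\<^sup>2 * (c * ?R) \<le> 2 * (4 * q * (norm_L2 (\<psi> t))\<^sup>2) + 2 * (p\<^sup>2 * c / 4 * ?R)"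
        using q c by (subst (asm) ennreal_le_iff) auto
      then have "c * (rate DIM('a) t * p)\<^sup>2 \<le> 16 * q * (norm_L2 (\<psi> t))\<^sup>2"
        by (simp add: algebra_simps)
      then have "(rate DIM('a) t * p)\<^sup>2 \<le> (16 * q / c) * (norm_L2 (\<psi> t))\<^sup>2"
        using c by (simp add: field_simps)
      also have "\<dots> = (sqrt (16 * q / c) * norm_L2 (\<psi> t))\<^sup>2"
        using q c by (simp add: power_mult_distrib)
      finally show ?case
        by (rule power2_le_imp_le) (use q c in \<open>simp add: norm_L2_nonneg\<close>)
    qed
    then show "\<exists>T. \<forall>t\<ge>T. rate DIM('a) t * cmod P \<le> sqrt (16 * q / c) * norm_L2 (\<psi> t)"
      by (simp add: eventually_at_top_linorder p_def)
  qed
qed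

text \<open>The transform of \<phi> 2 is bounded by the L1 norm rather than replaced by its value at
  zero; the starting time thereby becomes independent of the data.\<close>

lemma solution_upper_bound:
  obtains C where "C > 0"
    "\<And>(\<phi> :: nat \<Rightarrow> 'a::euclidean_space \<Rightarrow> complex) \<psi> u t. \<lbrakk>cauchy_solution \<gamma> b \<nu> \<kappa> \<delta> \<phi> \<psi> u; t \<ge> 3\<rbrakk> \<Longrightarrow>
       norm_L2 (\<psi> t) \<le> C * (rate DIM('a) t * data_norm \<phi>)"
proof -
  have k: "\<kappa> \<le> \<delta> / 2" using \<kappa>_less by simp
  define q where "q = (2 * pi) ^ DIM('a)"
  have q: "q > 0" by (simp add: q_def)
  obtain C where C: "C \<ge> 0" and err: "\<And>(\<phi> :: nat \<Rightarrow> 'a \<Rightarrow> complex) \<psi> u t.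
       \<lbrakk>cauchy_solution \<gamma> b \<nu> \<kappa> \<delta> \<phi> \<psi> u; t \<ge> 3\<rbrakk> \<Longrightarrow>
       nnL2 (\<lambda>\<xi>. u t \<xi> - profile_symbol \<kappa> \<delta> t \<xi> * fourier (\<phi> 2) \<xi>)
         \<le> ennreal (C * (data_norm \<phi>)\<^sup>2 * ((rate DIM('a) t)\<^sup>2 / ln t))"
    using frequency_error[where 'a='a] by blast
  obtain C1 where C1: "C1 \<ge> 0" "\<And>t. t \<ge> 3 \<Longrightarrow>
    (\<integral>\<^sup>+\<xi>. ennreal ((prof \<kappa> \<delta> t (norm (\<xi>::'a)))\<^sup>2) \<partial>lborel) \<le> ennreal (C1 * (rate DIM('a) t)\<^sup>2)"
    using nn_integral_prof_upper[OF pos(3) k, where 'a='a] by blast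
  define B where "B = 4 / q * (2 * C + 2 * C1) + 1"
  have B: "B > 0" using C C1 q by (simp add: B_def add_nonneg_pos)
  show ?thesis
  proof (rule that[of "sqrt B"])
    show "0 < sqrt B" using B by simp
    fix \<phi> :: "nat \<Rightarrow> 'a \<Rightarrow> complex" and \<psi> u and t :: real
    assume sol: "cauchy_solution \<gamma> b \<nu> \<kappa> \<delta> \<phi> \<psi> u" and t: "t \<ge> 3"
    interpret cauchy_solution \<gamma> b \<nu> \<kappa> \<delta> \<phi> \<psi> u by (rule sol)
    have l: "ln t \<ge> 1" by (rule ln_ge_1[OF t])
    define S where "S = data_norm \<phi>"
    have S: "S \<ge> 0" by (simp add: S_def data_norm_ge)
    let ?R = "(rate DIM('a) t)\<^sup>2"
    have [measurable]: "\<phi> 2 \<in> borel_measurable borel" using data_integrable by auto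
    have um[measurable]: "u t \<in> borel_measurable borel" using u_measurable t by simp
    have [measurable]: "(profile_symbol \<kappa> \<delta> t :: 'a \<Rightarrow> complex) \<in> borel_measurable borel"
      unfolding profile_symbol_eq[abs_def] by measurable
    have "cmod (fourier (\<phi> 2) \<xi>) \<le> S" for \<xi>
      using cmod_fourier_le[of "\<phi> 2" \<xi>] data_norm_ge(1)[of \<phi>] norm_L1_nonneg[of "\<phi> 0"] norm_L1_nonneg[of "\<phi> 1"]
      by (simp add: S_def)
    then have "nnL2 (\<lambda>\<xi>. profile_symbol \<kappa> \<delta> t \<xi> * fourier (\<phi> 2) \<xi>) \<le> nnL2 (\<lambda>\<xi>::'a. profile_symbol \<kappa> \<delta> t \<xi> * complex_of_real S)"
      using S by (intro nnL2_mono) (auto simp: norm_mult intro!: AE_I2 mult_left_mono)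
    also have "\<dots> = ennreal (S\<^sup>2) * (\<integral>\<^sup>+\<xi>. ennreal ((prof \<kappa> \<delta> t (norm (\<xi>::'a)))\<^sup>2) \<partial>lborel)"
      unfolding nnL2_profile_symbol_mult by simp
    also have "\<dots> \<le> ennreal (S\<^sup>2) * ennreal (C1 * ?R)" by (intro mult_left_mono C1 t) auto
    also have "\<dots> = ennreal (S\<^sup>2 * (C1 * ?R))" using C1 by (intro ennreal_mult[symmetric]) auto
    finally have main: "nnL2 (\<lambda>\<xi>. profile_symbol \<kappa> \<delta> t \<xi> * fourier (\<phi> 2) \<xi>) \<le> ennreal (S\<^sup>2 * (C1 * ?R))" .
    have "nnL2 (\<lambda>\<xi>. u t \<xi> - profile_symbol \<kappa> \<delta> t \<xi> * fourier (\<phi> 2) \<xi>) \<le> ennreal (C * S\<^sup>2 * (?R / ln t))"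
      unfolding S_def by (rule err[OF sol t])
    also have "\<dots> \<le> ennreal (C * S\<^sup>2 * ?R)"
      using C l by (intro ennreal_leI mult_left_mono) (auto simp: divide_le_eq mult_le_cancel_left1)
    finally have er: "nnL2 (\<lambda>\<xi>. u t \<xi> - profile_symbol \<kappa> \<delta> t \<xi> * fourier (\<phi> 2) \<xi>) \<le> ennreal (C * S\<^sup>2 * ?R)" .
    have "nnL2 (\<psi> t) \<le> ennreal (4 / q) * nnL2 (u t)"
      unfolding q_def using t by (intro is_fourier_L2_le transform) auto
    also have "\<dots> \<le> ennreal (4 / q) * (2 * nnL2 (\<lambda>\<xi>. u t \<xi> - profile_symbol \<kappa> \<delta> t \<xi> * fourier (\<phi> 2) \<xi>)
       + 2 * nnL2 (\<lambda>\<xi>. profile_symbol \<kappa> \<delta> t \<xi> * fourier (\<phi> 2) \<xi>))"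
      using nnL2_add_le[of "\<lambda>\<xi>. u t \<xi> - profile_symbol \<kappa> \<delta> t \<xi> * fourier (\<phi> 2) \<xi>" "\<lambda>\<xi>. profile_symbol \<kappa> \<delta> t \<xi> * fourier (\<phi> 2) \<xi>"]
      by (intro mult_left_mono) auto
    also have "\<dots> \<le> ennreal (4 / q) * (2 * ennreal (C * S\<^sup>2 * ?R) + 2 * ennreal (S\<^sup>2 * (C1 * ?R)))"
      by (intro mult_left_mono add_mono er main) auto
    also have "\<dots> = ennreal (4 / q * (2 * (C * S\<^sup>2 * ?R) + 2 * (S\<^sup>2 * (C1 * ?R))))"
    proof -
      have n: "0 \<le> C * S\<^sup>2 * ?R" "0 \<le> S\<^sup>2 * (C1 * ?R)" "0 \<le> 4 / q" using C C1 q by auto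
      have "2 * ennreal (C * S\<^sup>2 * ?R) + 2 * ennreal (S\<^sup>2 * (C1 * ?R)) = ennreal (2 * (C * S\<^sup>2 * ?R) + 2 * (S\<^sup>2 * (C1 * ?R)))"
        using n(1,2) by (simp add: numeral_mult_ennreal)
      then show ?thesis using n by (simp only:) (intro ennreal_mult[symmetric], auto)
    qed
    also have "\<dots> \<le> ennreal ((sqrt B * (rate DIM('a) t * S))\<^sup>2)"
    proof (rule ennreal_leI)
      have "4 / q * (2 * (C * S\<^sup>2 * ?R) + 2 * (S\<^sup>2 * (C1 * ?R))) = (4 / q * (2 * C + 2 * C1)) * (?R * S\<^sup>2)"
        by (simp add: algebra_simps)
      also have "\<dots> \<le> B * (?R * S\<^sup>2)" by (intro mult_right_mono) (auto simp: B_def)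
      also have "\<dots> = (sqrt B * (rate DIM('a) t * S))\<^sup>2" using B by (simp add: power_mult_distrib)
      finally show "4 / q * (2 * (C * S\<^sup>2 * ?R) + 2 * (S\<^sup>2 * (C1 * ?R))) \<le> (sqrt B * (rate DIM('a) t * S))\<^sup>2" .
    qed
    finally show "norm_L2 (\<psi> t) \<le> sqrt B * (rate DIM('a) t * data_norm \<phi>)"
      using t S B by (intro norm_L2_le \<psi>_L2) (auto simp: S_def rate_nonneg)
  qed
qed

end

theorem theorem2p1:
  shows "\<exists>\<epsilon>>0. \<forall>\<gamma> b \<nu> \<kappa> \<delta> :: real.
    1 < \<gamma> \<and> \<gamma> \<le> 5 / 3 \<and> 0 < b \<and> 0 < \<nu> \<and> 0 < \<kappa> \<and>
    \<delta> = diffusion_coeff \<gamma> b \<nu> \<kappa> \<and> \<kappa> / \<delta> < \<epsilon> \<longrightarrow>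
      (\<forall>(\<phi> :: nat \<Rightarrow> real ^ 'n \<Rightarrow> complex) \<psi>.
         (\<forall>j\<in>{0,1,2}. \<phi> j \<in> Hneg_L1 (2 * real j)) \<and> is_solution \<gamma> b \<nu> \<kappa> \<phi> \<psi> \<longrightarrow>
         (\<forall>t>0. (\<lambda>x. \<psi> t x - profile \<kappa> \<delta> (\<phi> 2) t x) \<in> L2) \<and>
         (\<lambda>t. norm_L2 (\<lambda>x. \<psi> t x - profile \<kappa> \<delta> (\<phi> 2) t x)) \<in> o[at_top](rate CARD('n))) \<and>
      (\<exists>C>0. \<forall>(\<phi> :: nat \<Rightarrow> real ^ 'n \<Rightarrow> complex) \<psi>.
         (\<forall>j\<in>{0,1,2}. \<phi> j \<in> Hneg_L1 (2 * real j)) \<and> is_solution \<gamma> b \<nu> \<kappa> \<phi> \<psi> \<and>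
         cmod (total_integral (\<phi> 2)) \<noteq> 0 \<longrightarrow>
         (\<exists>T. \<forall>t\<ge>T. rate CARD('n) t * cmod (total_integral (\<phi> 2)) \<le> C * norm_L2 (\<psi> t))) \<and>
      (\<exists>C>0. \<exists>T. \<forall>(\<phi> :: nat \<Rightarrow> real ^ 'n \<Rightarrow> complex) \<psi>.
         (\<forall>j\<in>{0,1,2}. \<phi> j \<in> Hneg_L1 (2 * real j)) \<and> is_solution \<gamma> b \<nu> \<kappa> \<phi> \<psi> \<and>
         cmod (total_integral (\<phi> 2)) \<noteq> 0 \<longrightarrow>
         (\<forall>t\<ge>T. norm_L2 (\<psi> t) \<le>
            C * (rate CARD('n) t * (\<Sum>j\<in>{0,1,2}. norm_Hneg_L1 (2 * real j) (\<phi> j)))))"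
proof (rule exI[of _ "1 / 2"], intro conjI allI impI)
  \<comment> \<open>The threshold 1 / 2 is uniform in all parameters.\<close>
  show "(0::real) < 1 / 2" by simp
next
  fix \<gamma> b \<nu> \<kappa> \<delta> :: real
  assume "1 < \<gamma> \<and> \<gamma> \<le> 5 / 3 \<and> 0 < b \<and> 0 < \<nu> \<and> 0 < \<kappa> \<and> \<delta> = diffusion_coeff \<gamma> b \<nu> \<kappa> \<and> \<kappa> / \<delta> < 1 / 2"
  then interpret cauchy_parameters \<gamma> b \<nu> \<kappa> \<delta> by unfold_locales auto
  have dim: "DIM(real ^ 'n) = CARD('n)" by simp
  {
    fix \<phi> :: "nat \<Rightarrow> real ^ 'n \<Rightarrow> complex" and \<psi>
    assume "(\<forall>j\<in>{0,1,2}. \<phi> j \<in> Hneg_L1 (2 * real j)) \<and> is_solution \<gamma> b \<nu> \<kappa> \<phi> \<psi>"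
    then obtain u where "cauchy_solution \<gamma> b \<nu> \<kappa> \<delta> \<phi> \<psi> u" using is_solution_imp by blast
    then interpret cauchy_solution \<gamma> b \<nu> \<kappa> \<delta> \<phi> \<psi> u .
    show "(\<lambda>t. norm_L2 (\<lambda>x. \<psi> t x - profile \<kappa> \<delta> (\<phi> 2) t x)) \<in> o[at_top](rate CARD('n))"
      using solution_minus_profile_smallo unfolding dim .
    show "(\<lambda>x. \<psi> t x - profile \<kappa> \<delta> (\<phi> 2) t x) \<in> L2" if "0 < t" for t
      using that by (rule solution_minus_profile_L2)
  }
  show "\<exists>C>0. \<forall>(\<phi> :: nat \<Rightarrow> real ^ 'n \<Rightarrow> complex) \<psi>.
         (\<forall>j\<in>{0,1,2}. \<phi> j \<in> Hneg_L1 (2 * real j)) \<and> is_solution \<gamma> b \<nu> \<kappa> \<phi> \<psi> \<and>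
         cmod (total_integral (\<phi> 2)) \<noteq> 0 \<longrightarrow>
         (\<exists>T. \<forall>t\<ge>T. rate CARD('n) t * cmod (total_integral (\<phi> 2)) \<le> C * norm_L2 (\<psi> t))"
  proof (rule solution_lower_bound[where 'a = "real ^ 'n", unfolded dim])
    fix C :: real
    assume C: "C > 0" and le: "\<And>(\<phi> :: nat \<Rightarrow> real ^ 'n \<Rightarrow> complex) \<psi> u. \<lbrakk>cauchy_solution \<gamma> b \<nu> \<kappa> \<delta> \<phi> \<psi> u; total_integral (\<phi> 2) \<noteq> 0\<rbrakk> \<Longrightarrow>
       \<exists>T. \<forall>t\<ge>T. rate CARD('n) t * cmod (total_integral (\<phi> 2)) \<le> C * norm_L2 (\<psi> t)"
    show ?thesis
    proof (rule exI[of _ C], intro conjI allI impI)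
      show "C > 0" by (rule C)
    next
      fix \<phi> :: "nat \<Rightarrow> real ^ 'n \<Rightarrow> complex" and \<psi>
      assume \<phi>: "(\<forall>j\<in>{0,1,2}. \<phi> j \<in> Hneg_L1 (2 * real j)) \<and> is_solution \<gamma> b \<nu> \<kappa> \<phi> \<psi> \<and> cmod (total_integral (\<phi> 2)) \<noteq> 0"
      then obtain u where "cauchy_solution \<gamma> b \<nu> \<kappa> \<delta> \<phi> \<psi> u" using is_solution_imp by blast
      from le[OF this] \<phi> show "\<exists>T. \<forall>t\<ge>T. rate CARD('n) t * cmod (total_integral (\<phi> 2)) \<le> C * norm_L2 (\<psi> t)"
        by simp
    qed
  qed
  show "\<exists>C>0. \<exists>T. \<forall>(\<phi> :: nat \<Rightarrow> real ^ 'n \<Rightarrow> complex) \<psi>.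
         (\<forall>j\<in>{0,1,2}. \<phi> j \<in> Hneg_L1 (2 * real j)) \<and> is_solution \<gamma> b \<nu> \<kappa> \<phi> \<psi> \<and>
         cmod (total_integral (\<phi> 2)) \<noteq> 0 \<longrightarrow>
         (\<forall>t\<ge>T. norm_L2 (\<psi> t) \<le>
            C * (rate CARD('n) t * (\<Sum>j\<in>{0,1,2}. norm_Hneg_L1 (2 * real j) (\<phi> j))))"
  proof (rule solution_upper_bound[where 'a = "real ^ 'n", unfolded dim data_norm_def])
    fix C :: real
    assume C: "C > 0" and le: "\<And>(\<phi> :: nat \<Rightarrow> real ^ 'n \<Rightarrow> complex) \<psi> u t. \<lbrakk>cauchy_solution \<gamma> b \<nu> \<kappa> \<delta> \<phi> \<psi> u; t \<ge> 3\<rbrakk> \<Longrightarrow>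
       norm_L2 (\<psi> t) \<le> C * (rate CARD('n) t * (\<Sum>j\<in>{0,1,2}. norm_Hneg_L1 (2 * real j) (\<phi> j)))"
    show ?thesis
    \<comment> \<open>The starting time 3 is chosen before the data.\<close>
    proof (rule exI[of _ C], rule conjI, rule C, rule exI[of _ 3], intro allI impI)
      fix \<phi> :: "nat \<Rightarrow> real ^ 'n \<Rightarrow> complex" and \<psi> and t :: real
      assume "(\<forall>j\<in>{0,1,2}. \<phi> j \<in> Hneg_L1 (2 * real j)) \<and> is_solution \<gamma> b \<nu> \<kappa> \<phi> \<psi> \<and> cmod (total_integral (\<phi> 2)) \<noteq> 0"
        and t: "3 \<le> t"
      then obtain u where "cauchy_solution \<gamma> b \<nu> \<kappa> \<delta> \<phi> \<psi> u" using is_solution_imp by blast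
      from le[OF this t] show "norm_L2 (\<psi> t) \<le> C * (rate CARD('n) t * (\<Sum>j\<in>{0,1,2}. norm_Hneg_L1 (2 * real j) (\<phi> j)))" .
    qed
  qed
qed

end
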